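(* Let $k$ be a field and let $\mathcal K$ be the closed symmetric monoidal category of complexes of $k$-vector spaces. Let $\underline{\mathcal M}$ be a strongly pretriangulated $\mathcal K$-bicomplete $\mathcal K$-category (i.e. dg $k$-category). Assume that the underlying category $\mathcal M$ is equipped with a model structure turning it into a cofibrantly generated model category such that the class of cofibrations and the class of trivial cofibrations are both stable (a) under taking shifts, i.e. under mapping $i\colon E\to F$ to $[n]i\colon[n]E\to[n]F$ for all $n\in\mathbb Z$, and (b) under applying the functor $\mathrm{iCone}\colon\mathcal M\to\mathcal M$, i.e. under mapping $i\colon E\to F$ to $\mathrm{iCone}(i)\colon\mathrm{iCone}(E)\to\mathrm{iCone}(F)$. Then this model structure admits $\mathcal K$-enriched functorial factorizations.
   Context: Smallness is with respect to a fixed Grothendieck universe; cofibrantly generated includes that the small object argument is permitted. The underlying category of a dg category has the same objects and the closed degree zero morphisms. A dg $k$-category $\underline{\mathcal M}$ is strongly pretriangulated if, for the dg Yoneda functor $\mathrm{Yo}\colon\underline{\mathcal M}\to\{\text{right dg }\underline{\mathcal M}\text{-modules}\}$, the zero module, all shifts $[n]\mathrm{Yo}(M)$ ($M\in\mathcal M$, $n\in\mathbb Z$) and all cones $\mathrm{Cone}(\mathrm{Yo}(f))$ ($f$ a closed degree zero morphism) are isomorphic, via closed degree zero isomorphisms, to representable modules. Then shifts $[n]$ and cones are defined in $\underline{\mathcal M}$ by representability, and $\mathrm{iCone}(M):=\mathrm{Cone}(\mathrm{id}_M)$ defines a dg functor $\underline{\mathcal M}\to\underline{\mathcal M}$. $\underline{\mathcal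 M}$ is $\mathcal K$-bicomplete if it is tensored and cotensored over $\mathcal K$ and the underlying category $\mathcal M$ has all small limits and colimits. Tensored (cotensored) means: there are bifunctors $\odot\colon\mathcal M\times\mathcal K\to\mathcal M$ (resp. $\Psi\colon\mathcal K^{\mathrm{op}}\times\mathcal M\to\mathcal M$) with natural isomorphisms of complexes $\underline{\mathcal K}(R,\underline{\mathcal M}(M,N))\cong\underline{\mathcal M}(M\odot R,N)$ (resp. $\cong\underline{\mathcal M}(M,\Psi(R,N))$), where $\underline{\mathcal K}$ denotes the internal Hom complex. Let $\underline{\mathcal M}^{[1]}$ be the dg category whose objects are closed degree zero morphisms $f\colon A\to B$ and whose morphism complex from $f$ to $f'\colon A'\to B'$ is the subcomplex of $\underline{\mathcal M}(A,A')\times\underline{\mathcal M}(B,B')$ of pairs $(a,b)$ with $bf=f'a$; define $\underline{\mathcal M}^{[2]}$ (two composable arrows) similarly. A $\mathcal K$-enriched functorial factorization is a dg functor $\underline{\mathcal M}^{[1]}\to\underline{\mathcal M}^{[2]}$, $f\mapsto(A\xrightarrow{Lf}M(f)\xrightarrow{Rf}B)$, that is a section of the composition functor. The model structure admits $\mathcal K$-enriched functorial factorizations if there are two such, $(L,M,R)$ and $(L',M',R')$, with $Lf$ a cofibration, $Rf$ a trivial fibration, $L'f$ a trivial cofibration, $R'f$ a fibration for every $f$. *)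

theory Defs
  imports "HOL-Algebra.Module"
begin

section \<open>Grothendieck universes and smallness\<close>

text \<open>
  A universe is given as a type of sets together with its membership relation: \<open>elts x\<close> is the
  set of elements of \<open>x\<close>.  The closure conditions are unordered pairs, power sets (together with
  the fact that every subset of a member is a member), unions of families indexed by a member, and
  the existence of an infinite member.
\<close>

definition grothendieck_universe :: "('u \<Rightarrow> 'u set) \<Rightarrow> bool" where
  "grothendieck_universe elts \<longleftrightarrow>
     inj elts \<and> wf {(x, y). x \<in> elts y} \<and>
     (\<forall>x y. \<exists>z. elts z = {x, y}) \<and>
     (\<forall>x. \<exists>z. elts ` elts z = Pow (elts x)) \<and>
     (\<forall>x f. \<exists>z. elts z = (\<Union>i\<in>elts x. elts (f i))) \<and>
     (\<exists>x. infinite (elts x))"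

definition small :: "('u \<Rightarrow> 'u set) \<Rightarrow> 'a set \<Rightarrow> bool" where
  "small elts A \<longleftrightarrow> (\<exists>x f. bij_betw f A (elts x))"


section \<open>Categories\<close>

text \<open>Hom sets need not be disjoint; operations carry the objects as arguments, and \<open>Cmp C X Y Z g f\<close>
  is the composite of \<open>f : X \<rightarrow> Y\<close> followed by \<open>g : Y \<rightarrow> Z\<close>.\<close>

record ('o, 'm) cat =
  Obj :: "'o set"
  Arr :: "'o \<Rightarrow> 'o \<Rightarrow> 'm set"
  Idn :: "'o \<Rightarrow> 'm"
  Cmp :: "'o \<Rightarrow> 'o \<Rightarrow> 'o \<Rightarrow> 'm \<Rightarrow> 'm \<Rightarrow> 'm"

record ('i, 'j, 'o, 'm) fun_cat =
  FO :: "'i \<Rightarrow> 'o"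
  FA :: "'i \<Rightarrow> 'i \<Rightarrow> 'j \<Rightarrow> 'm"

definition category :: "('o, 'm) cat \<Rightarrow> bool" where
  "category C \<longleftrightarrow>
     (\<forall>X\<in>Obj C. Idn C X \<in> Arr C X X) \<and>
     (\<forall>X\<in>Obj C. \<forall>Y\<in>Obj C. \<forall>Z\<in>Obj C. \<forall>f\<in>Arr C X Y. \<forall>g\<in>Arr C Y Z. Cmp C X Y Z g f \<in> Arr C X Z) \<and>
     (\<forall>X\<in>Obj C. \<forall>Y\<in>Obj C. \<forall>f\<in>Arr C X Y.
        Cmp C X X Y f (Idn C X) = f \<and> Cmp C X Y Y (Idn C Y) f = f) \<and>
     (\<forall>X\<in>Obj C. \<forall>Y\<in>Obj C. \<forall>Z\<in>Obj C. \<forall>V\<in>Obj C. \<forall>f\<in>Arr C X Y. \<forall>g\<in>Arr C Y Z. \<forall>h\<in>Arr C Z V.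
        Cmp C X Z V h (Cmp C X Y Z g f) = Cmp C X Y V (Cmp C Y Z V h g) f)"

definition is_functor :: "('i, 'j) cat \<Rightarrow> ('o, 'm) cat \<Rightarrow> ('i, 'j, 'o, 'm) fun_cat \<Rightarrow> bool" where
  "is_functor J C D \<longleftrightarrow>
     (\<forall>a\<in>Obj J. FO D a \<in> Obj C) \<and>
     (\<forall>a\<in>Obj J. \<forall>b\<in>Obj J. \<forall>u\<in>Arr J a b. FA D a b u \<in> Arr C (FO D a) (FO D b)) \<and>
     (\<forall>a\<in>Obj J. FA D a a (Idn J a) = Idn C (FO D a)) \<and>
     (\<forall>a\<in>Obj J. \<forall>b\<in>Obj J. \<forall>c\<in>Obj J. \<forall>u\<in>Arr J a b. \<forall>v\<in>Arr J b c.
        FA D a c (Cmp J a b c v u) = Cmp C (FO D a) (FO D b) (FO D c) (FA D b c v) (FA D a b u))"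

definition op_cat :: "('o, 'm) cat \<Rightarrow> ('o, 'm) cat" where
  "op_cat C = \<lparr>Obj = Obj C, Arr = (\<lambda>X Y. Arr C Y X), Idn = Idn C,
     Cmp = (\<lambda>X Y Z g f. Cmp C Z Y X f g)\<rparr>"

definition prod_cat :: "('o, 'm) cat \<Rightarrow> ('p, 'n) cat \<Rightarrow> ('o \<times> 'p, 'm \<times> 'n) cat" where
  "prod_cat C D = \<lparr>Obj = Obj C \<times> Obj D,
     Arr = (\<lambda>(X, X') (Y, Y'). Arr C X Y \<times> Arr D X' Y'),
     Idn = (\<lambda>(X, X'). (Idn C X, Idn D X')),
     Cmp = (\<lambda>(X, X') (Y, Y') (Z, Z') (g, g') (f, f'). (Cmp C X Y Z g f, Cmp D X' Y' Z' g' f'))\<rparr>"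

definition set_cat :: "('u \<Rightarrow> 'u set) \<Rightarrow> ('u set, 'u \<Rightarrow> 'u) cat" where
  "set_cat elts = \<lparr>Obj = {A. small elts A}, Arr = (\<lambda>A B. A \<rightarrow>\<^sub>E B), Idn = (\<lambda>A. \<lambda>x\<in>A. x),
     Cmp = (\<lambda>A B C g f. compose A g f)\<rparr>"

definition cone_over ::
  "('o, 'm) cat \<Rightarrow> ('i, 'j) cat \<Rightarrow> ('i, 'j, 'o, 'm) fun_cat \<Rightarrow> 'o \<Rightarrow> ('i \<Rightarrow> 'm) \<Rightarrow> bool" where
  "cone_over C J D L p \<longleftrightarrow>
     L \<in> Obj C \<and> (\<forall>a\<in>Obj J. p a \<in> Arr C L (FO D a)) \<and>
     (\<forall>a\<in>Obj J. \<forall>b\<in>Obj J. \<forall>u\<in>Arr J a b. Cmp C L (FO D a) (FO D b) (FA D a b u) (p a) = p b)"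

definition is_limit ::
  "('o, 'm) cat \<Rightarrow> ('i, 'j) cat \<Rightarrow> ('i, 'j, 'o, 'm) fun_cat \<Rightarrow> 'o \<Rightarrow> ('i \<Rightarrow> 'm) \<Rightarrow> bool" where
  "is_limit C J D L p \<longleftrightarrow> cone_over C J D L p \<and>
     (\<forall>L' p'. cone_over C J D L' p' \<longrightarrow>
        (\<exists>!h. h \<in> Arr C L' L \<and> (\<forall>a\<in>Obj J. Cmp C L' L (FO D a) (p a) h = p' a)))"

definition cocone_under ::
  "('o, 'm) cat \<Rightarrow> ('i, 'j) cat \<Rightarrow> ('i, 'j, 'o, 'm) fun_cat \<Rightarrow> 'o \<Rightarrow> ('i \<Rightarrow> 'm) \<Rightarrow> bool" where
  "cocone_under C J D L q \<longleftrightarrow>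
     L \<in> Obj C \<and> (\<forall>a\<in>Obj J. q a \<in> Arr C (FO D a) L) \<and>
     (\<forall>a\<in>Obj J. \<forall>b\<in>Obj J. \<forall>u\<in>Arr J a b. Cmp C (FO D a) (FO D b) L (q b) (FA D a b u) = q a)"

definition is_colimit ::
  "('o, 'm) cat \<Rightarrow> ('i, 'j) cat \<Rightarrow> ('i, 'j, 'o, 'm) fun_cat \<Rightarrow> 'o \<Rightarrow> ('i \<Rightarrow> 'm) \<Rightarrow> bool" where
  "is_colimit C J D L q \<longleftrightarrow> cocone_under C J D L q \<and>
     (\<forall>L' q'. cocone_under C J D L' q' \<longrightarrow>
        (\<exists>!h. h \<in> Arr C L L' \<and> (\<forall>a\<in>Obj J. Cmp C (FO D a) L L' h (q a) = q' a)))"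

text \<open>Every small category is isomorphic to one whose objects and arrows are elements of the
  universe, so these are the only index categories that need to be considered.\<close>

definition small_category :: "('u \<Rightarrow> 'u set) \<Rightarrow> ('u, 'u) cat \<Rightarrow> bool" where
  "small_category elts J \<longleftrightarrow> category J \<and> small elts (Obj J) \<and>
     (\<forall>a\<in>Obj J. \<forall>b\<in>Obj J. small elts (Arr J a b))"

definition has_small_limits :: "('u \<Rightarrow> 'u set) \<Rightarrow> ('o, 'm) cat \<Rightarrow> bool" where
  "has_small_limits elts C \<longleftrightarrow>
     (\<forall>J D. small_category elts J \<and> is_functor J C D \<longrightarrow> (\<exists>L p. is_limit C J D L p))"

definition has_small_colimits :: "('u \<Rightarrow> 'u set) \<Rightarrow> ('o, 'm) cat \<Rightarrow> bool" where
  "has_small_colimits elts C \<longleftrightarrow>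
     (\<forall>J D. small_category elts J \<and> is_functor J C D \<longrightarrow> (\<exists>L q. is_colimit C J D L q))"


section \<open>Model structures\<close>

text \<open>A class of morphisms is a set of triples \<open>(X, Y, f)\<close> with \<open>f : X \<rightarrow> Y\<close>.\<close>

definition arrows :: "('o, 'm) cat \<Rightarrow> ('o \<times> 'o \<times> 'm) set" where
  "arrows C = {(X, Y, f). X \<in> Obj C \<and> Y \<in> Obj C \<and> f \<in> Arr C X Y}"

definition has_lifting :: "('o, 'm) cat \<Rightarrow> 'o \<times> 'o \<times> 'm \<Rightarrow> 'o \<times> 'o \<times> 'm \<Rightarrow> bool" where
  "has_lifting C = (\<lambda>(A, B, i) (X, Y, p).
     \<forall>u\<in>Arr C A X. \<forall>v\<in>Arr C B Y. Cmp C A X Y p u = Cmp C A B Y v i \<longrightarrow>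
       (\<exists>h\<in>Arr C B X. Cmp C A B X h i = u \<and> Cmp C B X Y p h = v))"

definition rlp :: "('o, 'm) cat \<Rightarrow> ('o \<times> 'o \<times> 'm) set \<Rightarrow> ('o \<times> 'o \<times> 'm) set" where
  "rlp C I = {p \<in> arrows C. \<forall>i\<in>I. has_lifting C i p}"

definition is_retract :: "('o, 'm) cat \<Rightarrow> 'o \<times> 'o \<times> 'm \<Rightarrow> 'o \<times> 'o \<times> 'm \<Rightarrow> bool" where
  "is_retract C = (\<lambda>(A, B, f) (X, Y, g).
     \<exists>s\<in>Arr C A X. \<exists>t\<in>Arr C X A. \<exists>s'\<in>Arr C B Y. \<exists>t'\<in>Arr C Y B.
       Cmp C A X A t s = Idn C A \<and> Cmp C B Y B t' s' = Idn C B \<and>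
       Cmp C A X Y g s = Cmp C A B Y s' f \<and> Cmp C X A B f t = Cmp C X Y B t' g)"

definition retract_closed :: "('o, 'm) cat \<Rightarrow> ('o \<times> 'o \<times> 'm) set \<Rightarrow> bool" where
  "retract_closed C S \<longleftrightarrow> (\<forall>f\<in>arrows C. \<forall>g\<in>S. is_retract C f g \<longrightarrow> f \<in> S)"

definition two_of_three :: "('o, 'm) cat \<Rightarrow> ('o \<times> 'o \<times> 'm) set \<Rightarrow> bool" where
  "two_of_three C W \<longleftrightarrow>
     (\<forall>X Y Z f g. (X, Y, f) \<in> arrows C \<and> (Y, Z, g) \<in> arrows C \<longrightarrow>
        ((X, Y, f) \<in> W \<and> (Y, Z, g) \<in> W \<longrightarrow> (X, Z, Cmp C X Y Z g f) \<in> W) \<and>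
        ((X, Y, f) \<in> W \<and> (X, Z, Cmp C X Y Z g f) \<in> W \<longrightarrow> (Y, Z, g) \<in> W) \<and>
        ((Y, Z, g) \<in> W \<and> (X, Z, Cmp C X Y Z g f) \<in> W \<longrightarrow> (X, Y, f) \<in> W))"

definition has_factorizations ::
  "('o, 'm) cat \<Rightarrow> ('o \<times> 'o \<times> 'm) set \<Rightarrow> ('o \<times> 'o \<times> 'm) set \<Rightarrow> bool" where
  "has_factorizations C S T \<longleftrightarrow>
     (\<forall>X Y f. (X, Y, f) \<in> arrows C \<longrightarrow>
        (\<exists>Z l r. (X, Z, l) \<in> S \<and> (Z, Y, r) \<in> T \<and> Cmp C X Z Y r l = f))"

definition model_structure ::
  "('o, 'm) cat \<Rightarrow> ('o \<times> 'o \<times> 'm) set \<Rightarrow> ('o \<times> 'o \<times> 'm) set \<Rightarrow> ('o \<times> 'o \<times> 'm) set \<Rightarrow> bool" where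
  "model_structure C W Cof Fib \<longleftrightarrow>
     W \<subseteq> arrows C \<and> Cof \<subseteq> arrows C \<and> Fib \<subseteq> arrows C \<and>
     two_of_three C W \<and>
     retract_closed C W \<and> retract_closed C Cof \<and> retract_closed C Fib \<and>
     (\<forall>i\<in>Cof \<inter> W. \<forall>p\<in>Fib. has_lifting C i p) \<and>
     (\<forall>i\<in>Cof. \<forall>p\<in>Fib \<inter> W. has_lifting C i p) \<and>
     has_factorizations C (Cof \<inter> W) Fib \<and>
     has_factorizations C Cof (Fib \<inter> W)"


section \<open>Cofibrant generation\<close>

text \<open>Ordinals are well-orders on small subsets of the universe, viewed as categories.\<close>

definition order_cat :: "'u rel \<Rightarrow> ('u, unit) cat" where
  "order_cat r = \<lparr>Obj = Field r, Arr = (\<lambda>a b. {u. (a, b) \<in> r}), Idn = (\<lambda>a. ()),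
     Cmp = (\<lambda>a b c v u. ())\<rparr>"

definition is_succ :: "'u rel \<Rightarrow> 'u \<Rightarrow> 'u \<Rightarrow> bool" where
  "is_succ r a b \<longleftrightarrow> a \<in> underS r b \<and> underS r b \<subseteq> under r a"

definition is_limit_elt :: "'u rel \<Rightarrow> 'u \<Rightarrow> bool" where
  "is_limit_elt r c \<longleftrightarrow> c \<in> Field r \<and> underS r c \<noteq> {} \<and> (\<nexists>a. is_succ r a c)"

definition lambda_sequence :: "('o, 'm) cat \<Rightarrow> 'u rel \<Rightarrow> ('u, unit, 'o, 'm) fun_cat \<Rightarrow> bool" where
  "lambda_sequence C r X \<longleftrightarrow> is_functor (order_cat r) C X \<and>
     (\<forall>c. is_limit_elt r c \<longrightarrow>
        is_colimit C (order_cat (Restr r (underS r c))) X (FO X c) (\<lambda>b. FA X b c ()))"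

definition successor_maps_in :: "'u rel \<Rightarrow> ('u, unit, 'o, 'm) fun_cat \<Rightarrow> ('o \<times> 'o \<times> 'm) set \<Rightarrow> bool" where
  "successor_maps_in r X S \<longleftrightarrow> (\<forall>a b. is_succ r a b \<longrightarrow> (FO X a, FO X b, FA X a b ()) \<in> S)"

definition is_pushout ::
  "('o, 'm) cat \<Rightarrow> 'o \<Rightarrow> 'o \<Rightarrow> 'o \<Rightarrow> 'o \<Rightarrow> 'm \<Rightarrow> 'm \<Rightarrow> 'm \<Rightarrow> 'm \<Rightarrow> bool" where
  "is_pushout C A B X Y i u j v \<longleftrightarrow>
     A \<in> Obj C \<and> B \<in> Obj C \<and> X \<in> Obj C \<and> Y \<in> Obj C \<and>
     i \<in> Arr C A B \<and> u \<in> Arr C A X \<and> j \<in> Arr C X Y \<and> v \<in> Arr C B Y \<and>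
     Cmp C A X Y j u = Cmp C A B Y v i \<and>
     (\<forall>Z\<in>Obj C. \<forall>x\<in>Arr C X Z. \<forall>b\<in>Arr C B Z. Cmp C A X Z x u = Cmp C A B Z b i \<longrightarrow>
        (\<exists>!h. h \<in> Arr C Y Z \<and> Cmp C X Y Z h j = x \<and> Cmp C B Y Z h v = b))"

definition pushouts_of :: "('o, 'm) cat \<Rightarrow> ('o \<times> 'o \<times> 'm) set \<Rightarrow> ('o \<times> 'o \<times> 'm) set" where
  "pushouts_of C I = {(X, Y, j). \<exists>A B i u v. (A, B, i) \<in> I \<and> is_pushout C A B X Y i u j v}"

definition relative_cell_complexes ::
  "('u \<Rightarrow> 'u set) \<Rightarrow> ('o, 'm) cat \<Rightarrow> ('o \<times> 'o \<times> 'm) set \<Rightarrow> ('o \<times> 'o \<times> 'm) set" where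
  "relative_cell_complexes elts C I =
     {(A, B, f). \<exists>(r :: 'u rel) X q z.
        Well_order r \<and> small elts (Field r) \<and>
        lambda_sequence C r X \<and> successor_maps_in r X (pushouts_of C I) \<and>
        is_colimit C (order_cat r) X B q \<and>
        z \<in> Field r \<and> (\<forall>b\<in>Field r. (z, b) \<in> r) \<and> A = FO X z \<and> f = q z}"

text \<open>\<open>C(V, -)\<close> applied to a diagram.\<close>

definition hom_diagram ::
  "('o, 'm) cat \<Rightarrow> 'o \<Rightarrow> ('i, 'j, 'o, 'm) fun_cat \<Rightarrow> ('i, 'j, 'm set, 'm \<Rightarrow> 'm) fun_cat" where
  "hom_diagram C V X = \<lparr>FO = (\<lambda>a. Arr C V (FO X a)),
     FA = (\<lambda>a b u. \<lambda>g\<in>Arr C V (FO X a). Cmp C V (FO X a) (FO X b) (FA X a b u) g)\<rparr>"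

text \<open>\<open>V\<close> is small relative to \<open>S\<close>: for some cardinal \<open>\<kappa>\<close> and all regular cardinals \<open>\<lambda> \<ge> \<kappa>\<close>, the
  functor \<open>C(V, -)\<close> preserves the colimit of every \<open>\<lambda>\<close>-sequence with successor maps in \<open>S\<close>.\<close>

definition small_relative_to ::
  "('u \<Rightarrow> 'u set) \<Rightarrow> ('o, 'u) cat \<Rightarrow> 'o \<Rightarrow> ('o \<times> 'o \<times> 'u) set \<Rightarrow> bool" where
  "small_relative_to elts C V S \<longleftrightarrow>
     (\<exists>\<kappa> :: 'u rel. Card_order \<kappa> \<and> small elts (Field \<kappa>) \<and>
        (\<forall>r :: 'u rel. Card_order r \<and> infinite (Field r) \<and> regularCard r \<and> small elts (Field r) \<and>
             (\<kappa>, r) \<in> ordLeq \<longrightarrow>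
           (\<forall>X L q. lambda_sequence C r X \<and> successor_maps_in r X S \<and>
                is_colimit C (order_cat r) X L q \<longrightarrow>
              is_colimit (set_cat elts) (order_cat r) (hom_diagram C V X) (Arr C V L)
                (\<lambda>a. \<lambda>g\<in>Arr C V (FO X a). Cmp C V (FO X a) L (q a) g))))"

definition permits_small_object_argument ::
  "('u \<Rightarrow> 'u set) \<Rightarrow> ('o, 'u) cat \<Rightarrow> ('o \<times> 'o \<times> 'u) set \<Rightarrow> bool" where
  "permits_small_object_argument elts C I \<longleftrightarrow>
     (\<forall>(A, B, i)\<in>I. small_relative_to elts C A (relative_cell_complexes elts C I))"

definition cofibrantly_generated ::
  "('u \<Rightarrow> 'u set) \<Rightarrow> ('o, 'u) cat \<Rightarrow> ('o \<times> 'o \<times> 'u) set \<Rightarrow> ('o \<times> 'o \<times> 'u) set \<Rightarrow> bool" where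
  "cofibrantly_generated elts C W Fib \<longleftrightarrow>
     (\<exists>I \<subseteq> arrows C. small elts I \<and> permits_small_object_argument elts C I \<and> Fib \<inter> W = rlp C I) \<and>
     (\<exists>J \<subseteq> arrows C. small elts J \<and> permits_small_object_argument elts C J \<and> Fib = rlp C J)"


section \<open>Complexes of vector spaces\<close>

text \<open>Complexes are graded cohomologically.  Vector spaces are modules over a field; the fields
  \<open>mult\<close> and \<open>one\<close> that the record of modules inherits from rings play no role.\<close>

record ('k, 'a) cplx =
  Deg :: "int \<Rightarrow> ('k, 'a) module"
  Diff :: "int \<Rightarrow> 'a \<Rightarrow> 'a"

definition linear_on :: "'k ring \<Rightarrow> ('k, 'a) module \<Rightarrow> ('k, 'b) module \<Rightarrow> ('a \<Rightarrow> 'b) \<Rightarrow> bool" where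
  "linear_on k V V' f \<longleftrightarrow> f \<in> carrier V \<rightarrow> carrier V' \<and>
     (\<forall>x\<in>carrier V. \<forall>y\<in>carrier V. f (x \<oplus>\<^bsub>V\<^esub> y) = f x \<oplus>\<^bsub>V'\<^esub> f y) \<and>
     (\<forall>a\<in>carrier k. \<forall>x\<in>carrier V. f (a \<odot>\<^bsub>V\<^esub> x) = a \<odot>\<^bsub>V'\<^esub> f x)"

text \<open>Multiplication by \<open>(-1)^n\<close>.\<close>

definition ksign :: "('k, 'a) module \<Rightarrow> int \<Rightarrow> 'a \<Rightarrow> 'a" where
  "ksign V n x = (if even n then x else \<ominus>\<^bsub>V\<^esub> x)"

definition complex :: "'k ring \<Rightarrow> ('k, 'a) cplx \<Rightarrow> bool" where
  "complex k R \<longleftrightarrow>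
     (\<forall>n. module k (Deg R n)) \<and>
     (\<forall>n. linear_on k (Deg R n) (Deg R (n + 1)) (Diff R n)) \<and>
     (\<forall>n. \<forall>x\<in>carrier (Deg R n). Diff R (n + 1) (Diff R n x) = \<zero>\<^bsub>Deg R (n + 1 + 1)\<^esub>)"

definition small_complex :: "('u \<Rightarrow> 'u set) \<Rightarrow> ('k, 'a) cplx \<Rightarrow> bool" where
  "small_complex elts R \<longleftrightarrow> (\<forall>n. small elts (carrier (Deg R n)))"

definition chain_map :: "'k ring \<Rightarrow> ('k, 'a) cplx \<Rightarrow> ('k, 'b) cplx \<Rightarrow> (int \<Rightarrow> 'a \<Rightarrow> 'b) \<Rightarrow> bool" where
  "chain_map k R S f \<longleftrightarrow>
     (\<forall>n. linear_on k (Deg R n) (Deg S n) (f n)) \<and>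
     (\<forall>n. \<forall>x\<in>carrier (Deg R n). f (n + 1) (Diff R n x) = Diff S n (f n x))"

definition chain_iso :: "'k ring \<Rightarrow> ('k, 'a) cplx \<Rightarrow> ('k, 'b) cplx \<Rightarrow> (int \<Rightarrow> 'a \<Rightarrow> 'b) \<Rightarrow> bool" where
  "chain_iso k R S f \<longleftrightarrow> chain_map k R S f \<and>
     (\<forall>n. bij_betw (f n) (carrier (Deg R n)) (carrier (Deg S n)))"

text \<open>The internal Hom complex, with \<open>d(h) = d \<circ> h - (-1)^n h \<circ> d\<close> for \<open>h\<close> of degree \<open>n\<close>.\<close>

definition int_hom :: "'k ring \<Rightarrow> ('k, 'a) cplx \<Rightarrow> ('k, 'b) cplx \<Rightarrow> ('k, int \<Rightarrow> 'a \<Rightarrow> 'b) cplx" where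
  "int_hom k R S = \<lparr>
     Deg = (\<lambda>n. \<lparr>
       carrier = {h. \<forall>p. h p \<in> extensional (carrier (Deg R p)) \<and>
                         linear_on k (Deg R p) (Deg S (p + n)) (h p)},
       mult = undefined, one = undefined,
       zero = (\<lambda>p. \<lambda>x\<in>carrier (Deg R p). \<zero>\<^bsub>Deg S (p + n)\<^esub>),
       add = (\<lambda>h h' p. \<lambda>x\<in>carrier (Deg R p). h p x \<oplus>\<^bsub>Deg S (p + n)\<^esub> h' p x),
       smult = (\<lambda>a h p. \<lambda>x\<in>carrier (Deg R p). a \<odot>\<^bsub>Deg S (p + n)\<^esub> h p x)\<rparr>),
     Diff = (\<lambda>n h p. \<lambda>x\<in>carrier (Deg R p).
       Diff S (p + n) (h p x) \<ominus>\<^bsub>Deg S (p + n + 1)\<^esub>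
         ksign (Deg S (p + n + 1)) n (h (p + 1) (Diff R p x)))\<rparr>"


section \<open>Dg categories\<close>

text \<open>\<open>DCmp M A B C p q g f\<close> is the composite of \<open>f \<in> M(A,B)^q\<close> followed by \<open>g \<in> M(B,C)^p\<close>; it is an
  element of \<open>M(A,C)^(p+q)\<close>.\<close>

record ('o, 'k, 'm) dgcat =
  DObj :: "'o set"
  DHom :: "'o \<Rightarrow> 'o \<Rightarrow> ('k, 'm) cplx"
  DId :: "'o \<Rightarrow> 'm"
  DCmp :: "'o \<Rightarrow> 'o \<Rightarrow> 'o \<Rightarrow> int \<Rightarrow> int \<Rightarrow> 'm \<Rightarrow> 'm \<Rightarrow> 'm"

abbreviation homs :: "('o, 'k, 'm) dgcat \<Rightarrow> 'o \<Rightarrow> 'o \<Rightarrow> int \<Rightarrow> 'm set" where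
  "homs M A B n \<equiv> carrier (Deg (DHom M A B) n)"

definition dg_category :: "'k ring \<Rightarrow> ('o, 'k, 'm) dgcat \<Rightarrow> bool" where
  "dg_category k M \<longleftrightarrow>
     (\<forall>A\<in>DObj M. \<forall>B\<in>DObj M. complex k (DHom M A B)) \<and>
     (\<forall>A\<in>DObj M. DId M A \<in> homs M A A 0 \<and> Diff (DHom M A A) 0 (DId M A) = \<zero>\<^bsub>Deg (DHom M A A) 1\<^esub>) \<and>
     (\<forall>A\<in>DObj M. \<forall>B\<in>DObj M. \<forall>C\<in>DObj M. \<forall>p q.
        (\<forall>f\<in>homs M A B q.
           linear_on k (Deg (DHom M B C) p) (Deg (DHom M A C) (p + q)) (\<lambda>g. DCmp M A B C p q g f)) \<and>
        (\<forall>g\<in>homs M B C p.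
           linear_on k (Deg (DHom M A B) q) (Deg (DHom M A C) (p + q)) (\<lambda>f. DCmp M A B C p q g f)) \<and>
        (\<forall>f\<in>homs M A B q. \<forall>g\<in>homs M B C p.
           Diff (DHom M A C) (p + q) (DCmp M A B C p q g f) =
             DCmp M A B C (p + 1) q (Diff (DHom M B C) p g) f
               \<oplus>\<^bsub>Deg (DHom M A C) (p + q + 1)\<^esub>
             ksign (Deg (DHom M A C) (p + q + 1)) p
               (DCmp M A B C p (q + 1) g (Diff (DHom M A B) q f)))) \<and>
     (\<forall>A\<in>DObj M. \<forall>B\<in>DObj M. \<forall>p. \<forall>f\<in>homs M A B p.
        DCmp M A A B p 0 f (DId M A) = f \<and> DCmp M A B B 0 p (DId M B) f = f) \<and>
     (\<forall>A\<in>DObj M. \<forall>B\<in>DObj M. \<forall>C\<in>DObj M. \<forall>D\<in>DObj M. \<forall>p q r.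
        \<forall>f\<in>homs M A B r. \<forall>g\<in>homs M B C q. \<forall>h\<in>homs M C D p.
        DCmp M A C D p (q + r) h (DCmp M A B C q r g f) =
          DCmp M A B D (p + q) r (DCmp M B C D p q h g) f)"

text \<open>Enrichment in complexes of small vector spaces.\<close>

definition K_category :: "('u \<Rightarrow> 'u set) \<Rightarrow> 'k ring \<Rightarrow> ('o, 'k, 'm) dgcat \<Rightarrow> bool" where
  "K_category elts k M \<longleftrightarrow> dg_category k M \<and>
     (\<forall>A\<in>DObj M. \<forall>B\<in>DObj M. small_complex elts (DHom M A B))"

definition underlying :: "('o, 'k, 'm) dgcat \<Rightarrow> ('o, 'm) cat" where
  "underlying M = \<lparr>Obj = DObj M,
     Arr = (\<lambda>A B. {f \<in> homs M A B 0. Diff (DHom M A B) 0 f = \<zero>\<^bsub>Deg (DHom M A B) 1\<^esub>}),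
     Idn = DId M,
     Cmp = (\<lambda>A B C g f. DCmp M A B C 0 0 g f)\<rparr>"

record ('o, 'm, 'p, 'n) dgfun =
  DFO :: "'o \<Rightarrow> 'p"
  DFA :: "'o \<Rightarrow> 'o \<Rightarrow> int \<Rightarrow> 'm \<Rightarrow> 'n"

definition dg_functor ::
  "'k ring \<Rightarrow> ('o, 'k, 'm) dgcat \<Rightarrow> ('p, 'k, 'n) dgcat \<Rightarrow> ('o, 'm, 'p, 'n) dgfun \<Rightarrow> bool" where
  "dg_functor k M N F \<longleftrightarrow>
     (\<forall>A\<in>DObj M. DFO F A \<in> DObj N) \<and>
     (\<forall>A\<in>DObj M. \<forall>B\<in>DObj M. chain_map k (DHom M A B) (DHom N (DFO F A) (DFO F B)) (DFA F A B)) \<and>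
     (\<forall>A\<in>DObj M. DFA F A A 0 (DId M A) = DId N (DFO F A)) \<and>
     (\<forall>A\<in>DObj M. \<forall>B\<in>DObj M. \<forall>C\<in>DObj M. \<forall>p q. \<forall>f\<in>homs M A B q. \<forall>g\<in>homs M B C p.
        DFA F A C (p + q) (DCmp M A B C p q g f) =
          DCmp N (DFO F A) (DFO F B) (DFO F C) p q (DFA F B C p g) (DFA F A B q f))"

text \<open>The category \<open>K\<close> of complexes of small vector spaces, enriched over itself.\<close>

definition K_dg :: "('u \<Rightarrow> 'u set) \<Rightarrow> 'k ring \<Rightarrow> (('k, 'a) cplx, 'k, int \<Rightarrow> 'a \<Rightarrow> 'a) dgcat" where
  "K_dg elts k = \<lparr>DObj = {R. complex k R \<and> small_complex elts R},
     DHom = int_hom k,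
     DId = (\<lambda>R p. \<lambda>x\<in>carrier (Deg R p). x),
     DCmp = (\<lambda>R S T m n g f p. \<lambda>x\<in>carrier (Deg R p). g (p + n) (f p x))\<rparr>"


section \<open>Tensors and cotensors\<close>

text \<open>\<open>M(a, b) : M(A, B) \<rightarrow> M(A', B')\<close> for closed degree zero \<open>a : A' \<rightarrow> A\<close> and \<open>b : B \<rightarrow> B'\<close>.\<close>

definition hom_map ::
  "('o, 'k, 'm) dgcat \<Rightarrow> 'o \<Rightarrow> 'o \<Rightarrow> 'o \<Rightarrow> 'o \<Rightarrow> 'm \<Rightarrow> 'm \<Rightarrow> int \<Rightarrow> 'm \<Rightarrow> 'm" where
  "hom_map M A A' B B' a b = (\<lambda>p. \<lambda>x\<in>homs M A B p.
     DCmp M A' B B' 0 p b (DCmp M A' A B p 0 x a))"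

text \<open>\<open>K(r, M(a, b))\<close> on an element \<open>h\<close> of \<open>K(R, M(A, B))\<close> of degree \<open>n\<close>.\<close>

definition hom_hom_map ::
  "('u \<Rightarrow> 'u set) \<Rightarrow> 'k ring \<Rightarrow> ('o, 'k, 'u) dgcat \<Rightarrow> ('k, 'u) cplx \<Rightarrow> ('k, 'u) cplx \<Rightarrow>
     'o \<Rightarrow> 'o \<Rightarrow> 'o \<Rightarrow> 'o \<Rightarrow> (int \<Rightarrow> 'u \<Rightarrow> 'u) \<Rightarrow> 'u \<Rightarrow> 'u \<Rightarrow> int \<Rightarrow> (int \<Rightarrow> 'u \<Rightarrow> 'u) \<Rightarrow> int \<Rightarrow> 'u \<Rightarrow> 'u" where
  "hom_hom_map elts k M R R' A A' B B' r a b n h =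
     DCmp (K_dg elts k) R' (DHom M A B) (DHom M A' B') 0 n (hom_map M A A' B B' a b)
       (DCmp (K_dg elts k) R' R (DHom M A B) n 0 h r)"

text \<open>The bifunctors live on underlying categories, so naturality of the isomorphisms of complexes is
  with respect to closed degree zero morphisms.\<close>

definition tensored :: "('u \<Rightarrow> 'u set) \<Rightarrow> 'k ring \<Rightarrow> ('o, 'k, 'u) dgcat \<Rightarrow> bool" where
  "tensored elts k M \<longleftrightarrow>
     (\<exists>T \<phi>.
        is_functor (prod_cat (underlying M) (underlying (K_dg elts k))) (underlying M) T \<and>
        (\<forall>A\<in>DObj M. \<forall>R\<in>DObj (K_dg elts k). \<forall>B\<in>DObj M.
           chain_iso k (int_hom k R (DHom M A B)) (DHom M (FO T (A, R)) B) (\<phi> A R B)) \<and>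
        (\<forall>A\<in>DObj M. \<forall>A'\<in>DObj M. \<forall>B\<in>DObj M. \<forall>B'\<in>DObj M.
         \<forall>R\<in>DObj (K_dg elts k). \<forall>R'\<in>DObj (K_dg elts k).
         \<forall>a\<in>Arr (underlying M) A' A. \<forall>b\<in>Arr (underlying M) B B'.
         \<forall>r\<in>Arr (underlying (K_dg elts k)) R' R.
         \<forall>n. \<forall>h\<in>carrier (Deg (int_hom k R (DHom M A B)) n).
           \<phi> A' R' B' n (hom_hom_map elts k M R R' A A' B B' r a b n h) =
           hom_map M (FO T (A, R)) (FO T (A', R')) B B' (FA T (A', R') (A, R) (a, r)) b n
             (\<phi> A R B n h)))"

definition cotensored :: "('u \<Rightarrow> 'u set) \<Rightarrow> 'k ring \<Rightarrow> ('o, 'k, 'u) dgcat \<Rightarrow> bool" where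
  "cotensored elts k M \<longleftrightarrow>
     (\<exists>T \<phi>.
        is_functor (prod_cat (op_cat (underlying (K_dg elts k))) (underlying M)) (underlying M) T \<and>
        (\<forall>A\<in>DObj M. \<forall>R\<in>DObj (K_dg elts k). \<forall>B\<in>DObj M.
           chain_iso k (int_hom k R (DHom M A B)) (DHom M A (FO T (R, B))) (\<phi> A R B)) \<and>
        (\<forall>A\<in>DObj M. \<forall>A'\<in>DObj M. \<forall>B\<in>DObj M. \<forall>B'\<in>DObj M.
         \<forall>R\<in>DObj (K_dg elts k). \<forall>R'\<in>DObj (K_dg elts k).
         \<forall>a\<in>Arr (underlying M) A' A. \<forall>b\<in>Arr (underlying M) B B'.
         \<forall>r\<in>Arr (underlying (K_dg elts k)) R' R.
         \<forall>n. \<forall>h\<in>carrier (Deg (int_hom k R (DHom M A B)) n).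
           \<phi> A' R' B' n (hom_hom_map elts k M R R' A A' B B' r a b n h) =
           hom_map M A A' (FO T (R, B)) (FO T (R', B')) a (FA T (R, B) (R', B') (r, b)) n
             (\<phi> A R B n h)))"

definition K_bicomplete :: "('u \<Rightarrow> 'u set) \<Rightarrow> 'k ring \<Rightarrow> ('o, 'k, 'u) dgcat \<Rightarrow> bool" where
  "K_bicomplete elts k M \<longleftrightarrow> tensored elts k M \<and> cotensored elts k M \<and>
     has_small_limits elts (underlying M) \<and> has_small_colimits elts (underlying M)"


section \<open>Right dg modules and strong pretriangulation\<close>

text \<open>\<open>MAct N A B p q x f\<close> is \<open>x \<cdot> f \<in> N(A)^(p+q)\<close> for \<open>x \<in> N(B)^p\<close> and \<open>f \<in> M(A,B)^q\<close>.\<close>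

record ('o, 'k, 'a, 'm) dgmod =
  MVal :: "'o \<Rightarrow> ('k, 'a) cplx"
  MAct :: "'o \<Rightarrow> 'o \<Rightarrow> int \<Rightarrow> int \<Rightarrow> 'a \<Rightarrow> 'm \<Rightarrow> 'a"

definition right_dg_module :: "'k ring \<Rightarrow> ('o, 'k, 'm) dgcat \<Rightarrow> ('o, 'k, 'a, 'm) dgmod \<Rightarrow> bool" where
  "right_dg_module k M N \<longleftrightarrow>
     (\<forall>A\<in>DObj M. complex k (MVal N A)) \<and>
     (\<forall>A\<in>DObj M. \<forall>B\<in>DObj M. \<forall>p q.
        (\<forall>f\<in>homs M A B q.
           linear_on k (Deg (MVal N B) p) (Deg (MVal N A) (p + q)) (\<lambda>x. MAct N A B p q x f)) \<and>
        (\<forall>x\<in>carrier (Deg (MVal N B) p).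
           linear_on k (Deg (DHom M A B) q) (Deg (MVal N A) (p + q)) (\<lambda>f. MAct N A B p q x f)) \<and>
        (\<forall>f\<in>homs M A B q. \<forall>x\<in>carrier (Deg (MVal N B) p).
           Diff (MVal N A) (p + q) (MAct N A B p q x f) =
             MAct N A B (p + 1) q (Diff (MVal N B) p x) f
               \<oplus>\<^bsub>Deg (MVal N A) (p + q + 1)\<^esub>
             ksign (Deg (MVal N A) (p + q + 1)) p
               (MAct N A B p (q + 1) x (Diff (DHom M A B) q f)))) \<and>
     (\<forall>A\<in>DObj M. \<forall>p. \<forall>x\<in>carrier (Deg (MVal N A) p). MAct N A A p 0 x (DId M A) = x) \<and>
     (\<forall>A\<in>DObj M. \<forall>B\<in>DObj M. \<forall>C\<in>DObj M. \<forall>p q r.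
        \<forall>f\<in>homs M A B r. \<forall>g\<in>homs M B C q. \<forall>x\<in>carrier (Deg (MVal N C) p).
        MAct N A C p (q + r) x (DCmp M A B C q r g f) =
          MAct N A B (p + q) r (MAct N B C p q x g) f)"

text \<open>Closed degree zero isomorphisms of right dg modules.\<close>

definition dgmod_iso ::
  "'k ring \<Rightarrow> ('o, 'k, 'm) dgcat \<Rightarrow> ('o, 'k, 'a, 'm) dgmod \<Rightarrow> ('o, 'k, 'b, 'm) dgmod \<Rightarrow>
     ('o \<Rightarrow> int \<Rightarrow> 'a \<Rightarrow> 'b) \<Rightarrow> bool" where
  "dgmod_iso k M N N' \<phi> \<longleftrightarrow>
     right_dg_module k M N \<and> right_dg_module k M N' \<and>
     (\<forall>A\<in>DObj M. chain_iso k (MVal N A) (MVal N' A) (\<phi> A)) \<and>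
     (\<forall>A\<in>DObj M. \<forall>B\<in>DObj M. \<forall>p q. \<forall>x\<in>carrier (Deg (MVal N B) p). \<forall>f\<in>homs M A B q.
        \<phi> A (p + q) (MAct N A B p q x f) = MAct N' A B p q (\<phi> B p x) f)"

definition Yo :: "('o, 'k, 'm) dgcat \<Rightarrow> 'o \<Rightarrow> ('o, 'k, 'm, 'm) dgmod" where
  "Yo M X = \<lparr>MVal = (\<lambda>A. DHom M A X), MAct = (\<lambda>A B p q x f. DCmp M A B X p q x f)\<rparr>"

definition Yo_map :: "('o, 'k, 'm) dgcat \<Rightarrow> 'o \<Rightarrow> 'o \<Rightarrow> 'm \<Rightarrow> 'o \<Rightarrow> int \<Rightarrow> 'm \<Rightarrow> 'm" where
  "Yo_map M X Y f = (\<lambda>A p x. DCmp M A X Y 0 p f x)"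

definition zero_dgmod :: "('o, 'k, unit, 'm) dgmod" where
  "zero_dgmod = \<lparr>
     MVal = (\<lambda>A. \<lparr>Deg = (\<lambda>n. \<lparr>carrier = {()}, mult = undefined, one = undefined,
                       zero = (), add = (\<lambda>x y. ()), smult = (\<lambda>a x. ())\<rparr>),
                  Diff = (\<lambda>n x. ())\<rparr>),
     MAct = (\<lambda>A B p q x f. ())\<rparr>"

text \<open>\<open>([n]N)(A)^p = N(A)^(n+p)\<close> with differential \<open>(-1)^n d\<close> and unchanged right action.\<close>

definition shift_dgmod :: "int \<Rightarrow> ('o, 'k, 'a, 'm) dgmod \<Rightarrow> ('o, 'k, 'a, 'm) dgmod" where
  "shift_dgmod n N = \<lparr>
     MVal = (\<lambda>A. \<lparr>Deg = (\<lambda>p. Deg (MVal N A) (n + p)),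
                  Diff = (\<lambda>p x. ksign (Deg (MVal N A) (n + p + 1)) n (Diff (MVal N A) (n + p) x))\<rparr>),
     MAct = (\<lambda>A B p q x f. MAct N A B (n + p) q x f)\<rparr>"

definition prod_module :: "('k, 'a) module \<Rightarrow> ('k, 'b) module \<Rightarrow> ('k, 'a \<times> 'b) module" where
  "prod_module V V' = \<lparr>carrier = carrier V \<times> carrier V', mult = undefined, one = undefined,
     zero = (\<zero>\<^bsub>V\<^esub>, \<zero>\<^bsub>V'\<^esub>),
     add = (\<lambda>(x, x') (y, y'). (x \<oplus>\<^bsub>V\<^esub> y, x' \<oplus>\<^bsub>V'\<^esub> y')),
     smult = (\<lambda>a (x, x'). (a \<odot>\<^bsub>V\<^esub> x, a \<odot>\<^bsub>V'\<^esub> x'))\<rparr>"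

text \<open>The cone of \<open>f : N \<rightarrow> N'\<close> is \<open>N' \<oplus> [1]N\<close> with \<open>d(y, x) = (d y + f x, - d x)\<close>.\<close>

definition cone_dgmod ::
  "('o, 'k, 'a, 'm) dgmod \<Rightarrow> ('o, 'k, 'b, 'm) dgmod \<Rightarrow> ('o \<Rightarrow> int \<Rightarrow> 'a \<Rightarrow> 'b) \<Rightarrow>
     ('o, 'k, 'b \<times> 'a, 'm) dgmod" where
  "cone_dgmod N N' f = \<lparr>
     MVal = (\<lambda>A. \<lparr>Deg = (\<lambda>p. prod_module (Deg (MVal N' A) p) (Deg (MVal N A) (p + 1))),
                  Diff = (\<lambda>p (y, x).
                    (Diff (MVal N' A) p y \<oplus>\<^bsub>Deg (MVal N' A) (p + 1)\<^esub> f A (p + 1) x,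
                     \<ominus>\<^bsub>Deg (MVal N A) (p + 1 + 1)\<^esub> Diff (MVal N A) (p + 1) x))\<rparr>),
     MAct = (\<lambda>A B p q (y, x) g. (MAct N' A B p q y g, MAct N A B (p + 1) q x g))\<rparr>"

definition strongly_pretriangulated :: "'k ring \<Rightarrow> ('o, 'k, 'm) dgcat \<Rightarrow> bool" where
  "strongly_pretriangulated k M \<longleftrightarrow>
     (\<exists>X\<in>DObj M. \<exists>\<phi>. dgmod_iso k M zero_dgmod (Yo M X) \<phi>) \<and>
     (\<forall>E\<in>DObj M. \<forall>n. \<exists>X\<in>DObj M. \<exists>\<phi>. dgmod_iso k M (shift_dgmod n (Yo M E)) (Yo M X) \<phi>) \<and>
     (\<forall>(E, F, f)\<in>arrows (underlying M). \<exists>X\<in>DObj M. \<exists>\<phi>.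
        dgmod_iso k M (cone_dgmod (Yo M E) (Yo M F) (Yo_map M E F f)) (Yo M X) \<phi>)"

text \<open>Shifts and \<open>iCone(E) = Cone(id_E)\<close> in a strongly pretriangulated category: a representing
  object together with the representing isomorphism is chosen.  By the Yoneda lemma, the functors
  \<open>[n]\<close> and \<open>iCone\<close> on the underlying category are determined by these choices.\<close>

definition shift_rep ::
  "'k ring \<Rightarrow> ('o, 'k, 'm) dgcat \<Rightarrow> int \<Rightarrow> 'o \<Rightarrow> 'o \<times> ('o \<Rightarrow> int \<Rightarrow> 'm \<Rightarrow> 'm)" where
  "shift_rep k M n E = (SOME (X, \<phi>). X \<in> DObj M \<and> dgmod_iso k M (shift_dgmod n (Yo M E)) (Yo M X) \<phi>)"

definition shift_obj :: "'k ring \<Rightarrow> ('o, 'k, 'm) dgcat \<Rightarrow> int \<Rightarrow> 'o \<Rightarrow> 'o" where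
  "shift_obj k M n E = fst (shift_rep k M n E)"

definition shift_map :: "'k ring \<Rightarrow> ('o, 'k, 'm) dgcat \<Rightarrow> int \<Rightarrow> 'o \<Rightarrow> 'o \<Rightarrow> 'm \<Rightarrow> 'm" where
  "shift_map k M n E F i =
     (THE j. j \<in> Arr (underlying M) (shift_obj k M n E) (shift_obj k M n F) \<and>
        (\<forall>A\<in>DObj M. \<forall>p. \<forall>x\<in>homs M A E (n + p).
           snd (shift_rep k M n F) A p (Yo_map M E F i A (n + p) x) =
           Yo_map M (shift_obj k M n E) (shift_obj k M n F) j A p (snd (shift_rep k M n E) A p x)))"

definition iCone_rep ::
  "'k ring \<Rightarrow> ('o, 'k, 'm) dgcat \<Rightarrow> 'o \<Rightarrow> 'o \<times> ('o \<Rightarrow> int \<Rightarrow> 'm \<times> 'm \<Rightarrow> 'm)" where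
  "iCone_rep k M E = (SOME (X, \<phi>). X \<in> DObj M \<and>
     dgmod_iso k M (cone_dgmod (Yo M E) (Yo M E) (Yo_map M E E (DId M E))) (Yo M X) \<phi>)"

definition iCone_obj :: "'k ring \<Rightarrow> ('o, 'k, 'm) dgcat \<Rightarrow> 'o \<Rightarrow> 'o" where
  "iCone_obj k M E = fst (iCone_rep k M E)"

definition iCone_map :: "'k ring \<Rightarrow> ('o, 'k, 'm) dgcat \<Rightarrow> 'o \<Rightarrow> 'o \<Rightarrow> 'm \<Rightarrow> 'm" where
  "iCone_map k M E F i =
     (THE j. j \<in> Arr (underlying M) (iCone_obj k M E) (iCone_obj k M F) \<and>
        (\<forall>A\<in>DObj M. \<forall>p. \<forall>y\<in>homs M A E p. \<forall>x\<in>homs M A E (p + 1).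
           snd (iCone_rep k M F) A p (Yo_map M E F i A p y, Yo_map M E F i A (p + 1) x) =
           Yo_map M (iCone_obj k M E) (iCone_obj k M F) j A p (snd (iCone_rep k M E) A p (y, x))))"

definition stable_under_shifts ::
  "'k ring \<Rightarrow> ('o, 'k, 'm) dgcat \<Rightarrow> ('o \<times> 'o \<times> 'm) set \<Rightarrow> bool" where
  "stable_under_shifts k M S \<longleftrightarrow>
     (\<forall>n. \<forall>(E, F, i)\<in>S. (shift_obj k M n E, shift_obj k M n F, shift_map k M n E F i) \<in> S)"

definition stable_under_iCone ::
  "'k ring \<Rightarrow> ('o, 'k, 'm) dgcat \<Rightarrow> ('o \<times> 'o \<times> 'm) set \<Rightarrow> bool" where
  "stable_under_iCone k M S \<longleftrightarrow>
     (\<forall>(E, F, i)\<in>S. (iCone_obj k M E, iCone_obj k M F, iCone_map k M E F i) \<in> S)"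


section \<open>Enriched functorial factorizations\<close>

definition arr1 :: "('o, 'k, 'm) dgcat \<Rightarrow> ('o \<times> 'o \<times> 'm, 'k, 'm \<times> 'm) dgcat" where
  "arr1 M = \<lparr>DObj = arrows (underlying M),
     DHom = (\<lambda>(A, B, f) (A', B', f').
       \<lparr>Deg = (\<lambda>n. (prod_module (Deg (DHom M A A') n) (Deg (DHom M B B') n))
                 \<lparr>carrier := {(a, b). a \<in> homs M A A' n \<and> b \<in> homs M B B' n \<and>
                    DCmp M A B B' n 0 b f = DCmp M A A' B' 0 n f' a}\<rparr>),
        Diff = (\<lambda>n (a, b). (Diff (DHom M A A') n a, Diff (DHom M B B') n b))\<rparr>),
     DId = (\<lambda>(A, B, f). (DId M A, DId M B)),
     DCmp = (\<lambda>(A, B, f) (A', B', f') (A'', B'', f'') p q (a', b') (a, b).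
       (DCmp M A A' A'' p q a' a, DCmp M B B' B'' p q b' b))\<rparr>"

text \<open>Objects \<open>(A, X, B, l, r)\<close> stand for \<open>l : A \<rightarrow> X\<close> and \<open>r : X \<rightarrow> B\<close>.\<close>

definition arr2 :: "('o, 'k, 'm) dgcat \<Rightarrow> ('o \<times> 'o \<times> 'o \<times> 'm \<times> 'm, 'k, 'm \<times> 'm \<times> 'm) dgcat" where
  "arr2 M = \<lparr>DObj = {(A, X, B, l, r). (A, X, l) \<in> arrows (underlying M) \<and> (X, B, r) \<in> arrows (underlying M)},
     DHom = (\<lambda>(A, X, B, l, r) (A', X', B', l', r').
       \<lparr>Deg = (\<lambda>n. (prod_module (Deg (DHom M A A') n)
                     (prod_module (Deg (DHom M X X') n) (Deg (DHom M B B') n)))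
                 \<lparr>carrier := {(a, x, b). a \<in> homs M A A' n \<and> x \<in> homs M X X' n \<and> b \<in> homs M B B' n \<and>
                    DCmp M A X X' n 0 x l = DCmp M A A' X' 0 n l' a \<and>
                    DCmp M X B B' n 0 b r = DCmp M X X' B' 0 n r' x}\<rparr>),
        Diff = (\<lambda>n (a, x, b). (Diff (DHom M A A') n a, Diff (DHom M X X') n x, Diff (DHom M B B') n b))\<rparr>),
     DId = (\<lambda>(A, X, B, l, r). (DId M A, DId M X, DId M B)),
     DCmp = (\<lambda>(A, X, B, l, r) (A', X', B', l', r') (A'', X'', B'', l'', r'') p q (a', x', b') (a, x, b).
       (DCmp M A A' A'' p q a' a, DCmp M X X' X'' p q x' x, DCmp M B B' B'' p q b' b))\<rparr>"

definition composition_functor ::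
  "('o, 'k, 'm) dgcat \<Rightarrow> ('o \<times> 'o \<times> 'o \<times> 'm \<times> 'm, 'm \<times> 'm \<times> 'm, 'o \<times> 'o \<times> 'm, 'm \<times> 'm) dgfun" where
  "composition_functor M = \<lparr>DFO = (\<lambda>(A, X, B, l, r). (A, B, DCmp M A X B 0 0 r l)),
     DFA = (\<lambda>_ _ n (a, x, b). (a, b))\<rparr>"

definition enriched_functorial_factorization ::
  "'k ring \<Rightarrow> ('o, 'k, 'm) dgcat \<Rightarrow>
     ('o \<times> 'o \<times> 'm, 'm \<times> 'm, 'o \<times> 'o \<times> 'o \<times> 'm \<times> 'm, 'm \<times> 'm \<times> 'm) dgfun \<Rightarrow> bool" where
  "enriched_functorial_factorization k M F \<longleftrightarrow>
     dg_functor k (arr1 M) (arr2 M) F \<and>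
     (\<forall>f\<in>DObj (arr1 M). DFO (composition_functor M) (DFO F f) = f) \<and>
     (\<forall>f\<in>DObj (arr1 M). \<forall>g\<in>DObj (arr1 M). \<forall>n. \<forall>u\<in>homs (arr1 M) f g n.
        DFA (composition_functor M) (DFO F f) (DFO F g) n (DFA F f g n u) = u)"

definition factors_through ::
  "('o, 'k, 'm) dgcat \<Rightarrow> ('o \<times> 'o \<times> 'm, 'm \<times> 'm, 'o \<times> 'o \<times> 'o \<times> 'm \<times> 'm, 'm \<times> 'm \<times> 'm) dgfun \<Rightarrow>
     ('o \<times> 'o \<times> 'm) set \<Rightarrow> ('o \<times> 'o \<times> 'm) set \<Rightarrow> bool" where
  "factors_through M F S T \<longleftrightarrow>
     (\<forall>f\<in>DObj (arr1 M). case DFO F f of (A, X, B, l, r) \<Rightarrow> (A, X, l) \<in> S \<and> (X, B, r) \<in> T)"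

definition admits_enriched_functorial_factorizations ::
  "'k ring \<Rightarrow> ('o, 'k, 'm) dgcat \<Rightarrow>
     ('o \<times> 'o \<times> 'm) set \<Rightarrow> ('o \<times> 'o \<times> 'm) set \<Rightarrow> ('o \<times> 'o \<times> 'm) set \<Rightarrow> bool" where
  "admits_enriched_functorial_factorizations k M W Cof Fib \<longleftrightarrow>
     (\<exists>F F'.
        enriched_functorial_factorization k M F \<and> factors_through M F Cof (Fib \<inter> W) \<and>
        enriched_functorial_factorization k M F' \<and> factors_through M F' (Cof \<inter> W) Fib)"

end

theory Submission
  imports Defs
begin

text \<open>The small object argument is run internally to complexes: at each stage all commutative squares from
the generators are attached at once, a square of any degree contributing a cell, by tensoring the generators with
the complexes of squares. The universal property of a stage then holds for arrows of every degree, because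
arrows of degree \<open>n\<close> into \<open>E\<close> are the closed arrows of degree zero into a shifted cone of an identity; so all
constructions are dg functors. Stability under shifts and \<open>iCone\<close> gives lifts of squares of every degree, and of
closed ones by closed arrows; over a field these choices can be made linear and compatible with the
differentials, hence the attaching maps are cofibrations.\<close>

section \<open>Small sets\<close>

text \<open>The smallness hypothesis is the obstacle: it concerns sequences whose successor maps are
  relative cell complexes, that is, transfinite composites of pushouts of single generators. A step
  of the enriched tower attaches tensors of generators with complexes and is only known to have the
  left lifting property against \<open>rlp UM I\<close>. Therefore the ordinary small object
  argument is carried out as well, to factor any arrow into a relative cell complex and an element
  of \<open>rlp\<close>. Used along the enriched tower it produces a sequence of relative cell
  complexes of which the tower is a retract, and factoring maps through a stage passes to retracts.
  The ordinary tower adds one cell per step along a well-order that is not small, since no bound on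
  the number of cells is known in advance; the enriched tower runs along one small infinite
  cardinal, the same for every arrow. Functoriality needs no choice beyond one tower for each arrow:
  a square of any degree determines a unique map of towers, so linearity, compatibility with the
  differential and with composition follow from uniqueness.\<close>

locale universe =
 fixes elts :: "'u => 'u set"
 assumes gu: "grothendieck_universe elts"
begin

lemma inj_elts: "elts x = elts y ==> x = y"
 using gu by (auto simp: grothendieck_universe_def dest: injD)

lemma ex_pair: "EX z. elts z = {x, y}"
 using gu by (auto simp: grothendieck_universe_def)

lemma ex_Pow: "EX z. elts ` elts z = Pow (elts x)"
 using gu by (auto simp: grothendieck_universe_def)

lemma ex_Union: "EX z. elts z = (\<Union>i\<in>elts x. elts (f i))"
 using gu by (simp add: grothendieck_universe_def)

lemma ex_subset: "S \<subseteq> elts x ==> EX y. elts y = S"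
 using ex_Pow[of x] by (metis Pow_iff imageE)

definition upair :: "'u => 'u => 'u" where
 "upair x y = (SOME z. elts z = {x, y})"

lemma elts_upair: "elts (upair x y) = {x, y}"
 unfolding upair_def using ex_pair by (rule someI_ex)

text \<open>The Kuratowski pair, an injection of \<open>'u \<times> 'u\<close> into
  \<open>'u\<close>. Besides bounding dependent sums, it later recodes complexes of pairs as
  complexes with elements in \<open>'u\<close>, the only ones with which tensors are given.\<close>

definition kpair :: "'u => 'u => 'u" where
 "kpair x y = upair (upair x x) (upair x y)"

lemma kpair_inject: "kpair x y = kpair x' y' \<longleftrightarrow> x = x' & y = y'"
 unfolding kpair_def by (metis doubleton_eq_iff elts_upair)

lemma ex_image: "EX z. elts z = f ` elts x"
 using ex_Union[of "%i. upair (f i) (f i)" x] by (simp add: elts_upair UNION_singleton_eq_range)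

lemma small_elts: "small elts (elts x)"
 unfolding small_def using bij_betw_id by blast

lemma small_bij: "bij_betw g A B ==> small elts B ==> small elts A"
 unfolding small_def using bij_betw_trans by blast

lemma small_subset:
 assumes "small elts A" "B \<subseteq> A" shows "small elts B"
proof -
 obtain x f where f: "bij_betw f A (elts x)"
 using assms by (auto simp: small_def)
 have "f ` B \<subseteq> elts x" using f assms(2) by (auto simp: bij_betw_def)
 then obtain y where "elts y = f ` B" using ex_subset by blast
 then have "bij_betw f B (elts y)"
 using f assms(2) by (auto simp: bij_betw_def intro: inj_on_subset)
 then show ?thesis by (auto simp: small_def)
qed

lemma small_image:
 assumes "small elts A" shows "small elts (g ` A)"
proof -
 have "bij_betw (inv_into A g) (g ` A) (inv_into A g ` g ` A)"
 by (simp add: bij_betw_def inj_on_inv_into)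
 moreover have "inv_into A g ` g ` A \<subseteq> A"
 by (auto intro: inv_into_into)
 ultimately show ?thesis
 using small_bij small_subset[OF assms] by blast
qed

lemma small_inj: "inj_on g A ==> g ` A \<subseteq> B ==> small elts B ==> small elts A"
 by (meson inj_on_imp_bij_betw small_bij small_subset)

text \<open>Base and fibres are coded by members \<open>x\<close> and \<open>y a\<close>. The union
  axiom collects the codes \<open>kpair i c\<close>, with \<open>i\<close> in \<open>elts x\<close>,
  into one member, into which the dependent pairs inject.\<close>

lemma small_Sigma:
 assumes "small elts A" "!!a. a : A ==> small elts (F a)"
 shows "small elts (Sigma A F)"
proof -
 obtain x f where f: "bij_betw f A (elts x)"
 using assms by (auto simp: small_def)
 have "EX y g. bij_betw g (F a) (elts y)" if "a : A" for a
 using assms(2)[OF that] by (simp add: small_def)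
 then obtain y g where g: "!!a. a : A ==> bij_betw (g a) (F a) (elts (y a))"
 by metis
 define a where "a = inv_into A f"
 have "ALL i. EX z. elts z = kpair i ` elts (y (a i))"
 using ex_image by blast
 then obtain z where z: "!!i. elts (z i) = kpair i ` elts (y (a i))" by metis
 obtain s where s: "elts s = (\<Union>i\<in>elts x. elts (z i))"
 using ex_Union by blast
 have fa: "f b : elts x" "a (f b) = b" if "b : A" for b
 using f that by (auto simp: a_def bij_betw_def)
 have "inj_on (%(b, c). kpair (f b) (g b c)) (Sigma A F)"
 using f g by (auto simp: inj_on_def kpair_inject bij_betw_def)
 moreover have "(%(b, c). kpair (f b) (g b c)) ` Sigma A F \<subseteq> elts s"
 unfolding s z using fa g by (fastforce simp: bij_betw_def)
 ultimately show ?thesis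
 using small_elts small_inj by blast
qed

lemma small_UN:
 assumes "small elts A" "!!a. a : A ==> small elts (F a)"
 shows "small elts (\<Union>a\<in>A. F a)"
proof -
 have "(\<Union>a\<in>A. F a) = snd ` Sigma A F" by force
 then show ?thesis using small_image[OF small_Sigma[OF assms]] by simp
qed

lemma small_Times: "small elts A ==> small elts B ==> small elts (A \<times> B)"
 by (simp add: small_Sigma)

lemma infinite_u: "infinite (UNIV :: 'u set)"
proof -
 obtain x where "infinite (elts x)"
 using gu by (auto simp: grothendieck_universe_def)
 then show ?thesis using finite_subset[OF subset_UNIV] by metis
qed

lemma small_Un:
 assumes "small elts A" "small elts B" shows "small elts (A \<union> B)"
proof -
 obtain u v :: 'u where "u ~= v"
 using infinite_u ex_new_if_finite[of "{undefined :: 'u}"] by auto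
 have "small elts {u, v}"
 using small_elts by (metis elts_upair)
 then have "small elts (\<Union>i\<in>{u, v}. if i = u then A else B)"
 by (rule small_UN) (simp add: assms)
 with \<open>u ~= v\<close> show ?thesis by (simp add: Un_commute)
qed

lemma small_insert:
 assumes "small elts A" shows "small elts (insert a A)"
proof -
 have "small elts ((%_. a) ` elts (upair undefined undefined))"
 by (rule small_image[OF small_elts])
 then have "small elts {a}" unfolding elts_upair by simp
 from small_Un[OF this assms] show ?thesis unfolding Un_insert_left Un_empty_left .
qed

lemma small_empty: "small elts ({} :: 'a set)"
proof -
 have "small elts ((%_. undefined :: 'a) ` elts undefined)"
 by (rule small_image[OF small_elts])
 then show ?thesis by (rule small_subset) simp
qed

lemma small_finite: "finite A ==> small elts A"
proof (induction A rule: finite_induct)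
 case empty show ?case by (rule small_empty)
next
 case (insert a A) then show ?case by (simp add: small_insert)
qed

lemma small_Pow:
 assumes "small elts A" shows "small elts (Pow A)"
proof -
 obtain x f where f: "bij_betw f A (elts x)"
 using assms by (auto simp: small_def)
 obtain z where z: "elts ` elts z = Pow (elts x)"
 using ex_Pow by blast
 then have "small elts (Pow (elts x))"
 using small_image[OF small_elts, of elts z] by simp
 moreover have "bij_betw (image f) (Pow A) (Pow (elts x))"
 using f by (rule bij_betw_Pow)
 ultimately show ?thesis using small_bij by blast
qed

text \<open>Cantor's argument: if a single \<open>elts x\<close> were in bijection with the whole
  type, every set of elements would have an image of the form \<open>elts z\<close>, which injects
  the power set of the type into the type.\<close>

lemma not_small_UNIV: "\<not> small elts (UNIV :: 'u set)"
proof
 assume s: "small elts (UNIV :: 'u set)"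
 then obtain x and f :: "'u => 'u" where "bij_betw f UNIV (elts x)" by (auto simp: small_def)
 then have f: "inj f" "range f = elts x" by (auto simp: bij_betw_def)
 have "EX z. elts z = f ` S" for S
 using ex_subset[of "f ` S" x] f by blast
 then obtain g where g: "!!S. elts (g S) = f ` S" by metis
 have "inj g"
 by (metis g f(1) inj_image_eq_iff injI)
 then have "surj (inv_into UNIV g)" by (rule inj_imp_surj_inv)
 then show False using Cantors_theorem by (metis Pow_UNIV)
qed

text \<open>A substitute for the class of all small ordinals. In a cardinal well-order of the whole
  type keep the elements with a small initial segment. If they formed a small set, either this set
  would be the whole type, against \<open>not_small_UNIV\<close>, or the first discarded element
  would have a small initial segment after all.\<close>

lemma ex_long_well_order:
 "EX r :: 'u rel. Well_order r & (ALL a:Field r. small elts (underS r a)) & \<not> small elts (Field r)"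
proof -
 define w :: "'u rel" where "w = card_of UNIV"
 have W: "Well_order w" unfolding w_def by (rule card_of_Well_order)
 have F: "Field w = UNIV" by (simp add: w_def Field_card_of)
 define N where "N = {a. small elts (underS w a)}"
 define r where "r = Restr w N"
 have "refl_on UNIV w" using W F by (metis well_order_on_def linear_order_on_def partial_order_on_def preorder_on_def)
 then have F': "Field r = N" by (auto simp: r_def Field_def refl_on_def)
 then have r: "Well_order r" "Field r = N" using Well_order_Restr[OF W, of N] by (auto simp: r_def)
 have "\<not> small elts N"
 proof (cases "N = UNIV")
 case True then show ?thesis using not_small_UNIV by simp
 next
 case False
 then obtain b where "b : - N" by auto
 moreover have "wf (w - Id)" using W by (simp add: well_order_on_def)
 ultimately obtain a where a: "a \<notin> N" "!!c. (c, a) : w - Id ==> c : N"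
 by (metis ComplD ComplI wfE_min)
 have "underS w a \<subseteq> N" using a(2) by (auto simp: underS_def)
 then show ?thesis using a(1) small_subset[of N "underS w a"] by (auto simp: N_def)
 qed
 moreover have "small elts (underS r a)" if "a : N" for a
 proof -
 have "underS r a \<subseteq> underS w a" by (auto simp: underS_def r_def)
 then show ?thesis using that small_subset[of "underS w a" "underS r a"] by (auto simp: N_def)
 qed
 ultimately show ?thesis using r by blast
qed

text \<open>The successor cardinal of a small infinite set containing all the given fields is
  regular, and it is small because it embeds into the power set of that set. Since
  \<open>cardSuc\<close> lives on sets of elements, the result is finally transported to a member of
  the universe, so as to be a relation on \<open>'u\<close>.\<close>

lemma ex_regular_card:
 fixes kav :: "'i => 'u rel"
 assumes "small elts J" "!!i. i : J ==> Card_order (kav i) & small elts (Field (kav i))"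
 shows "EX r :: 'u rel. Card_order r & infinite (Field r) & regularCard r & small elts (Field r) &
 (ALL i:J. (kav i, r) : ordLeq)"
proof -
 obtain x0 where x0: "infinite (elts x0)"
 using gu by (auto simp: grothendieck_universe_def)
 define S where "S = elts x0 \<union> (\<Union>i\<in>J. Field (kav i))"
 have sS: "small elts S"
 unfolding S_def by (rule small_Un[OF small_elts small_UN]) (use assms in auto)
 have iS: "infinite S" using x0 by (simp add: S_def)
 define c where "c = cardSuc (card_of S)"
 have c: "Card_order c" "(card_of S, c) : ordLess"
 by (simp_all add: c_def cardSuc_Card_order[OF card_of_Card_order] cardSuc_greater[OF card_of_Card_order])
 have ic: "infinite (Field c)"
 unfolding c_def using iS cardSuc_finite[OF card_of_Card_order, of S] by (simp add: Field_card_of)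
 have "(c, card_of (Pow S)) : ordLeq"
 unfolding c_def by (rule cardSuc_least[OF card_of_Card_order card_of_Card_order card_of_Pow])
 then have "(card_of (Field c), card_of (Pow S)) : ordLeq"
 using card_of_Field_ordIso[OF c(1)] ordIso_ordLeq_trans by blast
 then obtain e where e: "inj_on e (Field c)" "e ` Field c \<subseteq> Pow S"
 using card_of_ordLeq by metis
 have "small elts (Field c)"
 using small_inj[OF e small_Pow[OF sS]] .
 then obtain y f where f: "bij_betw f (Field c) (elts y)" by (auto simp: small_def)
 have iso: "(c, card_of (elts y)) : ordIso"
 using ordIso_transitive[OF ordIso_symmetric[OF card_of_Field_ordIso[OF c(1)]]] f card_of_ordIso by blast
 have reg: "regularCard c"
 unfolding c_def
 by (rule infinite_cardSuc_regularCard[OF _ card_of_Card_order]) (simp add: Field_card_of iS)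
 have "Cinfinite c" using c(1) ic by (simp add: cinfinite_def)
 then have "regularCard (card_of (elts y))" using regularCard_ordIso[OF iso] reg by blast
 moreover have "(kav i, card_of (elts y)) : ordLeq" if "i : J" for i
 proof -
 have "(card_of (Field (kav i)), card_of S) : ordLeq"
 using that by (intro card_of_mono1) (auto simp: S_def)
 then have "(kav i, card_of S) : ordLeq"
 using that assms(2) ordIso_ordLeq_trans[OF ordIso_symmetric[OF card_of_Field_ordIso]] by blast
 then show ?thesis
 using ordLeq_transitive[OF _ ordLeq_ordIso_trans[OF ordLess_imp_ordLeq[OF c(2)] iso]] by blast
 qed
 moreover have "infinite (elts y)" using f ic bij_betw_finite by blast
 ultimately show ?thesis
 using small_elts by (intro exI[of _ "card_of (elts y)"]) (auto simp: card_of_card_order_on Field_card_of)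
qed

end

section \<open>Arrows with source and target\<close>

abbreviation dm :: "'o \<times> 'o \<times> 'm => 'o" where "dm f \<equiv> fst f"
abbreviation cd :: "'o \<times> 'o \<times> 'm => 'o" where "cd f \<equiv> fst (snd f)"
abbreviation mor :: "'o \<times> 'o \<times> 'm => 'm" where "mor f \<equiv> snd (snd f)"

text \<open>Hom sets may overlap, so arrows are handled as triples of source, target and morphism.
  Composition of triples needs no object arguments, and equations between long composites can be
  rewritten by associativity alone.\<close>

definition cmp :: "('o, 'm) cat => 'o \<times> 'o \<times> 'm => 'o \<times> 'o \<times> 'm => 'o \<times> 'o \<times> 'm" where
 "cmp C g f = (dm f, cd g, Cmp C (dm f) (cd f) (cd g) (mor g) (mor f))"

definition idt :: "('o, 'm) cat => 'o => 'o \<times> 'o \<times> 'm" where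
 "idt C X = (X, X, Idn C X)"

definition hm :: "('o, 'm) cat => 'o => 'o => ('o \<times> 'o \<times> 'm) set" where
 "hm C A B = {f : arrows C. dm f = A & cd f = B}"

lemma hm_iff [simp]: "f : hm C A B \<longleftrightarrow> f : arrows C & dm f = A & cd f = B"
 by (simp add: hm_def)

lemma tri_eqI: "dm f = dm g ==> cd f = cd g ==> mor f = mor g ==> f = g"
 by (simp add: prod_eq_iff)

lemma arrows_iff: "f : arrows C \<longleftrightarrow> dm f : Obj C & cd f : Obj C & mor f : Arr C (dm f) (cd f)"
 by (cases f) (auto simp: arrows_def)

lemma arrows_Obj: "f : arrows C ==> dm f : Obj C" "f : arrows C ==> cd f : Obj C"
 by (auto simp: arrows_iff)

lemma cmp_dm [simp]: "dm (cmp C g f) = dm f"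
 and cmp_cd [simp]: "cd (cmp C g f) = cd g"
 by (simp_all add: cmp_def)

lemma idt_dm [simp]: "dm (idt C X) = X"
 and idt_cd [simp]: "cd (idt C X) = X"
 by (simp_all add: idt_def)

locale ccat =
 fixes C :: "('o, 'm) cat"
 assumes cat: "category C"
begin

abbreviation ccmp (infixr \<open>$\<close> 75) where "g $ f \<equiv> cmp C g f"

lemma cat_id: "X : Obj C ==> Idn C X : Arr C X X"
 using cat[unfolded category_def, THEN conjunct1] by (rule bspec)

lemma cat_cmp: "X : Obj C ==> Y : Obj C ==> Z : Obj C ==> f : Arr C X Y ==> g : Arr C Y Z ==>
 Cmp C X Y Z g f : Arr C X Z"
 by (rule cat[unfolded category_def, THEN conjunct2, THEN conjunct1, THEN bspec, THEN bspec, THEN bspec, THEN bspec, THEN bspec])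

lemma cat_idr: "X : Obj C ==> Y : Obj C ==> f : Arr C X Y ==> Cmp C X X Y f (Idn C X) = f"
 and cat_idl: "X : Obj C ==> Y : Obj C ==> f : Arr C X Y ==> Cmp C X Y Y (Idn C Y) f = f"
 using cat[unfolded category_def, THEN conjunct2, THEN conjunct2, THEN conjunct1] by blast+

lemma cat_assoc: "X : Obj C ==> Y : Obj C ==> Z : Obj C ==> V : Obj C ==>
 f : Arr C X Y ==> g : Arr C Y Z ==> h : Arr C Z V ==>
 Cmp C X Z V h (Cmp C X Y Z g f) = Cmp C X Y V (Cmp C Y Z V h g) f"
 by (rule cat[unfolded category_def, THEN conjunct2, THEN conjunct2, THEN conjunct2, THEN bspec, THEN bspec, THEN bspec, THEN bspec, THEN bspec, THEN bspec, THEN bspec])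

lemma cmp_arr [simp]:
 "f : arrows C ==> g : arrows C ==> cd f = dm g ==> g $ f : arrows C"
 by (simp add: arrows_iff cmp_def cat_cmp)

lemma idt_arr [simp]: "X : Obj C ==> idt C X : arrows C"
 by (simp add: arrows_iff idt_def cat_id)

lemma cmp_assoc [simp]:
 "f : arrows C ==> g : arrows C ==> h : arrows C ==> cd f = dm g ==> cd g = dm h ==>
 (h $ g) $ f = h $ g $ f"
 by (simp add: arrows_iff cmp_def cat_assoc)

text \<open>Composites are normalized to the right; this form replaces the head \<open>h $ g\<close>
  of a longer composite in that normal form.\<close>

lemma cmp_assoc':
 "h $ g = k ==> f : arrows C ==> g : arrows C ==> h : arrows C ==> cd f = dm g ==> cd g = dm h ==>
 h $ g $ f = k $ f"
 by (metis cmp_assoc)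

lemma cmp_idt_left [simp]: "f : arrows C ==> cd f = X ==> idt C X $ f = f"
 by (cases f) (simp add: arrows_iff cmp_def idt_def cat_idl)

lemma cmp_idt_right [simp]: "f : arrows C ==> dm f = X ==> f $ idt C X = f"
 by (cases f) (simp add: arrows_iff cmp_def idt_def cat_idr)

lemma has_lifting_iff:
 assumes "i : arrows C" "p : arrows C"
 shows "has_lifting C i p \<longleftrightarrow> (ALL u:hm C (dm i) (dm p). ALL v:hm C (cd i) (cd p).
 p $ u = v $ i --> (EX h:hm C (cd i) (dm p). h $ i = u & p $ h = v))"
proof -
 obtain A B i' where i: "i = (A, B, i')" by (metis prod_cases3)
 obtain X Y p' where p: "p = (X, Y, p')" by (metis prod_cases3)
 have ob: "A : Obj C" "B : Obj C" "X : Obj C" "Y : Obj C"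
 using assms by (auto simp: i p arrows_iff)
 have *: "(ALL u:hm C A X. P u) \<longleftrightarrow> (ALL u:Arr C A X. P (A, X, u))"
 "(EX u:hm C A X. P u) \<longleftrightarrow> (EX u:Arr C A X. P (A, X, u))"
 if "A : Obj C" "X : Obj C" for P A X
 using that by (auto simp: arrows_iff)
 show ?thesis
 unfolding has_lifting_def i p using ob by (simp add: * cmp_def)
qed

end

section \<open>Diagrams indexed by relations\<close>

text \<open>Diagrams are indexed by a relation of arbitrary element type and keep their transition
  arrows as triples. Transfinite sequences and the span-shaped diagrams of pushouts are treated
  together in this way.\<close>

definition diag :: "('o, 'm) cat => 'i rel => ('i => 'o) => ('i => 'i => 'o \<times> 'o \<times> 'm) => bool" where
 "diag C R D x \<longleftrightarrow> (ALL a:Field R. D a : Obj C) &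
 (ALL a b. (a, b) : R --> x a b : hm C (D a) (D b)) &
 (ALL a:Field R. x a a = idt C (D a)) &
 (ALL a b c. (a, b) : R --> (b, c) : R --> cmp C (x b c) (x a b) = x a c)"

definition cocone ::
 "('o, 'm) cat => 'i rel => ('i => 'o) => ('i => 'i => 'o \<times> 'o \<times> 'm) => 'o => ('i => 'o \<times> 'o \<times> 'm) => bool" where
 "cocone C R D x L q \<longleftrightarrow> L : Obj C & (ALL a:Field R. q a : hm C (D a) L) &
 (ALL a b. (a, b) : R --> cmp C (q b) (x a b) = q a)"

definition colim ::
 "('o, 'm) cat => 'i rel => ('i => 'o) => ('i => 'i => 'o \<times> 'o \<times> 'm) => 'o => ('i => 'o \<times> 'o \<times> 'm) => bool" where
 "colim C R D x L q \<longleftrightarrow> cocone C R D x L q &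
 (ALL L' q'. cocone C R D x L' q' --> (EX! h. h : hm C L L' & (ALL a:Field R. cmp C h (q a) = q' a)))"

definition fc :: "('i => 'o) => ('i => 'i => 'o \<times> 'o \<times> 'm) => ('i, 'j, 'o, 'm) fun_cat" where
 "fc D x = \<lparr>FO = D, FA = (%a b u. mor (x a b))\<rparr>"

definition tr :: "('i, unit, 'o, 'm) fun_cat => 'i => 'i => 'o \<times> 'o \<times> 'm" where
 "tr X a b = (FO X a, FO X b, FA X a b ())"

lemma fc_tr: "fc (FO X) (tr X) = X"
 by (simp add: fc_def tr_def)

lemma diagD:
 assumes "diag C R D x"
 shows "a : Field R ==> D a : Obj C"
 "(a, b) : R ==> x a b : arrows C" "(a, b) : R ==> dm (x a b) = D a" "(a, b) : R ==> cd (x a b) = D b"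
 "a : Field R ==> x a a = idt C (D a)"
 "(a, b) : R ==> (b, c) : R ==> cmp C (x b c) (x a b) = x a c"
 using assms by (auto simp: diag_def)

lemma coconeD:
 assumes "cocone C R D x L q"
 shows "L : Obj C" "a : Field R ==> q a : arrows C" "a : Field R ==> dm (q a) = D a"
 "a : Field R ==> cd (q a) = L" "(a, b) : R ==> cmp C (q b) (x a b) = q a"
 using assms by (auto simp: cocone_def)

lemma colim_cocone: "colim C R D x L q ==> cocone C R D x L q"
 by (simp add: colim_def)

lemmas colimD = coconeD[OF colim_cocone]

lemma colim_ex:
 "colim C R D x L q ==> cocone C R D x L' q' ==>
 EX h. h : hm C L L' & (ALL a:Field R. cmp C h (q a) = q' a)"
 unfolding colim_def by blast

lemma (in ccat) colim_eqI:
 assumes co: "colim C R D x L q" and d: "diag C R D x"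
 and h: "h : arrows C" "dm h = L" and h': "h' : arrows C" "dm h' = L" and cd: "cd h = cd h'"
 and eq: "!!a. a : Field R ==> h $ q a = h' $ q a"
 shows "h = h'"
proof -
 have "cocone C R D x (cd h) (%a. h $ q a)"
 unfolding cocone_def
 proof (intro conjI ballI allI impI)
 fix a b assume ab: "(a, b) : R"
 then have "a : Field R" "b : Field R" by (auto simp: Field_def)
 then show "(h $ q b) $ x a b = h $ q a"
 using ab h colimD[OF co] diagD[OF d] by simp
 qed (use h colimD[OF co] in "auto simp: arrows_Obj")
 then have "EX! k. k : hm C L (cd h) & (ALL a:Field R. k $ q a = h $ q a)"
 using co unfolding colim_def by blast
 moreover have "h : hm C L (cd h) & (ALL a:Field R. h $ q a = h $ q a)"
 using h by simp
 moreover have "h' : hm C L (cd h) & (ALL a:Field R. h' $ q a = h $ q a)"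
 using h' eq cd by simp
 ultimately show ?thesis by blast
qed

lemma Field_Restr: "refl_on (Field r) r ==> S \<subseteq> Field r ==> Field (Restr r S) = S"
 by (auto simp: Field_def refl_on_def)

lemma diag_Restr: "diag C r D x ==> diag C (Restr r S) D x"
 unfolding diag_def by (auto simp: Field_def)

lemma colim_cong:
 assumes "!!a. a : Field R ==> D a = D' a & q a = q' a" "!!a b. (a, b) : R ==> x a b = x' a b"
 shows "colim C R D x L q = colim C R D' x' L q'"
proof -
 have "cocone C R D x L' w = cocone C R D' x' L' w" for L' w
 unfolding cocone_def using assms by (intro conj_cong) auto
 moreover have "cocone C R D x L q = cocone C R D x L q'"
 unfolding cocone_def using assms(1) by (intro conj_cong) (simp_all add: FieldI1 FieldI2)
 ultimately show ?thesis
 unfolding colim_def using assms(1) by simp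
qed

lemma is_functor_order_cat:
 assumes "refl_on (Field R) R" "trans R"
 shows "is_functor (order_cat R) C X \<longleftrightarrow> diag C R (FO X) (tr X)"
proof -
 have T: "(a, b) : R ==> (b, c) : R ==> (a, c) : R" for a b c using assms(2) by (auto dest: transD)
 have I: "a : Field R ==> (a, a) : R" for a using assms(1) by (auto simp: refl_on_def)
 show ?thesis
 proof
 assume f: "is_functor (order_cat R) C X"
 note f = f[unfolded is_functor_def order_cat_def cat.select_convs]
 note f1 = f[THEN conjunct1, THEN bspec]
 note f2 = f[THEN conjunct2, THEN conjunct1, THEN bspec, THEN bspec, THEN bspec]
 note f3 = f[THEN conjunct2, THEN conjunct2, THEN conjunct1, THEN bspec]
 note f4 = f[THEN conjunct2, THEN conjunct2, THEN conjunct2,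
 THEN bspec, THEN bspec, THEN bspec, THEN bspec, THEN bspec]
 show "diag C R (FO X) (tr X)"
 unfolding diag_def
 proof (intro conjI ballI allI impI)
 fix a assume "a : Field R"
 then show "FO X a : Obj C" "tr X a a = idt C (FO X a)"
 using f1 f3 by (simp_all add: tr_def idt_def)
 next
 fix a b assume ab: "(a, b) : R"
 note Fab = FieldI1[OF ab] FieldI2[OF ab]
 show "tr X a b : hm C (FO X a) (FO X b)"
 using f2[OF Fab, of "()"] f1[OF Fab(1)] f1[OF Fab(2)] ab by (simp add: tr_def arrows_iff)
 fix c assume bc: "(b, c) : R"
 have "FA X a c () = Cmp C (FO X a) (FO X b) (FO X c) (FA X b c ()) (FA X a b ())"
 by (rule f4[OF Fab FieldI2[OF bc]]) (use ab bc in simp_all)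
 then show "cmp C (tr X b c) (tr X a b) = tr X a c" by (simp add: tr_def cmp_def)
 qed
 next
 assume d: "diag C R (FO X) (tr X)"
 show "is_functor (order_cat R) C X"
 unfolding is_functor_def order_cat_def cat.select_convs
 proof (intro conjI ballI)
 fix a assume a: "a : Field R"
 show "FO X a : Obj C" using diagD(1)[OF d a] .
 show "FA X a a () = Idn C (FO X a)" using diagD(5)[OF d a] by (simp add: tr_def idt_def)
 fix b and u :: unit assume u: "u : {u. (a, b) : R}"
 then have ab: "(a, b) : R" by (metis mem_Collect_eq)
 show "FA X a b u : Arr C (FO X a) (FO X b)"
 using diagD(2)[OF d ab] by (simp add: tr_def arrows_iff)
 fix c and v :: unit assume "v : {u. (b, c) : R}"
 then have bc: "(b, c) : R" by (metis mem_Collect_eq)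
 show "FA X a c () = Cmp C (FO X a) (FO X b) (FO X c) (FA X b c v) (FA X a b u)"
 using diagD(6)[OF d ab bc] by (simp add: tr_def cmp_def)
 qed
 qed
qed

lemma cocone_cong:
 assumes "!!a. a : Field R ==> q a = q' a"
 shows "cocone C R D x L q = cocone C R D x L q'"
 unfolding cocone_def using assms by (intro conj_cong) (simp_all add: FieldI1 FieldI2)

lemma cocone_retag:
 assumes "cocone C R D x L w"
 shows "cocone C R D x L (%a. (D a, L, mor (w a)))"
proof -
 have "cocone C R D x L (%a. (D a, L, mor (w a))) = cocone C R D x L w"
 by (rule cocone_cong) (simp add: prod_eq_iff coconeD(3,4)[OF assms])
 then show ?thesis using assms by blast
qed

text \<open>The renaming \<open>e\<close> of indices lets one statement cover both
  \<open>order_cat\<close>, where it is the identity, and a copy of a preorder inside the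
  universe.\<close>

lemma is_colimit_iff_colim:
 fixes J :: "('j, 'a) cat" and e :: "'i => 'j"
 assumes d: "diag C R D x"
 and e: "inj_on e (Field R)" "Obj J = e ` Field R"
 and J: "!!a b. a : Field R ==> b : Field R ==> Arr J (e a) (e b) ~= {} \<longleftrightarrow> (a, b) : R"
 and X: "!!a. a : Field R ==> FO X (e a) = D a"
 "!!a b u. a : Field R ==> b : Field R ==> u : Arr J (e a) (e b) ==> FA X (e a) (e b) u = mor (x a b)"
 shows "is_colimit C J X L q \<longleftrightarrow> colim C R D x L (%a. (D a, L, q (e a)))"
proof -
 have *: "cmp C (D b, L, q' (e b)) (x a b) = (D a, L, q' (e a)) \<longleftrightarrow>
 Cmp C (D a) (D b) L (q' (e b)) (mor (x a b)) = q' (e a)" if "(a, b) : R" for a b L q'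
 using diagD(3,4)[OF d that] by (simp add: cmp_def)
 have **: "(D a, L, q' (e a)) : hm C (D a) L \<longleftrightarrow> q' (e a) : Arr C (D a) L"
 if "a : Field R" "L : Obj C" for a L q'
 using diagD(1)[OF d that(1)] that by (simp add: arrows_iff)
 have coc: "cocone_under C J X L q' \<longleftrightarrow> cocone C R D x L (%a. (D a, L, q' (e a)))" for L q'
 proof (cases "L : Obj C")
 case L: True
 have 1: "(ALL a:Obj J. q' a : Arr C (FO X a) L) \<longleftrightarrow> (ALL a:Field R. (D a, L, q' (e a)) : hm C (D a) L)"
 unfolding e(2) ball_simps using **[OF _ L] X(1) by (intro ball_cong) simp_all
 have 2: "(ALL u:Arr J (e a) (e b). Cmp C (FO X (e a)) (FO X (e b)) L (q' (e b)) (FA X (e a) (e b) u) = q' (e a)) \<longleftrightarrow>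
 ((a, b) : R --> cmp C (D b, L, q' (e b)) (x a b) = (D a, L, q' (e a)))"
 if "a : Field R" "b : Field R" for a b
 using J[OF that] * X(1)[OF that(1)] X(1)[OF that(2)] X(2)[OF that] by auto
 have 3: "(ALL a:Field R. ALL b:Field R. (a, b) : R --> P a b) \<longleftrightarrow> (ALL a b. (a, b) : R --> P a b)" for P
 by (blast intro: FieldI1 FieldI2)
 show ?thesis
 unfolding cocone_under_def cocone_def 1 3[symmetric]
 unfolding e(2) ball_simps using L 2 by (intro conj_cong ball_cong) simp_all
 next
 case False then show ?thesis by (simp add: cocone_under_def cocone_def)
 qed
 define e' where "e' = inv_into (Field R) e"
 have e'e: "e' (e a) = a" if "a : Field R" for a
 using e that by (simp add: e'_def)
 show ?thesis
 proof (cases "cocone C R D x L (%a. (D a, L, q (e a)))")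
 case True
 then have L: "L : Obj C" by (rule coconeD)
 have key: "(h : hm C L L' & (ALL a:Field R. cmp C h (D a, L, q (e a)) = (D a, L', q' (e a)))) \<longleftrightarrow>
 dm h = L & cd h = L' & mor h : Arr C L L' & (ALL a:Obj J. Cmp C (FO X a) L L' (mor h) (q a) = q' a)"
 if "L' : Obj C" for h L' q'
 proof -
 have "(ALL a:Field R. cmp C h (D a, L, q (e a)) = (D a, L', q' (e a))) \<longleftrightarrow>
 (ALL a:Obj J. Cmp C (FO X a) L L' (mor h) (q a) = q' a)" if "cd h = L'"
 unfolding e(2) ball_simps using X(1) that by (intro ball_cong) (simp_all add: cmp_def)
 then show ?thesis using that L by (auto simp: arrows_iff)
 qed
 have ex1: "(EX! h. h : hm C L L' & (ALL a:Field R. cmp C h (D a, L, q (e a)) = (D a, L', q' (e a)))) \<longleftrightarrow>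
 (EX! h. h : Arr C L L' & (ALL a:Obj J. Cmp C (FO X a) L L' h (q a) = q' a))" (is "(EX! h. ?P h) \<longleftrightarrow> (EX! h. ?Q h)")
 if L': "L' : Obj C" for L' q'
 proof -
 have PQ: "?P h \<longleftrightarrow> dm h = L & cd h = L' & ?Q (mor h)" for h
 by (rule key[OF L'])
 show ?thesis
 proof
 assume "EX! h. ?P h"
 then obtain h where h: "?P h" "!!k. ?P k ==> k = h" by blast
 show "EX! h. ?Q h"
 proof (rule ex1I)
 show "?Q (mor h)" using h(1) unfolding PQ by blast
 fix k assume "?Q k"
 then have "?P (L, L', k)" unfolding PQ fst_conv snd_conv by blast
 from h(2)[OF this] show "k = mor h" by (metis snd_conv)
 qed
 next
 assume "EX! h. ?Q h"
 then obtain h where h: "?Q h" "!!k. ?Q k ==> k = h" by blast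
 show "EX! h. ?P h"
 proof (rule ex1I)
 show "?P (L, L', h)" using h(1) unfolding PQ fst_conv snd_conv by blast
 fix k assume "?P k"
 then have "dm k = L" "cd k = L'" "?Q (mor k)" unfolding PQ by blast+
 then show "k = (L, L', h)" using h(2) by (metis prod.collapse)
 qed
 qed
 qed
 have ex1': "(EX! h. h : hm C L L' & (ALL a:Field R. cmp C h (D a, L, q (e a)) = w a)) \<longleftrightarrow>
 (EX! h. h : Arr C L L' & (ALL a:Obj J. Cmp C (FO X a) L L' h (q a) = mor (w (e' a))))"
 if w: "cocone C R D x L' w" for L' w
 proof -
 have "(D a, L', mor (w (e' (e a)))) = w a" if "a : Field R" for a
 using coconeD(3,4)[OF w that] e'e[OF that] by (simp add: prod_eq_iff)
 then show ?thesis
 using ex1[OF coconeD(1)[OF w], of "%a. mor (w (e' a))"] by (simp cong: ball_cong)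
 qed
 show ?thesis
 proof
 assume A: "is_colimit C J X L q"
 show "colim C R D x L (%a. (D a, L, q (e a)))"
 unfolding colim_def
 proof (intro conjI True allI impI)
 fix L' w assume w: "cocone C R D x L' w"
 have "cocone C R D x L' (%a. (D a, L', mor (w (e' (e a))))) =
 cocone C R D x L' (%a. (D a, L', mor (w a)))"
 by (rule cocone_cong) (simp add: e'e)
 with cocone_retag[OF w] have "cocone C R D x L' (%a. (D a, L', mor (w (e' (e a)))))"
 by blast
 then have "cocone_under C J X L' (%a. mor (w (e' a)))" unfolding coc .
 with A show "EX! h. h : hm C L L' & (ALL a:Field R. cmp C h (D a, L, q (e a)) = w a)"
 unfolding ex1'[OF w] is_colimit_def by blast
 qed
 next
 assume A: "colim C R D x L (%a. (D a, L, q (e a)))"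
 show "is_colimit C J X L q"
 unfolding is_colimit_def
 proof (intro conjI allI impI)
 show "cocone_under C J X L q" unfolding coc by (rule True)
 fix L' q' assume "cocone_under C J X L' q'"
 then have c: "cocone C R D x L' (%a. (D a, L', q' (e a)))" unfolding coc .
 from A c show "EX! h. h : Arr C L L' & (ALL a:Obj J. Cmp C (FO X a) L L' h (q a) = q' a)"
 unfolding colim_def ex1[OF coconeD(1)[OF c], symmetric] by blast
 qed
 qed
 next
 case False then show ?thesis unfolding is_colimit_def colim_def coc by simp
 qed
qed

lemma is_colimit_order_cat:
 assumes d: "diag C R D x"
 shows "is_colimit C (order_cat R) (fc D x) L q \<longleftrightarrow> colim C R D x L (%a. (D a, L, q a))"
 by (rule is_colimit_iff_colim[OF d, where e = "%a. a"]) (simp_all add: order_cat_def fc_def)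

text \<open>Colimits are assumed for index categories whose objects and arrows are elements of the
  universe. A small preorder is therefore recoded as such a category \<open>J\<close>, with
  \<open>undefined\<close> as the single arrow wherever the relation holds.\<close>

lemma (in universe) small_poset_colimit:
 fixes R :: "'i rel" and C :: "('o, 'm) cat"
 assumes C: "category C" "has_small_colimits elts C"
 and R: "refl_on (Field R) R" "trans R" "small elts (Field R)" and d: "diag C R D x"
 shows "EX L q. colim C R D x L q"
proof -
 obtain e :: "'i => 'u" and y where e: "bij_betw e (Field R) (elts y)"
 using R(3) by (auto simp: small_def)
 define e' where "e' = inv_into (Field R) e"
 have e'e: "e' (e a) = a" if "a : Field R" for a
 using e that by (simp add: e'_def bij_betw_def)
 define J :: "('u, 'u) cat" where
 "J = \<lparr>Obj = e ` Field R, Arr = (%a b. {c. c = undefined & (e' a, e' b) : R}), Idn = (%a. undefined),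
 Cmp = (%a b c v u. undefined)\<rparr>"
 have T: "(a, b) : R ==> (b, c) : R ==> (a, c) : R" for a b c using R(2) by (auto dest: transD)
 have I: "a : Field R ==> (a, a) : R" for a using R(1) by (auto simp: refl_on_def)
 define X :: "('u, 'u, 'o, 'm) fun_cat" where "X = fc (%a. D (e' a)) (%a b. x (e' a) (e' b))"
 have "category J"
 unfolding category_def J_def cat.select_convs using T I by (auto simp: e'e)
 moreover have "small elts (Arr J a b)" for a b
 by (rule small_finite) (simp add: J_def)
 ultimately have "small_category elts J"
 unfolding small_category_def using small_image[OF R(3), of e] by (simp add: J_def)
 moreover have "is_functor J C X"
 unfolding is_functor_def
 proof (intro conjI ballI)
 fix a assume "a : Obj J"
 then obtain a0 where a: "a = e a0" "a0 : Field R" by (auto simp: J_def)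
 show "FO X a : Obj C" using diagD(1)[OF d] a by (simp add: X_def fc_def e'e)
 show "FA X a a (Idn J a) = Idn C (FO X a)"
 using diagD(5)[OF d] a by (simp add: X_def fc_def e'e idt_def)
 fix b assume "b : Obj J"
 then obtain b0 where b: "b = e b0" "b0 : Field R" by (auto simp: J_def)
 show "FA X a b u : Arr C (FO X a) (FO X b)" if "u : Arr J a b" for u
 using diagD(2-4)[OF d, of a0 b0] that a b by (auto simp: X_def fc_def e'e J_def arrows_iff)
 fix c u v assume "c : Obj J" and u: "u : Arr J a b" and v: "v : Arr J b c"
 then obtain c0 where c: "c = e c0" "c0 : Field R" by (auto simp: J_def)
 have ab: "(a0, b0) : R" "(b0, c0) : R" using u v a b c by (auto simp: J_def e'e)
 show "FA X a c (Cmp J a b c v u) = Cmp C (FO X a) (FO X b) (FO X c) (FA X b c v) (FA X a b u)"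
 using diagD(6)[OF d ab] diagD(2-4)[OF d ab(1)] diagD(2-4)[OF d ab(2)] a b c
 by (auto simp: X_def fc_def e'e cmp_def prod_eq_iff)
 qed
 ultimately obtain L q where Lq: "is_colimit C J X L q"
 using C(2) unfolding has_small_colimits_def by blast
 have "is_colimit C J X L q \<longleftrightarrow> colim C R D x L (%a. (D a, L, q (e a)))"
 by (rule is_colimit_iff_colim[OF d]) (use e in "auto simp: J_def X_def fc_def e'e bij_betw_def")
 with Lq show ?thesis by blast
qed

declare arrows_Obj [simp]

section \<open>Well-orders\<close>

locale wo =
 fixes r :: "'i rel"
 assumes Wr: "Well_order r"
begin

lemma r_refl: "a : Field r ==> (a, a) : r"
 using Wr by (auto simp: order_on_defs refl_on_def)

lemma r_trans: "(a, b) : r ==> (b, c) : r ==> (a, c) : r"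
 using Wr by (auto simp: order_on_defs dest: transD)

lemma r_antisym: "(a, b) : r ==> (b, a) : r ==> a = b"
 using Wr by (auto simp: order_on_defs dest: antisymD)

lemma r_total: "a : Field r ==> b : Field r ==> (a, b) : r \<or> (b, a) : r"
 using Wr r_refl by (cases "a = b") (auto simp: order_on_defs total_on_def)

lemma r_wf: "wf (r - Id)"
 using Wr by (simp add: well_order_on_def)

lemma refl_r: "refl_on (Field r) r" using Wr by (auto simp: order_on_defs)

lemma trans_r: "trans r" using Wr by (auto simp: order_on_defs)

lemma underS_iff: "a : underS r b \<longleftrightarrow> a ~= b & (a, b) : r"
 by (auto simp: underS_def)

lemma under_iff: "a : under r b \<longleftrightarrow> (a, b) : r"
 by (auto simp: under_def)

lemma not_le: "a : Field r ==> b : Field r ==> (a, b) \<notin> r \<longleftrightarrow> b : underS r a"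
 using r_total r_antisym r_refl by (auto simp: underS_iff)

lemma r_induct [consumes 1, case_names less]:
 assumes "a : Field r"
 and "!!a. a : Field r ==> (!!b. b : underS r a ==> P b) ==> P a"
 shows "P a"
 using r_wf assms(1)
proof (induction a rule: wf_induct_rule)
 case (less a)
 show ?case
 proof (rule assms(2)[OF less.prems])
 fix b assume b: "b : underS r a"
 then have "(b, a) : r - Id" "b : Field r" by (auto simp: underS_iff FieldI1)
 then show "P b" by (rule less.IH)
 qed
qed

lemma r_least:
 assumes "S ~= {}" "S \<subseteq> Field r"
 shows "EX m:S. ALL s:S. (m, s) : r"
proof -
 obtain m where m: "m : S" "!!y. (y, m) : r - Id ==> y \<notin> S"
 using wfE_min[OF r_wf] assms(1) by (metis ex_in_conv)
 have "(m, s) : r" if "s : S" for s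
 using m(2)[of s] r_total[of m s] r_refl[of m] that assms(2) m(1) by blast
 then show ?thesis using m(1) by blast
qed

lemma succ_under:
 assumes "is_succ r a b"
 shows "(a, b) : r" "a ~= b" "c : underS r b \<longleftrightarrow> (c, a) : r"
proof -
 show ab: "(a, b) : r" "a ~= b" using assms by (auto simp: is_succ_def underS_iff)
 show "c : underS r b \<longleftrightarrow> (c, a) : r"
 proof
 assume "c : underS r b" then show "(c, a) : r"
 using assms under_iff[of c a] by (auto simp: is_succ_def)
 next
 assume ca: "(c, a) : r"
 then have "(c, b) : r" using ab r_trans by blast
 moreover have "c ~= b" using ca ab r_antisym by blast
 ultimately show "c : underS r b" by (simp add: underS_iff)
 qed
qed

lemma succ_unique: "is_succ r a b ==> is_succ r a' b ==> a = a'"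
 using succ_under[of a b] succ_under[of a' b] r_antisym[of a a'] underS_iff[of a b] underS_iff[of a' b] by blast

lemma ex_succ:
 assumes "a : underS r b"
 shows "EX c. is_succ r a c & (c, b) : r"
proof -
 have aF: "a : Field r" "b : Field r" using assms by (auto simp: underS_iff FieldI1 FieldI2)
 obtain c where c: "a : underS r c" "!!d. a : underS r d ==> (c, d) : r"
 proof -
 have "{d. a : underS r d} \<subseteq> Field r" by (auto simp: underS_iff intro: FieldI2)
 then show ?thesis using r_least[of "{d. a : underS r d}"] assms that by blast
 qed
 have "(d, a) : r" if "d : underS r c" for d
 proof (rule ccontr)
 assume n: "(d, a) \<notin> r"
 have dF: "d : Field r" using that by (auto simp: underS_iff FieldI1)
 from n have "a : underS r d" using not_le[OF dF aF(1)] by simp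
 then have "(c, d) : r" by (rule c(2))
 then show False using that r_antisym by (auto simp: underS_iff)
 qed
 then show ?thesis using c assms by (auto simp: is_succ_def under_iff)
qed

lemma r_cases:
 assumes "a : Field r"
 obtains (zero) "underS r a = {}" | (succ) b where "is_succ r b a" | (lim) "is_limit_elt r a"
 using assms by (auto simp: is_limit_elt_def)

lemma limit_succ:
 assumes "is_limit_elt r c" "a : underS r c"
 shows "EX b. is_succ r a b & b : underS r c"
 using ex_succ[OF assms(2)] assms(1) by (auto simp: is_limit_elt_def underS_iff)

lemma underS_Field: "underS r c \<subseteq> Field r" by (auto simp: underS_iff FieldI1)

lemma Field_RU: "Field (Restr r (underS r c)) = underS r c"
 by (rule Field_Restr[OF refl_r underS_Field])

lemma refl_Restr: "refl_on (Field (Restr r S)) (Restr r S)"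
 using refl_r by (auto simp: refl_on_def Field_def)

lemma trans_Restr: "trans (Restr r S)"
 using trans_r by (auto simp: trans_def)

end

lemma (in wo) diag_cong:
 assumes d: "diag C r D x" and x: "!!a b. (a, b) : r ==> x a b = x' a b"
 shows "diag C r D x'"
 unfolding diag_def
proof (intro conjI ballI allI impI)
 fix a assume a: "a : Field r"
 show "D a : Obj C" by (rule diagD(1)[OF d a])
 show "x' a a = idt C (D a)" using diagD(5)[OF d a] x[OF r_refl[OF a]] by simp
next
 fix a b assume ab: "(a, b) : r"
 show "x' a b : hm C (D a) (D b)" using diagD(2-4)[OF d ab] x[OF ab] by simp
 fix c assume bc: "(b, c) : r"
 show "cmp C (x' b c) (x' a b) = x' a c"
 using diagD(6)[OF d ab bc] x[OF ab] x[OF bc] x[OF r_trans[OF ab bc]] by simp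
qed

definition lamseq :: "('o, 'm) cat => 'i rel => ('i => 'o) => ('i => 'i => 'o \<times> 'o \<times> 'm) => bool" where
 "lamseq C r D x \<longleftrightarrow> diag C r D x &
 (ALL c. is_limit_elt r c --> colim C (Restr r (underS r c)) D x (D c) (%b. x b c))"

lemma FO_fc: "FO (fc D x) = D" by (simp add: fc_def)

lemma FA_fc: "FA (fc D x) a b u = mor (x a b)" by (simp add: fc_def)

lemma lambda_sequence_fc:
 assumes "Well_order r" "lamseq C r D x"
 shows "lambda_sequence C r (fc D x)"
proof -
 interpret wo r by unfold_locales (rule assms)
 have d: "diag C r D x" using assms by (simp add: lamseq_def)
 have t: "tr (fc D x) a b = x a b" if "(a, b) : r" for a b
 using diagD(3,4)[OF d that] by (simp add: tr_def fc_def prod_eq_iff)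
 have "diag C r (FO (fc D x)) (tr (fc D x))"
 unfolding FO_fc by (rule diag_cong[OF d t[symmetric]])
 then have f: "is_functor (order_cat r) C (fc D x)"
 using is_functor_order_cat[OF refl_r trans_r, of C "fc D x"] by blast
 have "is_colimit C (order_cat (Restr r (underS r c))) (fc D x) (D c) (%b. mor (x b c))"
 if c: "is_limit_elt r c" for c
 proof -
 have *: "(D b, D c, mor (x b c)) = x b c" if "b : underS r c" for b
 using diagD(3,4)[OF d, of b c] that by (simp add: underS_iff prod_eq_iff)
 have "colim C (Restr r (underS r c)) D x (D c) (%a. x a c)"
 using assms(2) c unfolding lamseq_def by blast
 also have "?this \<longleftrightarrow> colim C (Restr r (underS r c)) D x (D c) (%a. (D a, D c, mor (x a c)))"
 by (rule colim_cong) (simp_all add: Field_RU *)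
 finally show ?thesis unfolding is_colimit_order_cat[OF diag_Restr[OF d]] .
 qed
 with f show ?thesis unfolding lambda_sequence_def FO_fc FA_fc by blast
qed

lemma lamseq_tr:
 assumes "Well_order r" "lambda_sequence C r X"
 shows "lamseq C r (FO X) (tr X)"
proof -
 interpret wo r by unfold_locales (rule assms)
 have d: "diag C r (FO X) (tr X)"
 using assms(2) is_functor_order_cat[OF refl_r trans_r] by (auto simp: lambda_sequence_def)
 have "colim C (Restr r (underS r c)) (FO X) (tr X) (FO X c) (%b. tr X b c)"
 if c: "is_limit_elt r c" for c
 using assms(2) c is_colimit_order_cat[OF diag_Restr[OF d], of "underS r c" "FO X c" "%b. FA X b c ()"]
 unfolding fc_tr lambda_sequence_def tr_def by blast
 with d show ?thesis by (simp add: lamseq_def)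
qed

context ccat
begin

text \<open>A cocone \<open>w\<close> on the cofinal part is extended to an index \<open>a\<close>
  by composing with the transition from \<open>a\<close> to some \<open>e b\<close> above it.
  Totality of \<open>R'\<close> makes this independent of \<open>b\<close>, as two choices can be
  compared along the diagram.\<close>

lemma colim_cofinal:
 assumes d: "diag C R D x" and co: "colim C R D x L q"
 and e: "!!a b. (a, b) : R' ==> (e a, e b) : R" "!!b. b : Field R' ==> e b : Field R"
 and cof: "!!a. a : Field R ==> EX b:Field R'. (a, e b) : R"
 and tot: "!!a b. a : Field R' ==> b : Field R' ==> (a, b) : R' \<or> (b, a) : R'"
 and tr: "trans R" and rf: "!!a. a : Field R ==> (a, a) : R"
 shows "colim C R' (%b. D (e b)) (%a b. x (e a) (e b)) L (%b. q (e b))"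
proof -
 have cc: "cocone C R' (%b. D (e b)) (%a b. x (e a) (e b)) L (%b. q (e b))"
 unfolding cocone_def using colimD[OF co] e by auto
 have "EX! h. h : hm C L L' & (ALL b:Field R'. h $ q (e b) = w b)"
 if w: "cocone C R' (%b. D (e b)) (%a b. x (e a) (e b)) L' w" for L' w
 proof -
 note wD = coconeD[OF w]
 define f where "f a = (SOME b. b : Field R' & (a, e b) : R)" for a
 have f: "f a : Field R' & (a, e (f a)) : R" if "a : Field R" for a
 unfolding f_def using cof[OF that] by (metis (mono_tags, lifting) someI_ex)
 have ind: "w b $ x a (e b) = w b' $ x a (e b')"
 if b: "(b, b') : R'" "(a, e b) : R" for a b b'
 proof -
 have bF: "b : Field R'" "b' : Field R'" using b by (auto intro: FieldI1 FieldI2)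
 have "w b $ x a (e b) = (w b' $ x (e b) (e b')) $ x a (e b)" using wD(5)[OF b(1)] by simp
 also have "... = w b' $ x (e b) (e b') $ x a (e b)"
 using diagD(2-4)[OF d b(2)] diagD(2-4)[OF d e(1)[OF b(1)]] wD(2-4)[OF bF(2)] by simp
 finally show ?thesis using diagD(6)[OF d b(2) e(1)[OF b(1)]] by simp
 qed
 have ind': "w b $ x a (e b) = w b' $ x a (e b')"
 if "b : Field R'" "b' : Field R'" "(a, e b) : R" "(a, e b') : R" for a b b'
 using tot[OF that(1,2)] ind that(3,4) by metis
 have c: "cocone C R D x L' (%a. w (f a) $ x a (e (f a)))"
 unfolding cocone_def
 proof (intro conjI ballI allI impI)
 show "L' : Obj C" by (rule wD)
 show "w (f a) $ x a (e (f a)) : hm C (D a) L'" if "a : Field R" for a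
 using f[OF that] wD diagD(2-4)[OF d, of a "e (f a)"] by simp
 fix a b assume ab: "(a, b) : R"
 have F: "a : Field R" "b : Field R" using ab by (auto intro: FieldI1 FieldI2)
 have a2: "(a, e (f b)) : R" using ab f[OF F(2)] tr by (meson transD)
 have "(w (f b) $ x b (e (f b))) $ x a b = w (f b) $ x b (e (f b)) $ x a b"
 using f[OF F(2)] wD diagD(2-4)[OF d, of b "e (f b)"] diagD(2-4)[OF d ab] by simp
 also have "... = w (f b) $ x a (e (f b))"
 using diagD(6)[OF d ab, of "e (f b)"] f[OF F(2)] by simp
 also have "... = w (f a) $ x a (e (f a))"
 using ind' f[OF F(1)] f[OF F(2)] a2 by blast
 finally show "(w (f b) $ x b (e (f b))) $ x a b = w (f a) $ x a (e (f a))" .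
 qed
 obtain h where h: "h : hm C L L'" "!!a. a : Field R ==> h $ q a = w (f a) $ x a (e (f a))"
 using colim_ex[OF co c] by blast
 have h2: "h $ q (e b) = w b" if b: "b : Field R'" for b
 proof -
 have "h $ q (e b) = w (f (e b)) $ x (e b) (e (f (e b)))" using h(2) e(2)[OF b] by blast
 also have "... = w b $ x (e b) (e b)"
 by (rule ind') (use f[OF e(2)[OF b]] b rf[OF e(2)[OF b]] in auto)
 also have "... = w b"
 using diagD(5)[OF d e(2)[OF b]] wD(2,3)[OF b] by simp
 finally show ?thesis .
 qed
 show ?thesis
 proof (rule ex1I[of _ h])
 show "h : hm C L L' & (ALL b:Field R'. h $ q (e b) = w b)" using h(1) h2 by blast
 fix k assume k: "k : hm C L L' & (ALL b:Field R'. k $ q (e b) = w b)"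
 show "k = h"
 proof (rule colim_eqI[OF co d])
 fix a assume a: "a : Field R"
 have q: "q a = q (e (f a)) $ x a (e (f a))"
 using colimD(5)[OF co] f[OF a] by simp
 have eF: "e (f a) : Field R" using f[OF a] e(2) by blast
 have "k $ q a = (k $ q (e (f a))) $ x a (e (f a))"
 unfolding q
 by (rule cmp_assoc[symmetric]) (use k colimD(2-4)[OF co eF] diagD(2-4)[OF d, of a "e (f a)"] f[OF a] in simp_all)
 also have "... = (h $ q (e (f a))) $ x a (e (f a))"
 using k h2 f[OF a] by simp
 also have "... = h $ q a"
 unfolding q using h(1) colimD(2-4)[OF co eF] diagD(2-4)[OF d, of a "e (f a)"] f[OF a] by simp
 finally show "k $ q a = h $ q a" .
 qed (use k h(1) in auto)
 qed
 qed
 with cc show ?thesis unfolding colim_def by blast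
qed

text \<open>A largest index computes the colimit.\<close>

lemma colim_top:
 assumes d: "diag C R D x" and t: "t : Field R" "!!a. a : Field R ==> (a, t) : R"
 shows "colim C R D x (D t) (%a. x a t)"
proof -
 have cc: "cocone C R D x (D t) (%a. x a t)"
 unfolding cocone_def
 proof (intro conjI ballI allI impI)
 fix a b assume ab: "(a, b) : R"
 show "x b t $ x a b = x a t" using diagD(6)[OF d ab t(2)[OF FieldI2[OF ab]]] .
 qed (use diagD[OF d] t in auto)
 have "EX! h. h : hm C (D t) L' & (ALL a:Field R. h $ x a t = w a)"
 if w: "cocone C R D x L' w" for L' w
 proof (rule ex1I[of _ "w t"])
 show "w t : hm C (D t) L' & (ALL a:Field R. w t $ x a t = w a)"
 using coconeD[OF w] t by simp
 fix k assume k: "k : hm C (D t) L' & (ALL a:Field R. k $ x a t = w a)"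
 then have "k $ x t t = w t" using t by simp
 then show "k = w t" using k diagD(5)[OF d t(1)] by simp
 qed
 with cc show ?thesis unfolding colim_def by blast
qed

section \<open>Lifting properties\<close>

definition llp :: "('o \<times> 'o \<times> 'm) set => ('o \<times> 'o \<times> 'm) set" where
 "llp T = {i : arrows C. ALL p:T. has_lifting C i p}"

lemma llp_lift:
 assumes "i : llp T" "p : T" "T \<subseteq> arrows C"
 and "u : arrows C" "v : arrows C" "dm u = dm i" "cd u = dm p" "dm v = cd i" "cd v = cd p"
 and "p $ u = v $ i"
 shows "EX h. h : arrows C & dm h = cd i & cd h = dm p & h $ i = u & p $ h = v"
proof -
 have ip: "i : arrows C" "p : arrows C" "has_lifting C i p" using assms by (auto simp: llp_def)
 have uv: "u : hm C (dm i) (dm p)" "v : hm C (cd i) (cd p)" using assms by simp_all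
 from ip(3)[unfolded has_lifting_iff[OF ip(1,2)], THEN bspec, OF uv(1), THEN bspec, OF uv(2), THEN mp, OF assms(10)]
 obtain h where "h : hm C (cd i) (dm p)" "h $ i = u" "p $ h = v" by (elim bexE conjE)
 then show ?thesis by (intro exI[of _ h]) simp
qed

lemma llpI:
 assumes "i : arrows C" "T \<subseteq> arrows C"
 and "!!p u v. p : T ==> p : arrows C ==> u : arrows C ==> v : arrows C ==> dm u = dm i ==> cd u = dm p ==>
 dm v = cd i ==> cd v = cd p ==> p $ u = v $ i ==>
 EX h. h : arrows C & dm h = cd i & cd h = dm p & h $ i = u & p $ h = v"
 shows "i : llp T"
 unfolding llp_def
proof (intro CollectI conjI ballI assms(1))
 fix p assume p: "p : T"
 then have pa: "p : arrows C" using assms(2) by blast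
 show "has_lifting C i p"
 unfolding has_lifting_iff[OF assms(1) pa]
 proof (intro ballI impI)
 fix u v assume u: "u : hm C (dm i) (dm p)" "v : hm C (cd i) (cd p)" "p $ u = v $ i"
 obtain h where "h : arrows C & dm h = cd i & cd h = dm p & h $ i = u & p $ h = v"
 using assms(3)[OF p pa, of u v] u by auto
 then show "EX h:hm C (cd i) (dm p). h $ i = u & p $ h = v" by auto
 qed
qed

lemma llp_arrows: "i : llp T ==> i : arrows C" by (simp add: llp_def)

lemma rlp_lift:
 assumes "p : rlp C I" "i : I" "I \<subseteq> arrows C"
 and "u : arrows C" "v : arrows C" "dm u = dm i" "cd u = dm p" "dm v = cd i" "cd v = cd p"
 and "p $ u = v $ i"
 shows "EX h. h : arrows C & dm h = cd i & cd h = dm p & h $ i = u & p $ h = v"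
proof -
 have ip: "i : arrows C" "p : arrows C" "has_lifting C i p" using assms by (auto simp: rlp_def)
 have uv: "u : hm C (dm i) (dm p)" "v : hm C (cd i) (cd p)" using assms by simp_all
 from ip(3)[unfolded has_lifting_iff[OF ip(1,2)], THEN bspec, OF uv(1), THEN bspec, OF uv(2), THEN mp, OF assms(10)]
 obtain h where "h : hm C (cd i) (dm p)" "h $ i = u" "p $ h = v" by (elim bexE conjE)
 then show ?thesis by (intro exI[of _ h]) simp
qed

lemma rlpI:
 assumes "p : arrows C" "I \<subseteq> arrows C"
 and "!!i u v. i : I ==> i : arrows C ==> u : arrows C ==> v : arrows C ==> dm u = dm i ==> cd u = dm p ==>
 dm v = cd i ==> cd v = cd p ==> p $ u = v $ i ==>
 EX h. h : arrows C & dm h = cd i & cd h = dm p & h $ i = u & p $ h = v"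
 shows "p : rlp C I"
 unfolding rlp_def
proof (intro CollectI conjI ballI assms(1))
 fix i assume i: "i : I"
 then have ia: "i : arrows C" using assms(2) by blast
 show "has_lifting C i p"
 unfolding has_lifting_iff[OF ia assms(1)]
 proof (intro ballI impI)
 fix u v assume u: "u : hm C (dm i) (dm p)" "v : hm C (cd i) (cd p)" "p $ u = v $ i"
 obtain h where "h : arrows C & dm h = cd i & cd h = dm p & h $ i = u & p $ h = v"
 using assms(3)[OF i ia, of u v] u by auto
 then show "EX h:hm C (cd i) (dm p). h $ i = u & p $ h = v" by auto
 qed
qed

end

context wo begin

lemma le_lt_trans:
 assumes "(a, b) : r" "b : underS r c" shows "a : underS r c"
proof -
 have bc: "b ~= c" "(b, c) : r" using assms(2) by (auto simp: underS_iff)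
 have "a ~= c" using r_antisym[of b c] assms(1) bc by blast
 then show ?thesis using r_trans[OF assms(1) bc(2)] by (simp add: underS_iff)
qed

lemma lt_le_trans:
 assumes "a : underS r b" "(b, c) : r" shows "a : underS r c"
proof -
 have ab: "a ~= b" "(a, b) : r" using assms(1) by (auto simp: underS_iff)
 have "a ~= c" using r_antisym[of a b] assms(2) ab by blast
 then show ?thesis using r_trans[OF ab(2) assms(2)] by (simp add: underS_iff)
qed

lemma underS_le: "a : underS r b ==> (a, b) : r" by (simp add: underS_iff)

lemma underS_F: "a : underS r b ==> a : Field r" "a : underS r b ==> b : Field r"
 by (auto simp: underS_iff intro: FieldI1 FieldI2)

end

text \<open>Lifts on all stages are chosen by well-founded recursion, each restricting to the
  earlier ones: the given map at the first stage, a lift against the transition map at a successor,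
  the induced map at a limit. Their induced map out of the colimit is the required lift.\<close>

lemma (in ccat) llp_transfinite:
 assumes Wr: "Well_order r" and X: "lamseq C r D x" and co: "colim C r D x L q"
 and T: "T \<subseteq> arrows C" and succ: "!!a b. is_succ r a b ==> x a b : llp T"
 and z: "z : Field r" "!!b. b : Field r ==> (z, b) : r"
 shows "q z : llp T"
proof (rule llpI[OF _ T])
 interpret wo r by unfold_locales (rule Wr)
 have d: "diag C r D x" using X by (simp add: lamseq_def)
 note q = colimD[OF co]
 show "q z : arrows C" by (rule q(2)[OF z(1)])
 fix p u v
 assume p: "p : T" "p : arrows C" and u: "u : arrows C" "dm u = dm (q z)" "cd u = dm p"
 and v: "v : arrows C" "dm v = cd (q z)" "cd v = cd p" and sq: "p $ u = v $ q z"
 have u': "dm u = D z" and v': "dm v = L" using u v q z(1) by simp_all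
 \<comment> \<open>\<open>y\<close> is an admissible lift on stage \<open>a\<close>, given the lifts
   \<open>h\<close> strictly below \<open>a\<close>. Indices outside \<open>Field r\<close> impose
   nothing, so that the recursion may run over the whole type.\<close>
 define P where "P h a y \<longleftrightarrow> (a : Field r --> y : hm C (D a) (dm p) & p $ y = v $ q a & (a = z --> y = u) &
 (ALL b:underS r a. y $ x b a = h b))" for h a y
 have "EX h. ALL a. P h a (h a)"
 proof (rule dependent_wf_choice[OF r_wf])
 fix f g :: "'a => 'o \<times> 'o \<times> 'm" and a y
 assume "!!c. (c, a) : r - Id ==> f c = g c"
 then have "(ALL b:underS r a. y $ x b a = f b) = (ALL b:underS r a. y $ x b a = g b)"
 by (intro ball_cong refl) (simp add: underS_iff)
 then show "P f a y = P g a y" unfolding P_def by simp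
 next
 fix a h assume H: "!!c. (c, a) : r - Id ==> P h c (h c)"
 have Hc: "h c : arrows C" "dm (h c) = D c" "cd (h c) = dm p" "p $ h c = v $ q c"
 "b : underS r c ==> h c $ x b c = h b" if c: "c : underS r a" for b c
 proof -
 have "(c, a) : r - Id" "c : Field r" using c by (auto simp: underS_iff intro: FieldI1)
 then have *: "h c : hm C (D c) (dm p) & p $ h c = v $ q c & (c = z --> h c = u) &
 (ALL b:underS r c. h c $ x b c = h b)" using H P_def by blast
 then show "h c : arrows C" "dm (h c) = D c" "cd (h c) = dm p" "p $ h c = v $ q c"
 "b : underS r c ==> h c $ x b c = h b" by simp_all
 qed
 have Hle: "h c $ x b c = h b" if "c : underS r a" "(b, c) : r" for b c
 proof (cases "b = c")
 case True
 have "c : Field r" using that by (auto simp: underS_iff intro: FieldI1)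
 then show ?thesis using True diagD(5)[OF d] Hc(1,2)[OF that(1)] by simp
 next
 case False then show ?thesis using Hc(5)[OF that(1)] that(2) by (simp add: underS_iff)
 qed
 show "EX y. P h a y"
 proof (cases "a : Field r")
 case False then show ?thesis by (simp add: P_def)
 next
 case a: True
 note qa = q(2-4)[OF a]
 from a show ?thesis
 proof (cases rule: r_cases)
 case zero
 have "a = z" using zero z(2)[OF a] underS_iff[of z a] by auto
 then have "P h a u" unfolding P_def using u u' sq zero by simp
 then show ?thesis by blast
 next
 case (succ b)
 note s = succ_under[OF succ]
 have bu: "b : underS r a" using s by (simp add: underS_iff)
 note xb = diagD(2-4)[OF d s(1)]
 have "p $ h b = v $ q a $ x b a" using Hc(4)[OF bu] q(5)[OF s(1)] by simp
 also have "... = (v $ q a) $ x b a" using v v' qa xb by simp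
 finally have sq': "p $ h b = (v $ q a) $ x b a" .
 obtain y where y: "y : arrows C" "dm y = cd (x b a)" "cd y = dm p" "y $ x b a = h b" "p $ y = v $ q a"
 using llp_lift[OF assms(5)[OF succ] p(1) T Hc(1)[OF bu] _ _ _ _ _ sq'] Hc(2,3)[OF bu] v v' qa xb by auto
 have "y $ x c a = h c" if c: "c : underS r a" for c
 proof -
 have cb: "(c, b) : r" using c s(3) by simp
 have "y $ x c a = y $ x b a $ x c b" using diagD(6)[OF d cb s(1)] by simp
 also have "... = h b $ x c b"
 by (rule cmp_assoc'[OF y(4)]) (use y xb diagD(2-4)[OF d cb] in simp_all)
 also have "... = h c" using Hle[OF bu cb] by simp
 finally show ?thesis .
 qed
 moreover have "a ~= z" using s z(2)[OF FieldI1[OF s(1)]] r_antisym by blast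
 ultimately have "P h a y" unfolding P_def using y xb by simp
 then show ?thesis by blast
 next
 case lim
 have dR: "diag C (Restr r (underS r a)) D x" by (rule diag_Restr[OF d])
 have co': "colim C (Restr r (underS r a)) D x (D a) (%b. x b a)" using X lim by (simp add: lamseq_def)
 have "cocone C (Restr r (underS r a)) D x (dm p) h"
 unfolding cocone_def Field_RU using Hc(1-3) Hle p(2) by simp
 from colim_ex[OF co' this] obtain y where y: "y : hm C (D a) (dm p)"
 "!!b. b : underS r a ==> y $ x b a = h b" unfolding Field_RU by blast
 have "p $ y = v $ q a"
 proof (rule colim_eqI[OF co' dR])
 fix b assume "b : Field (Restr r (underS r a))"
 then have b: "b : underS r a" by (simp add: Field_RU)
 then have ba: "(b, a) : r" by (simp add: underS_iff)
 note xb = diagD(2-4)[OF d ba]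
 have "(p $ y) $ x b a = p $ h b" using y(1) y(2)[OF b] p xb by simp
 also have "... = (v $ q a) $ x b a" using Hc(4)[OF b] q(5)[OF ba] v v' qa xb by simp
 finally show "(p $ y) $ x b a = (v $ q a) $ x b a" .
 qed (use y p v v' qa in simp_all)
 moreover have "a ~= z" using lim z(2) underS_iff r_antisym by (metis FieldI1 ex_in_conv is_limit_elt_def)
 ultimately have "P h a y" unfolding P_def using y by simp
 then show ?thesis by blast
 qed
 qed
 qed
 then obtain h where h: "!!a. a : Field r ==> h a : hm C (D a) (dm p) & p $ h a = v $ q a & (a = z --> h a = u) &
 (ALL b:underS r a. h a $ x b a = h b)" unfolding P_def by blast
 have "h b $ x a b = h a" if "(a, b) : r" for a b
 proof (cases "a = b")
 case True
 have "a : Field r" using that by (rule FieldI1)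
 then show ?thesis using True diagD(5)[OF d] h[of a] by simp
 next
 case False
 then have "a : underS r b" using that by (simp add: underS_iff)
 then show ?thesis using h[OF FieldI2[OF that]] by blast
 qed
 moreover have "h a : hm C (D a) (dm p)" if "a : Field r" for a using h[OF that] by blast
 ultimately have "cocone C r D x (dm p) h" unfolding cocone_def using p(2) by simp
 from colim_ex[OF co this] obtain k where k: "k : hm C L (dm p)" "!!a. a : Field r ==> k $ q a = h a" by blast
 have "p $ k = v"
 proof (rule colim_eqI[OF co d])
 fix a assume a: "a : Field r"
 have "(p $ k) $ q a = p $ h a" using k p q(2-4)[OF a] a by simp
 also have "... = v $ q a" using h[OF a] by simp
 finally show "(p $ k) $ q a = v $ q a" .
 qed (use k p v v' in simp_all)
 moreover have "k $ q z = u" using k(2)[OF z(1)] h[OF z(1)] by simp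
 ultimately show "EX h. h : arrows C & dm h = cd (q z) & cd h = dm p & h $ q z = u & p $ h = v"
 using k(1) q(4)[OF z(1)] by (intro exI[of _ k]) simp
qed

section \<open>Transfinite towers\<close>

text \<open>Validity of stage \<open>b\<close> of a tower, stated through data at indices up to
  \<open>b\<close>. \<open>e\<close> is extra data on each stage (for instance a map to a target),
  \<open>G\<close> its admissibility, \<open>Rl\<close> its compatibility with transition arrows,
  and \<open>S\<close> is what a successor step has to achieve.\<close>

definition tower_at ::
 "('o, 'm) cat => 'i rel => 'o => 'e => ('i => 'o => 'e => bool) =>
 ('i => 'i => 'o => 'e => 'o => 'e => 'o \<times> 'o \<times> 'm => bool) =>
 ('i => 'i => ('i => 'o) => ('i => 'e) => ('i => 'i => 'o \<times> 'o \<times> 'm) => 'o => 'e => 'o \<times> 'o \<times> 'm => bool) =>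
 ('i => 'o) => ('i => 'e) => ('i => 'i => 'o \<times> 'o \<times> 'm) => 'i => bool" where
 "tower_at C r X0 e0 G Rl S X e x b \<longleftrightarrow>
 X b : Obj C & G b (X b) (e b) & x b b = idt C (X b) &
 (ALL a:underS r b. x a b : hm C (X a) (X b) & Rl a b (X a) (e a) (X b) (e b) (x a b)) &
 (ALL a a'. a : underS r a' --> a' : underS r b --> cmp C (x a' b) (x a a') = x a b) &
 (underS r b = {} --> X b = X0 & e b = e0) &
 (ALL a. is_succ r a b --> S a b X e x (X b) (e b) (x a b)) &
 (is_limit_elt r b --> colim C (Restr r (underS r b)) X x (X b) (%a. x a b))"

lemma tower_atD:
 assumes "tower_at C r X0 e0 G Rl S X e x b"
 shows "X b : Obj C" "G b (X b) (e b)" "x b b = idt C (X b)"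
 "a : underS r b ==> x a b : arrows C" "a : underS r b ==> dm (x a b) = X a" "a : underS r b ==> cd (x a b) = X b"
 "a : underS r b ==> Rl a b (X a) (e a) (X b) (e b) (x a b)"
 "a : underS r a' ==> a' : underS r b ==> cmp C (x a' b) (x a a') = x a b"
 "underS r b = {} ==> X b = X0" "underS r b = {} ==> e b = e0"
 "is_succ r a b ==> S a b X e x (X b) (e b) (x a b)"
 "is_limit_elt r b ==> colim C (Restr r (underS r b)) X x (X b) (%a. x a b)"
 using assms unfolding tower_at_def hm_iff by blast+

text \<open>Kept apart from \<open>tower_data\<close>, whose limit assumption is verified in
  applications with the help of \<open>tow_diag\<close>.\<close>

locale tower_base = ccat C + wo r
 for C :: "('o, 'm) cat" and r :: "'i rel" +
 fixes X0 :: 'o and e0 :: 'e and G :: "'i => 'o => 'e => bool"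
 and Rl :: "'i => 'i => 'o => 'e => 'o => 'e => 'o \<times> 'o \<times> 'm => bool"
 and S :: "'i => 'i => ('i => 'o) => ('i => 'e) => ('i => 'i => 'o \<times> 'o \<times> 'm) => 'o => 'e => 'o \<times> 'o \<times> 'm => bool"
begin

abbreviation "tow X e x b \<equiv> tower_at C r X0 e0 G Rl S X e x b"

lemma tow_diag:
 assumes U: "U \<subseteq> Field r" "!!a b. b : U ==> (a, b) : r ==> a : U" and t: "!!b. b : U ==> tow X e x b"
 shows "diag C (Restr r U) X x"
proof -
 have F: "Field (Restr r U) = U" by (rule Field_Restr[OF refl_r U(1)])
 show ?thesis
 unfolding diag_def F
 proof (intro conjI ballI allI impI)
 fix a assume a: "a : U"
 show "X a : Obj C" "x a a = idt C (X a)" using tower_atD(1,3)[OF t[OF a]] by simp_all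
 next
 fix a b assume ab: "(a, b) : Restr r U"
 then have u: "(a, b) : r" "a : U" "b : U" by auto
 show xab: "x a b : hm C (X a) (X b)"
 proof (cases "a = b")
 case True then show ?thesis using tower_atD(1,3)[OF t[OF u(2)]] by simp
 next
 case False then show ?thesis using u tower_atD(4-6)[OF t[OF u(3)], of a] by (simp add: underS_iff)
 qed
 fix c assume "(b, c) : Restr r U"
 then have v: "(b, c) : r" "c : U" by auto
 show "cmp C (x b c) (x a b) = x a c"
 proof (cases "a = b")
 case True
 show ?thesis
 proof (cases "b = c")
 case True with \<open>a = b\<close> show ?thesis using tower_atD(1,3)[OF t[OF u(2)]] by simp
 next
 case False then have "b : underS r c" using v by (simp add: underS_iff)
 with \<open>a = b\<close> show ?thesis using tower_atD(1,3)[OF t[OF u(2)]] tower_atD(4-6)[OF t[OF v(2)], of b] by simp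
 qed
 next
 case ne: False
 then have au: "a : underS r b" using u by (simp add: underS_iff)
 show ?thesis
 proof (cases "b = c")
 case True then show ?thesis using tower_atD(1,3)[OF t[OF u(3)]] tower_atD(4-6)[OF t[OF u(3)] au] by simp
 next
 case False then have "b : underS r c" using v by (simp add: underS_iff)
 then show ?thesis using tower_atD(8)[OF t[OF v(2)] au] by simp
 qed
 qed
 qed
qed

end

text \<open>\<open>S_cong\<close> expresses that the condition on the step from \<open>a\<close>
  reads only data at indices up to \<open>a\<close>. Later choices then cannot destroy it, which is
  what the recursion over stages requires.\<close>

locale tower_data = tower_base C r X0 e0 G Rl S
 for C :: "('o, 'm) cat" and r :: "'i rel" and X0 :: 'o and e0 :: 'e and G Rl S +
 assumes G0: "X0 : Obj C" "!!b. b : Field r ==> underS r b = {} ==> G b X0 e0"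
 and Rl_refl: "!!a Y f. G a Y f ==> Y : Obj C ==> Rl a a Y f Y f (idt C Y)"
 and Rl_trans: "!!a b c X e Y f Z g u v. a : underS r b ==> b : underS r c ==>
 Rl a b X e Y f u ==> Rl b c Y f Z g v ==> G a X e ==> G b Y f ==> G c Z g ==>
 u : hm C X Y ==> v : hm C Y Z ==> Rl a c X e Z g (cmp C v u)"
 and S_cong: "!!a b X e x X' e' x' Y f j. (!!c. (c, a) : r ==> X c = X' c & e c = e' c & (ALL d. x d c = x' d c)) ==>
 S a b X e x Y f j ==> S a b X' e' x' Y f j"
 and step: "!!a b X e x. is_succ r a b ==> (!!c. (c, a) : r ==> tower_at C r X0 e0 G Rl S X e x c) ==>
 EX Y f j. Y : Obj C & G b Y f & j : hm C (X a) Y & Rl a b (X a) (e a) Y f j & S a b X e x Y f j"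
 and lim: "!!c X e x. is_limit_elt r c ==> (!!b. b : underS r c ==> tower_at C r X0 e0 G Rl S X e x b) ==>
 EX L f q. colim C (Restr r (underS r c)) X x L q & G c L f & (ALL a:underS r c. Rl a c (X a) (e a) L f (q a))"
begin

lemma tow_cong:
 assumes agree: "!!c. (c, b) : r ==> X c = X' c & e c = e' c & (ALL d. x d c = x' d c)"
 and b: "b : Field r" and t: "tow X e x b"
 shows "tow X' e' x' b"
proof -
 note D = tower_atD[OF t]
 have ab: "X b = X' b" "e b = e' b" "x d b = x' d b" for d using agree[OF r_refl[OF b]] by auto
 have ac: "X c = X' c" "e c = e' c" "x d c = x' d c" if "c : underS r b" for c d
 using agree[of c] that by (auto simp: underS_iff)
 show ?thesis
 unfolding tower_at_def
 proof (intro conjI ballI allI impI)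
 show "X' b : Obj C" "G b (X' b) (e' b)" "x' b b = idt C (X' b)" using D(1-3) ab by simp_all
 next
 fix a assume a: "a : underS r b"
 show "x' a b : hm C (X' a) (X' b)" "Rl a b (X' a) (e' a) (X' b) (e' b) (x' a b)"
 using D(4-7)[OF a] ac[OF a] ab by simp_all
 next
 fix a a' assume a: "a : underS r a'" "a' : underS r b"
 show "cmp C (x' a' b) (x' a a') = x' a b" using D(8)[OF a] ac(3)[OF a(2), of a] ab(3) by simp
 next
 assume "underS r b = {}" then show "X' b = X0" "e' b = e0" using D(9,10) ab by simp_all
 next
 fix a assume s: "is_succ r a b"
 have "S a b X' e' x' (X b) (e b) (x a b)"
 proof (rule S_cong[OF _ D(11)[OF s]])
 fix c assume "(c, a) : r"
 then have "c : underS r b" using succ_under[OF s] by simp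
 then show "X c = X' c & e c = e' c & (ALL d. x d c = x' d c)" using ac by simp
 qed
 then show "S a b X' e' x' (X' b) (e' b) (x' a b)" using ab by simp
 next
 assume l: "is_limit_elt r b"
 have "colim C (Restr r (underS r b)) X x (X b) (%a. x a b) = colim C (Restr r (underS r b)) X' x' (X b) (%a. x' a b)"
 by (rule colim_cong) (auto simp: Field_RU ac ab)
 then show "colim C (Restr r (underS r b)) X' x' (X' b) (%a. x' a b)"
 using D(12)[OF l] ab by simp
 qed
qed

lemma tow_Rl:
 assumes "tow X e x a" "tow X e x b" "(a, b) : r"
 shows "Rl a b (X a) (e a) (X b) (e b) (x a b)"
proof (cases "a = b")
 case True then show ?thesis using Rl_refl tower_atD(1-3)[OF assms(1)] by simp
next
 case False then show ?thesis using tower_atD(7)[OF assms(2), of a] assms(3) by (simp add: underS_iff)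
qed

lemma tow_lamseq:
 assumes t: "!!b. b : Field r ==> tow X e x b"
 shows "lamseq C r X x"
proof -
 have R: "Restr r (Field r) = r" by (auto intro: FieldI1 FieldI2)
 have "diag C (Restr r (Field r)) X x"
 by (rule tow_diag) (auto intro: FieldI1 t)
 then show ?thesis
 unfolding lamseq_def R using tower_atD(12)[OF t] by (simp add: is_limit_elt_def)
qed

text \<open>Given all earlier stages, stage \<open>b\<close> and its column \<open>w\<close> of
  incoming transitions are: the starting object at zero, the chosen step preceded by the transitions
  into the predecessor at a successor, the colimit with its coprojections at a limit.\<close>

lemma tower_next:
 assumes b: "b : Field r" and t: "!!c. c : underS r b ==> tow X e x c"
 shows "EX Y f w. tow (X(b := Y)) (e(b := f)) (%a c. if c = b then w a else x a c) b"
proof -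
 have ne: "c ~= b" if "c : underS r b" for c using that by (simp add: underS_iff)
 have tr: "c : underS r b" if "c : underS r d" "d : underS r b" for c d
 using le_lt_trans[OF underS_le[OF that(1)] that(2)] .
 have dg: "diag C (Restr r (underS r b)) X x"
 proof (rule tow_diag[OF underS_Field _ t])
 fix a c assume "c : underS r b" "(a, c) : r"
 then show "a : underS r b" using le_lt_trans by blast
 qed
 have dr: "(a, c) : Restr r (underS r b)" if "c : underS r b" "(a, c) : r" for a c
 using le_lt_trans[OF that(2,1)] that by blast
 from b show ?thesis
 proof (cases rule: r_cases)
 case zero
 then have "\<not> is_succ r a b" for a by (auto simp: is_succ_def)
 moreover have "\<not> is_limit_elt r b" using zero by (simp add: is_limit_elt_def)
 ultimately have "tow (X(b := X0)) (e(b := e0)) (%a c. if c = b then idt C X0 else x a c) b"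
 unfolding tower_at_def using zero G0 b by simp
 then show ?thesis by (intro exI[of _ X0] exI[of _ e0] exI[of _ "%_. idt C X0"])
 next
 case (succ a)
 note s = succ_under[OF succ]
 have au: "a : underS r b" using s by (simp add: underS_iff)
 have ta: "tow X e x c" if "(c, a) : r" for c using t that s by blast
 obtain Y f j where Y: "Y : Obj C" "G b Y f" and j: "j : hm C (X a) Y" and R: "Rl a b (X a) (e a) Y f j"
 and S: "S a b X e x Y f j"
 using step[OF succ ta] by blast
 define w where "w c = (if c = b then idt C Y else j $ x c a)" for c
 have xa: "x c a : arrows C" "dm (x c a) = X c" "cd (x c a) = X a" if "c : underS r b" for c
 proof -
 have "(c, a) : Restr r (underS r b)" using that s au by simp
 then show "x c a : arrows C" "dm (x c a) = X c" "cd (x c a) = X a" using diagD(2-4)[OF dg] by simp_all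
 qed
 have xaa: "x a a = idt C (X a)" by (rule tower_atD(3)[OF t[OF au]])
 have "tow (X(b := Y)) (e(b := f)) (%a c. if c = b then w a else x a c) b"
 unfolding tower_at_def
 proof (intro conjI ballI allI impI)
 show "(X(b := Y)) b : Obj C" "G b ((X(b := Y)) b) ((e(b := f)) b)"
 "(if b = b then w b else x b b) = idt C ((X(b := Y)) b)" using Y by (simp_all add: w_def)
 next
 fix c assume c: "c : underS r b"
 show "(if b = b then w c else x c b) : hm C ((X(b := Y)) c) ((X(b := Y)) b)"
 using ne[OF c] xa[OF c] j by (simp add: w_def)
 have "Rl c b (X c) (e c) Y f (j $ x c a)"
 proof (cases "c = a")
 case True then show ?thesis using R j xaa by simp
 next
 case False
 then have ca: "c : underS r a" using c s by (simp add: underS_iff)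
 show ?thesis
 by (rule Rl_trans[OF ca au tower_atD(7)[OF t[OF au] ca] R tower_atD(2)[OF t[OF c]]
 tower_atD(2)[OF t[OF au]] Y(2) _ j]) (use xa[OF c] in simp)
 qed
 then show "Rl c b ((X(b := Y)) c) ((e(b := f)) c) ((X(b := Y)) b) ((e(b := f)) b) (if b = b then w c else x c b)"
 using ne[OF c] by (simp add: w_def)
 next
 fix c c' assume c: "c : underS r c'" "c' : underS r b"
 have cb: "c : underS r b" by (rule tr[OF c])
 have r1: "(c, c') : Restr r (underS r b)" "(c', a) : Restr r (underS r b)"
 using dr[OF c(2), of c] c(1) dr[OF au, of c'] c(2) s by (simp_all add: underS_iff)
 have "(j $ x c' a) $ x c c' = j $ x c' a $ x c c'"
 using j xa[OF c(2)] diagD(2-4)[OF dg r1(1)] by simp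
 also have "... = j $ x c a" using diagD(6)[OF dg r1] by simp
 finally show "cmp C (if b = b then w c' else x c' b) (if c' = b then w c else x c c') = (if b = b then w c else x c b)"
 using ne[OF c(2)] ne[OF cb] by (simp add: w_def)
 next
 assume "underS r b = {}" then show "(X(b := Y)) b = X0" "(e(b := f)) b = e0" using au by auto
 next
 fix a' assume "is_succ r a' b"
 then have [simp]: "a' = a" by (rule succ_unique[OF _ succ])
 have "S a b (X(b := Y)) (e(b := f)) (%a c. if c = b then w a else x a c) Y f j"
 proof (rule S_cong[OF _ S])
 fix c assume "(c, a) : r"
 then have "c ~= b" using s ne by blast
 then show "X c = (X(b := Y)) c & e c = (e(b := f)) c & (ALL d. x d c = (if c = b then w d else x d c))" by simp
 qed
 moreover have "w a = j" using ne[OF au] j xaa by (simp add: w_def)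
 ultimately show "S a' b (X(b := Y)) (e(b := f)) (%a c. if c = b then w a else x a c) ((X(b := Y)) b) ((e(b := f)) b)
 (if b = b then w a' else x a' b)" by simp
 next
 assume "is_limit_elt r b"
 then show "colim C (Restr r (underS r b)) (X(b := Y)) (%a c. if c = b then w a else x a c) ((X(b := Y)) b)
 (%a. if b = b then w a else x a b)" using succ by (auto simp: is_limit_elt_def)
 qed
 then show ?thesis by blast
 next
 case l: lim
 obtain L f q where co: "colim C (Restr r (underS r b)) X x L q" and Gb: "G b L f"
 and R: "!!a. a : underS r b ==> Rl a b (X a) (e a) L f (q a)"
 using lim[OF l t] by blast
 note q = colimD[OF co, unfolded Field_RU]
 define w where "w c = (if c = b then idt C L else q c)" for c
 have "tow (X(b := L)) (e(b := f)) (%a c. if c = b then w a else x a c) b"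
 unfolding tower_at_def
 proof (intro conjI ballI allI impI)
 show "(X(b := L)) b : Obj C" "G b ((X(b := L)) b) ((e(b := f)) b)"
 "(if b = b then w b else x b b) = idt C ((X(b := L)) b)" using q(1) Gb by (simp_all add: w_def)
 next
 fix c assume c: "c : underS r b"
 show "(if b = b then w c else x c b) : hm C ((X(b := L)) c) ((X(b := L)) b)"
 "Rl c b ((X(b := L)) c) ((e(b := f)) c) ((X(b := L)) b) ((e(b := f)) b) (if b = b then w c else x c b)"
 using ne[OF c] q(2-4)[OF c] R[OF c] by (simp_all add: w_def)
 next
 fix c c' assume c: "c : underS r c'" "c' : underS r b"
 have cb: "c : underS r b" by (rule tr[OF c])
 have "(c, c') : Restr r (underS r b)" using dr[OF c(2), of c] c(1) by (simp add: underS_iff)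
 from q(5)[OF this] show "cmp C (if b = b then w c' else x c' b) (if c' = b then w c else x c c') = (if b = b then w c else x c b)"
 using ne[OF c(2)] ne[OF cb] by (simp add: w_def)
 next
 assume "underS r b = {}" then show "(X(b := L)) b = X0" "(e(b := f)) b = e0" using l by (auto simp: is_limit_elt_def)
 next
 fix a' assume "is_succ r a' b"
 then show "S a' b (X(b := L)) (e(b := f)) (%a c. if c = b then w a else x a c) ((X(b := L)) b) ((e(b := f)) b)
 (if b = b then w a' else x a' b)" using l by (auto simp: is_limit_elt_def)
 next
 have "colim C (Restr r (underS r b)) X x L q = colim C (Restr r (underS r b)) (X(b := L)) (%a c. if c = b then w a else x a c) L w"
 by (rule colim_cong) (auto simp: Field_RU w_def underS_iff)
 then show "colim C (Restr r (underS r b)) (X(b := L)) (%a c. if c = b then w a else x a c) ((X(b := L)) b)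
 (%a. if b = b then w a else x a b)" using co by simp
 qed
 then show ?thesis by blast
 qed
qed

theorem tower_exists: "EX X e x. ALL b:Field r. tow X e x b"
proof -
 define Xf where "Xf F a = fst (F a)" for F :: "'i => 'o \<times> 'e \<times> ('i => 'o \<times> 'o \<times> 'm)" and a
 define ef where "ef F a = fst (snd (F a))" for F :: "'i => 'o \<times> 'e \<times> ('i => 'o \<times> 'o \<times> 'm)" and a
 define xf where "xf F a b = snd (snd (F b)) a" for F :: "'i => 'o \<times> 'e \<times> ('i => 'o \<times> 'o \<times> 'm)" and a b
 \<comment> \<open>A value of the recursion consists of an object, its extra data and the column of
   all transitions into it. The stage condition is evaluated for \<open>F(b := v)\<close>, hence
   depends on \<open>F\<close> only below \<open>b\<close>.\<close>
 define P where "P F b v \<longleftrightarrow> (b : Field r --> tow (Xf (F(b := v))) (ef (F(b := v))) (xf (F(b := v))) b)" for F b v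
 have "EX F. ALL b. P F b (F b)"
 proof (rule dependent_wf_choice[OF r_wf])
 have 1: "P g b v" if fg: "!!c. (c, b) : r - Id ==> f c = g c" and "P f b v" for f g b v
 unfolding P_def
 proof
 assume b: "b : Field r"
 show "tow (Xf (g(b := v))) (ef (g(b := v))) (xf (g(b := v))) b"
 proof (rule tow_cong[OF _ b])
 show "tow (Xf (f(b := v))) (ef (f(b := v))) (xf (f(b := v))) b" using b that(2) by (simp add: P_def)
 fix c assume "(c, b) : r"
 then have "(f(b := v)) c = (g(b := v)) c" using fg[of c] by auto
 then show "Xf (f(b := v)) c = Xf (g(b := v)) c & ef (f(b := v)) c = ef (g(b := v)) c &
 (ALL d. xf (f(b := v)) d c = xf (g(b := v)) d c)" unfolding Xf_def ef_def xf_def by simp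
 qed
 qed
 show "P f b v = P g b v" if "!!c. (c, b) : r - Id ==> f c = g c" for f g b v
 using 1[of b f g v] 1[of b g f v] that by metis
 next
 fix b F assume H: "!!c. (c, b) : r - Id ==> P F c (F c)"
 show "EX v. P F b v"
 proof (cases "b : Field r")
 case False then show ?thesis by (simp add: P_def)
 next
 case b: True
 have "tow (Xf F) (ef F) (xf F) c" if "c : underS r b" for c
 using H[of c] that FieldI1[of c b r] by (simp add: underS_iff P_def)
 from tower_next[OF b this] obtain Y f w where
 w: "tow ((Xf F)(b := Y)) ((ef F)(b := f)) (%a c. if c = b then w a else xf F a c) b" by blast
 have "Xf (F(b := (Y, f, w))) = (Xf F)(b := Y)" "ef (F(b := (Y, f, w))) = (ef F)(b := f)"
 "xf (F(b := (Y, f, w))) = (%a c. if c = b then w a else xf F a c)"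
 by (auto simp: Xf_def ef_def xf_def fun_eq_iff)
 then have "P F b (Y, f, w)" using w by (simp add: P_def)
 then show ?thesis by blast
 qed
 qed
 then obtain F where "!!b. P F b (F b)" by metis
 then have "ALL b:Field r. tow (Xf F) (ef F) (xf F) b" by (simp add: P_def)
 then show ?thesis by blast
qed

end

section \<open>Pushouts\<close>

text \<open>All spans are glued at once, as the colimit over a preorder in which \<open>None\<close>
  stands for \<open>X\<close>, \<open>Some (k, False)\<close> for the source of \<open>f k\<close>
  and \<open>Some (k, True)\<close> for its target. A single index gives the ordinary
  pushout.\<close>

lemma (in universe) wide_pushout:
 fixes C :: "('o, 'm) cat" and K :: "'k set"
 assumes C: "category C" "has_small_colimits elts C" and K: "small elts K" and X: "X : Obj C"
 and f: "!!k. k : K ==> f k : arrows C"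
 and g: "!!k. k : K ==> g k : arrows C" "!!k. k : K ==> dm (g k) = dm (f k)" "!!k. k : K ==> cd (g k) = X"
 shows "EX Y j w. Y : Obj C & j : hm C X Y & (ALL k:K. w k : hm C (cd (f k)) Y & cmp C j (g k) = cmp C (w k) (f k)) &
 (ALL Z:Obj C. ALL x:hm C X Z. ALL y. (ALL k:K. y k : hm C (cd (f k)) Z & cmp C x (g k) = cmp C (y k) (f k)) -->
 (EX h:hm C Y Z. cmp C h j = x & (ALL k:K. cmp C h (w k) = y k))) &
 (ALL h h'. h : arrows C --> h' : arrows C --> dm h = Y --> dm h' = Y --> cd h = cd h' -->
 cmp C h j = cmp C h' j --> (ALL k:K. cmp C h (w k) = cmp C h' (w k)) --> h = h')"
proof -
 interpret ccat C by unfold_locales (rule C)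
 define N :: "('k \<times> bool) option set" where "N = insert None ((%k. Some (k, False)) ` K \<union> (%k. Some (k, True)) ` K)"
 define R :: "('k \<times> bool) option rel" where
 "R = Id_on N \<union> (%k. (Some (k, False), None)) ` K \<union> (%k. (Some (k, False), Some (k, True))) ` K"
 define D where "D n = (case n of None => X | Some (k, b) => if b then cd (f k) else dm (f k))" for n
 define d where "d m n = (if m = n then idt C (D m) else case m of None => idt C X | Some (k, b) =>
 (case n of None => g k | Some _ => f k))" for m n :: "('k \<times> bool) option"
 have FR: "Field R = N" unfolding Field_def R_def N_def by (auto simp: Id_on_def)
 have Rc: "P" if "(m, n) : R" "m = n ==> m : N ==> P" "!!k. k : K ==> m = Some (k, False) ==> n = None ==> P"
 "!!k. k : K ==> m = Some (k, False) ==> n = Some (k, True) ==> P" for m n P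
 using that unfolding R_def by auto
 have Nc: "P" if "n : N" "n = None ==> P" "!!k b. k : K ==> n = Some (k, b) ==> P" for n P
 using that unfolding N_def by auto
 have R2: "m = n \<or> n = l" if "(m, n) : R" "(n, l) : R" for m n l
 using that unfolding R_def by auto
 have DO: "D n : Obj C" if "n : N" for n
 by (rule Nc[OF that]) (use X f in "auto simp: D_def")
 have dg: "diag C R D d"
 unfolding diag_def FR
 proof (intro conjI ballI allI impI)
 show "D n : Obj C" "d n n = idt C (D n)" if "n : N" for n using DO[OF that] by (simp_all add: d_def)
 show dm: "d m n : hm C (D m) (D n)" if "(m, n) : R" for m n
 by (rule Rc[OF that]) (use DO f g in "simp_all add: d_def D_def")
 fix m n l assume a: "(m, n) : R" "(n, l) : R"
 from R2[OF a] show "d n l $ d m n = d m l"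
 using dm[OF a(1)] dm[OF a(2)] by (elim disjE) (simp_all add: d_def)
 qed
 have refl: "refl_on (Field R) R" unfolding FR unfolding R_def N_def by (auto simp: refl_on_def)
 have trans: "trans R" unfolding trans_def using R2 by blast
 have "small elts N" unfolding N_def by (rule small_insert[OF small_Un[OF small_image[OF K] small_image[OF K]]])
 then obtain Y q where co: "colim C R D d Y q"
 using small_poset_colimit[OF C refl trans _ dg] FR by auto
 have N0: "None : N" and N1: "k : K ==> Some (k, b) : N" for k b by (cases b; auto simp: N_def)+
 have Rk: "(Some (k, False), None) : R" "(Some (k, False), Some (k, True)) : R" if "k : K" for k
 using that by (auto simp: R_def)
 note q = colimD[OF co, unfolded FR]
 define j where "j = q None"
 define w where "w k = q (Some (k, True))" for k
 have j: "j : hm C X Y" using q(2-4)[OF N0] by (simp add: j_def D_def)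
 have w: "w k : hm C (cd (f k)) Y" if "k : K" for k using q(2-4)[OF N1[OF that]] by (simp add: w_def D_def)
 have qF: "q (Some (k, False)) = j $ g k" "q (Some (k, False)) = w k $ f k" if "k : K" for k
 using q(5)[OF Rk(1)[OF that]] q(5)[OF Rk(2)[OF that]] by (simp_all add: j_def w_def d_def)
 have ex: "EX h:hm C Y Z. h $ j = x & (ALL k:K. h $ w k = y k)"
 if Z: "Z : Obj C" and x: "x : hm C X Z" and y: "ALL k:K. y k : hm C (cd (f k)) Z & x $ g k = y k $ f k" for Z x y
 proof -
 define q' where "q' n = (case n of None => x | Some (k, b) => if b then y k else x $ g k)" for n
 have "cocone C R D d Z q'"
 unfolding cocone_def FR
 proof (intro conjI ballI allI impI Z)
 fix n assume "n : N"
 then show q'n: "q' n : hm C (D n) Z"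
 by (rule Nc) (use x y f g in "simp_all add: q'_def D_def")
 next
 fix m n assume "(m, n) : R"
 then show "q' n $ d m n = q' m"
 proof (rule Rc)
 assume mn: "m = n" "m : N"
 have "q' n : hm C (D n) Z"
 by (rule Nc[OF mn(2)[unfolded mn(1)]]) (use x y f g in "simp_all add: q'_def D_def")
 then show "q' n $ d m n = q' m" using mn by (simp add: d_def)
 qed (use y in "simp_all add: q'_def d_def")
 qed
 from colim_ex[OF co this] obtain h where "h : hm C Y Z" "ALL n:N. h $ q n = q' n" unfolding FR by blast
 then show ?thesis using N0 N1 by (intro bexI[of _ h]) (auto simp: j_def w_def q'_def)
 qed
 have un: "h = h'" if h: "h : arrows C" "h' : arrows C" "dm h = Y" "dm h' = Y" "cd h = cd h'"
 and e: "h $ j = h' $ j" "ALL k:K. h $ w k = h' $ w k" for h h'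
 proof (rule colim_eqI[OF co dg h(1,3,2,4,5)])
 fix n assume "n : Field R"
 then have "n : N" by (simp add: FR)
 then show "h $ q n = h' $ q n"
 proof (rule Nc)
 fix k b assume k: "k : K" and n: "n = Some (k, b)"
 show "h $ q n = h' $ q n"
 proof (cases b)
 case True then show ?thesis using n e(2) k by (simp add: w_def)
 next
 case False
 have "h $ j $ g k = (h $ j) $ g k" using h j g k by simp
 also have "... = h' $ j $ g k" unfolding e(1) using h j g k by simp
 finally show ?thesis using False n qF(1)[OF k] by simp
 qed
 qed (use e(1) in "simp add: j_def")
 qed
 have "j $ g k = w k $ f k" if "k : K" for k using qF[OF that] by simp
 then show ?thesis
 using q(1) j w ex un
 by (intro exI[of _ Y] exI[of _ j] exI[of _ w]) blast
qed

context ccat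
begin

lemma is_pushoutI:
 assumes i: "i : arrows C" and u: "u : arrows C" "dm u = dm i"
 and j: "j : arrows C" "dm j = cd u" and v: "v : arrows C" "dm v = cd i" "cd v = cd j"
 and eq: "j $ u = v $ i"
 and ex: "!!x b. x : arrows C ==> b : arrows C ==> dm x = cd u ==> dm b = cd i ==> cd x = cd b ==> x $ u = b $ i ==>
 EX h:hm C (cd j) (cd x). h $ j = x & h $ v = b"
 and un: "!!h h'. h : arrows C ==> h' : arrows C ==> dm h = cd j ==> dm h' = cd j ==> cd h = cd h' ==>
 h $ j = h' $ j ==> h $ v = h' $ v ==> h = h'"
 shows "is_pushout C (dm i) (cd i) (cd u) (cd j) (mor i) (mor u) (mor j) (mor v)"
proof -
 have ob: "dm i : Obj C" "cd i : Obj C" "cd u : Obj C" "cd j : Obj C" using i u j by simp_all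
 have mm: "mor f : Arr C (dm f) (cd f)" if "f : arrows C" for f using that arrows_iff by blast
 have A: "mor i : Arr C (dm i) (cd i)" "mor u : Arr C (dm i) (cd u)" "mor j : Arr C (cd u) (cd j)" "mor v : Arr C (cd i) (cd j)"
 using mm[OF i] mm[OF u(1)] mm[OF j(1)] mm[OF v(1)] u j v by simp_all
 have E: "Cmp C (dm i) (cd u) (cd j) (mor j) (mor u) = Cmp C (dm i) (cd i) (cd j) (mor v) (mor i)"
 using eq u j v unfolding cmp_def by simp
 have "EX! h. h : Arr C (cd j) Z & Cmp C (cd u) (cd j) Z h (mor j) = x & Cmp C (cd i) (cd j) Z h (mor v) = b"
 if Z: "Z : Obj C" and x: "x : Arr C (cd u) Z" and b: "b : Arr C (cd i) Z"
 and xb: "Cmp C (dm i) (cd u) Z x (mor u) = Cmp C (dm i) (cd i) Z b (mor i)" for Z x b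
 proof -
 have T: "(cd u, Z, x) : arrows C" "(cd i, Z, b) : arrows C" using Z x b ob by (simp_all add: arrows_iff del: arrows_Obj)
 have "(cd u, Z, x) $ u = (cd i, Z, b) $ i" using xb u by (simp add: cmp_def)
 from ex[OF T _ _ _ this] obtain h where h: "h : arrows C" "dm h = cd j" "cd h = Z" "h $ j = (cd u, Z, x)" "h $ v = (cd i, Z, b)"
 by auto
 show ?thesis
 proof (rule ex1I[of _ "mor h"], intro conjI)
 show "mor h : Arr C (cd j) Z" using mm[OF h(1)] h by simp
 have "mor (h $ j) = x" "mor (h $ v) = b" using h by simp_all
 then show "Cmp C (cd u) (cd j) Z (mor h) (mor j) = x" "Cmp C (cd i) (cd j) Z (mor h) (mor v) = b"
 using h j v by (simp_all add: cmp_def)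
 next
 fix k assume k: "k : Arr C (cd j) Z & Cmp C (cd u) (cd j) Z k (mor j) = x & Cmp C (cd i) (cd j) Z k (mor v) = b"
 have "(cd j, Z, k) = h"
 proof (rule un)
 show "(cd j, Z, k) : arrows C" using k Z ob by (simp add: arrows_iff del: arrows_Obj)
 show "(cd j, Z, k) $ j = h $ j" "(cd j, Z, k) $ v = h $ v" unfolding h(4,5) using k j v by (simp_all add: cmp_def)
 qed (use h in simp_all)
 then show "k = mor h" by auto
 qed
 qed
 then show ?thesis unfolding is_pushout_def using ob A E by blast
qed

lemma is_pushoutD:
 assumes "is_pushout C A B X Y i u j v"
 shows "(A, B, i) : arrows C" "(A, X, u) : arrows C" "(X, Y, j) : arrows C" "(B, Y, v) : arrows C"
 "(X, Y, j) $ (A, X, u) = (B, Y, v) $ (A, B, i)"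
 "x : arrows C ==> b : arrows C ==> dm x = X ==> dm b = B ==> cd x = cd b ==> x $ (A, X, u) = b $ (A, B, i) ==>
 EX h:hm C Y (cd x). h $ (X, Y, j) = x & h $ (B, Y, v) = b"
 "h : arrows C ==> h' : arrows C ==> dm h = Y ==> dm h' = Y ==> cd h = cd h' ==>
 h $ (X, Y, j) = h' $ (X, Y, j) ==> h $ (B, Y, v) = h' $ (B, Y, v) ==> h = h'"
proof -
 note p = assms[unfolded is_pushout_def]
 have ob: "A : Obj C" "B : Obj C" "X : Obj C" "Y : Obj C" using p by blast+
 have ar: "i : Arr C A B" "u : Arr C A X" "j : Arr C X Y" "v : Arr C B Y" using p by blast+
 have uni: "EX! h. h : Arr C Y Z & Cmp C X Y Z h j = x & Cmp C B Y Z h v = b"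
 if "Z : Obj C" "x : Arr C X Z" "b : Arr C B Z" "Cmp C A X Z x u = Cmp C A B Z b i" for Z x b
 using p that by blast
 have mm: "mor f : Arr C (dm f) (cd f)" if "f : arrows C" for f using that arrows_iff by blast
 show T: "(A, B, i) : arrows C" "(A, X, u) : arrows C" "(X, Y, j) : arrows C" "(B, Y, v) : arrows C"
 using ob ar by (simp_all add: arrows_iff del: arrows_Obj)
 have "Cmp C A X Y j u = Cmp C A B Y v i" using p by blast
 then show sq: "(X, Y, j) $ (A, X, u) = (B, Y, v) $ (A, B, i)" by (simp add: cmp_def)
 show "EX h:hm C Y (cd x). h $ (X, Y, j) = x & h $ (B, Y, v) = b"
 if x: "x : arrows C" "b : arrows C" "dm x = X" "dm b = B" "cd x = cd b" "x $ (A, X, u) = b $ (A, B, i)" for x b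
 proof -
 have c: "cd x : Obj C" using x by simp
 have "Cmp C A X (cd x) (mor x) u = Cmp C A B (cd x) (mor b) i" using x by (simp add: cmp_def)
 from ex1_implies_ex[OF uni[OF c _ _ this]] mm[OF x(1)] mm[OF x(2)] x(3-5)
 obtain h where h: "h : Arr C Y (cd x)" "Cmp C X Y (cd x) h j = mor x" "Cmp C B Y (cd x) h v = mor b" by auto
 have "(Y, cd x, h) $ (X, Y, j) = x" "(Y, cd x, h) $ (B, Y, v) = b" using h x by (simp_all add: cmp_def prod_eq_iff)
 moreover have "(Y, cd x, h) : hm C Y (cd x)" using h ob c by (simp add: arrows_iff del: arrows_Obj)
 ultimately show ?thesis by blast
 qed
 show "h = h'" if h: "h : arrows C" "h' : arrows C" "dm h = Y" "dm h' = Y" "cd h = cd h'"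
 "h $ (X, Y, j) = h' $ (X, Y, j)" "h $ (B, Y, v) = h' $ (B, Y, v)" for h h'
 proof -
 define x b where "x = h $ (X, Y, j)" and "b = h $ (B, Y, v)"
 have xa: "x : arrows C" "b : arrows C" "dm x = X" "dm b = B" "cd x = cd h" "cd b = cd h"
 using h T by (simp_all add: x_def b_def)
 have "x $ (A, X, u) = b $ (A, B, i)" unfolding x_def b_def using h T sq by simp
 then have "Cmp C A X (cd h) (mor x) u = Cmp C A B (cd h) (mor b) i" using xa by (simp add: cmp_def)
 then have U: "EX! k. k : Arr C Y (cd h) & Cmp C X Y (cd h) k j = mor x & Cmp C B Y (cd h) k v = mor b"
 using uni[of "cd h" "mor x" "mor b"] mm[OF xa(1)] mm[OF xa(2)] xa h(1) by simp
 have "mor h : Arr C Y (cd h) & Cmp C X Y (cd h) (mor h) j = mor x & Cmp C B Y (cd h) (mor h) v = mor b"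
 using mm[OF h(1)] h by (simp add: x_def b_def cmp_def)
 moreover have "mor h' : Arr C Y (cd h) & Cmp C X Y (cd h) (mor h') j = mor x & Cmp C B Y (cd h) (mor h') v = mor b"
 unfolding x_def b_def h(6,7) using mm[OF h(2)] h by (simp add: cmp_def)
 ultimately have "mor h = mor h'" using U by blast
 then show ?thesis using h by (intro tri_eqI) simp_all
 qed
qed

lemma pushout_llp:
 assumes "is_pushout C A B X Y i u j v" "(A, B, i) : llp T" "T \<subseteq> arrows C"
 shows "(X, Y, j) : llp T"
proof (rule llpI[OF _ assms(3)])
 note P = is_pushoutD[OF assms(1)]
 show "(X, Y, j) : arrows C" by (rule P)
 fix p x y assume p: "p : T" "p : arrows C" and x: "x : arrows C" "dm x = dm (X, Y, j)" "cd x = dm p"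
 and y: "y : arrows C" "dm y = cd (X, Y, j)" "cd y = cd p" and sq: "p $ x = y $ (X, Y, j)"
 have "p $ x $ (A, X, u) = (p $ x) $ (A, X, u)" using p x P by simp
 also have "... = y $ (X, Y, j) $ (A, X, u)" unfolding sq using y P by simp
 also have "... = (y $ (B, Y, v)) $ (A, B, i)" unfolding P(5) using y P by simp
 finally have "p $ x $ (A, X, u) = (y $ (B, Y, v)) $ (A, B, i)" .
 from llp_lift[OF assms(2) p(1) assms(3) _ _ _ _ _ _ this] obtain b where
 b: "b : arrows C" "dm b = B" "cd b = dm p" "b $ (A, B, i) = x $ (A, X, u)" "p $ b = y $ (B, Y, v)"
 using x y p P by auto
 obtain h where h: "h : arrows C" "dm h = Y" "cd h = dm p" "h $ (X, Y, j) = x" "h $ (B, Y, v) = b"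
 using P(6)[of x b] b x by auto
 have "p $ h = y"
 proof (rule P(7))
 show "(p $ h) $ (X, Y, j) = y $ (X, Y, j)" using sq h p P by simp
 show "(p $ h) $ (B, Y, v) = y $ (B, Y, v)" using b(5) h p P by simp
 qed (use p h y in simp_all)
 then show "EX h. h : arrows C & dm h = cd (X, Y, j) & cd h = dm p & h $ (X, Y, j) = x & p $ h = y"
 using h by (intro exI[of _ h]) simp
qed

end

section \<open>Relative cell complexes\<close>

lemma rc_llp:
 fixes elts :: "'u => 'u set" and C :: "('o, 'm) cat"
 assumes C: "category C" and I: "I \<subseteq> arrows C" and f: "f : relative_cell_complexes elts C I"
 shows "f : ccat.llp C (rlp C I)"
proof -
 interpret ccat C by unfold_locales (rule C)
 obtain A B g where fe: "f = (A, B, g)" by (metis prod_cases3)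
 obtain r :: "'u rel" and X q z where W: "Well_order r" and X: "lambda_sequence C r X"
 and s: "successor_maps_in r X (pushouts_of C I)" and co: "is_colimit C (order_cat r) X B q"
 and z: "z : Field r" "ALL b:Field r. (z, b) : r" and eq: "A = FO X z" "g = q z"
 using f unfolding fe relative_cell_complexes_def by blast
 have l: "lamseq C r (FO X) (tr X)" by (rule lamseq_tr[OF W X])
 then have d: "diag C r (FO X) (tr X)" by (simp add: lamseq_def)
 have co': "colim C r (FO X) (tr X) B (%a. (FO X a, B, q a))"
 using co is_colimit_order_cat[OF d, of B q] unfolding fc_tr by blast
 have T: "rlp C I \<subseteq> arrows C" by (auto simp: rlp_def)
 have Il: "i : llp (rlp C I)" if "i : I" for i
 unfolding llp_def using that I by (auto simp: rlp_def)
 have "tr X a b : llp (rlp C I)" if "is_succ r a b" for a b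
 proof -
 have "(FO X a, FO X b, FA X a b ()) : pushouts_of C I" using s that by (simp add: successor_maps_in_def)
 then obtain A B i u v where "(A, B, i) : I" "is_pushout C A B (FO X a) (FO X b) i u (FA X a b ()) v"
 unfolding pushouts_of_def by blast
 then show ?thesis unfolding tr_def using pushout_llp[OF _ Il T] by blast
 qed
 from llp_transfinite[OF W l co' T this z(1)] z(2) show ?thesis by (simp add: fe eq)
qed

text \<open>A segment of a tower is itself a relative cell complex. The interval is a well-order
  with largest element \<open>gav\<close>, so by \<open>colim_top\<close> its colimit is the last
  stage; its limit elements are limit elements of \<open>r\<close>, and there cofinality permits
  dropping the stages before \<open>bev\<close>.\<close>

lemma interval_rc:
 fixes r :: "'u rel" and elts :: "'u => 'u set"
 assumes C: "category C" and W: "Well_order r" and X: "lamseq C r X x" and le: "(bev, gav) : r"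
 and sm: "small elts {de. (bev, de) : r & (de, gav) : r}"
 and su: "!!a b. is_succ r a b ==> (bev, a) : r ==> (b, gav) : r ==> x a b : pushouts_of C I"
 shows "x bev gav : relative_cell_complexes elts C I"
proof -
 interpret ccat C by unfold_locales (rule C)
 interpret wo r by unfold_locales (rule W)
 define U where "U = {de. (bev, de) : r & (de, gav) : r}"
 define r' where "r' = Restr r U"
 have d: "diag C r X x" using X by (simp add: lamseq_def)
 have UF: "U \<subseteq> Field r" by (auto simp: U_def intro: FieldI1)
 have F': "Field r' = U" unfolding r'_def by (rule Field_Restr[OF refl_r UF])
 have W': "Well_order r'" unfolding r'_def by (rule Well_order_Restr[OF W])
 interpret w': wo r' by unfold_locales (rule W')
 have bU: "bev : U" "gav : U" using le r_refl[OF FieldI1[OF le]] r_refl[OF FieldI2[OF le]] by (simp_all add: U_def)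
 have d': "diag C r' X x" unfolding r'_def by (rule diag_Restr[OF d])
 have uS: "underS r' c = {de. (bev, de) : r & de : underS r c}" if c: "c : U" for c
 proof -
 have "(de, gav) : r" if "(de, c) : r" for de using c that r_trans[of de c gav] by (simp add: U_def)
 then show ?thesis using c by (auto simp: r'_def underS_def U_def)
 qed
 have uU: "de : U" if "c : U" "de : underS r' c" for c de
 using that by (auto simp: r'_def underS_def)
 have mids: "a : U & is_succ r' a c" if c: "c : U" and s: "is_succ r a c" and ba: "(bev, a) : r" for a c
 proof -
 note sc = succ_under[OF s]
 have "(a, gav) : r" using r_trans[OF sc(1)] c by (simp add: U_def)
 then have aU: "a : U" using ba by (simp add: U_def)
 have "a : underS r' c" unfolding uS[OF c] using ba sc(1,2) by (simp add: underS_iff)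
 moreover have "underS r' c \<subseteq> under r' a"
 proof
 fix de assume d: "de : underS r' c"
 then have "(de, a) : r" unfolding uS[OF c] using sc by simp
 then show "de : under r' a" using uU[OF c d] aU by (simp add: r'_def under_def)
 qed
 ultimately show ?thesis using aU by (simp add: is_succ_def)
 qed
 \<comment> \<open>A predecessor in \<open>r\<close> of an interval limit \<open>c\<close> would lie
   above some interval element below \<open>c\<close>, hence in the interval, where it would still
   be a predecessor.\<close>
 have lim: "is_limit_elt r c" if "is_limit_elt r' c" for c
 unfolding is_limit_elt_def
 proof (intro conjI notI)
 have c: "c : U" "underS r' c ~= {}" "\<nexists>a. is_succ r' a c" using that by (auto simp: is_limit_elt_def F')
 show "c : Field r" using c UF by blast
 show "underS r c = {} ==> False" using c(2) unfolding uS[OF c(1)] by blast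
 assume "EX a. is_succ r a c"
 then obtain a where a: "is_succ r a c" by blast
 obtain de where "(bev, de) : r" "de : underS r c" using c(2) unfolding uS[OF c(1)] by blast
 then have "(bev, a) : r" using succ_under(3)[OF a] r_trans by blast
 then show False using mids[OF c(1) a] c(3) by blast
 qed
 have "lamseq C r' X x"
 unfolding lamseq_def
 proof (intro conjI allI impI d')
 fix c assume c: "is_limit_elt r' c"
 then have cU: "c : U" "underS r' c ~= {}" by (auto simp: is_limit_elt_def F')
 then obtain de0 where d0: "de0 : underS r' c" by blast
 have "colim C (Restr r (underS r c)) X x (X c) (%b. x b c)" using X lim[OF c] by (simp add: lamseq_def)
 note cof = colim_cofinal[OF diag_Restr[OF d] this, where R' = "Restr r' (underS r' c)" and e = "%a. a"]
 show "colim C (Restr r' (underS r' c)) X x (X c) (%b. x b c)"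
 proof (rule cof)
 fix a b assume "(a, b) : Restr r' (underS r' c)"
 then show "(a, b) : Restr r (underS r c)" unfolding uS[OF cU(1)] by (auto simp: r'_def)
 next
 fix b assume "b : Field (Restr r' (underS r' c))"
 then show "b : Field (Restr r (underS r c))" unfolding w'.Field_RU Field_RU unfolding uS[OF cU(1)] by simp
 next
 fix a assume "a : Field (Restr r (underS r c))"
 then have a: "a : underS r c" by (simp add: Field_RU)
 show "EX b:Field (Restr r' (underS r' c)). (a, b) : Restr r (underS r c)"
 proof (cases "(bev, a) : r")
 case True
 then have "a : underS r' c" unfolding uS[OF cU(1)] using a by simp
 moreover have "(a, a) : r" using r_refl underS_F(1)[OF a] by blast
 ultimately show ?thesis unfolding w'.Field_RU using a by blast
 next
 case False
 have d1: "(bev, de0) : r" "de0 : underS r c" using d0 unfolding uS[OF cU(1)] by auto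
 have "(a, bev) : r" using False r_total[of a bev] underS_F(1)[OF a] FieldI1[OF le] by blast
 then have "(a, de0) : r" using d1 r_trans by blast
 then show ?thesis unfolding w'.Field_RU using d0 a d1 by blast
 qed
 next
 fix a b assume "a : Field (Restr r' (underS r' c))" "b : Field (Restr r' (underS r' c))"
 then have ab: "a : underS r' c" "b : underS r' c" by (simp_all add: w'.Field_RU)
 then show "(a, b) : Restr r' (underS r' c) \<or> (b, a) : Restr r' (underS r' c)"
 using w'.r_total[of a b] w'.underS_F(1) by blast
 next
 show "trans (Restr r (underS r c))" by (rule trans_Restr)
 show "(a, a) : Restr r (underS r c)" if "a : Field (Restr r (underS r c))" for a
 using that r_refl underS_F(1) unfolding Field_RU by blast
 qed
 qed
 then have ls: "lambda_sequence C r' (fc X x)" by (rule lambda_sequence_fc[OF W'])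
 have "(X a, X b, mor (x a b)) : pushouts_of C I" if s: "is_succ r' a b" for a b
 proof -
 have ab: "(a, b) : r'" "a ~= b" by (rule w'.succ_under[OF s])+
 then have ab': "(a, b) : r" "a : U" "b : U" by (auto simp: r'_def)
 have "is_succ r a b"
 unfolding is_succ_def
 proof (intro conjI subsetI)
 show "a : underS r b" using ab ab' by (simp add: underS_iff)
 fix c assume c: "c : underS r b"
 show "c : under r a"
 proof (cases "(bev, c) : r")
 case True
 then have "c : underS r' b" unfolding uS[OF ab'(3)] using c by simp
 then have "(c, a) : r'" using w'.succ_under[OF s] by simp
 then show ?thesis by (simp add: under_iff r'_def)
 next
 case False
 then have "(c, bev) : r" using r_total[of c bev] underS_F(1)[OF c] FieldI1[OF le] by blast
 then show ?thesis using ab'(2) r_trans by (simp add: under_iff U_def)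
 qed
 qed
 moreover have "(bev, a) : r" "(b, gav) : r" using ab' by (auto simp: U_def)
 ultimately have "x a b : pushouts_of C I" by (rule su)
 moreover have "(X a, X b, mor (x a b)) = x a b" using diagD(3,4)[OF d ab'(1)] by (simp add: prod_eq_iff)
 ultimately show ?thesis by simp
 qed
 then have sm': "successor_maps_in r' (fc X x) (pushouts_of C I)"
 unfolding successor_maps_in_def FO_fc FA_fc by blast
 have dg: "(de, gav) : r" if "de : U" for de using that by (simp add: U_def)
 have t1: "gav : Field r'" using bU F' by simp
 have t2: "(a, gav) : r'" if "a : Field r'" for a
 using that dg[of a] bU unfolding F' by (simp add: r'_def)
 have "colim C r' X x (X gav) (%a. x a gav)"
 by (rule colim_top[OF d' t1 t2])
 also have "?this \<longleftrightarrow> colim C r' X x (X gav) (%a. (X a, X gav, mor (x a gav)))"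
 by (rule colim_cong) (use diagD(3,4)[OF d dg] in "simp_all add: F' prod_eq_iff")
 finally have co: "is_colimit C (order_cat r') (fc X x) (X gav) (%a. mor (x a gav))"
 unfolding is_colimit_order_cat[OF d'] .
 have "small elts (Field r')" using sm unfolding F' U_def .
 moreover have "bev : Field r'" using bU F' by simp
 moreover have "ALL b:Field r'. (bev, b) : r'" unfolding F' using bU by (auto simp: r'_def U_def)
 ultimately have "(X bev, X gav, mor (x bev gav)) : relative_cell_complexes elts C I"
 unfolding relative_cell_complexes_def using W' ls sm' co
 by (simp only: mem_Collect_eq prod.case)
 (intro exI[of _ r'] exI[of _ "fc X x"] exI[of _ "%a. mor (x a gav)"] exI[of _ bev] conjI; simp add: FO_fc)
 moreover have "(X bev, X gav, mor (x bev gav)) = x bev gav" using diagD(3,4)[OF d le] by (simp add: prod_eq_iff)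
 ultimately show ?thesis by simp
qed

text \<open>If \<open>y\<close> were in no image, two maps out of \<open>L\<close> that differ only at \<open>y\<close> would agree on all stages.\<close>

lemma (in universe) set_colimit_surj:
 assumes co: "is_colimit (set_cat elts) J X L q" and y: "y : L"
 and X: "!!a b u g. a : Obj J ==> b : Obj J ==> u : Arr J a b ==> g : FO X a ==> FA X a b u g : FO X b"
 shows "EX a:Obj J. EX g:FO X a. q a g = y"
proof (rule ccontr)
 assume n: "\<not> ?thesis"
 obtain s t :: 'u where st: "s ~= t"
 using infinite_u ex_new_if_finite[of "{undefined :: 'u}"] by auto
 define T where "T = {s, t}"
 have T: "small elts T" unfolding T_def by (rule small_finite) simp
 have cc: "cocone_under (set_cat elts) J X L q" using co by (simp add: is_colimit_def)
 have qa: "q a : FO X a \<rightarrow>\<^sub>E L" if "a : Obj J" for a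
 using cc that by (simp add: cocone_under_def set_cat_def)
 define q' where "q' a = (\<lambda>g\<in>FO X a. s)" for a
 have "cocone_under (set_cat elts) J X T q'"
 unfolding cocone_under_def set_cat_def cat.select_convs
 proof (intro conjI ballI)
 show "T : {A. small elts A}" using T by simp
 show "q' a : FO X a \<rightarrow>\<^sub>E T" for a by (auto simp: q'_def T_def)
 show "compose (FO X a) (q' b) (FA X a b u) = q' a" if "a : Obj J" "b : Obj J" "u : Arr J a b" for a b u
 using X[OF that] by (auto simp: compose_def q'_def fun_eq_iff)
 qed
 then have ex1: "EX! h. h : Arr (set_cat elts) L T & (ALL a:Obj J. Cmp (set_cat elts) (FO X a) L T h (q a) = q' a)"
 using co by (simp add: is_colimit_def)
 define f1 f2 where "f1 = (\<lambda>x\<in>L. s)" and "f2 = (\<lambda>x\<in>L. if x = y then t else s)"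
 define Pm where "Pm h \<longleftrightarrow> h : Arr (set_cat elts) L T &
 (ALL a:Obj J. Cmp (set_cat elts) (FO X a) L T h (q a) = q' a)" for h
 have "EX! h. Pm h" using ex1 unfolding Pm_def .
 then obtain h where h: "!!k. Pm k ==> k = h" by blast
 have "f1 = h"
 proof (rule h, unfold Pm_def)
 show "f1 : Arr (set_cat elts) L T & (ALL a:Obj J. Cmp (set_cat elts) (FO X a) L T f1 (q a) = q' a)"
 proof (intro conjI ballI)
 show "f1 : Arr (set_cat elts) L T" by (auto simp: set_cat_def f1_def T_def)
 fix a assume a: "a : Obj J"
 show "Cmp (set_cat elts) (FO X a) L T f1 (q a) = q' a"
 using qa[OF a] by (auto simp: set_cat_def f1_def q'_def compose_def fun_eq_iff)
 qed
 qed
 moreover have "f2 = h"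
 proof (rule h, unfold Pm_def)
 show "f2 : Arr (set_cat elts) L T & (ALL a:Obj J. Cmp (set_cat elts) (FO X a) L T f2 (q a) = q' a)"
 proof (intro conjI ballI)
 show "f2 : Arr (set_cat elts) L T" by (auto simp: set_cat_def f2_def T_def)
 fix a assume a: "a : Obj J"
 have "q a g ~= y" if "g : FO X a" for g using n a that by blast
 then show "Cmp (set_cat elts) (FO X a) L T f2 (q a) = q' a"
 using qa[OF a] by (auto simp: set_cat_def f2_def q'_def compose_def fun_eq_iff)
 qed
 qed
 ultimately have "f1 = f2" by simp
 then have "f1 y = f2 y" by simp
 then show False using y st by (simp add: f1_def f2_def)
qed

section \<open>Factoring maps through a stage: what smallness provides\<close>

locale soa = ccat C + universe elts
 for C :: "('o, 'u) cat" and elts :: "'u => 'u set" +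
 fixes I :: "('o \<times> 'o \<times> 'u) set"
 assumes hsc: "has_small_colimits elts C"
 and I: "I \<subseteq> arrows C" "small elts I" "permits_small_object_argument elts C I"
 and homs: "!!X Y. X : Obj C ==> Y : Obj C ==> small elts (hm C X Y)"
begin

abbreviation "RC \<equiv> relative_cell_complexes elts C I"

text \<open>The surjectivity half of smallness, for one length \<open>r\<close> and all generators
  together. Commutative squares can be pulled back to a stage with it, because the stages map
  compatibly to the target and commutativity is an equation between maps into the target.\<close>

definition good :: "'u rel => bool" where
 "good r \<longleftrightarrow> Card_order r & infinite (Field r) & small elts (Field r) &
 (ALL D x L q i u. lamseq C r D x --> (ALL a b. is_succ r a b --> x a b : RC) --> colim C r D x L q -->
 i : I --> u : hm C (dm i) L --> (EX a:Field r. EX u':hm C (dm i) (D a). q a $ u' = u))"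

text \<open>Each generator has its own cardinal bound; a small regular cardinal above all of them
  serves every generator. That the Hom sets form a colimit in \<open>set_cat\<close> then yields a
  factorization through a stage by \<open>set_colimit_surj\<close>.\<close>

lemma ex_good: "EX r. good r"
proof -
 define Q where "Q i kav \<longleftrightarrow> Card_order kav & small elts (Field kav) &
 (ALL r :: 'u rel. Card_order r & infinite (Field r) & regularCard r & small elts (Field r) & (kav, r) : ordLeq -->
 (ALL X L q. lambda_sequence C r X & successor_maps_in r X RC & is_colimit C (order_cat r) X L q -->
 is_colimit (set_cat elts) (order_cat r) (hom_diagram C (dm i) X) (Arr C (dm i) L)
 (%a. \<lambda>g\<in>Arr C (dm i) (FO X a). Cmp C (dm i) (FO X a) L (q a) g)))"
 for i :: "'o \<times> 'o \<times> 'u" and kav :: "'u rel"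
 have "ALL i:I. EX kav. Q i kav"
 proof
 fix i assume "i : I"
 moreover obtain A B g where "i = (A, B, g)" by (metis prod_cases3)
 ultimately have "small_relative_to elts C (dm i) RC"
 using I(3) unfolding permits_small_object_argument_def by auto
 then show "EX kav. Q i kav" unfolding small_relative_to_def Q_def .
 qed
 from bchoice[OF this] obtain kav where Q: "!!i. i : I ==> Q i (kav i)" by blast
 have kav: "Card_order (kav i) & small elts (Field (kav i))" if "i : I" for i
 using Q[OF that] unfolding Q_def by blast
 have sm: "is_colimit (set_cat elts) (order_cat r) (hom_diagram C (dm i) X) (Arr C (dm i) L)
 (%a. \<lambda>g\<in>Arr C (dm i) (FO X a). Cmp C (dm i) (FO X a) L (q a) g)"
 if "i : I" "Card_order r & infinite (Field r) & regularCard r & small elts (Field r) & (kav i, r) : ordLeq"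
 "lambda_sequence C r X & successor_maps_in r X RC & is_colimit C (order_cat r) X L q"
 for i and r :: "'u rel" and X L q
 by (rule Q[OF that(1), unfolded Q_def, THEN conjunct2, THEN conjunct2, THEN spec, THEN mp, OF that(2),
 THEN spec, THEN spec, THEN spec, THEN mp, OF that(3)])
 obtain r :: "'u rel" where r: "Card_order r" "infinite (Field r)" "regularCard r" "small elts (Field r)"
 "!!i. i : I ==> (kav i, r) : ordLeq"
 using ex_regular_card[of I kav, OF I(2) kav] by blast
 have W: "Well_order r" using r(1) by (rule card_order_on_well_order_on)
 interpret wo r by unfold_locales (rule W)
 have "good r"
 unfolding good_def
 proof (intro conjI allI impI r)
 fix D x L q i u
 assume l: "lamseq C r D x" and s: "ALL a b. is_succ r a b --> x a b : RC" and co: "colim C r D x L q"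
 and i: "i : I" and u: "u : hm C (dm i) L"
 have d: "diag C r D x" using l by (simp add: lamseq_def)
 have qeq: "(D a, L, mor (q a)) = q a" if "a : Field r" for a
 using colimD(3,4)[OF co that] by (simp add: prod_eq_iff)
 have xeq: "(D a, D b, mor (x a b)) = x a b" if "(a, b) : r" for a b
 using diagD(3,4)[OF d that] by (simp add: prod_eq_iff)
 have 1: "lambda_sequence C r (fc D x)" by (rule lambda_sequence_fc[OF W l])
 have 2: "successor_maps_in r (fc D x) RC"
 unfolding successor_maps_in_def FO_fc FA_fc using s xeq succ_under(1) by metis
 have "colim C r D x L (%a. (D a, L, mor (q a))) = colim C r D x L q"
 by (rule colim_cong) (simp_all add: qeq)
 then have 3: "is_colimit C (order_cat r) (fc D x) L (%a. mor (q a))"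
 unfolding is_colimit_order_cat[OF d] using co by blast
 have ia: "i : arrows C" using i I by blast
 have mm: "mor f : Arr C (dm f) (cd f)" if "f : arrows C" for f using that arrows_iff by blast
 have uA: "mor u : Arr C (dm i) L" using u mm by fastforce
 note H = sm[OF i _ conjI[OF 1 conjI[OF 2 3]]]
 have "EX a:Obj (order_cat r). EX g:FO (hom_diagram C (dm i) (fc D x :: ('u, unit, _, _) fun_cat)) a.
 (\<lambda>g\<in>Arr C (dm i) (D a). Cmp C (dm i) (D a) L (mor (q a)) g) g = mor u"
 proof (rule set_colimit_surj[OF H[unfolded FO_fc] uA])
 show "Card_order r & infinite (Field r) & regularCard r & small elts (Field r) & (kav i, r) : ordLeq"
 using r i by blast
 fix a b w g assume "a : Obj (order_cat r)" "b : Obj (order_cat r)" "w : Arr (order_cat r) a b"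
 and g: "g : FO (hom_diagram C (dm i) (fc D x)) a"
 then have ab: "(a, b) : r" by (simp add: order_cat_def split: if_splits)
 have g': "g : Arr C (dm i) (D a)" using g by (simp add: hom_diagram_def FO_fc)
 have "Cmp C (dm i) (D a) (D b) (mor (x a b)) g : Arr C (dm i) (D b)"
 by (rule cat_cmp[OF _ diagD(1)[OF d FieldI1[OF ab]] diagD(1)[OF d FieldI2[OF ab]] g'])
 (use ia mm[OF diagD(2)[OF d ab]] diagD(3,4)[OF d ab] in simp_all)
 then show "FA (hom_diagram C (dm i) (fc D x)) a b w g : FO (hom_diagram C (dm i) (fc D x)) b"
 using g' by (simp add: hom_diagram_def FO_fc FA_fc)
 qed
 then obtain a g where a: "a : Field r" and g: "g : Arr C (dm i) (D a)"
 and eq: "Cmp C (dm i) (D a) L (mor (q a)) g = mor u"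
 by (auto simp: order_cat_def hom_diagram_def FO_fc)
 have "(dm i, D a, g) : hm C (dm i) (D a)"
 using g ia diagD(1)[OF d a] by (simp add: arrows_iff del: arrows_Obj)
 moreover have "q a $ (dm i, D a, g) = u"
 using eq colimD(3,4)[OF co a] u by (simp add: cmp_def prod_eq_iff)
 ultimately show "EX a:Field r. EX u':hm C (dm i) (D a). q a $ u' = u" using a by blast
 qed
 then show ?thesis by blast
qed

end

section \<open>The ordinary small object argument\<close>

locale long_order = universe elts + wo r
 for elts :: "'u => 'u set" and r :: "'u rel" +
 assumes smallS: "!!a. a : Field r ==> small elts (underS r a)" and notsmall: "\<not> small elts (Field r)"
begin

lemma small_under:
 assumes "a : Field r" shows "small elts (under r a)"
proof -
 have "under r a \<subseteq> insert a (underS r a)" by (auto simp: under_iff underS_iff)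
 then show ?thesis using small_subset[OF small_insert[OF smallS[OF assms]]] by blast
qed

text \<open>If no element bounded \<open>A\<close>, every element would precede some member of
  \<open>A\<close>, and a small union of small segments would be the whole order.\<close>

lemma bounded:
 assumes "small elts A" "A \<subseteq> Field r" shows "EX b:Field r. ALL s:A. (s, b) : r"
proof (rule ccontr)
 assume n: "\<not> ?thesis"
 have "Field r \<subseteq> (\<Union>s\<in>A. underS r s)"
 proof
 fix b assume b: "b : Field r"
 then obtain s where s: "s : A" "(s, b) \<notin> r" using n by blast
 then have "b : underS r s" using not_le[of s b] b assms(2) by blast
 then show "b : (\<Union>s\<in>A. underS r s)" using s by blast
 qed
 moreover have "small elts (\<Union>s\<in>A. underS r s)"
 by (rule small_UN[OF assms(1)]) (use assms(2) smallS in blast)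
 ultimately show False using notsmall small_subset by blast
qed

lemma ex_succ_long:
 assumes "a : Field r" shows "EX b. is_succ r a b"
proof -
 have "\<not> Field r \<subseteq> under r a" using notsmall small_subset[OF small_under[OF assms]] by blast
 then obtain b where "b : Field r" "b \<notin> under r a" by blast
 then have b: "b : Field r" "(b, a) \<notin> r" by (simp_all add: under_iff)
 then have "a : underS r b" using not_le[of b a] assms by simp
 then show ?thesis using ex_succ by blast
qed

lemma ex_zero: "EX z:Field r. ALL b:Field r. (z, b) : r"
proof -
 have "Field r ~= {}" using notsmall small_empty by metis
 then show ?thesis using r_least[of "Field r"] by blast
qed

end

locale soa_tower = soa C elts I + long_order elts r
 for C :: "('o, 'u) cat" and elts :: "'u => 'u set" and I and r :: "'u rel" +
 fixes f :: "'o \<times> 'o \<times> 'u"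
 assumes f: "f : arrows C"
begin

abbreviation "Z \<equiv> cd f"

definition lifts where
 "lifts X e x a bev i u v \<longleftrightarrow> (EX l:hm C (cd i) (X a). l $ i = x bev a $ u & e a $ l = v)"

definition square where
 "square X e bev i u v \<longleftrightarrow> i : I & u : hm C (dm i) (X bev) & v : hm C (cd i) Z & e bev $ u = v $ i"

text \<open>The squares still unhandled at stage \<open>a\<close>. A square remembers the stage
  \<open>bev\<close> of its birth, and lifts are measured after transport along
  \<open>x bev a\<close>; this makes it possible to count the squares born up to a given
  stage.\<close>

definition Unh where
 "Unh X e x a bev i u v \<longleftrightarrow> (bev, a) : r & square X e bev i u v & \<not> lifts X e x a bev i u v"

definition G where "G b Y p \<longleftrightarrow> p : hm C Y Z" for b :: 'u and Y p
definition Rl where "Rl a b X p Y p' x \<longleftrightarrow> p' $ x = p" for a b :: 'u and X Y :: 'o and p p' x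

text \<open>Exactly one cell is attached while unhandled squares exist, so that the step is a
  pushout of a single generator, as required in a relative cell complex. A square of earliest birth
  is served, so that squares born later cannot postpone it forever.\<close>

definition S where
 "S a b X e x Y p j \<longleftrightarrow> ((EX bev i u v. Unh X e x a bev i u v) -->
 (EX bev i u v w. Unh X e x a bev i u v & (ALL bev' i' u' v'. Unh X e x a bev' i' u' v' --> (bev, bev') : r) &
 is_pushout C (dm i) (cd i) (X a) Y (mor i) (mor (x bev a $ u)) (mor j) (mor w) &
 w : hm C (cd i) Y & p $ w = v & w $ i = j $ x bev a $ u))" for a b :: 'u

lemma Unh_cong:
 assumes "!!c. (c, a) : r ==> X c = X' c & e c = e' c & (ALL d. x d c = x' d c)"
 shows "Unh X e x a bev i u v = Unh X' e' x' a bev i u v"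
proof (cases "(bev, a) : r")
 case True
 then have "(a, a) : r" using r_refl FieldI2 by metis
 then show ?thesis unfolding Unh_def lifts_def square_def using assms True by simp
qed (simp add: Unh_def)

sublocale tower_base C r "dm f" f G Rl S by unfold_locales

lemma tow_p:
 assumes t: "tow X e x a" and b: "(bev, a) : r"
 shows "e a : arrows C" "dm (e a) = X a" "cd (e a) = Z" "x bev a : arrows C" "dm (x bev a) = X bev" "cd (x bev a) = X a"
 "e a $ x bev a = e bev"
proof -
 note D = tower_atD[OF t]
 show ea: "e a : arrows C" "dm (e a) = X a" "cd (e a) = Z" using D(2) by (simp_all add: G_def)
 have "x bev a : arrows C & dm (x bev a) = X bev & cd (x bev a) = X a & e a $ x bev a = e bev"
 proof (cases "bev = a")
 case True then show ?thesis using D(1,3) ea by simp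
 next
 case False
 then have "bev : underS r a" using b by (simp add: underS_iff)
 then show ?thesis using D(4-7)[of bev] by (simp add: Rl_def)
 qed
 then show "x bev a : arrows C" "dm (x bev a) = X bev" "cd (x bev a) = X a" "e a $ x bev a = e bev" by blast+
qed

sublocale tower_data C r "dm f" f G Rl S
proof unfold_locales
 show "dm f : Obj C" using f by simp
 show "G b (dm f) f" for b using f by (simp add: G_def)
 show "Rl a a Y g Y g (idt C Y)" if "G a Y g" for a Y g using that by (simp add: G_def Rl_def)
 show "Rl a c X e Y' g (cmp C v u)"
 if "Rl a b X e Y h u" "Rl b c Y h Y' g v" "G a X e" "G b Y h" "G c Y' g" "u : hm C X Y" "v : hm C Y Y'"
 for a b c X e Y h Y' g u v
 proof -
 have "g $ v $ u = (g $ v) $ u" using that by (simp add: G_def)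
 then show ?thesis using that(1,2) by (simp add: Rl_def)
 qed
 show "S a b X' e' x' Y g j"
 if c: "!!c. (c, a) : r ==> X c = X' c & e c = e' c & (ALL d. x d c = x' d c)" and s: "S a b X e x Y g j"
 for a b X e x X' e' x' Y g j
 proof -
 have U: "Unh X e x a bev i u v = Unh X' e' x' a bev i u v" for bev i u v by (rule Unh_cong[OF c])
 have "X a = X' a & x bev a = x' bev a" if "Unh X' e' x' a bev i u v" for bev i u v
 proof -
 have "(a, a) : r" using that r_refl FieldI2 unfolding Unh_def by metis
 then show ?thesis using c by blast
 qed
 then show ?thesis using s unfolding S_def U by metis
 qed
 show "EX Y g j. Y : Obj C & G b Y g & j : hm C (X a) Y & Rl a b (X a) (e a) Y g j & S a b X e x Y g j"
 if su: "is_succ r a b" and t: "!!c. (c, a) : r ==> tow X e x c" for a b X e x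
 proof -
 have aF: "a : Field r" using succ_under(1)[OF su] by (rule FieldI1)
 note ta = t[OF r_refl[OF aF]]
 note ea = tow_p(1-3)[OF ta r_refl[OF aF]]
 have Xa: "X a : Obj C" by (rule tower_atD(1)[OF ta])
 show ?thesis
 proof (cases "EX bev i u v. Unh X e x a bev i u v")
 case False
 then show ?thesis
 using Xa ea by (intro exI[of _ "X a"] exI[of _ "e a"] exI[of _ "idt C (X a)"]) (simp add: S_def G_def Rl_def)
 next
 case True
 define B where "B = {bev. EX i u v. Unh X e x a bev i u v}"
 have "B \<subseteq> Field r" unfolding B_def Unh_def by (auto intro: FieldI1)
 moreover have "B ~= {}" using True by (auto simp: B_def)
 ultimately obtain bev where b: "bev : B" "ALL bev':B. (bev, bev') : r" using r_least by blast
 obtain i u v where U: "Unh X e x a bev i u v" using b(1) by (auto simp: B_def)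
 then have le: "(bev, a) : r" and i: "i : I" and u: "u : arrows C" "dm u = dm i" "cd u = X bev"
 and v: "v : arrows C" "dm v = cd i" "cd v = Z" and sq: "e bev $ u = v $ i"
 by (simp_all add: Unh_def square_def)
 have ia: "i : arrows C" using i I by blast
 note xb = tow_p(4-7)[OF ta le]
 define g where "g = x bev a $ u"
 have g: "g : arrows C" "dm g = dm i" "cd g = X a" using u xb by (simp_all add: g_def)
 have eg: "e a $ g = v $ i"
 proof -
 have "e a $ g = (e a $ x bev a) $ u" unfolding g_def
 by (rule cmp_assoc[symmetric]) (use ea u xb in simp_all)
 then show ?thesis using xb(4) sq by simp
 qed
 \<comment> \<open>The pushout is obtained as the case of a single span in
   \<open>wide_pushout\<close>.\<close>
 have one: "small elts {()}" by (rule small_finite) simp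
 obtain Y j w where Y: "Y : Obj C" and j: "j : hm C (X a) Y"
 and w': "ALL k:{()}. w k : hm C (cd i) Y & j $ g = w k $ i"
 and ex': "ALL Z:Obj C. ALL x:hm C (X a) Z. ALL y. (ALL k:{()}. y k : hm C (cd i) Z & x $ g = y k $ i) -->
 (EX h:hm C Y Z. h $ j = x & (ALL k:{()}. h $ w k = y k))"
 and un': "ALL h h'. h : arrows C --> h' : arrows C --> dm h = Y --> dm h' = Y --> cd h = cd h' -->
 h $ j = h' $ j --> (ALL k:{()}. h $ w k = h' $ w k) --> h = h'"
 using wide_pushout[where K = "{()}" and f = "%_. i" and g = "%_. g", OF cat hsc one Xa ia g]
 by (elim exE conjE) (rule that)
 have w: "w () : hm C (cd i) Y" "j $ g = w () $ i" using w' by simp_all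
 have ex: "EX h:hm C Y Z. h $ j = x & h $ w () = b"
 if "Z : Obj C" "x : hm C (X a) Z" "b : hm C (cd i) Z & x $ g = b $ i" for Z x b
 using ex'[THEN bspec, OF that(1), THEN bspec, OF that(2), THEN spec, of "%_. b"] that(3) by simp
 have un: "h = h'" if "h : arrows C" "h' : arrows C" "dm h = Y" "dm h' = Y" "cd h = cd h'"
 "h $ j = h' $ j" "h $ w () = h' $ w ()" for h h'
 using un' that by blast
 have "EX h:hm C Y Z. h $ j = e a & h $ w () = v"
 using ex[of Z "e a" v] f ea v eg by simp
 then obtain p where p: "p : hm C Y Z" "p $ j = e a" "p $ w () = v" by blast
 have po: "is_pushout C (dm i) (cd i) (cd g) (cd j) (mor i) (mor g) (mor j) (mor (w ()))"
 proof (rule is_pushoutI[OF ia g(1,2)])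
 fix x b assume xb: "x : arrows C" "b : arrows C" "dm x = cd g" "dm b = cd i" "cd x = cd b" "x $ g = b $ i"
 then show "EX h:hm C (cd j) (cd x). h $ j = x & h $ w () = b"
 using ex[of "cd x" x b] g j by simp
 next
 fix h h' assume "h : arrows C" "h' : arrows C" "dm h = cd j" "dm h' = cd j" "cd h = cd h'" "h $ j = h' $ j" "h $ w () = h' $ w ()"
 then show "h = h'" using un[of h h'] j by simp
 qed (use j w g in simp_all)
 have "S a b X e x Y p j"
 unfolding S_def
 proof (intro impI exI conjI allI)
 show "Unh X e x a bev i u v" by (rule U)
 show "(bev, bev') : r" if "Unh X e x a bev' i' u' v'" for bev' i' u' v' using b(2) that unfolding B_def by blast
 show "is_pushout C (dm i) (cd i) (X a) Y (mor i) (mor (x bev a $ u)) (mor j) (mor (w ()))"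
 using po g j unfolding g_def[symmetric] by simp
 show "w () $ i = j $ x bev a $ u" using w unfolding g_def by simp
 qed (use w p in simp_all)
 then show ?thesis using Y j p by (intro exI[of _ Y] exI[of _ p] exI[of _ j]) (simp add: G_def Rl_def)
 qed
 qed
 show "EX L g q. colim C (Restr r (underS r c)) X x L q & G c L g & (ALL a:underS r c. Rl a c (X a) (e a) L g (q a))"
 if l: "is_limit_elt r c" and t: "!!b. b : underS r c ==> tow X e x b" for c X e x
 proof -
 have cF: "c : Field r" using l by (simp add: is_limit_elt_def)
 have dg: "diag C (Restr r (underS r c)) X x"
 by (rule tow_diag[OF underS_Field le_lt_trans t])
 have "EX L q. colim C (Restr r (underS r c)) X x L q"
 by (rule small_poset_colimit[OF cat hsc refl_Restr trans_Restr _ dg]) (simp add: Field_RU smallS[OF cF])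
 then obtain L q where co: "colim C (Restr r (underS r c)) X x L q" by blast
 have "cocone C (Restr r (underS r c)) X x Z e"
 unfolding cocone_def Field_RU
 proof (intro conjI ballI allI impI)
 show "Z : Obj C" using f by simp
 show "e a : hm C (X a) Z" if "a : underS r c" for a using tower_atD(2)[OF t[OF that]] by (simp add: G_def)
 show "e b $ x a b = e a" if "(a, b) : Restr r (underS r c)" for a b
 using tow_p(7)[OF t, of b a] that by simp
 qed
 from colim_ex[OF co this] obtain p where "p : hm C L Z" "!!a. a : underS r c ==> p $ q a = e a"
 unfolding Field_RU by blast
 then show ?thesis using co by (intro exI[of _ L] exI[of _ p] exI[of _ q]) (simp add: G_def Rl_def)
 qed
qed

end

context soa_tower
begin

context
 fixes X :: "'u => 'o" and e :: "'u => 'o \<times> 'o \<times> 'u" and x :: "'u => 'u => 'o \<times> 'o \<times> 'u"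
 assumes T: "!!b. b : Field r ==> tow X e x b"
begin

lemma T_lamseq: "lamseq C r X x" by (rule tow_lamseq[OF T])

lemma T_diag: "diag C r X x" using T_lamseq by (simp add: lamseq_def)

lemma T_p:
 assumes "(b, a) : r"
 shows "e a : arrows C" "dm (e a) = X a" "cd (e a) = Z" "x b a : arrows C" "dm (x b a) = X b" "cd (x b a) = X a"
 "e a $ x b a = e b"
 using tow_p[OF T[OF FieldI2[OF assms]] assms] by blast+

lemma lifts_mono:
 assumes l: "lifts X e x a bev i u v" and s: "square X e bev i u v" and le: "(bev, a) : r" "(a, a') : r"
 shows "lifts X e x a' bev i u v"
proof -
 obtain h where h: "h : arrows C" "dm h = cd i" "cd h = X a" "h $ i = x bev a $ u" "e a $ h = v"
 using l by (auto simp: lifts_def)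
 have i: "i : arrows C" and u: "u : arrows C" "cd u = X bev" using s I by (auto simp: square_def)
 note xa = T_p[OF le(2)] and xb = T_p[OF le(1)]
 have "(x a a' $ h) $ i = x a a' $ x bev a $ u" using h xa i by simp
 also have "... = x bev a' $ u"
 by (rule cmp_assoc'[OF diagD(6)[OF T_diag le]]) (use xa xb u in simp_all)
 finally have 1: "(x a a' $ h) $ i = x bev a' $ u" .
 have "e a' $ x a a' $ h = e a $ h"
 by (rule cmp_assoc'[OF xa(7)]) (use xa h in simp_all)
 then have 2: "e a' $ x a a' $ h = v" using h by simp
 show ?thesis unfolding lifts_def
 by (rule bexI[of _ "x a a' $ h"]) (use 1 2 xa h in simp_all)
qed

lemma step_lift:
 assumes su: "is_succ r a b" and ex: "EX bev i u v. Unh X e x a bev i u v"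
 shows "x a b : pushouts_of C I &
 (EX bev i u v. Unh X e x a bev i u v & (ALL bev' i' u' v'. Unh X e x a bev' i' u' v' --> (bev, bev') : r) & lifts X e x b bev i u v)"
proof -
 note ab = succ_under(1)[OF su]
 have "S a b X e x (X b) (e b) (x a b)" by (rule tower_atD(11)[OF T[OF FieldI2[OF ab]] su])
 then obtain bev i u v w where U: "Unh X e x a bev i u v" "ALL bev' i' u' v'. Unh X e x a bev' i' u' v' --> (bev, bev') : r"
 and po: "is_pushout C (dm i) (cd i) (X a) (X b) (mor i) (mor (x bev a $ u)) (mor (x a b)) (mor w)"
 and w: "w : hm C (cd i) (X b)" "e b $ w = v" "w $ i = x a b $ x bev a $ u"
 using ex unfolding S_def by blast
 have s: "square X e bev i u v" and le: "(bev, a) : r" using U(1) by (simp_all add: Unh_def)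
 have i: "i : I" and u: "u : arrows C" "cd u = X bev" using s by (auto simp: square_def)
 have "x a b $ x bev a $ u = x bev b $ u"
 by (rule cmp_assoc'[OF diagD(6)[OF T_diag le ab]]) (use T_p[OF le] T_p[OF ab] u in simp_all)
 then have "lifts X e x b bev i u v" unfolding lifts_def by (intro bexI[OF _ w(1)]) (use w in simp)
 moreover have "x a b : pushouts_of C I"
 proof -
 have "x a b = (X a, X b, mor (x a b))" using T_p(5,6)[OF ab] by (simp add: prod_eq_iff)
 moreover have "(dm i, cd i, mor i) : I" using i by simp
 ultimately have "(X a, X b, mor (x a b)) : pushouts_of C I"
 unfolding pushouts_of_def using po by blast
 then show ?thesis using \<open>x a b = (X a, X b, mor (x a b))\<close> by simp
 qed
 ultimately show ?thesis using U by blast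
qed

lemma squares_small:
 assumes "bev : Field r"
 shows "small elts {(bev', i, u, v). (bev', bev) : r & square X e bev' i u v}"
proof -
 define A where "A = (SIGMA bev':under r bev. SIGMA i:I. hm C (dm i) (X bev') \<times> hm C (cd i) Z)"
 have "small elts A"
 unfolding A_def
 proof (rule small_Sigma[OF small_under[OF assms]], rule small_Sigma[OF I(2)], rule small_Times)
 fix bev' i assume "bev' : under r bev" and i: "i : I"
 then have "X bev' : Obj C" using diagD(1)[OF T_diag] by (auto simp: under_iff intro: FieldI1)
 moreover have "i : arrows C" using i I by blast
 ultimately show "small elts (hm C (dm i) (X bev'))" "small elts (hm C (cd i) Z)"
 using homs f by (simp_all del: hm_iff)
 qed
 moreover have "{(bev', i, u, v). (bev', bev) : r & square X e bev' i u v} \<subseteq> A"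
 unfolding A_def square_def by (auto simp: under_iff)
 ultimately show ?thesis by (rule small_subset)
qed

text \<open>The chosen square at each stage after \<open>bev\<close> would be a new element of the small set of squares born up to \<open>bev\<close>.\<close>

lemma eventually_lifted:
 assumes b: "bev : Field r"
 shows "EX gav. bev : underS r gav & (ALL bev' i u v. (bev', bev) : r --> \<not> Unh X e x gav bev' i u v)"
proof (rule ccontr)
 assume n: "\<not> ?thesis"
 define A where "A = {gav. bev : underS r gav}"
 define B where "B = {(bev', i, u, v). (bev', bev) : r & square X e bev' i u v}"
 have AF: "A \<subseteq> Field r" by (auto simp: A_def underS_iff intro: FieldI2)
 have "ALL gav:A. EX c. case c of (bev', i, u, v) => (bev', bev) : r & Unh X e x gav bev' i u v &
 (ALL b. is_succ r gav b --> lifts X e x b bev' i u v)"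
 proof
 fix gav assume g: "gav : A"
 then have ex: "EX bev' i u v. (bev', bev) : r & Unh X e x gav bev' i u v" using n unfolding A_def by blast
 obtain b where su: "is_succ r gav b" using ex_succ_long g AF by blast
 from step_lift[OF su] ex obtain bev' i u v where U: "Unh X e x gav bev' i u v"
 "ALL bev'' i' u' v'. Unh X e x gav bev'' i' u' v' --> (bev', bev'') : r" "lifts X e x b bev' i u v" by blast
 obtain bev'' i'' u'' v'' where "(bev'', bev) : r" "Unh X e x gav bev'' i'' u'' v''" using ex by blast
 then have "(bev', bev) : r" using U(2) r_trans by blast
 moreover have "b' = b" if "is_succ r gav b'" for b'
 proof -
 have "(b, b') : r" "(b', b) : r"
 using succ_under[OF su] succ_under[OF that] not_le[of b b'] not_le[of b' b] FieldI2 underS_iff by metis+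
 then show ?thesis using r_antisym by blast
 qed
 ultimately have "(bev', bev) : r & Unh X e x gav bev' i u v & (ALL b. is_succ r gav b --> lifts X e x b bev' i u v)"
 using U by blast
 then show "EX c. case c of (bev', i, u, v) => (bev', bev) : r & Unh X e x gav bev' i u v &
 (ALL b. is_succ r gav b --> lifts X e x b bev' i u v)" by (intro exI[of _ "(bev', i, u, v)"]) simp
 qed
 from bchoice[OF this] obtain c where c': "ALL gav:A. case c gav of (bev', i, u, v) => (bev', bev) : r &
 Unh X e x gav bev' i u v & (ALL b. is_succ r gav b --> lifts X e x b bev' i u v)" by (elim exE)
 have c: "gav : A ==> case c gav of (bev', i, u, v) => (bev', bev) : r &
 Unh X e x gav bev' i u v & (ALL b. is_succ r gav b --> lifts X e x b bev' i u v)" for gav using c' by (rule bspec)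
 \<comment> \<open>A square served at \<open>gav\<close> is lifted from the next stage on, hence no
   longer unhandled at \<open>gav'\<close>; so the same square is never chosen twice and
   \<open>c\<close> is injective.\<close>
 have key: False if g: "gav : A" "gav' : A" "gav : underS r gav'" "c gav = c gav'" for gav gav'
 proof -
 obtain bev' i u v where cc: "c gav = (bev', i, u, v)" by (metis prod_cases4)
 from ex_succ[OF g(3)] obtain b where b: "is_succ r gav b" "(b, gav') : r" by blast
 have 1: "Unh X e x gav bev' i u v" "lifts X e x b bev' i u v" using c[OF g(1)] b unfolding cc by auto
 have 2: "Unh X e x gav' bev' i u v" using c[OF g(2)] unfolding g(4)[symmetric] cc by auto
 have "(bev', b) : r" using 1 r_trans succ_under(1)[OF b(1)] by (auto simp: Unh_def)
 then have "lifts X e x gav' bev' i u v" using lifts_mono[OF 1(2)] 1(1) b(2) by (simp add: Unh_def)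
 then show False using 2 by (simp add: Unh_def)
 qed
 have "inj_on c A"
 proof (rule inj_onI, rule ccontr)
 fix gav gav' assume g: "gav : A" "gav' : A" "c gav = c gav'" "gav ~= gav'"
 then have "gav : underS r gav' \<or> gav' : underS r gav" using r_total AF by (auto simp: underS_iff)
 then show False using key[of gav gav'] key[of gav' gav] g by metis
 qed
 moreover have "c ` A \<subseteq> B"
 proof
 fix y assume "y : c ` A"
 then obtain gav where g: "gav : A" "y = c gav" by blast
 obtain bev' i u v where cc: "c gav = (bev', i, u, v)" by (metis prod_cases4)
 show "y : B" using c[OF g(1)] unfolding g(2) cc B_def by (auto simp: Unh_def)
 qed
 ultimately have "small elts A" using squares_small[OF b] unfolding B_def[symmetric] by (rule small_inj)
 then have "small elts (under r bev \<union> A)" using small_Un small_under[OF b] by blast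
 moreover have "Field r \<subseteq> under r bev \<union> A" using not_le[OF _ b] by (auto simp: A_def under_iff)
 ultimately show False using small_subset notsmall by blast
qed

text \<open>Where nothing is left to handle, \<open>S\<close> leaves the step arbitrary. A segment
  is therefore known to be cellular only as long as unhandled squares persist.\<close>

lemma interval_RC:
 assumes le: "(bev, gav) : r" and bad: "!!de. de : underS r gav ==> EX bev i u v. Unh X e x de bev i u v"
 shows "x bev gav : RC"
proof (rule interval_rc[OF cat Wr T_lamseq le])
 have "{de. (bev, de) : r & (de, gav) : r} \<subseteq> under r gav" by (auto simp: under_iff)
 then show "small elts {de. (bev, de) : r & (de, gav) : r}" using small_under[OF FieldI2[OF le]] small_subset by blast
 fix a b assume s: "is_succ r a b" "(bev, a) : r" "(b, gav) : r"
 have "a : underS r b" using succ_under(1,2)[OF s(1)] by (simp add: underS_iff)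
 then have "a : underS r gav" using s(3) by (rule lt_le_trans)
 then show "x a b : pushouts_of C I" using step_lift[OF s(1) bad] by blast
qed

text \<open>Suppose unhandled squares remained at every stage. Let \<open>g\<close> send a stage to
  a later one at which all squares born so far are lifted. Iterating \<open>g\<close> along a
  \<open>good\<close> order \<open>s\<close> gives stages \<open>alv b\<close> with least bound
  \<open>v\<close>. A square unhandled at \<open>v\<close> comes, by goodness, from a square born at
  some \<open>alv a\<close>; that one is lifted at \<open>g (alv a)\<close>, hence at
  \<open>v\<close>, a contradiction.\<close>

lemma stage_lifts: "EX a:Field r. ALL bev i u v. \<not> Unh X e x a bev i u v"
proof (rule ccontr)
 assume "\<not> ?thesis"
 then have bad: "!!a. a : Field r ==> EX bev i u v. Unh X e x a bev i u v" by blast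
 obtain s where s: "good s" using ex_good by blast
 have Cs: "Card_order s" "infinite (Field s)" "small elts (Field s)" using s by (simp_all add: good_def)
 have Ws: "Well_order s" using Cs(1) by (rule card_order_on_well_order_on)
 interpret s: wo s by unfold_locales (rule Ws)
 have s_top: "EX b:Field s. a : underS s b" if "a : Field s" for a
 using infinite_Card_order_limit[OF Cs(1,2) that] by (auto simp: underS_def)
 from eventually_lifted obtain g where g: "!!bev. bev : Field r ==> bev : underS r (g bev)"
 "!!bev bev' i u v. bev : Field r ==> (bev', bev) : r ==> \<not> Unh X e x (g bev) bev' i u v" by metis
 have gF: "g bev : Field r" if "bev : Field r" for bev using underS_F(2)[OF g(1)[OF that]] .
 \<comment> \<open>\<open>v\<close> is the least bound of the stages \<open>g (alv b)\<close> for
   \<open>b\<close> in \<open>U\<close>. Defining \<open>alv b\<close> as the least bound over all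
   earlier indices treats zero, successors and limits uniformly.\<close>
 define lb where "lb U alv v \<longleftrightarrow> v : Field r & (ALL b:U. (g (alv b), v) : r) &
 (ALL w:Field r. (ALL b:U. (g (alv b), w) : r) --> (v, w) : r)" for U :: "'u set" and alv v
 have ex_lb: "EX v. lb U alv v" if U: "U \<subseteq> Field s" "!!b. b : U ==> alv b : Field r" for U alv
 proof -
 have "small elts ((%b. g (alv b)) ` U)" by (rule small_image[OF small_subset[OF Cs(3) U(1)]])
 then obtain w where w: "w : Field r" "ALL b:U. (g (alv b), w) : r"
 using bounded[of "(%b. g (alv b)) ` U"] U(2) gF by blast
 then obtain v where "v : Field r" "ALL b:U. (g (alv b), v) : r" "ALL w:{w\<in>Field r. ALL b:U. (g (alv b), w) : r}. (v, w) : r"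
 using r_least[of "{w\<in>Field r. ALL b:U. (g (alv b), w) : r}"] by blast
 then show ?thesis unfolding lb_def by blast
 qed
 have "EX alv. ALL b. b : Field s --> lb (underS s b) alv (alv b)"
 proof (rule dependent_wf_choice[OF s.r_wf])
 show "(b : Field s --> lb (underS s b) f v) = (b : Field s --> lb (underS s b) h v)"
 if "!!c. (c, b) : s - Id ==> f c = h c" for f h b v
 proof -
 have "f c = h c" if "c : underS s b" for c using that \<open>!!c. (c, b) : s - Id ==> f c = h c\<close> by (simp add: s.underS_iff)
 then show ?thesis unfolding lb_def by simp
 qed
 show "EX v. b : Field s --> lb (underS s b) f v"
 if "!!c. (c, b) : s - Id ==> c : Field s --> lb (underS s c) f (f c)" for b f
 proof -
 have "f c : Field r" if "c : underS s b" for c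
 using \<open>!!c. (c, b) : s - Id ==> c : Field s --> lb (underS s c) f (f c)\<close>[of c] that s.underS_F(1)[OF that]
 by (simp add: s.underS_iff lb_def)
 then show ?thesis using ex_lb[OF s.underS_Field] by blast
 qed
 qed
 then obtain alv where alv: "!!b. b : Field s ==> lb (underS s b) alv (alv b)" by blast
 have aF: "alv b : Field r" if "b : Field s" for b using alv[OF that] by (simp add: lb_def)
 have ag: "(g (alv a), alv b) : r" if "a : underS s b" for a b
 using alv[OF s.underS_F(2)[OF that]] that by (simp add: lb_def)
 have amono: "alv a : underS r (alv b)" if "a : underS s b" for a b
 by (rule lt_le_trans[OF g(1)[OF aF[OF s.underS_F(1)[OF that]]] ag[OF that]])
 have ale: "(alv a, alv b) : r" if "(a, b) : s" for a b
 proof (cases "a = b")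
 case True then show ?thesis using r_refl[OF aF[OF FieldI1[OF that]]] by simp
 next
 case False then show ?thesis using underS_le[OF amono] that by (simp add: s.underS_iff)
 qed
 \<comment> \<open>Every stage below \<open>v\<close> is dominated by some \<open>alv b\<close>,
   since \<open>g (alv b)\<close> lies below \<open>alv b'\<close> for a later \<open>b'\<close>. As
   \<open>U\<close> has no last element, no \<open>alv b\<close> is largest among them, so
   \<open>v\<close> has no predecessor.\<close>
 have lub: "is_limit_elt r v & (ALL d:underS r v. EX b:U. (d, alv b) : r) & (ALL b:U. alv b : underS r v)"
 if v: "lb U alv v" and U: "U \<subseteq> Field s" "U ~= {}" "!!b. b : U ==> EX b':U. b : underS s b'" for U v
 proof -
 have av: "alv b : underS r v" if "b : U" for b
 using lt_le_trans[OF g(1)[OF aF]] v that U(1) by (auto simp: lb_def)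
 have cof: "EX b:U. (d, alv b) : r" if d: "d : underS r v" for d
 proof -
 have dF: "d : Field r" and dv: "(v, d) \<notin> r"
 using underS_F(1)[OF d] d r_antisym by (auto simp: underS_iff)
 then obtain b where b: "b : U" "(g (alv b), d) \<notin> r" using v by (auto simp: lb_def)
 obtain b' where b': "b' : U" "b : underS s b'" using U(3)[OF b(1)] by blast
 have "d : underS r (g (alv b))" using not_le[of "g (alv b)" d] b gF aF U(1) dF by blast
 then have "(d, alv b') : r" using ag[OF b'(2)] r_trans underS_le by blast
 then show ?thesis using b' by blast
 qed
 have "is_limit_elt r v"
 unfolding is_limit_elt_def
 proof (intro conjI notI)
 show "v : Field r" using v by (simp add: lb_def)
 show "underS r v = {} ==> False" using av U(2) by blast
 assume "EX a. is_succ r a v"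
 then obtain a where a: "is_succ r a v" by blast
 have "a : underS r v" using succ_under(1,2)[OF a] by (simp add: underS_iff)
 then obtain b where b: "b : U" "(a, alv b) : r" using cof by blast
 obtain b' where b': "b' : U" "b : underS s b'" using U(3)[OF b(1)] by blast
 have "(alv b', a) : r" using av[OF b'(1)] succ_under(3)[OF a] by blast
 then have "(alv b', alv b) : r" using b(2) r_trans by blast
 then show False using amono[OF b'(2)] r_antisym by (auto simp: underS_iff)
 qed
 then show ?thesis using av cof by blast
 qed
 have col: "colim C (Restr s U) (%b. X (alv b)) (%a b. x (alv a) (alv b)) (X v) (%b. x (alv b) v)"
 if v: "lb U alv v" and U: "U \<subseteq> Field s" "U ~= {}" "!!b. b : U ==> EX b':U. b : underS s b'" for U v
 proof -
 note L = lub[OF that]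
 have FU: "Field (Restr s U) = U" by (rule Field_Restr[OF s.refl_r U(1)])
 have co: "colim C (Restr r (underS r v)) X x (X v) (%b. x b v)" using T_lamseq L by (simp add: lamseq_def)
 show ?thesis
 proof (rule colim_cofinal[OF diag_Restr[OF T_diag] co])
 show "(alv a, alv b) : Restr r (underS r v)" if "(a, b) : Restr s U" for a b
 using that ale L by blast
 show "alv b : Field (Restr r (underS r v))" if "b : Field (Restr s U)" for b
 using that L unfolding FU Field_RU by blast
 show "EX b:Field (Restr s U). (a, alv b) : Restr r (underS r v)" if "a : Field (Restr r (underS r v))" for a
 using that L unfolding FU Field_RU by blast
 show "(a, b) : Restr s U \<or> (b, a) : Restr s U" if "a : Field (Restr s U)" "b : Field (Restr s U)" for a b
 using that s.r_total U(1) unfolding FU by blast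
 show "trans (Restr r (underS r v))" by (rule trans_Restr)
 show "(a, a) : Restr r (underS r v)" if "a : Field (Restr r (underS r v))" for a
 using that r_refl underS_F(1) unfolding Field_RU by blast
 qed
 qed
 have dg: "diag C s (%b. X (alv b)) (%a b. x (alv a) (alv b))"
 unfolding diag_def
 proof (intro conjI ballI allI impI)
 show "X (alv a) : Obj C" "x (alv a) (alv a) = idt C (X (alv a))" if "a : Field s" for a
 using diagD(1,5)[OF T_diag aF[OF that]] by blast+
 show "x (alv a) (alv b) : hm C (X (alv a)) (X (alv b))" if "(a, b) : s" for a b
 using diagD(2-4)[OF T_diag ale[OF that]] by simp
 show "x (alv b) (alv c) $ x (alv a) (alv b) = x (alv a) (alv c)" if "(a, b) : s" "(b, c) : s" for a b c
 by (rule diagD(6)[OF T_diag ale[OF that(1)] ale[OF that(2)]])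
 qed
 have lm: "lamseq C s (%b. X (alv b)) (%a b. x (alv a) (alv b))"
 unfolding lamseq_def
 proof (intro conjI allI impI dg)
 fix c assume c: "is_limit_elt s c"
 show "colim C (Restr s (underS s c)) (%b. X (alv b)) (%a b. x (alv a) (alv b)) (X (alv c)) (%b. x (alv b) (alv c))"
 proof (rule col[OF alv s.underS_Field])
 show "c : Field s" "underS s c ~= {}" using c by (auto simp: is_limit_elt_def)
 fix b assume "b : underS s c"
 from s.limit_succ[OF c this] obtain b' where "is_succ s b b'" "b' : underS s c" by blast
 then show "EX b':underS s c. b : underS s b'" using s.succ_under(1,2) s.underS_iff by blast
 qed
 qed
 obtain v where v: "lb (Field s) alv v" using ex_lb[of "Field s" alv] aF by blast
 have vF: "v : Field r" using v by (simp add: lb_def)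
 have Rs: "Restr s (Field s) = s" by (auto intro: FieldI1 FieldI2)
 have ne: "Field s ~= {}" using Cs(2) by auto
 have colv: "colim C s (%b. X (alv b)) (%a b. x (alv a) (alv b)) (X v) (%b. x (alv b) v)"
 using col[OF v _ ne s_top] Rs by simp
 note Lv = lub[OF v _ ne s_top]
 \<comment> \<open>One step of the sped-up sequence is a whole segment of the tower. It is a
   relative cell complex, not a single pushout, which is the class of maps to which goodness
   refers.\<close>
 have RCs: "x (alv a) (alv b) : RC" if "is_succ s a b" for a b
 by (rule interval_RC[OF ale[OF s.succ_under(1)[OF that]]]) (use bad underS_F(1) in blast)
 obtain bev i u w where U: "Unh X e x v bev i u w" using bad[OF vF] by blast
 then have le: "(bev, v) : r" and i: "i : I" and u: "u : arrows C" "dm u = dm i" "cd u = X bev"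
 and w: "w : hm C (cd i) Z" and sq: "e bev $ u = w $ i" and nl: "\<not> lifts X e x v bev i u w"
 by (simp_all add: Unh_def square_def)
 note xb = T_p[OF le]
 have "x bev v $ u : hm C (dm i) (X v)" using xb u by simp
 then obtain a u' where a: "a : Field s" and u': "u' : hm C (dm i) (X (alv a))" "x (alv a) v $ u' = x bev v $ u"
 using s lm RCs colv i unfolding good_def by blast
 have av: "(alv a, v) : r" using Lv a underS_le by blast
 note xa = T_p[OF av]
 \<comment> \<open>The map \<open>u'\<close> and the old lower edge \<open>w\<close> again form a
   square: both composites can be compared after transport to stage \<open>v\<close>.\<close>
 have "e (alv a) $ u' = e v $ x (alv a) v $ u'"
 by (rule cmp_assoc'[OF xa(7), symmetric]) (use xa u' in simp_all)
 also have "... = e bev $ u" unfolding u'(2) by (rule cmp_assoc'[OF xb(7)]) (use xb u in simp_all)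
 finally have sq': "square X e (alv a) i u' w" unfolding square_def using i u' w sq by simp
 have aF': "alv a : Field r" by (rule aF[OF a])
 have ga: "(alv a, g (alv a)) : r" using underS_le[OF g(1)[OF aF']] .
 have "lifts X e x (g (alv a)) (alv a) i u' w"
 using g(2)[OF aF' r_refl[OF aF'], of i u' w] sq' ga by (simp add: Unh_def)
 moreover have "(g (alv a), v) : r" using v a by (simp add: lb_def)
 ultimately have "lifts X e x v (alv a) i u' w" using lifts_mono sq' ga by blast
 then have "lifts X e x v bev i u w" unfolding lifts_def u'(2) .
 then show False using nl by blast
qed

text \<open>The factorization stops at the least stage without unhandled squares: being such a stage
  gives the lifting property of the second factor, minimality makes the first factor cellular by
  \<open>interval_RC\<close>.\<close>

lemma factor_tower: "EX g h. g : RC & h : rlp C I & dm g = dm f & cd g = dm h & cd h = cd f & h $ g = f"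
proof -
 obtain a where a: "a : Field r" "ALL bev i u v. \<not> Unh X e x a bev i u v"
 and least: "!!b. b : Field r ==> ALL bev i u v. \<not> Unh X e x b bev i u v ==> (a, b) : r"
 proof -
 define Q where "Q = {a\<in>Field r. ALL bev i u v. \<not> Unh X e x a bev i u v}"
 have "Q ~= {}" using stage_lifts unfolding Q_def by blast
 moreover have "Q \<subseteq> Field r" unfolding Q_def by blast
 ultimately obtain a where "a : Q" "ALL b:Q. (a, b) : r" using r_least by blast
 then show ?thesis using that unfolding Q_def mem_Collect_eq by blast
 qed
 obtain z where z: "z : Field r" "ALL b:Field r. (z, b) : r" using ex_zero by blast
 then have za: "(z, a) : r" using a by blast
 have z0: "underS r z = {}" using z r_antisym by (auto simp: underS_iff FieldI1)
 have Xz: "X z = dm f" "e z = f" using tower_atD(9,10)[OF T[OF z(1)] z0] by simp_all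
 have "x z a : RC"
 proof (rule interval_RC[OF za])
 fix de assume d: "de : underS r a"
 then have "(a, de) \<notin> r" using r_antisym by (auto simp: underS_iff)
 then show "EX bev i u v. Unh X e x de bev i u v" using least[OF underS_F(1)[OF d]] by blast
 qed
 moreover have "e a : rlp C I"
 proof (rule rlpI[OF _ I(1)])
 note ea = T_p[OF r_refl[OF a(1)]]
 show "e a : arrows C" by (rule ea)
 fix i u v assume i: "i : I" "i : arrows C" and u: "u : arrows C" "v : arrows C" "dm u = dm i" "cd u = dm (e a)"
 "dm v = cd i" "cd v = cd (e a)" "e a $ u = v $ i"
 then have "square X e a i u v" unfolding square_def using ea by simp
 then have "lifts X e x a a i u v" using a r_refl[OF a(1)] unfolding Unh_def by blast
 moreover have "x a a $ u = u" using diagD(5)[OF T_diag a(1)] u ea by simp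
 ultimately obtain l where "l : hm C (cd i) (X a)" "l $ i = u" "e a $ l = v" unfolding lifts_def by auto
 then show "EX h. h : arrows C & dm h = cd i & cd h = dm (e a) & h $ i = u & e a $ h = v"
 using ea by (intro exI[of _ l]) simp
 qed
 ultimately show ?thesis
 using T_p[OF za] Xz by (intro exI[of _ "x z a"] exI[of _ "e a"]) simp
qed

end

end

theorem (in soa) factor:
 assumes "f : arrows C"
 shows "EX g h. g : RC & h : rlp C I & dm g = dm f & cd g = dm h & cd h = cd f & h $ g = f"
proof -
 obtain r :: "'u rel" where r: "Well_order r" "!!a. a : Field r ==> small elts (underS r a)" "\<not> small elts (Field r)"
 using ex_long_well_order by blast
 interpret soa_tower C elts I r f
 by unfold_locales (use r assms in simp_all)
 obtain X e x where "ALL b:Field r. tow X e x b" using tower_exists by blast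
 then show ?thesis using factor_tower by blast
qed

section \<open>Smallness relative to cofibrations\<close>

text \<open>The retract argument: factor \<open>f\<close> as a map in \<open>Sc\<close> followed by
  one in \<open>T\<close>. Lifting \<open>f\<close> against its own second factor exhibits
  \<open>f\<close> as a retract of the first one.\<close>

lemma (in ccat) llp_retract:
 assumes rc: "retract_closed C Sc" and fa: "has_factorizations C Sc T"
 and ST: "Sc \<subseteq> arrows C" "T \<subseteq> arrows C" and f: "f : llp T"
 shows "f : Sc"
proof -
 have fa': "f : arrows C" using f by (rule llp_arrows)
 obtain A B f0 where fe: "f = (A, B, f0)" by (metis prod_cases3)
 obtain Y l r where l: "(A, Y, l) : Sc" and r: "(Y, B, r) : T" and eq: "Cmp C A Y B r l = f0"
 using fa fa' unfolding has_factorizations_def fe by blast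
 have la: "(A, Y, l) : arrows C" "(Y, B, r) : arrows C" using l r ST by blast+
 have AB: "A : Obj C" "B : Obj C" using arrows_Obj[OF fa'] unfolding fe by simp_all
 have rl: "(Y, B, r) $ (A, Y, l) = f" using eq by (simp add: cmp_def fe)
 have "(Y, B, r) $ (A, Y, l) = idt C B $ f" using rl fa' by (simp add: fe)
 then obtain h where h: "h : arrows C" "dm h = B" "cd h = Y" "h $ f = (A, Y, l)" "(Y, B, r) $ h = idt C B"
 using llp_lift[OF f r ST(2), of "(A, Y, l)" "idt C B"] la AB fa' by (auto simp: fe)
 obtain h0 where he: "h = (B, Y, h0)" using h by (cases h) auto
 have "is_retract C f (A, Y, l)"
 unfolding fe is_retract_def prod.case
 proof (intro bexI conjI)
 show "Cmp C A A A (Idn C A) (Idn C A) = Idn C A" using cat_idr[OF AB(1) AB(1) cat_id[OF AB(1)]] .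
 show "Cmp C B Y B r h0 = Idn C B" using h(5) by (simp add: he cmp_def idt_def)
 show "Cmp C A A Y l (Idn C A) = Cmp C A B Y h0 f0"
 using h(4) cat_idr[of A Y l] la AB by (simp add: he fe cmp_def arrows_iff del: arrows_Obj)
 show "Cmp C A A B f0 (Idn C A) = Cmp C A Y B r l"
 using eq cat_idr[of A B f0] fa' by (simp add: fe arrows_iff del: arrows_Obj)
 show "Idn C A : Arr C A A" "Idn C A : Arr C A A" by (rule cat_id[OF AB(1)])+
 show "h0 : Arr C B Y" "r : Arr C Y B" using h(1) la by (simp_all add: he arrows_iff del: arrows_Obj)
 qed
 then show ?thesis using rc l fa' unfolding retract_closed_def by blast
qed

text \<open>A sequence \<open>D\<close> with successor maps in \<open>llp (rlp C I)\<close> is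
  exhibited as a retract of a sequence of relative cell complexes. The extra data of the tower built
  here is a pair \<open>(p, s)\<close> of a projection to \<open>D b\<close> and a section of it,
  both compatible with the transitions.\<close>

locale ladder = soa C elts I + wo r
 for C :: "('o, 'u) cat" and elts :: "'u => 'u set" and I and r :: "'u rel" +
 fixes D :: "'u => 'o" and x z
 assumes D: "lamseq C r D x" and sm: "small elts (Field r)"
 and succ: "!!a b. is_succ r a b ==> x a b : llp (rlp C I)"
 and z: "z : Field r" "!!b. b : Field r ==> (z, b) : r"
begin

lemma d: "diag C r D x" using D by (simp add: lamseq_def)

definition G where "G b Y e \<longleftrightarrow> (case e of (p, s) => p : hm C Y (D b) & s : hm C (D b) Y & p $ s = idt C (D b) & b : Field r)"
definition Rl where "Rl a b Y e Y' e' y \<longleftrightarrow> (case e of (p, s) => case e' of (p', s') => p' $ y = x a b $ p & y $ s = s' $ x a b)"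
 for Y Y' :: 'o
definition S where "S a b X e y Y f j \<longleftrightarrow> j : RC"
 for a b :: 'u and X :: "'u => 'o" and e :: "'u => ('o \<times> 'o \<times> 'u) \<times> ('o \<times> 'o \<times> 'u)"
 and y :: "'u => 'u => 'o \<times> 'o \<times> 'u" and Y :: 'o and f :: "('o \<times> 'o \<times> 'u) \<times> ('o \<times> 'o \<times> 'u)"

sublocale tower_base C r "D z" "(idt C (D z), idt C (D z))" G Rl S by unfold_locales

sublocale tower_data C r "D z" "(idt C (D z), idt C (D z))" G Rl S
proof unfold_locales
 have Dz: "D z : Obj C" by (rule diagD(1)[OF d z(1)])
 show "D z : Obj C" by (rule Dz)
 show "G b (D z) (idt C (D z), idt C (D z))" if b: "b : Field r" "underS r b = {}" for b
 proof -
 have "z = b" using z(2)[OF b(1)] b(2) by (auto simp: underS_iff)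
 then show ?thesis using Dz z(1) by (simp add: G_def)
 qed
 show "Rl a a Y e Y e (idt C Y)" if g: "G a Y e" for a Y e
 proof -
 obtain p s where e: "e = (p, s)" by (cases e)
 have "a : Field r" using g by (simp add: G_def e)
 then show ?thesis using g diagD(5)[OF d, of a] by (simp add: G_def Rl_def e)
 qed
 show "Rl a c X e Y' g (cmp C v u)"
 if ab: "a : underS r b" "b : underS r c" and R: "Rl a b X e Y h u" "Rl b c Y h Y' g v"
 and G: "G a X e" "G b Y h" "G c Y' g" and uv: "u : hm C X Y" "v : hm C Y Y'"
 for a b c X e Y h Y' g u v
 proof -
 obtain p s where e: "e = (p, s)" by (cases e)
 obtain p1 s1 where h: "h = (p1, s1)" by (cases h)
 obtain p2 s2 where g: "g = (p2, s2)" by (cases g)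
 have ps: "p : arrows C" "dm p = X" "cd p = D a" "s : arrows C" "dm s = D a" "cd s = X"
 "p1 : arrows C" "dm p1 = Y" "cd p1 = D b" "s1 : arrows C" "dm s1 = D b" "cd s1 = Y"
 "p2 : arrows C" "dm p2 = Y'" "cd p2 = D c" "s2 : arrows C" "dm s2 = D c" "cd s2 = Y'"
 using G by (simp_all add: G_def e h g)
 have R': "p1 $ u = x a b $ p" "u $ s = s1 $ x a b" "p2 $ v = x b c $ p1" "v $ s1 = s2 $ x b c"
 using R by (simp_all add: Rl_def e h g)
 note xx = diagD(2-4)[OF d underS_le[OF ab(1)]] diagD(2-4)[OF d underS_le[OF ab(2)]]
 note x3 = diagD(6)[OF d underS_le[OF ab(1)] underS_le[OF ab(2)]]
 have "p2 $ v $ u = (x b c $ p1) $ u" by (rule cmp_assoc'[OF R'(3)]) (use ps uv in simp_all)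
 also have "... = x b c $ x a b $ p" using ps xx uv R'(1) by simp
 also have "... = x a c $ p" by (rule cmp_assoc'[OF x3]) (use ps xx in simp_all)
 finally have 1: "p2 $ v $ u = x a c $ p" .
 have "(v $ u) $ s = v $ s1 $ x a b" using ps xx uv R'(2) by simp
 also have "... = (s2 $ x b c) $ x a b" by (rule cmp_assoc'[OF R'(4)]) (use ps xx uv in simp_all)
 also have "... = s2 $ x a c" using ps xx x3 by simp
 finally show ?thesis using 1 by (simp add: Rl_def e g)
 qed
 show "S a b X' e' x' Y g j" if "S a b X e x Y g j" for a b X e x X' e' x' Y g j
 using that by (simp add: S_def)
 show "EX Y g j. Y : Obj C & G b Y g & j : hm C (X a) Y & Rl a b (X a) (e a) Y g j & S a b X e y Y g j"
 if su: "is_succ r a b" and t: "!!c. (c, a) : r ==> tow X e y c" for a b X e y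
 proof -
 note ab = succ_under(1)[OF su]
 have F: "a : Field r" "b : Field r" using ab by (auto intro: FieldI1 FieldI2)
 obtain p s where e: "e a = (p, s)" by (cases "e a")
 have ps: "p : arrows C" "dm p = X a" "cd p = D a" "s : arrows C" "dm s = D a" "cd s = X a" "p $ s = idt C (D a)"
 using tower_atD(2)[OF t[OF r_refl[OF F(1)]]] by (simp_all add: G_def e)
 note xab = diagD(2-4)[OF d ab]
 have "x a b $ p : arrows C" using xab ps by simp
 from factor[OF this] obtain j p' where j: "j : RC" "dm j = X a" "cd j = dm p'"
 and p': "p' : rlp C I" "cd p' = D b" "p' $ j = x a b $ p" using xab ps by auto
 have T: "rlp C I \<subseteq> arrows C" by (auto simp: rlp_def)
 have ja: "j : arrows C" using rc_llp[OF cat I(1) j(1)] llp_arrows by blast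
 have p'a: "p' : arrows C" using p' T by blast
 have "p' $ j $ s = (x a b $ p) $ s"
 by (rule cmp_assoc'[OF p'(3)]) (use ja p'a ps j in simp_all)
 also have "... = idt C (D b) $ x a b" using xab ps by simp
 finally have sq: "p' $ j $ s = idt C (D b) $ x a b" .
 have Db: "D b : Obj C" by (rule diagD(1)[OF d F(2)])
 \<comment> \<open>The relative cell complex \<open>j\<close> and the new projection
   \<open>p'\<close> come from factoring \<open>x a b $ p\<close>. Since \<open>x a b\<close> has
   the left lifting property against \<open>p'\<close>, the map \<open>j $ s\<close> extends along
   it to a section of \<open>p'\<close>.\<close>
 obtain s' where s': "s' : arrows C" "dm s' = D b" "cd s' = dm p'" "s' $ x a b = j $ s" "p' $ s' = idt C (D b)"
 using llp_lift[OF succ[OF su] p'(1) T _ _ _ _ _ _ sq] ja p'a ps j p' xab Db by auto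
 show ?thesis
 proof (intro exI conjI)
 show "dm p' : Obj C" using p'a by simp
 show "G b (dm p') (p', s')" using p'a p' s' F by (simp add: G_def)
 show "j : hm C (X a) (dm p')" using ja j by simp
 show "Rl a b (X a) (e a) (dm p') (p', s') j" using p' s' by (simp add: Rl_def e)
 show "S a b X e y (dm p') (p', s') j" using j by (simp add: S_def)
 qed
 qed
 show "EX L g q. colim C (Restr r (underS r c)) X y L q & G c L g & (ALL a:underS r c. Rl a c (X a) (e a) L g (q a))"
 if l: "is_limit_elt r c" and t: "!!b. b : underS r c ==> tow X e y b" for c X e y
 proof -
 have cF: "c : Field r" using l by (simp add: is_limit_elt_def)
 have dg: "diag C (Restr r (underS r c)) X y"
 by (rule tow_diag[OF underS_Field le_lt_trans t])
 have "EX L q. colim C (Restr r (underS r c)) X y L q"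
 by (rule small_poset_colimit[OF cat hsc refl_Restr trans_Restr _ dg])
 (simp add: Field_RU small_subset[OF sm underS_Field])
 then obtain L q where co: "colim C (Restr r (underS r c)) X y L q" by blast
 note q = colimD[OF co, unfolded Field_RU]
 have coD: "colim C (Restr r (underS r c)) D x (D c) (%b. x b c)" using D l by (simp add: lamseq_def)
 have ps: "fst (e a) : arrows C" "dm (fst (e a)) = X a" "cd (fst (e a)) = D a"
 "snd (e a) : arrows C" "dm (snd (e a)) = D a" "cd (snd (e a)) = X a" "fst (e a) $ snd (e a) = idt C (D a)"
 if "a : underS r c" for a
 using tower_atD(2)[OF t[OF that]] by (cases "e a"; simp add: G_def)+
 have R: "fst (e b) $ y a b = x a b $ fst (e a)" "y a b $ snd (e a) = snd (e b) $ x a b"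
 if "(a, b) : Restr r (underS r c)" for a b
 proof -
 have "Rl a b (X a) (e a) (X b) (e b) (y a b)"
 proof (cases "a = b")
 case True
 have b: "b : underS r c" using that by simp
 show ?thesis using True diagD(5)[OF d] tower_atD(3)[OF t[OF b]] ps[OF b] underS_F(1)[OF b]
 by (simp add: Rl_def case_prod_beta)
 next
 case False
 then have "a : underS r b" "b : underS r c" using that by (auto simp: underS_iff)
 then show ?thesis using tower_atD(7)[OF t] by blast
 qed
 then show "fst (e b) $ y a b = x a b $ fst (e a)" "y a b $ snd (e a) = snd (e b) $ x a b"
 by (simp_all add: Rl_def case_prod_beta)
 qed
 have xc: "x a c : arrows C" "dm (x a c) = D a" "cd (x a c) = D c" if "a : underS r c" for a
 using diagD(2-4)[OF d underS_le[OF that]] by blast+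
 have Dc: "D c : Obj C" by (rule diagD(1)[OF d cF])
 have "cocone C (Restr r (underS r c)) X y (D c) (%a. x a c $ fst (e a))"
 unfolding cocone_def Field_RU
 proof (intro conjI ballI allI impI Dc)
 show "x a c $ fst (e a) : hm C (X a) (D c)" if "a : underS r c" for a using xc[OF that] ps[OF that] by simp
 fix a b assume ab: "(a, b) : Restr r (underS r c)"
 then have ab': "a : underS r c" "b : underS r c" "(a, b) : r" by auto
 note dab = diagD(2-4)[OF d ab'(3)] diagD(2-4)[OF dg ab]
 have "(x b c $ fst (e b)) $ y a b = x b c $ x a b $ fst (e a)"
 using xc[OF ab'(2)] ps[OF ab'(2)] dab R(1)[OF ab] by simp
 also have "... = x a c $ fst (e a)"
 by (rule cmp_assoc'[OF diagD(6)[OF d ab'(3) underS_le[OF ab'(2)]]]) (use xc[OF ab'(2)] dab ps[OF ab'(1)] in simp_all)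
 finally show "(x b c $ fst (e b)) $ y a b = x a c $ fst (e a)" .
 qed
 from colim_ex[OF co this] obtain p where p: "p : hm C L (D c)" "!!a. a : underS r c ==> p $ q a = x a c $ fst (e a)"
 unfolding Field_RU by blast
 have "cocone C (Restr r (underS r c)) D x L (%a. q a $ snd (e a))"
 unfolding cocone_def Field_RU
 proof (intro conjI ballI allI impI q(1))
 show "q a $ snd (e a) : hm C (D a) L" if "a : underS r c" for a using q(2-4)[OF that] ps[OF that] by simp
 fix a b assume ab: "(a, b) : Restr r (underS r c)"
 then have ab': "a : underS r c" "b : underS r c" "(a, b) : r" by auto
 note dab = diagD(2-4)[OF d ab'(3)] diagD(2-4)[OF dg ab]
 have "(q b $ snd (e b)) $ x a b = q b $ y a b $ snd (e a)"
 using q(2-4)[OF ab'(2)] ps[OF ab'(2)] dab R(2)[OF ab] by simp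
 also have "... = q a $ snd (e a)"
 by (rule cmp_assoc'[OF q(5)[OF ab]]) (use q(2-4)[OF ab'(2)] dab ps[OF ab'(1)] in simp_all)
 finally show "(q b $ snd (e b)) $ x a b = q a $ snd (e a)" .
 qed
 from colim_ex[OF coD this] obtain s where s: "s : hm C (D c) L" "!!a. a : underS r c ==> s $ x a c = q a $ snd (e a)"
 unfolding Field_RU by blast
 have "p $ s = idt C (D c)"
 proof (rule colim_eqI[OF coD diag_Restr[OF d]])
 fix a assume "a : Field (Restr r (underS r c))"
 then have a: "a : underS r c" by (simp add: Field_RU)
 have "(p $ s) $ x a c = p $ q a $ snd (e a)" using p(1) s(1) s(2)[OF a] xc[OF a] by simp
 also have "... = (x a c $ fst (e a)) $ snd (e a)"
 by (rule cmp_assoc'[OF p(2)[OF a]]) (use p(1) q(2-4)[OF a] ps[OF a] in simp_all)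
 also have "... = idt C (D c) $ x a c" using xc[OF a] ps[OF a] by simp
 finally show "(p $ s) $ x a c = idt C (D c) $ x a c" .
 qed (use p(1) s(1) Dc in simp_all)
 then have "G c L (p, s)" using p s cF by (simp add: G_def)
 moreover have "Rl a c (X a) (e a) L (p, s) (q a)" if "a : underS r c" for a
 using p(2)[OF that] s(2)[OF that] by (simp add: Rl_def case_prod_beta)
 ultimately show ?thesis using co by blast
 qed
qed

text \<open>Goodness applies to the cellular sequence: after composing with the section on colimits,
  \<open>u\<close> factors through some \<open>X a\<close>. Projecting back to \<open>D a\<close>
  gives a factorization of \<open>u\<close> itself.\<close>

lemma factors_through_stage:
 assumes g: "good r" and co: "colim C r D x L q" and i: "i : I" and u: "u : hm C (dm i) L"
 shows "EX a:Field r. EX u':hm C (dm i) (D a). q a $ u' = u"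
proof -
 obtain X e y where T: "!!b. b : Field r ==> tow X e y b" using tower_exists by blast
 have lm: "lamseq C r X y" by (rule tow_lamseq[OF T])
 then have dg: "diag C r X y" by (simp add: lamseq_def)
 have RCs: "y a b : RC" if "is_succ r a b" for a b
 using tower_atD(11)[OF T[OF FieldI2[OF succ_under(1)[OF that]]] that] by (simp add: S_def)
 obtain M w where M: "colim C r X y M w" using small_poset_colimit[OF cat hsc refl_r trans_r sm dg] by blast
 note w = colimD[OF M] and q = colimD[OF co]
 have ps: "fst (e a) : arrows C" "dm (fst (e a)) = X a" "cd (fst (e a)) = D a"
 "snd (e a) : arrows C" "dm (snd (e a)) = D a" "cd (snd (e a)) = X a" "fst (e a) $ snd (e a) = idt C (D a)"
 if "a : Field r" for a
 using tower_atD(2)[OF T[OF that]] by (cases "e a"; simp add: G_def)+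
 have R: "fst (e b) $ y a b = x a b $ fst (e a)" "y a b $ snd (e a) = snd (e b) $ x a b" if "(a, b) : r" for a b
 using tow_Rl[OF T[OF FieldI1[OF that]] T[OF FieldI2[OF that]] that] by (simp_all add: Rl_def case_prod_beta)
 have "cocone C r X y L (%a. q a $ fst (e a))"
 unfolding cocone_def
 proof (intro conjI ballI allI impI q(1))
 show "q a $ fst (e a) : hm C (X a) L" if "a : Field r" for a using q(2-4)[OF that] ps[OF that] by simp
 fix a b assume ab: "(a, b) : r"
 note F = FieldI1[OF ab] FieldI2[OF ab] and dab = diagD(2-4)[OF d ab] diagD(2-4)[OF dg ab]
 have "(q b $ fst (e b)) $ y a b = q b $ x a b $ fst (e a)" using q(2-4)[OF F(2)] ps[OF F(2)] dab R(1)[OF ab] by simp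
 also have "... = q a $ fst (e a)" by (rule cmp_assoc'[OF q(5)[OF ab]]) (use q(2-4)[OF F(2)] dab ps[OF F(1)] in simp_all)
 finally show "(q b $ fst (e b)) $ y a b = q a $ fst (e a)" .
 qed
 from colim_ex[OF M this] obtain p where p: "p : hm C M L" "!!a. a : Field r ==> p $ w a = q a $ fst (e a)" by blast
 have "cocone C r D x M (%a. w a $ snd (e a))"
 unfolding cocone_def
 proof (intro conjI ballI allI impI w(1))
 show "w a $ snd (e a) : hm C (D a) M" if "a : Field r" for a using w(2-4)[OF that] ps[OF that] by simp
 fix a b assume ab: "(a, b) : r"
 note F = FieldI1[OF ab] FieldI2[OF ab] and dab = diagD(2-4)[OF d ab] diagD(2-4)[OF dg ab]
 have "(w b $ snd (e b)) $ x a b = w b $ y a b $ snd (e a)" using w(2-4)[OF F(2)] ps[OF F(2)] dab R(2)[OF ab] by simp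
 also have "... = w a $ snd (e a)" by (rule cmp_assoc'[OF w(5)[OF ab]]) (use w(2-4)[OF F(2)] dab ps[OF F(1)] in simp_all)
 finally show "(w b $ snd (e b)) $ x a b = w a $ snd (e a)" .
 qed
 from colim_ex[OF co this] obtain s where s: "s : hm C L M" "!!a. a : Field r ==> s $ q a = w a $ snd (e a)" by blast
 have ps1: "p $ s = idt C L"
 proof (rule colim_eqI[OF co d])
 fix a assume a: "a : Field r"
 have "(p $ s) $ q a = p $ w a $ snd (e a)" using p(1) s(1) s(2)[OF a] q(2-4)[OF a] by simp
 also have "... = (q a $ fst (e a)) $ snd (e a)"
 by (rule cmp_assoc'[OF p(2)[OF a]]) (use p(1) w(2-4)[OF a] ps[OF a] in simp_all)
 also have "... = idt C L $ q a" using q(2-4)[OF a] ps[OF a] by simp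
 finally show "(p $ s) $ q a = idt C L $ q a" .
 qed (use p(1) s(1) q(1) in simp_all)
 have "s $ u : hm C (dm i) M" using s(1) u by simp
 then obtain a u' where a: "a : Field r" and u': "u' : hm C (dm i) (X a)" "w a $ u' = s $ u"
 using g lm RCs M i unfolding good_def by blast
 have "(q a $ fst (e a)) $ u' = p $ w a $ u'"
 by (rule cmp_assoc'[OF p(2)[OF a], symmetric]) (use p(1) w(2-4)[OF a] u' in simp_all)
 also have "... = idt C L $ u" unfolding u'(2) by (rule cmp_assoc'[OF ps1]) (use p(1) s(1) u in simp_all)
 finally have "q a $ fst (e a) $ u' = u" using q(2-4)[OF a] ps[OF a] u' u by simp
 moreover have "fst (e a) $ u' : hm C (dm i) (D a)" using ps[OF a] u' by simp
 ultimately show ?thesis using a by blast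
qed

end

section \<open>Graded arrows of a dg category\<close>

lemma linear_onD:
 assumes "linear_on k V V' f"
 shows "x : carrier V ==> f x : carrier V'"
 "x : carrier V ==> y : carrier V ==> f (x \<oplus>\<^bsub>V\<^esub> y) = f x \<oplus>\<^bsub>V'\<^esub> f y"
 "a : carrier k ==> x : carrier V ==> f (a \<odot>\<^bsub>V\<^esub> x) = a \<odot>\<^bsub>V'\<^esub> f x"
 using assms by (auto simp: linear_on_def)

lemma linear_on_zero:
 assumes "abelian_group V" "abelian_group V'" "linear_on k V V' f"
 shows "f \<zero>\<^bsub>V\<^esub> = \<zero>\<^bsub>V'\<^esub>"
proof -
 interpret V: abelian_group V by fact
 interpret V': abelian_group V' by fact
 have c: "f \<zero>\<^bsub>V\<^esub> : carrier V'" using linear_onD(1)[OF assms(3)] by simp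
 have "f \<zero>\<^bsub>V\<^esub> \<oplus>\<^bsub>V'\<^esub> f \<zero>\<^bsub>V\<^esub> = f \<zero>\<^bsub>V\<^esub>"
 using linear_onD(2)[OF assms(3), of "\<zero>\<^bsub>V\<^esub>" "\<zero>\<^bsub>V\<^esub>"] by simp
 then show ?thesis using c by (metis V'.a_assoc V'.a_inv_closed V'.r_neg V'.r_zero)
qed

lemma linear_on_minus:
 assumes "abelian_group V" "abelian_group V'" "linear_on k V V' f" "x : carrier V"
 shows "f (\<ominus>\<^bsub>V\<^esub> x) = \<ominus>\<^bsub>V'\<^esub> f x"
proof -
 interpret V: abelian_group V by fact
 interpret V': abelian_group V' by fact
 have "f (\<ominus>\<^bsub>V\<^esub> x) \<oplus>\<^bsub>V'\<^esub> f x = \<zero>\<^bsub>V'\<^esub>"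
 using linear_onD(2)[OF assms(3), of "\<ominus>\<^bsub>V\<^esub> x" x] linear_on_zero[OF assms(1-3)] assms(4) by (simp add: V.l_neg)
 then show ?thesis using linear_onD(1)[OF assms(3)] assms(4) by (metis V'.minus_equality V.a_inv_closed)
qed

text \<open>Homogeneous morphisms of all degrees form an ordinary category once the degree is stored
  with the element: composition adds degrees. The calculus of \<open>ccat\<close> thereby applies to
  arrows of every degree.\<close>

definition gr :: "('o, 'k, 'm) dgcat => ('o, int \<times> 'm) cat" where
 "gr M = \<lparr>Obj = DObj M, Arr = (%A B. {f. snd f : homs M A B (fst f)}), Idn = (%A. (0, DId M A)),
 Cmp = (%A B C g f. (fst g + fst f, DCmp M A B C (fst g) (fst f) (snd g) (snd f)))\<rparr>"

abbreviation deg :: "'o \<times> 'o \<times> int \<times> 'm => int" where "deg f \<equiv> fst (snd (snd f))"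
abbreviation val :: "'o \<times> 'o \<times> int \<times> 'm => 'm" where "val f \<equiv> snd (snd (snd f))"

lemma gr_arrows: "f : arrows (gr M) \<longleftrightarrow> dm f : DObj M & cd f : DObj M & val f : homs M (dm f) (cd f) (deg f)"
 by (simp add: arrows_iff gr_def del: arrows_Obj)

lemma gr_Obj [simp]: "Obj (gr M) = DObj M" by (simp add: gr_def)

lemma gr_cmp: "cmp (gr M) g f = (dm f, cd g, deg g + deg f, DCmp M (dm f) (cd f) (cd g) (deg g) (deg f) (val g) (val f))"
 by (simp add: cmp_def gr_def)

lemma gr_cmp_deg [simp]: "deg (cmp (gr M) g f) = deg g + deg f" by (simp add: gr_cmp)

lemma gr_idt: "idt (gr M) A = (A, A, 0, DId M A)" by (simp add: idt_def gr_def)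

lemma gr_idt_deg [simp]: "deg (idt (gr M) A) = 0" by (simp add: gr_idt)

locale dgc =
 fixes k :: "'k ring" and M :: "('o, 'k, 'm) dgcat"
 assumes fk: "field k" and dgM: "dg_category k M"
begin

lemma dg_cplx: "A : DObj M ==> B : DObj M ==> complex k (DHom M A B)"
 using dgM[unfolded dg_category_def, THEN conjunct1] by blast

lemma dg_mod: "A : DObj M ==> B : DObj M ==> module k (Deg (DHom M A B) n)"
 using dg_cplx by (simp add: complex_def)

lemma dg_ab: "A : DObj M ==> B : DObj M ==> abelian_group (Deg (DHom M A B) n)"
 using dg_mod by (simp add: module_def)

lemma dg_d: "A : DObj M ==> B : DObj M ==> linear_on k (Deg (DHom M A B) n) (Deg (DHom M A B) (n + 1)) (Diff (DHom M A B) n)"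
 using dg_cplx by (simp add: complex_def)

lemma dg_dd: "A : DObj M ==> B : DObj M ==> x : homs M A B n ==>
 Diff (DHom M A B) (n + 1) (Diff (DHom M A B) n x) = \<zero>\<^bsub>Deg (DHom M A B) (n + 1 + 1)\<^esub>"
 using dg_cplx unfolding complex_def by blast

lemma dg_id: "A : DObj M ==> DId M A : homs M A A 0"
 "A : DObj M ==> Diff (DHom M A A) 0 (DId M A) = \<zero>\<^bsub>Deg (DHom M A A) 1\<^esub>"
 using dgM[unfolded dg_category_def, THEN conjunct2, THEN conjunct1] by blast+

lemmas dg3 = dgM[unfolded dg_category_def, THEN conjunct2, THEN conjunct2, THEN conjunct1,
 THEN bspec, THEN bspec, THEN bspec, THEN spec, THEN spec]

lemma dg_linl: "A : DObj M ==> B : DObj M ==> C : DObj M ==> f : homs M A B q ==>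
 linear_on k (Deg (DHom M B C) p) (Deg (DHom M A C) (p + q)) (%g. DCmp M A B C p q g f)"
 using dg3[THEN conjunct1] by blast

lemma dg_linr: "A : DObj M ==> B : DObj M ==> C : DObj M ==> g : homs M B C p ==>
 linear_on k (Deg (DHom M A B) q) (Deg (DHom M A C) (p + q)) (%f. DCmp M A B C p q g f)"
 using dg3[THEN conjunct2, THEN conjunct1] by blast

lemma dg_leib: "A : DObj M ==> B : DObj M ==> C : DObj M ==> f : homs M A B q ==> g : homs M B C p ==>
 Diff (DHom M A C) (p + q) (DCmp M A B C p q g f) =
 DCmp M A B C (p + 1) q (Diff (DHom M B C) p g) f \<oplus>\<^bsub>Deg (DHom M A C) (p + q + 1)\<^esub>
 ksign (Deg (DHom M A C) (p + q + 1)) p (DCmp M A B C p (q + 1) g (Diff (DHom M A B) q f))"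
 using dg3[THEN conjunct2, THEN conjunct2] by blast

lemma dg_unit: "A : DObj M ==> B : DObj M ==> f : homs M A B p ==> DCmp M A A B p 0 f (DId M A) = f"
 "A : DObj M ==> B : DObj M ==> f : homs M A B p ==> DCmp M A B B 0 p (DId M B) f = f"
 using dgM[unfolded dg_category_def, THEN conjunct2, THEN conjunct2, THEN conjunct2, THEN conjunct1] by blast+

lemma dg_assoc: "A : DObj M ==> B : DObj M ==> C : DObj M ==> D : DObj M ==>
 f : homs M A B r ==> g : homs M B C q ==> h : homs M C D p ==>
 DCmp M A C D p (q + r) h (DCmp M A B C q r g f) = DCmp M A B D (p + q) r (DCmp M B C D p q h g) f"
 by (rule dgM[unfolded dg_category_def, THEN conjunct2, THEN conjunct2, THEN conjunct2, THEN conjunct2,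
 THEN bspec, THEN bspec, THEN bspec, THEN bspec, THEN spec, THEN spec, THEN spec, THEN bspec, THEN bspec, THEN bspec])

lemma dg_cmp_closed: "A : DObj M ==> B : DObj M ==> C : DObj M ==> f : homs M A B q ==> g : homs M B C p ==>
 DCmp M A B C p q g f : homs M A C (p + q)"
 using linear_onD(1)[OF dg_linr] by blast

lemma gr_category: "category (gr M)"
 unfolding category_def gr_def cat.select_convs
proof (intro conjI ballI)
 show "(0, DId M X) : {f. snd f : homs M X X (fst f)}" if "X : DObj M" for X using dg_id that by simp
 fix X Y f assume X: "X : DObj M" and Y: "Y : DObj M" and f: "f : {f. snd f : homs M X Y (fst f)}"
 then show "(fst f + fst (0, DId M X), DCmp M X X Y (fst f) (fst (0, DId M X)) (snd f) (snd (0, DId M X))) = f"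
 "(fst (0, DId M Y) + fst f, DCmp M X Y Y (fst (0, DId M Y)) (fst f) (snd (0, DId M Y)) (snd f)) = f"
 using dg_unit[OF X Y, of "snd f" "fst f"] by (simp_all add: prod_eq_iff)
 fix Z g assume Z: "Z : DObj M" and g: "g : {f. snd f : homs M Y Z (fst f)}"
 show "(fst g + fst f, DCmp M X Y Z (fst g) (fst f) (snd g) (snd f)) : {f. snd f : homs M X Z (fst f)}"
 using dg_cmp_closed[OF X Y Z, of "snd f" "fst f" "snd g" "fst g"] f g by simp
 fix V h assume V: "V : DObj M" and h: "h : {f. snd f : homs M Z V (fst f)}"
 show "(fst h + fst (fst g + fst f, DCmp M X Y Z (fst g) (fst f) (snd g) (snd f)),
 DCmp M X Z V (fst h) (fst (fst g + fst f, DCmp M X Y Z (fst g) (fst f) (snd g) (snd f))) (snd h)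
 (snd (fst g + fst f, DCmp M X Y Z (fst g) (fst f) (snd g) (snd f)))) =
 (fst (fst h + fst g, DCmp M Y Z V (fst h) (fst g) (snd h) (snd g)) + fst f,
 DCmp M X Y V (fst (fst h + fst g, DCmp M Y Z V (fst h) (fst g) (snd h) (snd g))) (fst f)
 (snd (fst h + fst g, DCmp M Y Z V (fst h) (fst g) (snd h) (snd g))) (snd f))"
 using dg_assoc[OF X Y Z V, of "snd f" "fst f" "snd g" "fst g" "snd h" "fst h"] f g h by (simp add: add.assoc)
qed

sublocale ccat "gr M" by unfold_locales (rule gr_category)

abbreviation gcmp (infixr \<open>$\<close> 75) where "g $ f \<equiv> cmp (gr M) g f"

abbreviation "GA \<equiv> arrows (gr M)"

abbreviation "UM \<equiv> underlying M"

text \<open>Operations on tagged arrows. A sum takes source, target and degree from its first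
  argument, so it is meaningful for arrows that are parallel and of equal degree, in the sense of
  \<open>par\<close>.\<close>

definition df where "df f = (dm f, cd f, deg f + 1, Diff (DHom M (dm f) (cd f)) (deg f) (val f))"
definition ad where "ad f g = (dm f, cd f, deg f, val f \<oplus>\<^bsub>Deg (DHom M (dm f) (cd f)) (deg f)\<^esub> val g)"
definition ng where "ng f = (dm f, cd f, deg f, \<ominus>\<^bsub>Deg (DHom M (dm f) (cd f)) (deg f)\<^esub> val f)"
definition sm where "sm c f = (dm f, cd f, deg f, c \<odot>\<^bsub>Deg (DHom M (dm f) (cd f)) (deg f)\<^esub> val f)"
definition zr where "zr A B n = (A, B, n, \<zero>\<^bsub>Deg (DHom M A B) n\<^esub>)" for n :: int

definition sg where "sg n f = (if even n then f else ng f)" for n :: int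

definition par where "par f g \<longleftrightarrow> dm f = dm g & cd f = cd g & deg f = deg g"
 for f g :: "'o \<times> 'o \<times> int \<times> 'm"

lemma ops_simps [simp]:
 "dm (df f) = dm f" "cd (df f) = cd f" "deg (df f) = deg f + 1"
 "dm (ad f g) = dm f" "cd (ad f g) = cd f" "deg (ad f g) = deg f"
 "dm (ng f) = dm f" "cd (ng f) = cd f" "deg (ng f) = deg f"
 "dm (sm c f) = dm f" "cd (sm c f) = cd f" "deg (sm c f) = deg f"
 "dm (zr A B n) = A" "cd (zr A B n) = B" "deg (zr A B n) = n"
 "dm (sg m f) = dm f" "cd (sg m f) = cd f" "deg (sg m f) = deg f"
 by (simp_all add: df_def ad_def ng_def sm_def zr_def sg_def)

lemma gr_arrD: "f : GA ==> dm f : DObj M" "f : GA ==> cd f : DObj M" "f : GA ==> val f : homs M (dm f) (cd f) (deg f)"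
 by (simp_all add: gr_arrows)

lemma gr_eqI: "par f g ==> val f = val g ==> f = g"
 by (simp add: par_def prod_eq_iff)

lemma df_GA [simp]: "f : GA ==> df f : GA"
 unfolding gr_arrows using linear_onD(1)[OF dg_d] by (simp add: df_def)

lemma ad_GA [simp]:
 assumes "f : GA" "g : GA" "par f g" shows "ad f g : GA"
proof -
 interpret V: abelian_group "Deg (DHom M (dm g) (cd g)) (deg g)" using dg_ab gr_arrD[OF assms(2)] by blast
 show ?thesis using gr_arrD[OF assms(1)] gr_arrD[OF assms(2)] assms(3)
 unfolding gr_arrows by (simp add: ad_def par_def)
qed

lemma ng_GA [simp]:
 assumes "f : GA" shows "ng f : GA"
proof -
 interpret V: abelian_group "Deg (DHom M (dm f) (cd f)) (deg f)" using dg_ab gr_arrD[OF assms(1)] by blast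
 show ?thesis using gr_arrD[OF assms(1)] unfolding gr_arrows by (simp add: ng_def)
qed

lemma sg_GA [simp]: "f : GA ==> sg n f : GA" by (simp add: sg_def)

lemma sm_GA [simp]:
 assumes "f : GA" "c : carrier k" shows "sm c f : GA"
proof -
 interpret V: module k "Deg (DHom M (dm f) (cd f)) (deg f)" using dg_mod gr_arrD[OF assms(1)] by blast
 show ?thesis using gr_arrD[OF assms(1)] assms(2) unfolding gr_arrows by (simp add: sm_def)
qed

lemma zr_GA [simp]:
 assumes "A : DObj M" "B : DObj M" shows "zr A B n : GA"
proof -
 interpret V: abelian_group "Deg (DHom M A B) n" using dg_ab assms by blast
 show ?thesis using assms unfolding gr_arrows by (simp add: zr_def)
qed

lemma ad_comm: assumes "f : GA" "g : GA" "par f g" shows "ad f g = ad g f"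
proof -
 interpret V: abelian_group "Deg (DHom M (dm f) (cd f)) (deg f)" using dg_ab gr_arrD[OF assms(1)] by blast
 show ?thesis using gr_arrD(3)[OF assms(1)] gr_arrD(3)[OF assms(2)] assms(3) V.a_comm by (simp add: ad_def par_def)
qed

lemma ad_assoc: assumes "f : GA" "g : GA" "h : GA" "par f g" "par f h" shows "ad (ad f g) h = ad f (ad g h)"
proof -
 interpret V: abelian_group "Deg (DHom M (dm f) (cd f)) (deg f)" using dg_ab gr_arrD[OF assms(1)] by blast
 show ?thesis using gr_arrD(3)[OF assms(1)] gr_arrD(3)[OF assms(2)] gr_arrD(3)[OF assms(3)] assms(4,5) V.a_assoc
 by (simp add: ad_def par_def)
qed

lemma ad_zr [simp]: assumes "f : GA" "dm f = A" "cd f = B" "deg f = n" shows "ad f (zr A B n) = f" "ad (zr A B n) f = f"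
proof -
 interpret V: abelian_group "Deg (DHom M (dm f) (cd f)) (deg f)" using dg_ab gr_arrD[OF assms(1)] by blast
 show "ad f (zr A B n) = f" "ad (zr A B n) f = f" using gr_arrD(3)[OF assms(1)] assms(2-4)
 by (auto simp: ad_def zr_def prod_eq_iff)
qed

lemma ad_ng: assumes "f : GA" shows "ad f (ng f) = zr (dm f) (cd f) (deg f)" "ad (ng f) f = zr (dm f) (cd f) (deg f)"
proof -
 interpret V: abelian_group "Deg (DHom M (dm f) (cd f)) (deg f)" using dg_ab gr_arrD[OF assms(1)] by blast
 show "ad f (ng f) = zr (dm f) (cd f) (deg f)" "ad (ng f) f = zr (dm f) (cd f) (deg f)" using gr_arrD(3)[OF assms(1)]
 by (simp_all add: ad_def ng_def zr_def V.r_neg V.l_neg)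
qed

lemma ng_ng [simp]: assumes "f : GA" shows "ng (ng f) = f"
proof -
 interpret V: abelian_group "Deg (DHom M (dm f) (cd f)) (deg f)" using dg_ab gr_arrD[OF assms(1)] by blast
 show ?thesis using gr_arrD(3)[OF assms(1)] by (simp add: ng_def prod_eq_iff)
qed

lemma ng_zr [simp]: assumes "A : DObj M" "B : DObj M" shows "ng (zr A B n) = zr A B n"
proof -
 interpret V: abelian_group "Deg (DHom M A B) n" using dg_ab assms by blast
 show ?thesis by (simp add: ng_def zr_def)
qed

lemma sg_zr [simp]: "A : DObj M ==> B : DObj M ==> sg m (zr A B n) = zr A B n" by (simp add: sg_def)

lemma ad_cancel:
 assumes "f : GA" "g : GA" "h : GA" "par f g" "par f h" "ad f h = ad g h" shows "f = g"
proof -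
 interpret V: abelian_group "Deg (DHom M (dm f) (cd f)) (deg f)" using dg_ab gr_arrD[OF assms(1)] by blast
 have p: "dm g = dm f" "cd g = cd f" "deg g = deg f" "dm h = dm f" "cd h = cd f" "deg h = deg f"
 using assms(4,5) by (simp_all add: par_def)
 have "val (ad f h) = val (ad g h)" using assms(6) by simp
 then have "val f = val g"
 using gr_arrD(3)[OF assms(1)] gr_arrD(3)[OF assms(2)] gr_arrD(3)[OF assms(3)] by (simp add: ad_def p)
 then show ?thesis using gr_eqI assms(4) by blast
qed

lemma df_df: assumes "f : GA" shows "df (df f) = zr (dm f) (cd f) (deg f + 2)"
 using dg_dd[OF gr_arrD[OF assms]] by (simp add: df_def zr_def add.assoc)

lemma df_ad: assumes "f : GA" "g : GA" "par f g" shows "df (ad f g) = ad (df f) (df g)"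
 using linear_onD(2)[OF dg_d[OF gr_arrD(1,2)[OF assms(1)]] gr_arrD(3)[OF assms(1)], of "val g"]
 gr_arrD(3)[OF assms(2)] assms(3) by (simp add: df_def ad_def par_def)

lemma df_sm: assumes "f : GA" "c : carrier k" shows "df (sm c f) = sm c (df f)"
 using linear_onD(3)[OF dg_d[OF gr_arrD(1,2)[OF assms(1)]] assms(2) gr_arrD(3)[OF assms(1)]]
 by (simp add: df_def sm_def)

lemma df_ng: assumes "f : GA" shows "df (ng f) = ng (df f)"
 using linear_on_minus[OF dg_ab dg_ab dg_d, OF gr_arrD(1,2)[OF assms] gr_arrD(1,2)[OF assms] gr_arrD(1,2)[OF assms] gr_arrD(3)[OF assms]]
 by (simp add: df_def ng_def)

lemma df_sg: "f : GA ==> df (sg m f) = sg m (df f)" by (simp add: sg_def df_ng)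

lemma df_zr [simp]: assumes "A : DObj M" "B : DObj M" shows "df (zr A B n) = zr A B (n + 1)"
 using linear_on_zero[OF dg_ab dg_ab dg_d, OF assms assms assms] by (simp add: df_def zr_def)

lemma df_idt [simp]: "A : DObj M ==> df (idt (gr M) A) = zr A A 1"
 using dg_id by (simp add: df_def gr_idt zr_def)

lemma cmp_ad_right:
 assumes "f : GA" "f' : GA" "par f f'" "g : GA" "cd f = dm g" shows "g $ ad f f' = ad (g $ f) (g $ f')"
 using linear_onD(2)[OF dg_linr[OF gr_arrD(1,2)[OF assms(1)] gr_arrD(2)[OF assms(4)]], of "val g" "deg g" "val f" "deg f" "val f'"]
 gr_arrD(3)[OF assms(1)] gr_arrD(3)[OF assms(2)] gr_arrD(3)[OF assms(4)] assms(3,5)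
 by (simp add: gr_cmp ad_def par_def)

lemma cmp_ad_left:
 assumes "g : GA" "g' : GA" "par g g'" "f : GA" "cd f = dm g" shows "ad g g' $ f = ad (g $ f) (g' $ f)"
 using linear_onD(2)[OF dg_linl[OF gr_arrD(1,2)[OF assms(4)] gr_arrD(2)[OF assms(1)]], of "val f" "deg f" "val g" "deg g" "val g'"]
 gr_arrD(3)[OF assms(1)] gr_arrD(3)[OF assms(2)] gr_arrD(3)[OF assms(4)] assms(3,5)
 by (simp add: gr_cmp ad_def par_def)

lemma cmp_sm_right:
 assumes "f : GA" "c : carrier k" "g : GA" "cd f = dm g" shows "g $ sm c f = sm c (g $ f)"
 using linear_onD(3)[OF dg_linr[OF gr_arrD(1,2)[OF assms(1)] gr_arrD(2)[OF assms(3)]], of "val g" "deg g" c "val f" "deg f"]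
 gr_arrD(3)[OF assms(1)] gr_arrD(3)[OF assms(3)] assms(2,4)
 by (simp add: gr_cmp sm_def)

lemma cmp_sm_left:
 assumes "g : GA" "c : carrier k" "f : GA" "cd f = dm g" shows "sm c g $ f = sm c (g $ f)"
 using linear_onD(3)[OF dg_linl[OF gr_arrD(1,2)[OF assms(3)] gr_arrD(2)[OF assms(1)]], of "val f" "deg f" c "val g" "deg g"]
 gr_arrD(3)[OF assms(1)] gr_arrD(3)[OF assms(3)] assms(2,4)
 by (simp add: gr_cmp sm_def)

lemma cmp_ng_right [simp]:
 assumes "f : GA" "g : GA" "cd f = dm g" shows "g $ ng f = ng (g $ f)"
 using linear_on_minus[OF dg_ab dg_ab dg_linr[OF gr_arrD(1,2)[OF assms(1)] gr_arrD(2)[OF assms(2)]], of "val g" "deg g" "val f" "deg f"]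
 gr_arrD[OF assms(1)] gr_arrD[OF assms(2)] assms(3)
 by (simp add: gr_cmp ng_def)

lemma cmp_ng_left [simp]:
 assumes "f : GA" "g : GA" "cd f = dm g" shows "ng g $ f = ng (g $ f)"
 using linear_on_minus[OF dg_ab dg_ab dg_linl[OF gr_arrD(1,2)[OF assms(1)] gr_arrD(2)[OF assms(2)]], of "val f" "deg f" "val g" "deg g"]
 gr_arrD[OF assms(1)] gr_arrD[OF assms(2)] assms(3)
 by (simp add: gr_cmp ng_def)

lemma cmp_zr_right [simp]:
 assumes "A : DObj M" "g : GA" "B = dm g" shows "g $ zr A B n = zr A (cd g) (deg g + n)"
 using linear_on_zero[OF dg_ab dg_ab dg_linr[OF assms(1) gr_arrD(1,2)[OF assms(2)]], of "val g" "deg g" n]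
 gr_arrD[OF assms(2)] assms
 by (simp add: gr_cmp zr_def)

lemma cmp_zr_left [simp]:
 assumes "f : GA" "C : DObj M" "cd f = B" shows "zr B C n $ f = zr (dm f) C (n + deg f)"
 using linear_on_zero[OF dg_ab dg_ab dg_linl[OF gr_arrD(1,2)[OF assms(1)] assms(2)], of "val f" "deg f" n]
 gr_arrD[OF assms(1)] assms
 by (simp add: gr_cmp zr_def)

lemma cmp_sg_right [simp]: "f : GA ==> g : GA ==> cd f = dm g ==> g $ sg m f = sg m (g $ f)"
 and cmp_sg_left [simp]: "f : GA ==> g : GA ==> cd f = dm g ==> sg m g $ f = sg m (g $ f)"
 by (simp_all add: sg_def)

lemma leibniz:
 assumes "f : GA" "g : GA" "cd f = dm g"
 shows "df (g $ f) = ad (df g $ f) (sg (deg g) (g $ df f))"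
proof (rule gr_eqI)
 show "par (df (g $ f)) (ad (df g $ f) (sg (deg g) (g $ df f)))" by (simp add: par_def)
 have e: "deg g + (deg f + 1) = deg g + deg f + 1" "deg g + 1 + deg f = deg g + deg f + 1" by simp_all
 show "val (df (g $ f)) = val (ad (df g $ f) (sg (deg g) (g $ df f)))"
 using dg_leib[OF gr_arrD(1,2)[OF assms(1)] gr_arrD(2)[OF assms(2)] gr_arrD(3)[OF assms(1)], of "val g" "deg g"]
 gr_arrD(3)[OF assms(2)] assms(3)
 by (simp add: df_def ad_def sg_def ng_def gr_cmp ksign_def e)
qed

definition cl where "cl f \<longleftrightarrow> df f = zr (dm f) (cd f) (deg f + 1)"

lemma leibniz_right: "f : GA ==> g : GA ==> cd f = dm g ==> cl f ==> df (g $ f) = df g $ f"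
 by (simp add: leibniz cl_def gr_arrD)

lemma leibniz_left: "f : GA ==> g : GA ==> cd f = dm g ==> cl g ==> df (g $ f) = sg (deg g) (g $ df f)"
 by (simp add: leibniz cl_def gr_arrD)

lemma cl_cmp: "f : GA ==> g : GA ==> cd f = dm g ==> cl f ==> cl g ==> cl (g $ f)"
 unfolding cl_def[of "g $ f"] by (subst leibniz_right) (simp_all add: cl_def gr_arrD ac_simps)

lemma cl_df: "f : GA ==> cl (df f)"
 by (simp add: cl_def df_df add.assoc)

lemma cl_idt: "A : DObj M ==> cl (idt (gr M) A)" by (simp add: cl_def)

section \<open>Closed arrows of degree zero\<close>

text \<open>\<open>io\<close> views an arrow of the underlying category as a graded arrow of degree
  0 and \<open>uo\<close> forgets the degree. As \<open>io\<close> is injective and preserves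
  composition, equations between underlying arrows are proved among graded ones.\<close>

definition io where "io f = (dm f, cd f, (0::int), mor f)" for f :: "'o \<times> 'o \<times> 'm"
definition uo where "uo g = (dm g, cd g, val g)" for g :: "'o \<times> 'o \<times> int \<times> 'm"

abbreviation "UA \<equiv> arrows UM"

lemma io_simps [simp]: "dm (io f) = dm f" "cd (io f) = cd f" "deg (io f) = 0" "dm (uo g) = dm g" "cd (uo g) = cd g"
 by (simp_all add: io_def uo_def)

lemma U_arrows: "f : UA \<longleftrightarrow> io f : GA & cl (io f)"
 unfolding arrows_iff[of f] gr_arrows
 by (auto simp: underlying_def io_def cl_def df_def zr_def)

lemma io_GA [simp]: "f : UA ==> io f : GA" and io_cl [simp]: "f : UA ==> cl (io f)" by (simp_all add: U_arrows)

lemma uo_io [simp]: "uo (io f) = f" by (simp add: io_def uo_def)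
lemma io_uo: "deg g = 0 ==> io (uo g) = g" by (simp add: io_def uo_def prod_eq_iff)

lemma uo_UA: "g : GA ==> deg g = 0 ==> cl g ==> uo g : UA" unfolding U_arrows by (simp add: io_uo)

lemma io_inj: "io f = io g ==> f = g" by (metis uo_io)

lemma io_cmp: "io (cmp UM g f) = io g $ io f"
 unfolding gr_cmp unfolding cmp_def by (simp add: io_def underlying_def)

lemma io_idt: "io (idt UM A) = idt (gr M) A"
 unfolding gr_idt unfolding idt_def by (simp add: io_def underlying_def)

lemma U_Obj [simp]: "Obj UM = DObj M" by (simp add: underlying_def)

lemma U_category: "category UM"
proof -
 have ar: "f : Arr UM X Y \<longleftrightarrow> (X, Y, f) : UA" if "X : Obj UM" "Y : Obj UM" for X Y f
 using that by (simp add: arrows_iff del: arrows_Obj)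
 have fa: "io (X, Y, f) : GA" "cl (io (X, Y, f))"
 if "X : Obj UM" "Y : Obj UM" "f : Arr UM X Y" for X Y f
 using ar[OF that(1,2)] that(3) U_arrows[of "(X, Y, f)"] by blast+
 have cm: "(X, Z, Cmp UM X Y Z g f) = cmp UM (Y, Z, g) (X, Y, f)" for X Y Z f g
 by (simp add: cmp_def)
 have id: "Idn UM X : Arr UM X X" if X: "X : Obj UM" for X
 proof -
 have "idt UM X : UA" unfolding U_arrows io_idt using X by (simp add: cl_idt)
 then show ?thesis unfolding ar[OF X X] idt_def .
 qed
 have idr: "Cmp UM X X Y f (Idn UM X) = f"
 and idl: "Cmp UM X Y Y (Idn UM Y) f = f"
 if X: "X : Obj UM" and Y: "Y : Obj UM" and f: "f : Arr UM X Y" for X Y f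
 proof -
 have "io (X, Y, Cmp UM X X Y f (Idn UM X)) = io (X, Y, f)"
 unfolding cm idt_def[symmetric] io_cmp io_idt using fa[OF X Y f] by simp
 then show "Cmp UM X X Y f (Idn UM X) = f" using io_inj by blast
 have "io (X, Y, Cmp UM X Y Y (Idn UM Y) f) = io (X, Y, f)"
 unfolding cm idt_def[symmetric] io_cmp io_idt using fa[OF X Y f] by simp
 then show "Cmp UM X Y Y (Idn UM Y) f = f" using io_inj by blast
 qed
 have cp: "Cmp UM X Y Z g f : Arr UM X Z"
 if X: "X : Obj UM" and Y: "Y : Obj UM" and Z: "Z : Obj UM"
 and f: "f : Arr UM X Y" and g: "g : Arr UM Y Z" for X Y Z f g
 unfolding ar[OF X Z] U_arrows cm io_cmp
 using fa[OF X Y f] fa[OF Y Z g] cl_cmp[OF fa(1)[OF X Y f] fa(1)[OF Y Z g]] by simp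
 have as: "Cmp UM X Z V h (Cmp UM X Y Z g f) =
 Cmp UM X Y V (Cmp UM Y Z V h g) f"
 if X: "X : Obj UM" and Y: "Y : Obj UM" and Z: "Z : Obj UM" and V: "V : Obj UM"
 and f: "f : Arr UM X Y" and g: "g : Arr UM Y Z" and h: "h : Arr UM Z V"
 for X Y Z V f g h
 proof -
 have "io (X, V, Cmp UM X Z V h (Cmp UM X Y Z g f)) =
 io (X, V, Cmp UM X Y V (Cmp UM Y Z V h g) f)"
 unfolding cm io_cmp using fa(1)[OF X Y f] fa(1)[OF Y Z g] fa(1)[OF Z V h] by simp
 then show ?thesis using io_inj by blast
 qed
 show ?thesis
 unfolding category_def
 by (intro conjI ballI) (rule id idr idl cp as; assumption)+
qed

end

section \<open>Shifts, cones and disks\<close>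

context dgc
begin

sublocale U: ccat UM by unfold_locales (rule U_category)

text \<open>Equational description of \<open>C\<close> as the cone of the identity of
  \<open>[n]E\<close>. \<open>df kav\<close> and \<open>kav\<close> include the two summands,
  shifted back to \<open>E\<close>; \<open>ep\<close> projects to the first; \<open>kav $ ep\<close>
  contracts \<open>C\<close>. These equations alone are used later, so the chosen representing
  objects need not be unfolded.\<close>

definition disk where
 "disk E C n kav ep \<longleftrightarrow> E : DObj M & C : DObj M &
 kav : GA & dm kav = E & cd kav = C & deg kav = -1 - n & ep : GA & dm ep = C & cd ep = E & deg ep = n &
 ep $ kav = zr E E (-1) & ep $ df kav = idt (gr M) E & df (kav $ ep) = idt (gr M) C"

lemma diskD:
 assumes "disk E C n kav ep"
 shows "E : DObj M" "C : DObj M" "kav : GA" "dm kav = E" "cd kav = C" "deg kav = -1 - n"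
 "ep : GA" "dm ep = C" "cd ep = E" "deg ep = n"
 "ep $ kav = zr E E (-1)" "ep $ df kav = idt (gr M) E" "df (kav $ ep) = idt (gr M) C"
 using assms unfolding disk_def by blast+

text \<open>Closed degree zero arrows out of a disk object are the arrows of one fixed degree out of \<open>E\<close>;
 dually, closed degree zero arrows into it are the arrows of degree \<open>n\<close> into \<open>E\<close>.\<close>

lemma disk_out:
 assumes D: "disk E C n kav ep" and y: "y : GA" "dm y = E" "deg y = -1 - n"
 shows "df (y $ ep) : GA" "cl (df (y $ ep))" "deg (df (y $ ep)) = 0" "df (y $ ep) $ kav = y"
proof -
 note d = diskD[OF D]
 show "df (y $ ep) : GA" "cl (df (y $ ep))" "deg (df (y $ ep)) = 0" using d y by (simp_all add: cl_df)
 have Y: "cd y : DObj M" using y by (simp add: gr_arrD)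
 have "(y $ ep) $ kav = zr E (cd y) (deg y - 1)" using d y by simp
 then have z: "df ((y $ ep) $ kav) = zr E (cd y) (deg y)" using d Y by simp
 have "df ((y $ ep) $ kav) = ad (df (y $ ep) $ kav) (sg (-1) ((y $ ep) $ df kav))"
 using leibniz[of kav "y $ ep"] d y by simp
 also have "(y $ ep) $ df kav = y" using d y by simp
 finally have *: "ad (df (y $ ep) $ kav) (ng y) = zr E (cd y) (deg y)" unfolding z by (simp add: sg_def)
 have "ad (df (y $ ep) $ kav) (ng y) = ad y (ng y)" unfolding * using ad_ng[OF y(1)] y by simp
 then show "df (y $ ep) $ kav = y"
 by (rule ad_cancel[rotated 5]) (use d y in "simp_all add: par_def")
qed

text \<open>Because \<open>kav $ ep\<close> has differential the identity, a closed \<open>w\<close>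
  of degree zero is itself the differential of \<open>w $ kav $ ep\<close>.\<close>

lemma disk_out_unique:
 assumes D: "disk E C n kav ep" and w: "w : GA" "dm w = C" "deg w = 0" "cl w"
 shows "w = df ((w $ kav) $ ep)"
proof -
 note d = diskD[OF D]
 have "df (w $ kav $ ep) = sg 0 (w $ df (kav $ ep))" using leibniz_left[of "kav $ ep" w] d w by simp
 then show ?thesis using d w by (simp add: sg_def)
qed

lemma disk_in:
 assumes D: "disk E C n kav ep" and y: "y : GA" "cd y = E" "deg y = n"
 shows "df (kav $ y) : GA" "cl (df (kav $ y))" "deg (df (kav $ y)) = 0" "ep $ df (kav $ y) = y"
proof -
 note d = diskD[OF D]
 show "df (kav $ y) : GA" "cl (df (kav $ y))" "deg (df (kav $ y)) = 0" using d y by (simp_all add: cl_df)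
 have Y: "dm y : DObj M" using y by (simp add: gr_arrD)
 have "df (kav $ y) = ad (df kav $ y) (sg (-1 - n) (kav $ df y))" using leibniz[of y kav] d y by simp
 then have "ep $ df (kav $ y) = ad (ep $ df kav $ y) (sg (-1 - n) (ep $ kav $ df y))"
 using d y by (simp add: cmp_ad_right par_def)
 also have "ep $ df kav $ y = y" using cmp_assoc'[OF d(12), of y] d y by simp
 also have "ep $ kav $ df y = zr (dm y) E n" using cmp_assoc'[OF d(11), of "df y"] d y by simp
 finally show "ep $ df (kav $ y) = y" using d y Y by simp
qed

lemma disk_in_unique:
 assumes D: "disk E C n kav ep" and w: "w : GA" "cd w = C" "deg w = 0" "cl w"
 shows "w = df (kav $ ep $ w)"
proof -
 note d = diskD[OF D]
 have "df ((kav $ ep) $ w) = df (kav $ ep) $ w" using leibniz_right[of w "kav $ ep"] d w by simp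
 then show ?thesis using d w by simp
qed

text \<open>A disk on \<open>X\<close> becomes one on \<open>E\<close> along a closed isomorphism of
  nonzero degree; this reduces all disks to cones of identities.\<close>

lemma disk_shift:
 assumes D: "disk X C 0 kav ep" and E: "E : DObj M"
 and s: "si : GA" "dm si = E" "cd si = X" "deg si = - n" "cl si"
 and t: "tu : GA" "dm tu = X" "cd tu = E" "deg tu = n"
 and st: "si $ tu = idt (gr M) X" "tu $ si = idt (gr M) E"
 shows "disk E C n (kav $ si) (tu $ ep)"
proof -
 note d = diskD[OF D]
 have 1: "(tu $ ep) $ kav $ si = zr E E (-1)"
 using cmp_assoc'[OF d(11), of si] d s t E by simp
 have "(tu $ ep) $ df (kav $ si) = tu $ ep $ df kav $ si" using leibniz_right[of si kav] d s t by simp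
 then have 2: "(tu $ ep) $ df (kav $ si) = idt (gr M) E" using cmp_assoc'[OF d(12), of si] d s t st by simp
 have "(kav $ si) $ tu $ ep = kav $ ep" using cmp_assoc'[OF st(1), of ep] d s t by simp
 then show ?thesis unfolding disk_def using 1 2 d s t E by simp
qed

end

section \<open>Universal elements for shifts and for cones of identities\<close>

locale ptr = dgc +
 assumes spt: "strongly_pretriangulated k M"
begin

lemma shift_rep:
 assumes E: "E : DObj M"
 shows "shift_obj k M n E : DObj M"
 "dgmod_iso k M (shift_dgmod n (Yo M E)) (Yo M (shift_obj k M n E)) (snd (shift_rep k M n E))"
proof -
 obtain X phv where "X : DObj M & dgmod_iso k M (shift_dgmod n (Yo M E)) (Yo M X) phv"
 using spt E unfolding strongly_pretriangulated_def by blast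
 then have "case (X, phv) of (X, phv) => X : DObj M & dgmod_iso k M (shift_dgmod n (Yo M E)) (Yo M X) phv" by simp
 then have "case shift_rep k M n E of (X, phv) => X : DObj M & dgmod_iso k M (shift_dgmod n (Yo M E)) (Yo M X) phv"
 unfolding shift_rep_def by (rule someI)
 then show "shift_obj k M n E : DObj M"
 "dgmod_iso k M (shift_dgmod n (Yo M E)) (Yo M (shift_obj k M n E)) (snd (shift_rep k M n E))"
 unfolding shift_obj_def by (simp_all add: case_prod_beta)
qed

lemma iCone_rep:
 assumes E: "E : DObj M"
 shows "iCone_obj k M E : DObj M"
 "dgmod_iso k M (cone_dgmod (Yo M E) (Yo M E) (Yo_map M E E (DId M E))) (Yo M (iCone_obj k M E)) (snd (iCone_rep k M E))"
proof -
 have "idt UM E : UA" using E by simp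
 then have "(E, E, DId M E) : UA" by (simp add: idt_def underlying_def)
 then obtain X phv where "X : DObj M & dgmod_iso k M (cone_dgmod (Yo M E) (Yo M E) (Yo_map M E E (DId M E))) (Yo M X) phv"
 using spt unfolding strongly_pretriangulated_def by blast
 then have "case (X, phv) of (X, phv) => X : DObj M &
 dgmod_iso k M (cone_dgmod (Yo M E) (Yo M E) (Yo_map M E E (DId M E))) (Yo M X) phv" by simp
 then have "case iCone_rep k M E of (X, phv) => X : DObj M &
 dgmod_iso k M (cone_dgmod (Yo M E) (Yo M E) (Yo_map M E E (DId M E))) (Yo M X) phv"
 unfolding iCone_rep_def by (rule someI)
 then show "iCone_obj k M E : DObj M"
 "dgmod_iso k M (cone_dgmod (Yo M E) (Yo M E) (Yo_map M E E (DId M E))) (Yo M (iCone_obj k M E)) (snd (iCone_rep k M E))"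
 unfolding iCone_obj_def by (simp_all add: case_prod_beta)
qed

lemma dgmod_isoD:
 assumes "dgmod_iso k M N N' phv" "A : DObj M"
 shows "bij_betw (phv A n) (carrier (Deg (MVal N A) n)) (carrier (Deg (MVal N' A) n))"
 "linear_on k (Deg (MVal N A) n) (Deg (MVal N' A) n) (phv A n)"
 "x : carrier (Deg (MVal N A) n) ==> phv A (n + 1) (Diff (MVal N A) n x) = Diff (MVal N' A) n (phv A n x)"
 "B : DObj M ==> y : carrier (Deg (MVal N B) p) ==> f : homs M A B q ==>
 phv A (p + q) (MAct N A B p q y f) = MAct N' A B p q (phv B p y) f"
 using assms unfolding dgmod_iso_def chain_iso_def chain_map_def by blast+

text \<open>Yoneda: the chosen representing isomorphism is composition with its value
  \<open>si\<close> at the identity of \<open>E\<close>. The preimage \<open>tu\<close> of the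
  identity of \<open>[n]E\<close> is inverse to it, and \<open>si\<close> is closed because the
  isomorphism commutes with differentials.\<close>

lemma shift_data:
 assumes E: "E : DObj M"
 shows "EX si tu. si : GA & dm si = E & cd si = shift_obj k M n E & deg si = - n & cl si &
 tu : GA & dm tu = shift_obj k M n E & cd tu = E & deg tu = n & cl tu &
 si $ tu = idt (gr M) (shift_obj k M n E) & tu $ si = idt (gr M) E &
 (ALL A:DObj M. ALL p. ALL x:homs M A E (n + p). snd (shift_rep k M n E) A p x = val (si $ (A, E, n + p, x)))"
proof -
 define X where "X = shift_obj k M n E"
 define phv where "phv = snd (shift_rep k M n E)"
 have X: "X : DObj M" and iso: "dgmod_iso k M (shift_dgmod n (Yo M E)) (Yo M X) phv"
 using shift_rep[OF E] by (simp_all add: X_def phv_def)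
 note D = dgmod_isoD[OF iso]
 have bij: "bij_betw (phv A p) (homs M A E (n + p)) (homs M A X p)" if "A : DObj M" for A p
 using D(1)[OF that, of p] by (simp add: shift_dgmod_def Yo_def)
 have act: "phv A (p + q) (DCmp M A B E (n + p) q y f) = DCmp M A B X p q (phv B p y) f"
 if "A : DObj M" "B : DObj M" "y : homs M B E (n + p)" "f : homs M A B q" for A B p q y f
 using D(4)[OF that(1,2), of y p f q] that by (simp add: shift_dgmod_def Yo_def)
 define si where "si = (E, X, - n, phv E (- n) (DId M E))"
 have idE: "DId M E : homs M E E (n + - n)" using dg_id(1)[OF E] by simp
 have s: "si : GA" "dm si = E" "cd si = X" "deg si = - n"
 unfolding gr_arrows using E X bij[OF E, of "- n"] idE by (auto simp: si_def bij_betw_def)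
 have val: "phv A p x = val (si $ (A, E, n + p, x))" if A: "A : DObj M" and x: "x : homs M A E (n + p)" for A p x
 proof -
 have "phv A (- n + (n + p)) (DCmp M A E E (n + - n) (n + p) (DId M E) x) = DCmp M A E X (- n) (n + p) (phv E (- n) (DId M E)) x"
 by (rule act[OF A E idE x])
 then show ?thesis using dg_unit(2)[OF A E x] by (simp add: gr_cmp si_def)
 qed
 have "DId M X : homs M X X 0" by (rule dg_id(1)[OF X])
 then obtain t where t: "t : homs M X E (n + 0)" "phv X 0 t = DId M X"
 using bij[OF X, of 0] unfolding bij_betw_def by (metis imageE)
 define tu where "tu = (X, E, n, t)"
 have tt: "tu : GA" "dm tu = X" "cd tu = E" "deg tu = n"
 unfolding gr_arrows using t E X by (simp_all add: tu_def)
 have st: "si $ tu = idt (gr M) X"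
 proof (rule gr_eqI)
 show "par (si $ tu) (idt (gr M) X)" using s tt by (simp add: par_def)
 show "val (si $ tu) = val (idt (gr M) X)" using val[OF X t(1)] t(2) by (simp add: tu_def gr_idt)
 qed
 have ts: "tu $ si = idt (gr M) E"
 proof (rule gr_eqI)
 show "par (tu $ si) (idt (gr M) E)" using s tt by (simp add: par_def)
 have c: "tu $ si : GA" using s tt by simp
 have m: "val (tu $ si) : homs M E E (n + - n)" using gr_arrD(3)[OF c] s tt by simp
 have e: "(E, E, n + - n, val (tu $ si)) = tu $ si" using s tt by (simp add: prod_eq_iff)
 have "phv E (- n) (val (tu $ si)) = val (si $ tu $ si)" unfolding val[OF E m] e ..
 also have "si $ tu $ si = si" using cmp_assoc'[OF st, of si] s tt by simp
 also have "val si = phv E (- n) (DId M E)" by (simp add: si_def)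
 finally have "val (tu $ si) = DId M E" using bij[OF E, of "- n"] m idE unfolding bij_betw_def inj_on_def by blast
 then show "val (tu $ si) = val (idt (gr M) E)" by (simp add: gr_idt)
 qed
 have cls: "cl si"
 proof -
 have z: "ksign (Deg (DHom M E E) (n + - n + 1)) n (Diff (DHom M E E) (n + - n) (DId M E)) = \<zero>\<^bsub>Deg (DHom M E E) 1\<^esub>"
 proof -
 interpret abelian_group "Deg (DHom M E E) 1" by (rule dg_ab[OF E E])
 show ?thesis using dg_id(2)[OF E] by (simp add: ksign_def)
 qed
 have idE': "DId M E : carrier (Deg (MVal (shift_dgmod n (Yo M E)) E) (- n))" using idE by (simp add: shift_dgmod_def Yo_def)
 have "phv E (- n + 1) (ksign (Deg (DHom M E E) (n + - n + 1)) n (Diff (DHom M E E) (n + - n) (DId M E)))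
 = Diff (DHom M E X) (- n) (phv E (- n) (DId M E))"
 using D(3)[OF E idE'] by (simp add: shift_dgmod_def Yo_def)
 then have 1: "val (df si) = phv E (- n + 1) \<zero>\<^bsub>Deg (DHom M E E) 1\<^esub>" unfolding z by (simp add: df_def si_def)
 have zc: "\<zero>\<^bsub>Deg (DHom M E E) 1\<^esub> : homs M E E (n + (- n + 1))"
 proof -
 interpret abelian_group "Deg (DHom M E E) 1" by (rule dg_ab[OF E E])
 show ?thesis by simp
 qed
 have "val (df si) = val (si $ zr E E 1)" unfolding 1 val[OF E zc] by (simp add: zr_def)
 then have "val (df si) = val (zr E X (- n + 1))" using s E by simp
 then show "cl si" unfolding cl_def by (intro gr_eqI) (use s in "simp_all add: par_def")
 qed
 have "cl tu"
 proof -
 have "zr X X 1 = ad (df si $ tu) (sg (- n) (si $ df tu))" using leibniz[of tu si] s tt X st by simp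
 also have "... = sg (- n) (si $ df tu)" using cls s tt X unfolding cl_def by simp
 finally have "zr X X 1 = sg (- n) (si $ df tu)" .
 then have "sg (- n) (zr X X 1) = sg (- n) (sg (- n) (si $ df tu))" by simp
 also have "... = si $ df tu" using s tt by (simp add: sg_def)
 finally have "si $ df tu = zr X X 1" using X by simp
 then have "tu $ si $ df tu = zr X E (n + 1)" using tt X by simp
 moreover have "tu $ si $ df tu = df tu" using cmp_assoc'[OF ts, of "df tu"] s tt by simp
 ultimately show ?thesis using tt by (simp add: cl_def)
 qed
 then show ?thesis
 unfolding X_def[symmetric] phv_def[symmetric] using s tt st ts cls val by blast
qed

text \<open>Evaluating the condition in the definition of \<open>shift_map\<close> at the identity
  of \<open>dm i\<close> leaves \<open>si' $ io i $ tu\<close> as the only candidate, and this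
  candidate satisfies it. The description operator is thus replaced by an equation.\<close>

lemma shift_map_eq:
 assumes i: "i : UA"
 and s: "si : GA" "dm si = dm i" "cd si = shift_obj k M n (dm i)" "deg si = - n" "cl si"
 and t: "tu : GA" "dm tu = shift_obj k M n (dm i)" "cd tu = dm i" "deg tu = n" "cl tu"
 and st: "si $ tu = idt (gr M) (shift_obj k M n (dm i))" "tu $ si = idt (gr M) (dm i)"
 and v: "!!A p x. A : DObj M ==> x : homs M A (dm i) (n + p) ==>
 snd (shift_rep k M n (dm i)) A p x = val (si $ (A, dm i, n + p, x))"
 and s': "si' : GA" "dm si' = cd i" "cd si' = shift_obj k M n (cd i)" "deg si' = - n" "cl si'"
 and v': "!!A p x. A : DObj M ==> x : homs M A (cd i) (n + p) ==>
 snd (shift_rep k M n (cd i)) A p x = val (si' $ (A, cd i, n + p, x))"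
 shows "io (shift_obj k M n (dm i), shift_obj k M n (cd i), shift_map k M n (dm i) (cd i) (mor i)) $ si = si' $ io i"
proof -
 define E F where "E = dm i" and "F = cd i"
 define X Y where "X = shift_obj k M n E" and "Y = shift_obj k M n F"
 note defs = E_def[symmetric] F_def[symmetric] X_def[symmetric] Y_def[symmetric]
 have E: "E : DObj M" "F : DObj M" using arrows_Obj[OF i] by (simp_all add: E_def F_def)
 have X: "X : DObj M" "Y : DObj M" using shift_rep(1)[OF E(1)] shift_rep(1)[OF E(2)] by (simp_all add: X_def Y_def E_def F_def)
 note s = s[unfolded defs] and t = t[unfolded defs] and st = st[unfolded defs] and v = v[unfolded defs]
 and s' = s'[unfolded defs] and v' = v'[unfolded defs]
 have ii: "io i : GA" "dm (io i) = E" "cd (io i) = F" "cl (io i)" using i by (simp_all add: E_def F_def)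
 define P where "P j \<longleftrightarrow> j : Arr UM X Y &
 (ALL A:DObj M. ALL p. ALL x:homs M A E (n + p).
 snd (shift_rep k M n F) A p (Yo_map M E F (mor i) A (n + p) x) =
 Yo_map M X Y j A p (snd (shift_rep k M n E) A p x))" for j
 have Pj: "io (X, Y, j) $ si = si' $ io i" if "P j" for j
 proof -
 have ja: "(X, Y, j) : UA" using that X by (simp add: P_def arrows_iff del: arrows_Obj)
 then have jG: "io (X, Y, j) : GA" by simp
 have idE: "DId M E : homs M E E (n + - n)" using dg_id(1)[OF E(1)] by simp
 have "snd (shift_rep k M n F) E (- n) (Yo_map M E F (mor i) E (n + - n) (DId M E)) =
 Yo_map M X Y j E (- n) (snd (shift_rep k M n E) E (- n) (DId M E))"
 using that E(1) idE unfolding P_def by blast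
 moreover have "Yo_map M E F (mor i) E (n + - n) (DId M E) = mor i"
 using dg_unit(1)[OF E gr_arrD(3)[OF ii(1), unfolded ii]] by (simp add: Yo_map_def io_def)
 moreover have "mor i : homs M E F (n + - n)" using gr_arrD(3)[OF ii(1), unfolded ii] by (simp add: io_def)
 ultimately have "val (si' $ (E, F, n + - n, mor i)) = Yo_map M X Y j E (- n) (val (si $ (E, E, n + - n, DId M E)))"
 using v'[OF E(1), of "mor i" "- n"] v[OF E(1) idE] by simp
 moreover have "(E, F, n + - n, mor i) = io i" by (simp add: io_def E_def F_def)
 moreover have "si $ (E, E, n + - n, DId M E) = si" using s by (simp add: gr_idt[symmetric])
 ultimately have "val (si' $ io i) = Yo_map M X Y j E (- n) (val si)" by simp
 also have "... = val (io (X, Y, j) $ si)" using s by (simp add: Yo_map_def gr_cmp io_def)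
 finally show ?thesis by (intro gr_eqI) (use s s' ii in "simp_all add: par_def")
 qed
 define j0 where "j0 = si' $ io i $ tu"
 have j0: "j0 : GA" "dm j0 = X" "cd j0 = Y" "deg j0 = 0" "cl j0"
 using s' t ii by (simp_all add: j0_def cl_cmp)
 have "uo j0 : UA" by (rule uo_UA) (use j0 in simp_all)
 then have jA: "val j0 : Arr UM X Y" using arrows_iff[of "uo j0"] j0 by (simp add: uo_def)
 have io0: "io (X, Y, val j0) = j0" using j0 by (simp add: io_def prod_eq_iff)
 have "P (val j0)"
 unfolding P_def
 proof (intro conjI ballI allI jA)
 fix A p x assume A: "A : DObj M" and x: "x : homs M A E (n + p)"
 define x' where "x' = (A, E, n + p, x)"
 have x': "x' : GA" "dm x' = A" "cd x' = E" "deg x' = n + p" using A E x unfolding gr_arrows by (simp_all add: x'_def)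
 have y: "(A, F, n + p, Yo_map M E F (mor i) A (n + p) x) = io i $ x'"
 by (simp add: gr_cmp io_def x'_def Yo_map_def E_def F_def)
 have "io i $ x' : GA" using ii x' by simp
 then have yc: "Yo_map M E F (mor i) A (n + p) x : homs M A F (n + p)" unfolding y[symmetric] by (simp add: gr_arrows)
 have "si' $ io i $ x' = j0 $ si $ x'"
 using cmp_assoc'[OF st(2), of x'] s s' t ii x' by (simp add: j0_def)
 moreover have "val (j0 $ si $ x') = Yo_map M X Y (val j0) A p (val (si $ x'))"
 using j0 s x' by (simp add: gr_cmp[of M j0] Yo_map_def)
 ultimately show "snd (shift_rep k M n F) A p (Yo_map M E F (mor i) A (n + p) x) =
 Yo_map M X Y (val j0) A p (snd (shift_rep k M n E) A p x)"
 unfolding v'[OF A yc] v[OF A x] y x'_def[symmetric] by simp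
 qed
 moreover have "j = val j0" if "P j" for j
 proof -
 have ja: "(X, Y, j) : UA" using that X by (simp add: P_def arrows_iff del: arrows_Obj)
 then have jG: "io (X, Y, j) : GA" by simp
 have "io (X, Y, j) = (io (X, Y, j) $ si) $ tu" using jG s t st by simp
 also have "... = j0" unfolding Pj[OF that] j0_def using s' t ii by simp
 finally show ?thesis by (auto simp: io_def)
 qed
 ultimately have "P (THE j. P j)" by (intro theI[of P "val j0"]) blast+
 moreover have "shift_map k M n E F (mor i) = (THE j. P j)"
 unfolding shift_map_def P_def X_def Y_def E_def F_def ..
 ultimately show ?thesis using Pj unfolding defs by simp
qed

text \<open>Yoneda once more: the representing isomorphism is determined by its values
  \<open>j\<close> at \<open>(id, 0)\<close> and \<open>kav\<close> at \<open>(0, id)\<close>, and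
  \<open>j\<close> is the differential of \<open>kav\<close>. The coordinates of the identity of
  \<open>C\<close> provide \<open>ep\<close> and \<open>pev\<close>.\<close>

lemma cone_data:
 assumes E: "E : DObj M"
 shows "EX kav ep. disk E (iCone_obj k M E) 0 kav ep &
 (ALL A:DObj M. ALL p. ALL y:homs M A E p. ALL x:homs M A E (p + 1).
 snd (iCone_rep k M E) A p (y, x) = val (ad (df kav $ (A, E, p, y)) (kav $ (A, E, p + 1, x))))"
proof -
 define C where "C = iCone_obj k M E"
 define phv where "phv = snd (iCone_rep k M E)"
 have C: "C : DObj M" and iso: "dgmod_iso k M (cone_dgmod (Yo M E) (Yo M E) (Yo_map M E E (DId M E))) (Yo M C) phv"
 using iCone_rep[OF E] by (simp_all add: C_def phv_def)
 note D = dgmod_isoD[OF iso]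
 define Z where "Z A p = \<zero>\<^bsub>Deg (DHom M A E) p\<^esub>" for A p
 have Zc: "Z A p : homs M A E p" if "A : DObj M" for A p
 proof -
 interpret abelian_group "Deg (DHom M A E) p" by (rule dg_ab[OF that E])
 show ?thesis by (simp add: Z_def)
 qed
 have Zt: "(A, E, p, Z A p) = zr A E p" for A p by (simp add: zr_def Z_def)
 have bij: "bij_betw (phv A p) (homs M A E p \<times> homs M A E (p + 1)) (homs M A C p)" if "A : DObj M" for A p
 using D(1)[OF that, of p] by (simp add: cone_dgmod_def Yo_def prod_module_def)
 have mem: "phv A p (y, x) : homs M A C p" if "A : DObj M" "y : homs M A E p" "x : homs M A E (p + 1)" for A p y x
 using bij[OF that(1), of p] that unfolding bij_betw_def by blast
 have inj: "y = y' & x = x'" if "A : DObj M" "y : homs M A E p" "x : homs M A E (p + 1)" "y' : homs M A E p" "x' : homs M A E (p + 1)"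
 "phv A p (y, x) = phv A p (y', x')" for A p y x y' x'
 using bij[OF that(1), of p] that(2-6) unfolding bij_betw_def inj_on_def by (metis Pair_inject mem_Sigma_iff)
 have act: "phv A (p + q) (DCmp M A B E p q y f, DCmp M A B E (p + 1) q x f) = DCmp M A B C p q (phv B p (y, x)) f"
 if "A : DObj M" "B : DObj M" "y : homs M B E p" "x : homs M B E (p + 1)" "f : homs M A B q" for A B p q y x f
 using D(4)[OF that(1,2), of "(y, x)" p f q] that by (simp add: cone_dgmod_def Yo_def prod_module_def)
 have dif: "phv A (p + 1) (Diff (DHom M A E) p y \<oplus>\<^bsub>Deg (DHom M A E) (p + 1)\<^esub> x, \<ominus>\<^bsub>Deg (DHom M A E) (p + 1 + 1)\<^esub> Diff (DHom M A E) (p + 1) x)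
 = Diff (DHom M A C) p (phv A p (y, x))"
 if A: "A : DObj M" and yx: "y : homs M A E p" "x : homs M A E (p + 1)" for A p y x
 using D(3)[OF A, of "(y, x)" p] yx dg_unit(2)[OF A E yx(2)] by (simp add: cone_dgmod_def Yo_def prod_module_def Yo_map_def)
 have add: "phv A p (y, x) = phv A p (y, Z A (p + 1)) \<oplus>\<^bsub>Deg (DHom M A C) p\<^esub> phv A p (Z A p, x)"
 if A: "A : DObj M" and yx: "y : homs M A E p" "x : homs M A E (p + 1)" for A p y x
 proof -
 interpret V0: abelian_group "Deg (DHom M A E) p" by (rule dg_ab[OF A E])
 interpret V1: abelian_group "Deg (DHom M A E) (p + 1)" by (rule dg_ab[OF A E])
 have l: "linear_on k (prod_module (Deg (DHom M A E) p) (Deg (DHom M A E) (p + 1))) (Deg (DHom M A C) p) (phv A p)"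
 using D(2)[OF A, of p] by (simp add: cone_dgmod_def Yo_def)
 have "phv A p ((y, Z A (p + 1)) \<oplus>\<^bsub>prod_module (Deg (DHom M A E) p) (Deg (DHom M A E) (p + 1))\<^esub> (Z A p, x))
 = phv A p (y, Z A (p + 1)) \<oplus>\<^bsub>Deg (DHom M A C) p\<^esub> phv A p (Z A p, x)"
 by (rule linear_onD(2)[OF l]) (use yx Zc[OF A] in "simp_all add: prod_module_def")
 then show ?thesis using yx by (simp add: prod_module_def Z_def)
 qed
 have id0: "DId M E : homs M E E (-1 + 1)" "DId M E : homs M E E 0" using dg_id(1)[OF E] by simp_all
 \<comment> \<open>Degree -1 is where the second summand, which is \<open>[1]E\<close>, contains the
   identity of \<open>E\<close>.\<close>
 define kav where "kav = (E, C, -1 :: int, phv E (-1) (Z E (-1), DId M E))"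
 define j where "j = (E, C, 0 :: int, phv E 0 (DId M E, Z E (0 + 1)))"
 have ka: "kav : GA" "dm kav = E" "cd kav = C" "deg kav = -1"
 unfolding gr_arrows using E C mem[OF E Zc[OF E] id0(1)] by (simp_all add: kav_def)
 have ja: "j : GA" "dm j = E" "cd j = C" "deg j = 0"
 unfolding gr_arrows using E C mem[OF E id0(2) Zc[OF E]] by (simp_all add: j_def)
 have tagA: "(A, E, p, x) : GA" if "A : DObj M" "x : homs M A E p" for A p x
 unfolding gr_arrows using that E by simp
 have vk: "phv A p (Z A p, x) = val (kav $ (A, E, p + 1, x))" if A: "A : DObj M" and x: "x : homs M A E (p + 1)" for A p x
 proof -
 have "phv A (-1 + (p + 1)) (DCmp M A E E (-1) (p + 1) (Z E (-1)) x, DCmp M A E E (-1 + 1) (p + 1) (DId M E) x) =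
 DCmp M A E C (-1) (p + 1) (phv E (-1) (Z E (-1), DId M E)) x"
 by (rule act[OF A E Zc[OF E] id0(1) x])
 moreover have "DCmp M A E E (-1) (p + 1) (Z E (-1)) x = Z A p"
 using arg_cong[OF cmp_zr_left[OF tagA[OF A x] E, of E "-1"], of val] by (simp add: gr_cmp zr_def Z_def)
 moreover have "DCmp M A E E (-1 + 1) (p + 1) (DId M E) x = x" using dg_unit(2)[OF A E x] by simp
 ultimately show ?thesis by (simp add: gr_cmp kav_def)
 qed
 have vj: "phv A p (y, Z A (p + 1)) = val (j $ (A, E, p, y))" if A: "A : DObj M" and y: "y : homs M A E p" for A p y
 proof -
 have "phv A (0 + p) (DCmp M A E E 0 p (DId M E) y, DCmp M A E E (0 + 1) p (Z E (0 + 1)) y) =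
 DCmp M A E C 0 p (phv E 0 (DId M E, Z E (0 + 1))) y"
 by (rule act[OF A E id0(2) Zc[OF E] y])
 moreover have "DCmp M A E E (0 + 1) p (Z E (0 + 1)) y = Z A (p + 1)"
 using arg_cong[OF cmp_zr_left[OF tagA[OF A y] E, of E 1], of val] by (simp add: gr_cmp zr_def Z_def add.commute)
 moreover have "DCmp M A E E 0 p (DId M E) y = y" using dg_unit(2)[OF A E y] by simp
 ultimately show ?thesis by (simp add: gr_cmp j_def)
 qed
 have vv: "phv A p (y, x) = val (ad (j $ (A, E, p, y)) (kav $ (A, E, p + 1, x)))"
 if A: "A : DObj M" and yx: "y : homs M A E p" "x : homs M A E (p + 1)" for A p y x
 unfolding add[OF that] vj[OF A yx(1)] vk[OF A yx(2)] using ja by (simp add: ad_def)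
 have dk: "df kav = j"
 proof (rule gr_eqI)
 show "par (df kav) j" using ka ja by (simp add: par_def)
 interpret V0: abelian_group "Deg (DHom M E E) 0" by (rule dg_ab[OF E E])
 interpret V1: abelian_group "Deg (DHom M E E) 1" by (rule dg_ab[OF E E])
 have dz: "Diff (DHom M E E) (-1) (Z E (-1)) = \<zero>\<^bsub>Deg (DHom M E E) 0\<^esub>"
 using arg_cong[OF df_zr[OF E E, of "-1"], of val] by (simp add: df_def zr_def Z_def)
 have "phv E (-1 + 1) (Diff (DHom M E E) (-1) (Z E (-1)) \<oplus>\<^bsub>Deg (DHom M E E) (-1 + 1)\<^esub> DId M E,
 \<ominus>\<^bsub>Deg (DHom M E E) (-1 + 1 + 1)\<^esub> Diff (DHom M E E) (-1 + 1) (DId M E)) = Diff (DHom M E C) (-1) (phv E (-1) (Z E (-1), DId M E))"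
 by (rule dif[OF E Zc[OF E] id0(1)])
 moreover have "\<ominus>\<^bsub>Deg (DHom M E E) 1\<^esub> \<zero>\<^bsub>Deg (DHom M E E) 1\<^esub> = \<zero>\<^bsub>Deg (DHom M E E) 1\<^esub>"
 using arg_cong[OF ng_zr[OF E E, of 1], of val] by (simp add: ng_def zr_def)
 ultimately show "val (df kav) = val j" using dz dg_id[OF E] by (simp add: df_def kav_def j_def Z_def)
 qed
 have idC: "DId M C : homs M C C 0" by (rule dg_id(1)[OF C])
 then have "DId M C : phv C 0 ` (homs M C E 0 \<times> homs M C E (0 + 1))"
 using bij[OF C, of 0] unfolding bij_betw_def by simp
 then obtain e0 e1 where e: "e0 : homs M C E 0" "e1 : homs M C E (0 + 1)" "phv C 0 (e0, e1) = DId M C"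
 by (elim imageE SigmaE) (rule that, simp_all)
 define ep where "ep = (C, E, 0 :: int, e0)"
 define pev where "pev = (C, E, 1 :: int, e1)"
 have ea: "ep : GA" "dm ep = C" "cd ep = E" "deg ep = 0" and pa: "pev : GA" "dm pev = C" "cd pev = E" "deg pev = 1"
 unfolding gr_arrows using e E C by (simp_all add: ep_def pev_def)
 have idC': "ad (j $ ep) (kav $ pev) = idt (gr M) C"
 by (rule gr_eqI) (use vv[OF C e(1,2)] e(3) ja ea in "simp_all add: par_def ep_def pev_def gr_idt")
 have gi: "f = f' & g = g'"
 if f: "f : GA" "f' : GA" "dm f' = dm f" "cd f = E" "cd f' = E" "deg f' = deg f"
 and g: "g : GA" "g' : GA" "dm g = dm f" "dm g' = dm f" "cd g = E" "cd g' = E" "deg g = deg f + 1" "deg g' = deg f + 1"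
 and eq: "ad (j $ f) (kav $ g) = ad (j $ f') (kav $ g')" for f f' g g'
 proof -
 have A: "dm f : DObj M" using f by (simp add: gr_arrD)
 have c: "val f : homs M (dm f) E (deg f)" "val f' : homs M (dm f) E (deg f)" "val g : homs M (dm f) E (deg f + 1)"
 "val g' : homs M (dm f) E (deg f + 1)"
 using gr_arrD(3)[OF f(1)] gr_arrD(3)[OF f(2)] gr_arrD(3)[OF g(1)] gr_arrD(3)[OF g(2)] f g by simp_all
 have t: "(dm f, E, deg f, val f) = f" "(dm f, E, deg f, val f') = f'" "(dm f, E, deg f + 1, val g) = g" "(dm f, E, deg f + 1, val g') = g'"
 using f g by (simp_all add: prod_eq_iff)
 have "phv (dm f) (deg f) (val f, val g) = phv (dm f) (deg f) (val f', val g')"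
 unfolding vv[OF A c(1,3)] vv[OF A c(2,4)] t eq ..
 from inj[OF A c(1,3) c(2,4) this] have "val f = val f'" "val g = val g'" by simp_all
 then show ?thesis using f g by (simp add: prod_eq_iff)
 qed
 \<comment> \<open>Differentiating the decomposition of the identity of \<open>C\<close> gives
   \<open>j $ (d ep + pev) - kav $ d pev = 0\<close>; the first coordinate of this equation is the
   claim.\<close>
 have pe: "pev = ng (df ep)"
 proof -
 interpret V1: abelian_group "Deg (DHom M C E) 1" by (rule dg_ab[OF C E])
 have dj: "df j = zr E C 1" unfolding dk[symmetric] using df_df[OF ka(1)] ka by simp
 have "df (j $ ep) = j $ df ep" using leibniz[of ep j] ja ea dj C by (simp add: sg_def)
 moreover have "df (kav $ pev) = ad (j $ pev) (ng (kav $ df pev))" using leibniz[of pev kav] ka pa dk by (simp add: sg_def)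
 moreover have "df (ad (j $ ep) (kav $ pev)) = ad (df (j $ ep)) (df (kav $ pev))"
 by (rule df_ad) (use ja ea ka pa in "simp_all add: par_def")
 moreover have "df (ad (j $ ep) (kav $ pev)) = zr C C 1" using idC' C by simp
 ultimately have "zr C C 1 = ad (j $ df ep) (ad (j $ pev) (kav $ ng (df pev)))" using ka pa by simp
 also have "... = ad (ad (j $ df ep) (j $ pev)) (kav $ ng (df pev))"
 by (rule ad_assoc[symmetric]) (use ja ea ka pa in "simp_all add: par_def")
 also have "ad (j $ df ep) (j $ pev) = j $ ad (df ep) pev"
 by (rule cmp_ad_right[symmetric]) (use ja ea pa in "simp_all add: par_def")
 finally have z: "zr C C 1 = ad (j $ ad (df ep) pev) (kav $ ng (df pev))" .
 have "ad (j $ zr C E 1) (kav $ zr C E 2) = zr C C 1" using ja ka C E by simp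
 then have "ad (j $ ad (df ep) pev) (kav $ ng (df pev)) = ad (j $ zr C E 1) (kav $ zr C E 2)"
 by (rule trans[OF z[symmetric], OF sym])
 then have "ad (df ep) pev = zr C E 1"
 by (rule gi[THEN conjunct1, rotated -1]) (use ea pa C E in "simp_all add: par_def")
 then have "ad pev (df ep) = ad (ng (df ep)) (df ep)"
 using ad_comm[of "df ep" pev] ad_ng[of "df ep"] ea pa by (simp add: par_def)
 then show ?thesis by (rule ad_cancel[rotated 5]) (use ea pa in "simp_all add: par_def")
 qed
 have "df (kav $ ep) = ad (j $ ep) (ng (kav $ df ep))" using leibniz[of ep kav] ka ea dk by (simp add: sg_def)
 then have 3: "df (kav $ ep) = idt (gr M) C" using idC' pe ka ea by simp
 \<comment> \<open>Every \<open>f\<close> into \<open>C\<close> has coordinates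
   \<open>ep $ f\<close> and \<open>pev $ f\<close>. Comparing them for \<open>kav\<close> and
   \<open>j\<close> with the obvious ones yields the remaining disk equations.\<close>
 have key: "ad (j $ ep $ f) (kav $ pev $ f) = f" if f: "f : GA" "cd f = C" for f
 proof -
 have "f = ad (j $ ep) (kav $ pev) $ f" unfolding idC' using f by simp
 also have "... = ad ((j $ ep) $ f) ((kav $ pev) $ f)"
 by (rule cmp_ad_left) (use ja ea ka pa f in "simp_all add: par_def")
 finally show ?thesis using ja ea ka pa f by simp
 qed
 have k1: "ad (j $ zr E E (-1)) (kav $ idt (gr M) E) = kav" using ja ka E by simp
 have 1: "ep $ kav = zr E E (-1)"
 by (rule gi[THEN conjunct1, of _ _ "pev $ kav" "idt (gr M) E"]) (use ea ka pa E k1 key[OF ka(1,3)] in simp_all)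
 have k2: "ad (j $ idt (gr M) E) (kav $ zr E E 1) = j" using ja ka E by simp
 have 2: "ep $ j = idt (gr M) E"
 by (rule gi[THEN conjunct1, of _ _ "pev $ j" "zr E E 1"]) (use ea ja pa E k2 key[OF ja(1,3)] in simp_all)
 have "disk E C 0 kav ep" unfolding disk_def using E C ka ea 1 2 3 dk by simp
 then show ?thesis using vv unfolding C_def[symmetric] phv_def[symmetric] dk[symmetric] by blast
qed

text \<open>Evaluation at \<open>(0, id)\<close> forces the composite of \<open>iCone_map\<close>
  with \<open>kav\<close> to be \<open>kav' $ io i\<close>. By the correspondence for disks there is
  exactly one closed arrow of degree zero with this property.\<close>

lemma iCone_map_eq:
 assumes i: "i : UA"
 and D: "disk (dm i) (iCone_obj k M (dm i)) 0 kav ep"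
 and v: "!!A p y x. A : DObj M ==> y : homs M A (dm i) p ==> x : homs M A (dm i) (p + 1) ==>
 snd (iCone_rep k M (dm i)) A p (y, x) = val (ad (df kav $ (A, dm i, p, y)) (kav $ (A, dm i, p + 1, x)))"
 and D': "disk (cd i) (iCone_obj k M (cd i)) 0 kav' ep'"
 and v': "!!A p y x. A : DObj M ==> y : homs M A (cd i) p ==> x : homs M A (cd i) (p + 1) ==>
 snd (iCone_rep k M (cd i)) A p (y, x) = val (ad (df kav' $ (A, cd i, p, y)) (kav' $ (A, cd i, p + 1, x)))"
 shows "io (iCone_obj k M (dm i), iCone_obj k M (cd i), iCone_map k M (dm i) (cd i) (mor i)) $ kav = kav' $ io i"
proof -
 define E F where "E = dm i" and "F = cd i"
 define X Y where "X = iCone_obj k M E" and "Y = iCone_obj k M F"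
 note defs = E_def[symmetric] F_def[symmetric] X_def[symmetric] Y_def[symmetric]
 note D = D[unfolded defs] and D' = D'[unfolded defs] and v = v[unfolded defs] and v' = v'[unfolded defs]
 note d = diskD[OF D] and d' = diskD[OF D']
 have E: "E : DObj M" "F : DObj M" "X : DObj M" "Y : DObj M" using d d' by blast+
 have ii: "io i : GA" "dm (io i) = E" "cd (io i) = F" "cl (io i)" using i by (simp_all add: E_def F_def)
 define P where "P j \<longleftrightarrow> j : Arr UM X Y &
 (ALL A:DObj M. ALL p. ALL y:homs M A E p. ALL x:homs M A E (p + 1).
 snd (iCone_rep k M F) A p (Yo_map M E F (mor i) A p y, Yo_map M E F (mor i) A (p + 1) x) =
 Yo_map M X Y j A p (snd (iCone_rep k M E) A p (y, x)))" for j
 have yo: "(A, F, p, Yo_map M E F (mor i) A p y) = io i $ (A, E, p, y)" for A p y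
 by (simp add: gr_cmp io_def Yo_map_def E_def F_def)
 have tagG: "(A, E, p, y) : GA" if "A : DObj M" "y : homs M A E p" for A p y
 unfolding gr_arrows using that E by simp
 have yc: "Yo_map M E F (mor i) A p y : homs M A F p" if "A : DObj M" "y : homs M A E p" for A p y
 proof -
 have "io i $ (A, E, p, y) : GA" using ii tagG[OF that] by simp
 then show ?thesis unfolding yo[symmetric] by (simp add: gr_arrows)
 qed
 have L: "snd (iCone_rep k M F) A p (Yo_map M E F (mor i) A p y, Yo_map M E F (mor i) A (p + 1) x) =
 val (ad (df kav' $ io i $ (A, E, p, y)) (kav' $ io i $ (A, E, p + 1, x)))"
 if A: "A : DObj M" and yx: "y : homs M A E p" "x : homs M A E (p + 1)" for A p y x
 unfolding v'[OF A yc[OF A yx(1)] yc[OF A yx(2)]] yo ..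
 have R: "Yo_map M X Y j A p (snd (iCone_rep k M E) A p (y, x)) =
 val (io (X, Y, j) $ ad (df kav $ (A, E, p, y)) (kav $ (A, E, p + 1, x)))"
 if A: "A : DObj M" and yx: "y : homs M A E p" "x : homs M A E (p + 1)" for A p y x j
 unfolding v[OF A yx] gr_cmp[of M "io (X, Y, j)"] using d by (simp add: Yo_map_def io_def)
 have Pj: "io (X, Y, j) $ kav = kav' $ io i & io (X, Y, j) : GA & cl (io (X, Y, j))" if "P j" for j
 proof -
 have ja: "(X, Y, j) : UA" using that E by (simp add: P_def arrows_iff del: arrows_Obj)
 then have jG: "io (X, Y, j) : GA" "cl (io (X, Y, j))" by simp_all
 have idE: "DId M E : homs M E E (-1 + 1)" using dg_id(1)[OF E(1)] by simp
 have zE: "val (zr E E (-1)) : homs M E E (-1)" using gr_arrD(3)[OF zr_GA[OF E(1,1), of "-1"]] by simp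
 have "val (ad (df kav' $ io i $ (E, E, -1, val (zr E E (-1)))) (kav' $ io i $ (E, E, -1 + 1, DId M E))) =
 val (io (X, Y, j) $ ad (df kav $ (E, E, -1, val (zr E E (-1)))) (kav $ (E, E, -1 + 1, DId M E)))"
 using that E(1) zE idE L[OF E(1) zE idE] R[OF E(1) zE idE, of j] unfolding P_def by metis
 moreover have "(E, E, -1, val (zr E E (-1))) = zr E E (-1)" by (simp add: zr_def)
 moreover have "(E, E, -1 + 1, DId M E) = idt (gr M) E" by (simp add: gr_idt)
 ultimately have "val (kav' $ io i) = val (io (X, Y, j) $ kav)" using d d' ii jG E by simp
 then have "kav' $ io i = io (X, Y, j) $ kav" by (intro gr_eqI) (use d d' ii in "simp_all add: par_def")
 then show ?thesis using jG by simp
 qed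
 define y0 where "y0 = kav' $ io i"
 have y0: "y0 : GA" "dm y0 = E" "cd y0 = Y" "deg y0 = -1 - 0" using d' ii by (simp_all add: y0_def)
 define j0 where "j0 = df (y0 $ ep)"
 have j0: "j0 : GA" "dm j0 = X" "cd j0 = Y" "deg j0 = 0" "cl j0" "j0 $ kav = y0"
 using disk_out[OF D y0(1,2,4)] d y0 by (simp_all add: j0_def)
 have j0d: "j0 $ df kav = df kav' $ io i"
 proof -
 have "df (j0 $ kav) = j0 $ df kav" using leibniz_left[of kav j0] j0 d by (simp add: sg_def)
 moreover have "df y0 = df kav' $ io i" unfolding y0_def using leibniz_right[of "io i" kav'] d' ii by simp
 ultimately show ?thesis using j0(6) by simp
 qed
 have "uo j0 : UA" by (rule uo_UA) (use j0 in simp_all)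
 then have jA: "val j0 : Arr UM X Y" using arrows_iff[of "uo j0"] j0 by (simp add: uo_def)
 have io0: "io (X, Y, val j0) = j0" using j0 by (simp add: io_def prod_eq_iff)
 have "P (val j0)"
 unfolding P_def
 proof (intro conjI ballI allI jA)
 fix A p y x assume A: "A : DObj M" and y: "y : homs M A E p" and x: "x : homs M A E (p + 1)"
 define y' x' where "y' = (A, E, p, y)" and "x' = (A, E, p + 1, x)"
 have g: "y' : GA" "dm y' = A" "cd y' = E" "deg y' = p" "x' : GA" "dm x' = A" "cd x' = E" "deg x' = p + 1"
 using tagG[OF A y] tagG[OF A x] by (simp_all add: x'_def y'_def)
 have "j0 $ ad (df kav $ y') (kav $ x') = ad (j0 $ df kav $ y') (j0 $ kav $ x')"
 by (rule cmp_ad_right) (use j0 d g in "simp_all add: par_def")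
 also have "j0 $ df kav $ y' = df kav' $ io i $ y'" using cmp_assoc'[OF j0d, of y'] j0 d d' ii g by simp
 also have "j0 $ kav $ x' = kav' $ io i $ x'" using cmp_assoc'[OF j0(6), of x'] j0 d d' ii g by (simp add: y0_def)
 finally show "snd (iCone_rep k M F) A p (Yo_map M E F (mor i) A p y, Yo_map M E F (mor i) A (p + 1) x) =
 Yo_map M X Y (val j0) A p (snd (iCone_rep k M E) A p (y, x))"
 unfolding L[OF A y x] R[OF A y x] io0 x'_def[symmetric] y'_def[symmetric] by simp
 qed
 moreover have "j = val j0" if "P j" for j
 proof -
 note p = Pj[OF that]
 have "io (X, Y, j) = df ((io (X, Y, j) $ kav) $ ep)" by (rule disk_out_unique[OF D]) (use p in simp_all)
 also have "... = j0" using p unfolding j0_def y0_def by simp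
 finally show ?thesis by (auto simp: io_def)
 qed
 ultimately have "P (THE j. P j)" by (intro theI[of P "val j0"]) blast+
 moreover have "iCone_map k M E F (mor i) = (THE j. P j)"
 unfolding iCone_map_def P_def X_def Y_def E_def F_def ..
 ultimately show ?thesis using Pj unfolding defs by simp
qed

lemma disk_exists:
 assumes E: "E : DObj M" shows "EX C kav ep. disk E C n kav ep"
proof -
 from shift_data[OF E, of n] obtain si tu where s: "si : GA" "dm si = E" "cd si = shift_obj k M n E" "deg si = - n" "cl si"
 "tu : GA" "dm tu = shift_obj k M n E" "cd tu = E" "deg tu = n"
 "si $ tu = idt (gr M) (shift_obj k M n E)" "tu $ si = idt (gr M) E" by (elim exE conjE) (rule that)
 from cone_data[OF shift_rep(1)[OF E, of n]] obtain kav ep where "disk (shift_obj k M n E) (iCone_obj k M (shift_obj k M n E)) 0 kav ep"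
 by (elim exE conjE) (rule that)
 from disk_shift[OF this E s] show ?thesis by (intro exI)
qed

text \<open>Stability with the choices hidden: some member \<open>c\<close> of \<open>S\<close> is
  conjugate to \<open>i\<close> by closed isomorphisms of degree \<open>- n\<close>.\<close>

lemma stable_shift:
 assumes S: "S \<subseteq> UA" "stable_under_shifts k M S" and i: "i : S"
 shows "EX si tu si' tu' c. c : S &
 si : GA & dm si = dm i & cd si = dm c & deg si = - n & cl si & tu : GA & dm tu = dm c & cd tu = dm i & deg tu = n & cl tu &
 si $ tu = idt (gr M) (dm c) & tu $ si = idt (gr M) (dm i) &
 si' : GA & dm si' = cd i & cd si' = cd c & deg si' = - n & cl si' & tu' : GA & dm tu' = cd c & cd tu' = cd i & deg tu' = n & cl tu' &
 si' $ tu' = idt (gr M) (cd c) & tu' $ si' = idt (gr M) (cd i) & io c $ si = si' $ io i"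
proof -
 have ia: "i : UA" using S i by blast
 have E: "dm i : DObj M" "cd i : DObj M" using arrows_Obj[OF ia] by simp_all
 define c where "c = (shift_obj k M n (dm i), shift_obj k M n (cd i), shift_map k M n (dm i) (cd i) (mor i))"
 have "(dm i, cd i, mor i) : S" using i by simp
 then have cS: "c : S" using S(2) unfolding stable_under_shifts_def c_def by blast
 from shift_data[OF E(1), of n] obtain si tu where s: "si : GA" "dm si = dm i" "cd si = shift_obj k M n (dm i)" "deg si = - n" "cl si"
 and t: "tu : GA" "dm tu = shift_obj k M n (dm i)" "cd tu = dm i" "deg tu = n" "cl tu"
 and st: "si $ tu = idt (gr M) (shift_obj k M n (dm i))" "tu $ si = idt (gr M) (dm i)"
 and v: "ALL A:DObj M. ALL p. ALL x:homs M A (dm i) (n + p). snd (shift_rep k M n (dm i)) A p x = val (si $ (A, dm i, n + p, x))"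
 by (elim exE conjE) (rule that)
 from shift_data[OF E(2), of n] obtain si' tu' where s': "si' : GA" "dm si' = cd i" "cd si' = shift_obj k M n (cd i)" "deg si' = - n" "cl si'"
 and t': "tu' : GA" "dm tu' = shift_obj k M n (cd i)" "cd tu' = cd i" "deg tu' = n" "cl tu'"
 and st': "si' $ tu' = idt (gr M) (shift_obj k M n (cd i))" "tu' $ si' = idt (gr M) (cd i)"
 and v': "ALL A:DObj M. ALL p. ALL x:homs M A (cd i) (n + p). snd (shift_rep k M n (cd i)) A p x = val (si' $ (A, cd i, n + p, x))"
 by (elim exE conjE) (rule that)
 have "io c $ si = si' $ io i"
 unfolding c_def by (rule shift_map_eq[OF ia s t st v[THEN bspec, THEN spec, THEN bspec] s' v'[THEN bspec, THEN spec, THEN bspec]])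
 then show ?thesis
 using cS s t st s' t' st'
 by (intro exI[of _ si] exI[of _ tu] exI[of _ si'] exI[of _ tu'] exI[of _ c]) (simp add: c_def)
qed

text \<open>Shifting first and then taking \<open>iCone\<close> gives a member \<open>c\<close> of
  \<open>S\<close> between disks on the source and the target of \<open>i\<close>, natural with
  respect to \<open>kav\<close>.\<close>

lemma stable_disk:
 assumes S: "S \<subseteq> UA" "stable_under_shifts k M S" "stable_under_iCone k M S" and i: "i : S"
 shows "EX kav ep kav' ep' c. c : S & disk (dm i) (dm c) n kav ep & disk (cd i) (cd c) n kav' ep' & io c $ kav = kav' $ io i"
proof -
 have ia: "i : UA" using S i by blast
 have E: "dm i : DObj M" "cd i : DObj M" using arrows_Obj[OF ia] by simp_all
 from stable_shift[OF S(1,2) i, of n] obtain si tu si' tu' b where b: "b : S"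
 and s: "si : GA" "dm si = dm i" "cd si = dm b" "deg si = - n" "cl si" "tu : GA" "dm tu = dm b" "cd tu = dm i" "deg tu = n"
 "cl tu" "si $ tu = idt (gr M) (dm b)" "tu $ si = idt (gr M) (dm i)"
 and s': "si' : GA" "dm si' = cd i" "cd si' = cd b" "deg si' = - n" "cl si'" "tu' : GA" "dm tu' = cd b" "cd tu' = cd i" "deg tu' = n"
 "cl tu'" "si' $ tu' = idt (gr M) (cd b)" "tu' $ si' = idt (gr M) (cd i)"
 and eq: "io b $ si = si' $ io i"
 by (elim exE conjE) (rule that)
 have ba: "b : UA" using S b by blast
 have X: "dm b : DObj M" "cd b : DObj M" using arrows_Obj[OF ba] by simp_all
 define c where "c = (iCone_obj k M (dm b), iCone_obj k M (cd b), iCone_map k M (dm b) (cd b) (mor b))"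
 have "(dm b, cd b, mor b) : S" using b by simp
 then have cS: "c : S" using S(3) unfolding stable_under_iCone_def c_def by blast
 then have ca: "io c : GA" using S by auto
 from cone_data[OF X(1)] obtain kav ep where D: "disk (dm b) (iCone_obj k M (dm b)) 0 kav ep"
 and v: "ALL A:DObj M. ALL p. ALL y:homs M A (dm b) p. ALL x:homs M A (dm b) (p + 1).
 snd (iCone_rep k M (dm b)) A p (y, x) = val (ad (df kav $ (A, dm b, p, y)) (kav $ (A, dm b, p + 1, x)))"
 by (elim exE conjE) (rule that)
 from cone_data[OF X(2)] obtain kav' ep' where D': "disk (cd b) (iCone_obj k M (cd b)) 0 kav' ep'"
 and v': "ALL A:DObj M. ALL p. ALL y:homs M A (cd b) p. ALL x:homs M A (cd b) (p + 1).
 snd (iCone_rep k M (cd b)) A p (y, x) = val (ad (df kav' $ (A, cd b, p, y)) (kav' $ (A, cd b, p + 1, x)))"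
 by (elim exE conjE) (rule that)
 have k: "io c $ kav = kav' $ io b"
 unfolding c_def by (rule iCone_map_eq[OF ba D v[THEN bspec, THEN spec, THEN bspec, THEN bspec]
 D' v'[THEN bspec, THEN spec, THEN bspec, THEN bspec]])
 note d = diskD[OF D] and d' = diskD[OF D']
 have "io c $ kav $ si = (kav' $ io b) $ si"
 by (rule cmp_assoc'[OF k]) (use d s ca in "simp_all add: c_def")
 also have "... = (kav' $ si') $ io i" using d' s s' ba ia eq by simp
 finally have "io c $ kav $ si = (kav' $ si') $ io i" .
 moreover have "disk (dm i) (dm c) n (kav $ si) (tu $ ep)" unfolding c_def fst_conv
 by (rule disk_shift[OF D E(1)]) (use s in simp_all)
 moreover have "disk (cd i) (cd c) n (kav' $ si') (tu' $ ep')" unfolding c_def fst_conv snd_conv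
 by (rule disk_shift[OF D' E(2)]) (use s' in simp_all)
 ultimately show ?thesis
 using cS by (intro exI[of _ "kav $ si"] exI[of _ "tu $ ep"] exI[of _ "kav' $ si'"] exI[of _ "tu' $ ep'"] exI[of _ c]) simp
qed

section \<open>Lifting squares of arbitrary degree\<close>

lemma closed_lift:
 assumes c: "c : U.llp T" and p: "p : T" "T \<subseteq> UA"
 and w: "w : GA" "deg w = 0" "cl w" "dm w = dm c" "cd w = dm p"
 and w': "w' : GA" "deg w' = 0" "cl w'" "dm w' = cd c" "cd w' = cd p" and eq: "io p $ w = w' $ io c"
 shows "EX h. h : GA & deg h = 0 & cl h & dm h = cd c & cd h = dm p & h $ io c = w & io p $ h = w'"
proof -
 have u: "uo w : UA" "uo w' : UA" by (rule uo_UA[OF w(1-3)], rule uo_UA[OF w'(1-3)])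
 have e: "dm (uo w) = dm c" "cd (uo w) = dm p" "dm (uo w') = cd c" "cd (uo w') = cd p" using w w' by simp_all
 have "io (cmp UM p (uo w)) = io (cmp UM (uo w') c)"
 unfolding io_cmp using eq w w' by (simp add: io_uo)
 then have "cmp UM p (uo w) = cmp UM (uo w') c" by (rule io_inj)
 from U.llp_lift[OF c p u e this] obtain h where h: "h : UA" "dm h = cd c" "cd h = dm p"
 "cmp UM h c = uo w" "cmp UM p h = uo w'" by (elim exE conjE) (rule that)
 have "io h $ io c = w" "io p $ io h = w'"
 unfolding io_cmp[symmetric] h(4,5) using w w' by (simp_all add: io_uo)
 then show ?thesis using h(1-3) by (intro exI[of _ "io h"]) simp
qed

context
 fixes S T i p
 assumes S: "S \<subseteq> UA" "stable_under_shifts k M S" "stable_under_iCone k M S" "S \<subseteq> U.llp T" and i: "i : S"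
 and p: "p : T" "T \<subseteq> UA"
begin

text \<open>A closed square of degree d out of \<open>i\<close> is a closed square of degree zero
  out of a shift of \<open>i\<close>, which again belongs to \<open>S\<close>; its lift is composed
  back with the shifting isomorphism.\<close>

lemma enriched_lift_closed:
 assumes u: "u : GA" "dm u = dm i" "cd u = dm p" "cl u" and v: "v : GA" "dm v = cd i" "cd v = cd p" "cl v"
 and dg: "deg v = deg u" and eq: "io p $ u = v $ io i"
 shows "EX h. h : GA & deg h = deg u & cl h & dm h = cd i & cd h = dm p & h $ io i = u & io p $ h = v"
proof -
 have ia: "io i : GA" and pa: "io p : GA" using S(1) i p by auto
 \<comment> \<open>With shift \<open>- deg u\<close> the isomorphisms \<open>tu\<close>,
   \<open>tu'\<close> have degree \<open>- deg u\<close>, so the composites \<open>u $ tu\<close>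
   and \<open>v $ tu'\<close> have degree zero.\<close>
 from stable_shift[OF S(1,2) i, of "- deg u"] obtain si tu si' tu' b where b: "b : S"
 and s: "si : GA" "dm si = dm i" "cd si = dm b" "deg si = - (- deg u)" "cl si" "tu : GA" "dm tu = dm b" "cd tu = dm i" "deg tu = - deg u"
 "cl tu" "si $ tu = idt (gr M) (dm b)" "tu $ si = idt (gr M) (dm i)"
 and s': "si' : GA" "dm si' = cd i" "cd si' = cd b" "deg si' = - (- deg u)" "cl si'" "tu' : GA" "dm tu' = cd b" "cd tu' = cd i" "deg tu' = - deg u"
 "cl tu'" "si' $ tu' = idt (gr M) (cd b)" "tu' $ si' = idt (gr M) (cd i)"
 and bs: "io b $ si = si' $ io i"
 by (elim exE conjE) (rule that)
 have ba: "io b : GA" using S(1) b by auto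
 have tb: "tu' $ io b = io i $ tu"
 proof -
 have "tu' $ io b = tu' $ io b $ si $ tu" using s s' ba by simp
 also have "... = tu' $ (si' $ io i) $ tu" using cmp_assoc'[OF bs, of tu] s s' ba by simp
 also have "... = io i $ tu" using cmp_assoc'[OF s'(12), of "io i $ tu"] s s' ia by simp
 finally show ?thesis .
 qed
 have "io p $ u $ tu = (v $ io i) $ tu" by (rule cmp_assoc'[OF eq]) (use u s pa in simp_all)
 also have "... = (v $ tu') $ io b" using v s s' ia ba tb by simp
 finally have sq: "io p $ u $ tu = (v $ tu') $ io b" .
 have w: "u $ tu : GA" "deg (u $ tu) = 0" "cl (u $ tu)" "dm (u $ tu) = dm b" "cd (u $ tu) = dm p"
 using u s by (simp_all add: cl_cmp)
 have w': "v $ tu' : GA" "deg (v $ tu') = 0" "cl (v $ tu')" "dm (v $ tu') = cd b" "cd (v $ tu') = cd p"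
 using v s' dg by (simp_all add: cl_cmp)
 obtain h where h: "h : GA" "deg h = 0" "cl h" "dm h = cd b" "cd h = dm p" "h $ io b = u $ tu" "io p $ h = v $ tu'"
 using closed_lift[OF subsetD[OF S(4) b] p w w' sq] by (elim exE conjE) (rule that)
 have "(h $ si') $ io i = h $ io b $ si" using bs h s s' ia by simp
 also have "... = (u $ tu) $ si" by (rule cmp_assoc'[OF h(6)]) (use h s ba in simp_all)
 finally have 1: "(h $ si') $ io i = u" using u s by simp
 have "io p $ h $ si' = (v $ tu') $ si'" by (rule cmp_assoc'[OF h(7)]) (use h s' pa in simp_all)
 then have 2: "io p $ h $ si' = v" using v s' by simp
 show ?thesis using 1 2 h s' by (intro exI[of _ "h $ si'"]) (simp add: cl_cmp)
qed

text \<open>A square of any degree, closed or not, corresponds to a closed square of degree zero out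
  of the disk of \<open>i\<close>, and that disk belongs to \<open>S\<close> by stability under
  shifts and \<open>iCone\<close>.\<close>

lemma enriched_lift:
 assumes u: "u : GA" "dm u = dm i" "cd u = dm p" and v: "v : GA" "dm v = cd i" "cd v = cd p"
 and dg: "deg v = deg u" and eq: "io p $ u = v $ io i"
 shows "EX h. h : GA & deg h = deg u & dm h = cd i & cd h = dm p & h $ io i = u & io p $ h = v"
proof -
 have ia: "io i : GA" "cl (io i)" and pa: "io p : GA" "cl (io p)" using S(1) i p by auto
 \<comment> \<open>For this index \<open>kav\<close> and \<open>kav'\<close> have degree
   \<open>deg u\<close>, hence closed arrows of degree zero out of the disks are exactly the arrows
   of degree \<open>deg u\<close> out of \<open>dm i\<close> and \<open>cd i\<close>.\<close>
 from stable_disk[OF S(1-3) i, of "- deg u - 1"] obtain kav ep kav' ep' c where c: "c : S"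
 and D: "disk (dm i) (dm c) (- deg u - 1) kav ep" and D': "disk (cd i) (cd c) (- deg u - 1) kav' ep'"
 and k: "io c $ kav = kav' $ io i" by (elim exE conjE) (rule that)
 have ca: "io c : GA" "cl (io c)" using S(1) c by auto
 note d = diskD[OF D] and d' = diskD[OF D']
 define w w' where "w = df (u $ ep)" and "w' = df (v $ ep')"
 have w: "w : GA" "deg w = 0" "cl w" "dm w = dm c" "cd w = dm p" "w $ kav = u"
 using disk_out[OF D u(1,2)] d u by (simp_all add: w_def)
 have w': "w' : GA" "deg w' = 0" "cl w'" "dm w' = cd c" "cd w' = cd p" "w' $ kav' = v"
 using disk_out[OF D' v(1,2)] d' v dg by (simp_all add: w'_def)
 have e1: "(io p $ w) $ kav = v $ io i" using w d pa eq by simp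
 have "(w' $ io c) $ kav = w' $ kav' $ io i" using w' d ca k by simp
 also have "... = v $ io i" by (rule cmp_assoc'[OF w'(6)]) (use w' d' ia in simp_all)
 finally have e2: "(w' $ io c) $ kav = v $ io i" .
 have "io p $ w = df (((io p $ w) $ kav) $ ep)" by (rule disk_out_unique[OF D]) (use w pa in "simp_all add: cl_cmp")
 also have "... = df (((w' $ io c) $ kav) $ ep)" unfolding e1 e2 ..
 also have "... = w' $ io c" by (rule disk_out_unique[OF D, symmetric]) (use w' ca in "simp_all add: cl_cmp")
 finally have sq: "io p $ w = w' $ io c" .
 obtain h where h: "h : GA" "deg h = 0" "cl h" "dm h = cd c" "cd h = dm p" "h $ io c = w" "io p $ h = w'"
 using closed_lift[OF subsetD[OF S(4) c] p w(1-5) w'(1-5) sq] by (elim exE conjE) (rule that)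
 have "(h $ kav') $ io i = h $ io c $ kav" using k h d' ia by simp
 also have "... = w $ kav" by (rule cmp_assoc'[OF h(6)]) (use h d ca in simp_all)
 finally have 1: "(h $ kav') $ io i = u" using w by simp
 have "io p $ h $ kav' = w' $ kav'" by (rule cmp_assoc'[OF h(7)]) (use h d' pa in simp_all)
 then have 2: "io p $ h $ kav' = v" using w' by simp
 show ?thesis using 1 2 h d' by (intro exI[of _ "h $ kav'"]) simp
qed

end

end

section \<open>Linear relations\<close>

definition lin_rel :: "'k ring => ('k, 'a) module => ('k, 'b) module => ('a => 'b => bool) => bool" where
 "lin_rel k U V L \<longleftrightarrow> L \<zero>\<^bsub>U\<^esub> \<zero>\<^bsub>V\<^esub> & (ALL x y. L x y --> x : carrier U & y : carrier V) &
 (ALL x y x' y'. L x y --> L x' y' --> L (x \<oplus>\<^bsub>U\<^esub> x') (y \<oplus>\<^bsub>V\<^esub> y')) &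
 (ALL a:carrier k. ALL x y. L x y --> L (a \<odot>\<^bsub>U\<^esub> x) (a \<odot>\<^bsub>V\<^esub> y))"

lemma lin_relD:
 assumes "lin_rel k U V L"
 shows "L \<zero>\<^bsub>U\<^esub> \<zero>\<^bsub>V\<^esub>" "L x y ==> x : carrier U" "L x y ==> y : carrier V"
 "L x y ==> L x' y' ==> L (x \<oplus>\<^bsub>U\<^esub> x') (y \<oplus>\<^bsub>V\<^esub> y')" "a : carrier k ==> L x y ==> L (a \<odot>\<^bsub>U\<^esub> x) (a \<odot>\<^bsub>V\<^esub> y)"
 using assms unfolding lin_rel_def by blast+

lemma lin_relI:
 assumes "L \<zero>\<^bsub>U\<^esub> \<zero>\<^bsub>V\<^esub>" "!!x y. L x y ==> x : carrier U" "!!x y. L x y ==> y : carrier V"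
 "!!x y x' y'. L x y ==> L x' y' ==> L (x \<oplus>\<^bsub>U\<^esub> x') (y \<oplus>\<^bsub>V\<^esub> y')"
 "!!a x y. a : carrier k ==> L x y ==> L (a \<odot>\<^bsub>U\<^esub> x) (a \<odot>\<^bsub>V\<^esub> y)"
 shows "lin_rel k U V L"
 using assms unfolding lin_rel_def by blast

text \<open>A single-valued linear relation that is maximal inside a total one is itself total.\<close>

lemma linear_selection:
 assumes k: "field k" and U: "module k U" and V: "module k V"
 and L: "lin_rel k U V L" and G: "lin_rel k U V G" and GL: "!!x y. G x y ==> L x y" and G1: "!!y. G \<zero>\<^bsub>U\<^esub> y ==> y = \<zero>\<^bsub>V\<^esub>"
 and tot: "!!x. x : carrier U ==> EX y. L x y"
 shows "EX t. linear_on k U V t & (ALL x:carrier U. L x (t x)) & (ALL x y. G x y --> t x = y)"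
proof -
 interpret k: field k by (rule k)
 interpret U: module k U by (rule U)
 interpret V: module k V by (rule V)
 \<comment> \<open>\<open>g\<close> is the graph of a linear map on a subspace, lying between
   \<open>G\<close> and \<open>L\<close>. Single-valuedness is required at zero, which suffices for
   a linear relation.\<close>
 define P where "P g \<longleftrightarrow> lin_rel k U V (%x y. (x, y) : g) & (ALL x y. (x, y) : g --> L x y) & (ALL y. (\<zero>\<^bsub>U\<^esub>, y) : g --> y = \<zero>\<^bsub>V\<^esub>)
 & (ALL x y. G x y --> (x, y) : g)" for g
 have PD: "lin_rel k U V (%x y. (x, y) : g)" "!!x y. (x, y) : g ==> L x y" "!!y. (\<zero>\<^bsub>U\<^esub>, y) : g ==> y = \<zero>\<^bsub>V\<^esub>"
 "!!x y. G x y ==> (x, y) : g" if "P g" for g using that unfolding P_def by blast+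
 have "EX m:{g. P g}. ALL g:{g. P g}. m \<subseteq> g --> g = m"
 proof (rule subset_Zorn_nonempty)
 have "P {(x, y). G x y}" unfolding P_def using G GL G1 by simp
 then show "{g. P g} ~= {}" by blast
 fix c assume c0: "c ~= {}" and c: "subset.chain {g. P g} c"
 have cP: "P g" if "g : c" for g using c that unfolding subset.chain_def by blast
 have cc: "g \<subseteq> g' \<or> g' \<subseteq> g" if "g : c" "g' : c" for g g' using c that unfolding subset.chain_def by blast
 obtain g0 where g0: "g0 : c" using c0 by blast
 have "lin_rel k U V (%x y. (x, y) : \<Union>c)"
 proof (rule lin_relI)
 show "(\<zero>\<^bsub>U\<^esub>, \<zero>\<^bsub>V\<^esub>) : \<Union>c" using lin_relD(1)[OF PD(1)[OF cP[OF g0]]] g0 by blast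
 show "x : carrier U" "y : carrier V" if "(x, y) : \<Union>c" for x y
 using that lin_relD(2,3)[OF PD(1)[OF cP]] by blast+
 fix x y assume xy: "(x, y) : \<Union>c"
 show "(a \<odot>\<^bsub>U\<^esub> x, a \<odot>\<^bsub>V\<^esub> y) : \<Union>c" if "a : carrier k" for a
 using xy that lin_relD(5)[OF PD(1)[OF cP]] by blast
 fix x' y' assume xy': "(x', y') : \<Union>c"
 obtain g where g: "g : c" "(x, y) : g" "(x', y') : g" using xy xy' cc by blast
 show "(x \<oplus>\<^bsub>U\<^esub> x', y \<oplus>\<^bsub>V\<^esub> y') : \<Union>c" using lin_relD(4)[OF PD(1)[OF cP[OF g(1)]] g(2,3)] g(1) by blast
 qed
 moreover have "ALL x y. (x, y) : \<Union>c --> L x y" using PD(2)[OF cP] by blast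
 moreover have "ALL y. (\<zero>\<^bsub>U\<^esub>, y) : \<Union>c --> y = \<zero>\<^bsub>V\<^esub>" using PD(3)[OF cP] by blast
 moreover have "ALL x y. G x y --> (x, y) : \<Union>c" using PD(4)[OF cP[OF g0]] g0 by blast
 ultimately show "\<Union>c : {g. P g}" unfolding P_def by blast
 qed
 then obtain m where m: "P m" and mx: "!!g. P g ==> m \<subseteq> g ==> g = m" by blast
 note mr = lin_relD[OF PD(1)[OF m]]
 have mtot: "EX y. (x, y) : m" if x: "x : carrier U" for x
 proof (rule ccontr)
 assume nx: "\<nexists>y. (x, y) : m"
 obtain y where y: "L x y" using tot[OF x] by blast
 have yc: "y : carrier V" by (rule lin_relD(3)[OF L y])
 define g where "g = {(u \<oplus>\<^bsub>U\<^esub> c \<odot>\<^bsub>U\<^esub> x, v \<oplus>\<^bsub>V\<^esub> c \<odot>\<^bsub>V\<^esub> y) |u v c. (u, v) : m & c : carrier k}"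
 have gI: "(u \<oplus>\<^bsub>U\<^esub> c \<odot>\<^bsub>U\<^esub> x, v \<oplus>\<^bsub>V\<^esub> c \<odot>\<^bsub>V\<^esub> y) : g" if "(u, v) : m" "c : carrier k" for u v c
 unfolding g_def using that by blast
 have gE: "EX u v c. a = u \<oplus>\<^bsub>U\<^esub> c \<odot>\<^bsub>U\<^esub> x & b = v \<oplus>\<^bsub>V\<^esub> c \<odot>\<^bsub>V\<^esub> y & (u, v) : m & c : carrier k" if "(a, b) : g" for a b
 using that unfolding g_def by blast
 have mg: "m \<subseteq> g"
 proof (rule subrelI)
 fix u v assume uv: "(u, v) : m"
 have "u \<oplus>\<^bsub>U\<^esub> \<zero>\<^bsub>k\<^esub> \<odot>\<^bsub>U\<^esub> x = u" "v \<oplus>\<^bsub>V\<^esub> \<zero>\<^bsub>k\<^esub> \<odot>\<^bsub>V\<^esub> y = v"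
 using mr(2,3)[OF uv] x yc by (simp_all add: U.smult_l_null V.smult_l_null)
 then show "(u, v) : g" using gI[OF uv k.zero_closed] by simp
 qed
 have "lin_rel k U V (%x y. (x, y) : g)"
 proof (rule lin_relI)
 show "(\<zero>\<^bsub>U\<^esub>, \<zero>\<^bsub>V\<^esub>) : g" using mg mr(1) by blast
 fix a b assume ab: "(a, b) : g"
 from gE[OF ab] obtain u v c where 1: "a = u \<oplus>\<^bsub>U\<^esub> c \<odot>\<^bsub>U\<^esub> x" "b = v \<oplus>\<^bsub>V\<^esub> c \<odot>\<^bsub>V\<^esub> y" "(u, v) : m" "c : carrier k" by blast
 note uc = mr(2,3)[OF 1(3)]
 show "a : carrier U" "b : carrier V" using 1 uc x yc by simp_all
 show "(d \<odot>\<^bsub>U\<^esub> a, d \<odot>\<^bsub>V\<^esub> b) : g" if d: "d : carrier k" for d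
 proof -
 have "d \<odot>\<^bsub>U\<^esub> a = d \<odot>\<^bsub>U\<^esub> u \<oplus>\<^bsub>U\<^esub> (d \<otimes>\<^bsub>k\<^esub> c) \<odot>\<^bsub>U\<^esub> x" "d \<odot>\<^bsub>V\<^esub> b = d \<odot>\<^bsub>V\<^esub> v \<oplus>\<^bsub>V\<^esub> (d \<otimes>\<^bsub>k\<^esub> c) \<odot>\<^bsub>V\<^esub> y"
 using d 1 uc x yc by (simp_all add: U.smult_r_distr V.smult_r_distr U.smult_assoc1 V.smult_assoc1)
 then show ?thesis using gI[OF mr(5)[OF d 1(3)] k.m_closed[OF d 1(4)]] by simp
 qed
 fix a' b' assume ab': "(a', b') : g"
 from gE[OF ab'] obtain u' v' c' where 2: "a' = u' \<oplus>\<^bsub>U\<^esub> c' \<odot>\<^bsub>U\<^esub> x" "b' = v' \<oplus>\<^bsub>V\<^esub> c' \<odot>\<^bsub>V\<^esub> y" "(u', v') : m" "c' : carrier k" by blast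
 note uc' = mr(2,3)[OF 2(3)]
 have "a \<oplus>\<^bsub>U\<^esub> a' = (u \<oplus>\<^bsub>U\<^esub> u') \<oplus>\<^bsub>U\<^esub> (c \<oplus>\<^bsub>k\<^esub> c') \<odot>\<^bsub>U\<^esub> x"
 using 1 2 uc uc' x by (simp add: U.smult_l_distr U.a_ac)
 moreover have "b \<oplus>\<^bsub>V\<^esub> b' = (v \<oplus>\<^bsub>V\<^esub> v') \<oplus>\<^bsub>V\<^esub> (c \<oplus>\<^bsub>k\<^esub> c') \<odot>\<^bsub>V\<^esub> y"
 using 1 2 uc uc' yc by (simp add: V.smult_l_distr V.a_ac)
 ultimately show "(a \<oplus>\<^bsub>U\<^esub> a', b \<oplus>\<^bsub>V\<^esub> b') : g"
 using gI[OF mr(4)[OF 1(3) 2(3)] k.a_closed[OF 1(4) 2(4)]] by simp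
 qed
 moreover have "ALL a b. (a, b) : g --> L a b"
 proof (intro allI impI)
 fix a b assume "(a, b) : g"
 from gE[OF this] obtain u v c where 1: "a = u \<oplus>\<^bsub>U\<^esub> c \<odot>\<^bsub>U\<^esub> x" "b = v \<oplus>\<^bsub>V\<^esub> c \<odot>\<^bsub>V\<^esub> y" "(u, v) : m" "c : carrier k" by blast
 show "L a b" unfolding 1(1,2) by (rule lin_relD(4)[OF L PD(2)[OF m 1(3)] lin_relD(5)[OF L 1(4) y]])
 qed
 moreover have "ALL b. (\<zero>\<^bsub>U\<^esub>, b) : g --> b = \<zero>\<^bsub>V\<^esub>"
 proof (intro allI impI)
 fix b assume "(\<zero>\<^bsub>U\<^esub>, b) : g"
 from gE[OF this] obtain u v c where 1: "\<zero>\<^bsub>U\<^esub> = u \<oplus>\<^bsub>U\<^esub> c \<odot>\<^bsub>U\<^esub> x" "b = v \<oplus>\<^bsub>V\<^esub> c \<odot>\<^bsub>V\<^esub> y" "(u, v) : m" "c : carrier k" by blast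
 note uc = mr(2,3)[OF 1(3)]
 \<comment> \<open>Were \<open>c\<close> nonzero, dividing by it would put \<open>x\<close> into the
   domain of \<open>m\<close>. This is the point at which a field of scalars is used.\<close>
 have "c = \<zero>\<^bsub>k\<^esub>"
 proof (rule ccontr)
 assume "c ~= \<zero>\<^bsub>k\<^esub>"
 then have ci: "c : Units k" using 1(4) k.field_Units by blast
 define d where "d = \<ominus>\<^bsub>k\<^esub> (inv\<^bsub>k\<^esub> c)"
 have d: "d : carrier k" using ci by (simp add: d_def)
 have ux: "u = \<ominus>\<^bsub>U\<^esub> (c \<odot>\<^bsub>U\<^esub> x)" using U.minus_equality[OF 1(1)[symmetric]] uc x 1(4) by simp
 have cc: "inv\<^bsub>k\<^esub> c : carrier k" "inv\<^bsub>k\<^esub> c \<otimes>\<^bsub>k\<^esub> c = \<one>\<^bsub>k\<^esub>" using ci by simp_all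
 have dc: "d \<otimes>\<^bsub>k\<^esub> c = \<ominus>\<^bsub>k\<^esub> \<one>\<^bsub>k\<^esub>" using k.l_minus[OF cc(1) 1(4)] cc(2) by (simp add: d_def)
 have "d \<odot>\<^bsub>U\<^esub> u = \<ominus>\<^bsub>U\<^esub> ((d \<otimes>\<^bsub>k\<^esub> c) \<odot>\<^bsub>U\<^esub> x)"
 using d x 1(4) unfolding ux by (simp add: U.smult_r_minus U.smult_assoc1)
 then have "d \<odot>\<^bsub>U\<^esub> u = x" unfolding dc using x by (simp add: U.smult_l_minus)
 then show False using mr(5)[OF d 1(3)] nx by auto
 qed
 then have "u = \<zero>\<^bsub>U\<^esub>" "b = v" using 1 uc x yc by (simp_all add: U.smult_l_null V.smult_l_null)
 then show "b = \<zero>\<^bsub>V\<^esub>" using PD(3)[OF m] 1(3) by simp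
 qed
 moreover have "ALL x y. G x y --> (x, y) : g" using PD(4)[OF m] mg by blast
 ultimately have "P g" unfolding P_def by (intro conjI)
 then have "g = m" by (rule mx[OF _ mg])
 moreover have "(\<zero>\<^bsub>U\<^esub> \<oplus>\<^bsub>U\<^esub> \<one>\<^bsub>k\<^esub> \<odot>\<^bsub>U\<^esub> x, \<zero>\<^bsub>V\<^esub> \<oplus>\<^bsub>V\<^esub> \<one>\<^bsub>k\<^esub> \<odot>\<^bsub>V\<^esub> y) : g" by (rule gI[OF mr(1) k.one_closed])
 ultimately show False using nx x by simp
 qed
 have m1: "y = y'" if a: "(x, y) : m" "(x, y') : m" for x y y'
 proof -
 have "(x \<oplus>\<^bsub>U\<^esub> (\<ominus>\<^bsub>k\<^esub> \<one>\<^bsub>k\<^esub>) \<odot>\<^bsub>U\<^esub> x, y \<oplus>\<^bsub>V\<^esub> (\<ominus>\<^bsub>k\<^esub> \<one>\<^bsub>k\<^esub>) \<odot>\<^bsub>V\<^esub> y') : m"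
 by (rule mr(4)[OF a(1) mr(5)[OF _ a(2)]]) simp
 then have "(\<zero>\<^bsub>U\<^esub>, y \<oplus>\<^bsub>V\<^esub> \<ominus>\<^bsub>V\<^esub> y') : m"
 using mr(2)[OF a(1)] mr(3)[OF a(2)] by (simp add: U.smult_l_minus V.smult_l_minus U.r_neg)
 then have "y \<oplus>\<^bsub>V\<^esub> \<ominus>\<^bsub>V\<^esub> y' = \<zero>\<^bsub>V\<^esub>" by (rule PD(3)[OF m])
 then show ?thesis using mr(3)[OF a(1)] mr(3)[OF a(2)] V.minus_equality V.minus_minus by (metis V.a_inv_closed)
 qed
 define t where "t x = (SOME y. (x, y) : m)" for x
 have t: "(x, t x) : m" if "x : carrier U" for x unfolding t_def by (rule someI_ex[OF mtot[OF that]])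
 have tl: "linear_on k U V t"
 unfolding linear_on_def
 proof (intro conjI ballI funcsetI)
 show "t x : carrier V" if "x : carrier U" for x by (rule mr(3)[OF t[OF that]])
 show "t (x \<oplus>\<^bsub>U\<^esub> y) = t x \<oplus>\<^bsub>V\<^esub> t y" if "x : carrier U" "y : carrier U" for x y
 by (rule m1[OF t mr(4)[OF t t]]) (use that in simp_all)
 show "t (a \<odot>\<^bsub>U\<^esub> x) = a \<odot>\<^bsub>V\<^esub> t x" if "a : carrier k" "x : carrier U" for a x
 by (rule m1[OF t mr(5)[OF _ t]]) (use that in simp_all)
 qed
 show ?thesis
 by (rule exI[of _ t]) (use tl PD(2)[OF m t] m1[OF t PD(4)[OF m]] lin_relD(2)[OF G] in blast)
qed

text \<open>Over a field the boundary data can be lifted first (\<open>a\<close>) and then extended to the cycles (\<open>c\<close>).\<close>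

theorem chain_lift:
 assumes k: "field k" and K: "complex k K" and N: "complex k N"
 and L: "!!n. lin_rel k (Deg K n) (Deg N n) (L n)" and Ld: "!!n x y. L n x y ==> L (n + 1) (Diff K n x) (Diff N n y)"
 and tot: "!!n x. x : carrier (Deg K n) ==> EX y. L n x y"
 and cyc: "!!n x. x : carrier (Deg K n) ==> Diff K n x = \<zero>\<^bsub>Deg K (n + 1)\<^esub> ==> EX y. L n x y & Diff N n y = \<zero>\<^bsub>Deg N (n + 1)\<^esub>"
 shows "EX t. chain_map k K N t & (ALL n. ALL x:carrier (Deg K n). L n x (t n x))"
proof -
 have Km: "module k (Deg K n)" and Nm: "module k (Deg N n)" for n using K N by (simp_all add: complex_def)
 have Ka: "abelian_group (Deg K n)" and Na: "abelian_group (Deg N n)" for n using Km Nm by (simp_all add: module_def)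
 have Kd: "linear_on k (Deg K n) (Deg K (n + 1)) (Diff K n)" and Nd: "linear_on k (Deg N n) (Deg N (n + 1)) (Diff N n)" for n
 using K N by (simp_all add: complex_def)
 have Kdd: "x : carrier (Deg K n) ==> Diff K (n + 1) (Diff K n x) = \<zero>\<^bsub>Deg K (n + 1 + 1)\<^esub>"
 and Ndd: "y : carrier (Deg N n) ==> Diff N (n + 1) (Diff N n y) = \<zero>\<^bsub>Deg N (n + 1 + 1)\<^esub>" for n x y
 using K N unfolding complex_def by blast+
 note kd = linear_onD[OF Kd] and nd = linear_onD[OF Nd] and kd0 = linear_on_zero[OF Ka Ka Kd] and nd0 = linear_on_zero[OF Na Na Nd]
 have k0: "\<zero>\<^bsub>Deg K n\<^esub> : carrier (Deg K n)" "\<zero>\<^bsub>Deg K n\<^esub> \<oplus>\<^bsub>Deg K n\<^esub> \<zero>\<^bsub>Deg K n\<^esub> = \<zero>\<^bsub>Deg K n\<^esub>" "a : carrier k ==> a \<odot>\<^bsub>Deg K n\<^esub> \<zero>\<^bsub>Deg K n\<^esub> = \<zero>\<^bsub>Deg K n\<^esub>"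
 "x : carrier (Deg K n) ==> y : carrier (Deg K n) ==> x \<oplus>\<^bsub>Deg K n\<^esub> y : carrier (Deg K n)"
 "a : carrier k ==> x : carrier (Deg K n) ==> a \<odot>\<^bsub>Deg K n\<^esub> x : carrier (Deg K n)" for n a x y
 proof -
 interpret module k "Deg K n" by (rule Km)
 show "\<zero>\<^bsub>Deg K n\<^esub> : carrier (Deg K n)" "\<zero>\<^bsub>Deg K n\<^esub> \<oplus>\<^bsub>Deg K n\<^esub> \<zero>\<^bsub>Deg K n\<^esub> = \<zero>\<^bsub>Deg K n\<^esub>" "a : carrier k ==> a \<odot>\<^bsub>Deg K n\<^esub> \<zero>\<^bsub>Deg K n\<^esub> = \<zero>\<^bsub>Deg K n\<^esub>"
 "x : carrier (Deg K n) ==> y : carrier (Deg K n) ==> x \<oplus>\<^bsub>Deg K n\<^esub> y : carrier (Deg K n)"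
 "a : carrier k ==> x : carrier (Deg K n) ==> a \<odot>\<^bsub>Deg K n\<^esub> x : carrier (Deg K n)"
 by (simp_all add: smult_r_null)
 qed
 have n0: "\<zero>\<^bsub>Deg N n\<^esub> : carrier (Deg N n)" "\<zero>\<^bsub>Deg N n\<^esub> \<oplus>\<^bsub>Deg N n\<^esub> \<zero>\<^bsub>Deg N n\<^esub> = \<zero>\<^bsub>Deg N n\<^esub>" "a : carrier k ==> a \<odot>\<^bsub>Deg N n\<^esub> \<zero>\<^bsub>Deg N n\<^esub> = \<zero>\<^bsub>Deg N n\<^esub>"
 "x : carrier (Deg N n) ==> x \<oplus>\<^bsub>Deg N n\<^esub> \<zero>\<^bsub>Deg N n\<^esub> = x" "x : carrier (Deg N n) ==> \<zero>\<^bsub>Deg N n\<^esub> \<oplus>\<^bsub>Deg N n\<^esub> x = x" for n a x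
 proof -
 interpret module k "Deg N n" by (rule Nm)
 show "\<zero>\<^bsub>Deg N n\<^esub> : carrier (Deg N n)" "\<zero>\<^bsub>Deg N n\<^esub> \<oplus>\<^bsub>Deg N n\<^esub> \<zero>\<^bsub>Deg N n\<^esub> = \<zero>\<^bsub>Deg N n\<^esub>" "a : carrier k ==> a \<odot>\<^bsub>Deg N n\<^esub> \<zero>\<^bsub>Deg N n\<^esub> = \<zero>\<^bsub>Deg N n\<^esub>"
 "x : carrier (Deg N n) ==> x \<oplus>\<^bsub>Deg N n\<^esub> \<zero>\<^bsub>Deg N n\<^esub> = x" "x : carrier (Deg N n) ==> \<zero>\<^bsub>Deg N n\<^esub> \<oplus>\<^bsub>Deg N n\<^esub> x = x"
 by (simp_all add: smult_r_null)
 qed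
 define Z where "Z n x \<longleftrightarrow> x : carrier (Deg K n) & Diff K n x = \<zero>\<^bsub>Deg K (n + 1)\<^esub>" for n x
 have Z: "Z n \<zero>\<^bsub>Deg K n\<^esub>" "Z n x ==> Z n y ==> Z n (x \<oplus>\<^bsub>Deg K n\<^esub> y)" "a : carrier k ==> Z n x ==> Z n (a \<odot>\<^bsub>Deg K n\<^esub> x)"
 "x : carrier (Deg K n) ==> Z (n + 1) (Diff K n x)" "Z n x ==> x : carrier (Deg K n)" for n x y a
 unfolding Z_def using k0 kd kd0 Kdd by simp_all
 \<comment> \<open>\<open>pev n\<close> is a linear projection onto the cycles, obtained as an
   extension of the identity of the cycles.\<close>
 define Qp where "Qp n pev \<longleftrightarrow> linear_on k (Deg K n) (Deg K n) pev & (ALL x:carrier (Deg K n). x : carrier (Deg K n) & Z n (pev x)) &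
 (ALL x y. (Z n x & y = x) --> pev x = y)" for n pev
 have exQp: "EX pev. Qp n pev" for n
 unfolding Qp_def
 proof (rule linear_selection[OF k Km Km])
 show "lin_rel k (Deg K n) (Deg K n) (%x y. x : carrier (Deg K n) & Z n y)"
 by (rule lin_relI) (use Z k0 in simp_all)
 show "lin_rel k (Deg K n) (Deg K n) (%x y. Z n x & y = x)"
 by (rule lin_relI) (use Z k0 in simp_all)
 show "EX y. x : carrier (Deg K n) & Z n y" if "x : carrier (Deg K n)" for x
 by (rule exI[of _ "\<zero>\<^bsub>Deg K n\<^esub>"]) (simp add: that Z(1))
 qed (simp_all add: Z(5))
 then obtain pev where "!!n. Qp n (pev n)" by metis
 then have pev: "!!n. linear_on k (Deg K n) (Deg K n) (pev n)" "!!n x. x : carrier (Deg K n) ==> Z n (pev n x)" "!!n x. Z n x ==> pev n x = x"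
 unfolding Qp_def by blast+
 note pi = linear_onD[OF pev(1)] and pi0 = linear_on_zero[OF Ka Ka pev(1)]
 \<comment> \<open>\<open>a\<close> is to lift the complementary part \<open>u = x - pev n x\<close>
   of \<open>x\<close>, with no condition on differentials, and to vanish on cycles.\<close>
 define La where "La n x y \<longleftrightarrow> (EX u. x : carrier (Deg K n) & u : carrier (Deg K n) & x = u \<oplus>\<^bsub>Deg K n\<^esub> pev n x & L n u y)" for n x y
 define Qa where "Qa n a \<longleftrightarrow> linear_on k (Deg K n) (Deg N n) a & (ALL x:carrier (Deg K n). La n x (a x)) &
 (ALL x y. (Z n x & y = \<zero>\<^bsub>Deg N n\<^esub>) --> a x = y)" for n a
 have exQa: "EX a. Qa n a" for n
 proof -
 interpret K: module k "Deg K n" by (rule Km)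
 show ?thesis unfolding Qa_def
 proof (rule linear_selection[OF k Km Nm])
 show "lin_rel k (Deg K n) (Deg N n) (La n)"
 proof (rule lin_relI)
 show "La n \<zero>\<^bsub>Deg K n\<^esub> \<zero>\<^bsub>Deg N n\<^esub>" unfolding La_def
 by (rule exI[of _ "\<zero>\<^bsub>Deg K n\<^esub>"]) (simp add: pi0 lin_relD(1)[OF L])
 show "x : carrier (Deg K n)" if "La n x y" for x y using that unfolding La_def by blast
 show "y : carrier (Deg N n)" if "La n x y" for x y using that lin_relD(3)[OF L] unfolding La_def by blast
 fix x y assume "La n x y"
 then obtain u where u: "x : carrier (Deg K n)" "u : carrier (Deg K n)" "x = u \<oplus>\<^bsub>Deg K n\<^esub> pev n x" "L n u y" unfolding La_def by blast
 show "La n (a \<odot>\<^bsub>Deg K n\<^esub> x) (a \<odot>\<^bsub>Deg N n\<^esub> y)" if a: "a : carrier k" for a unfolding La_def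
 proof (intro exI[of _ "a \<odot>\<^bsub>Deg K n\<^esub> u"] conjI)
 have "a \<odot>\<^bsub>Deg K n\<^esub> x = a \<odot>\<^bsub>Deg K n\<^esub> (u \<oplus>\<^bsub>Deg K n\<^esub> pev n x)" using u(3) by simp
 also have "... = a \<odot>\<^bsub>Deg K n\<^esub> u \<oplus>\<^bsub>Deg K n\<^esub> pev n (a \<odot>\<^bsub>Deg K n\<^esub> x)" using a u(1,2) pi by (simp add: K.smult_r_distr)
 finally show "a \<odot>\<^bsub>Deg K n\<^esub> x = a \<odot>\<^bsub>Deg K n\<^esub> u \<oplus>\<^bsub>Deg K n\<^esub> pev n (a \<odot>\<^bsub>Deg K n\<^esub> x)" .
 qed (use a u(1,2) lin_relD(5)[OF L a u(4)] in simp_all)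
 fix x' y' assume "La n x' y'"
 then obtain u' where u': "x' : carrier (Deg K n)" "u' : carrier (Deg K n)" "x' = u' \<oplus>\<^bsub>Deg K n\<^esub> pev n x'" "L n u' y'" unfolding La_def by blast
 show "La n (x \<oplus>\<^bsub>Deg K n\<^esub> x') (y \<oplus>\<^bsub>Deg N n\<^esub> y')" unfolding La_def
 proof (intro exI[of _ "u \<oplus>\<^bsub>Deg K n\<^esub> u'"] conjI)
 have "x \<oplus>\<^bsub>Deg K n\<^esub> x' = (u \<oplus>\<^bsub>Deg K n\<^esub> pev n x) \<oplus>\<^bsub>Deg K n\<^esub> (u' \<oplus>\<^bsub>Deg K n\<^esub> pev n x')" using u(3) u'(3) by simp
 also have "... = (u \<oplus>\<^bsub>Deg K n\<^esub> u') \<oplus>\<^bsub>Deg K n\<^esub> pev n (x \<oplus>\<^bsub>Deg K n\<^esub> x')" using u(1,2) u'(1,2) pi by (simp add: K.a_ac)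
 finally show "x \<oplus>\<^bsub>Deg K n\<^esub> x' = (u \<oplus>\<^bsub>Deg K n\<^esub> u') \<oplus>\<^bsub>Deg K n\<^esub> pev n (x \<oplus>\<^bsub>Deg K n\<^esub> x')" .
 qed (use u(1,2) u'(1,2) lin_relD(4)[OF L u(4) u'(4)] in simp_all)
 qed
 show "lin_rel k (Deg K n) (Deg N n) (%x y. Z n x & y = \<zero>\<^bsub>Deg N n\<^esub>)"
 by (rule lin_relI) (use Z n0 in auto)
 show "La n x y" if "Z n x & y = \<zero>\<^bsub>Deg N n\<^esub>" for x y unfolding La_def
 by (rule exI[of _ "\<zero>\<^bsub>Deg K n\<^esub>"]) (use that pev(3) Z(5) lin_relD(1)[OF L] in simp)
 show "EX y. La n x y" if x: "x : carrier (Deg K n)" for x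
 proof -
 have px: "pev n x : carrier (Deg K n)" by (rule pi(1)[OF x])
 obtain y where "L n (x \<ominus>\<^bsub>Deg K n\<^esub> pev n x) y" using tot[of "x \<ominus>\<^bsub>Deg K n\<^esub> pev n x" n] x px by auto
 moreover have "x = (x \<ominus>\<^bsub>Deg K n\<^esub> pev n x) \<oplus>\<^bsub>Deg K n\<^esub> pev n x"
 using x px by (simp add: a_minus_def K.a_assoc K.l_neg)
 ultimately show ?thesis unfolding La_def using x px by (intro exI[of _ y] exI[of _ "x \<ominus>\<^bsub>Deg K n\<^esub> pev n x"]) simp
 qed
 qed simp
 qed
 then obtain a where "!!n. Qa n (a n)" by metis
 then have a: "!!n. linear_on k (Deg K n) (Deg N n) (a n)" "!!n x. x : carrier (Deg K n) ==> La n x (a n x)" "!!n x. Z n x ==> a n x = \<zero>\<^bsub>Deg N n\<^esub>"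
 unfolding Qa_def by blast+
 note al = linear_onD[OF a(1)] and al0 = linear_on_zero[OF Ka Na a(1)]
 have dK: "Diff K n x = Diff K n u" if "u : carrier (Deg K n)" "x = u \<oplus>\<^bsub>Deg K n\<^esub> pev n x" "x : carrier (Deg K n)" for n x u
 proof -
 interpret K': module k "Deg K (n + 1)" by (rule Km)
 have "Diff K n (u \<oplus>\<^bsub>Deg K n\<^esub> pev n x) = Diff K n u" using pev(2)[OF that(3)] that(1) pi(1) kd unfolding Z_def by simp
 then show ?thesis using that(2) by simp
 qed
 define Lc where "Lc n x y \<longleftrightarrow> x : carrier (Deg K n) & L n (pev n x) y & Diff N n y = \<zero>\<^bsub>Deg N (n + 1)\<^esub>" for n x y
 \<comment> \<open>\<open>c\<close> lifts the cycle part \<open>pev x\<close> by closed elements and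
   is prescribed on boundaries: \<open>Diff w\<close> goes to the differential of
   \<open>a w\<close>. This is well defined because \<open>a\<close> vanishes on cycles, so
   \<open>Diff w = 0\<close> forces the prescribed value to be zero.\<close>
 define Qc where "Qc n c \<longleftrightarrow> linear_on k (Deg K (n + 1)) (Deg N (n + 1)) c & (ALL x:carrier (Deg K (n + 1)). Lc (n + 1) x (c x)) &
 (ALL x y. (EX w:carrier (Deg K n). x = Diff K n w & y = Diff N n (a n w)) --> c x = y)" for n c
 have exQc: "EX c. Qc n c" for n
 unfolding Qc_def
 proof (rule linear_selection[OF k Km Nm])
 show "lin_rel k (Deg K (n + 1)) (Deg N (n + 1)) (Lc (n + 1))"
 proof (rule lin_relI)
 show "Lc (n + 1) \<zero>\<^bsub>Deg K (n + 1)\<^esub> \<zero>\<^bsub>Deg N (n + 1)\<^esub>" unfolding Lc_def using k0 pi0 nd0 lin_relD(1)[OF L] by simp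
 show "x : carrier (Deg K (n + 1))" "y : carrier (Deg N (n + 1))" if "Lc (n + 1) x y" for x y using that lin_relD(3)[OF L] unfolding Lc_def by blast+
 fix x y assume 1: "Lc (n + 1) x y"
 have yc: "y : carrier (Deg N (n + 1))" using 1 lin_relD(3)[OF L] unfolding Lc_def by blast
 show "Lc (n + 1) (a \<odot>\<^bsub>Deg K (n + 1)\<^esub> x) (a \<odot>\<^bsub>Deg N (n + 1)\<^esub> y)" if a: "a : carrier k" for a
 using 1 lin_relD(5)[OF L a, of "n + 1" "pev (n + 1) x" y] yc a unfolding Lc_def by (simp add: k0 n0 pi nd)
 fix x' y' assume 2: "Lc (n + 1) x' y'"
 have yc': "y' : carrier (Deg N (n + 1))" using 2 lin_relD(3)[OF L] unfolding Lc_def by blast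
 show "Lc (n + 1) (x \<oplus>\<^bsub>Deg K (n + 1)\<^esub> x') (y \<oplus>\<^bsub>Deg N (n + 1)\<^esub> y')"
 using 1 2 lin_relD(4)[OF L, of "n + 1" "pev (n + 1) x" y "pev (n + 1) x'" y'] yc yc' unfolding Lc_def by (simp add: k0 n0 pi nd)
 qed
 show "lin_rel k (Deg K (n + 1)) (Deg N (n + 1)) (%x y. EX w:carrier (Deg K n). x = Diff K n w & y = Diff N n (a n w))"
 proof (rule lin_relI)
 show "EX w:carrier (Deg K n). \<zero>\<^bsub>Deg K (n + 1)\<^esub> = Diff K n w & \<zero>\<^bsub>Deg N (n + 1)\<^esub> = Diff N n (a n w)"
 by (rule bexI[of _ "\<zero>\<^bsub>Deg K n\<^esub>"]) (simp_all add: k0 kd0 nd0 al0)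
 fix x y assume "EX w:carrier (Deg K n). x = Diff K n w & y = Diff N n (a n w)"
 then obtain w where w: "w : carrier (Deg K n)" "x = Diff K n w" "y = Diff N n (a n w)" by blast
 show "x : carrier (Deg K (n + 1))" "y : carrier (Deg N (n + 1))" using w kd nd al by simp_all
 show "EX w:carrier (Deg K n). c \<odot>\<^bsub>Deg K (n + 1)\<^esub> x = Diff K n w & c \<odot>\<^bsub>Deg N (n + 1)\<^esub> y = Diff N n (a n w)" if "c : carrier k" for c
 by (rule bexI[of _ "c \<odot>\<^bsub>Deg K n\<^esub> w"]) (use w that kd nd al k0 in simp_all)
 fix x' y' assume "EX w:carrier (Deg K n). x' = Diff K n w & y' = Diff N n (a n w)"
 then obtain w' where w': "w' : carrier (Deg K n)" "x' = Diff K n w'" "y' = Diff N n (a n w')" by blast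
 show "EX w:carrier (Deg K n). x \<oplus>\<^bsub>Deg K (n + 1)\<^esub> x' = Diff K n w & y \<oplus>\<^bsub>Deg N (n + 1)\<^esub> y' = Diff N n (a n w)"
 by (rule bexI[of _ "w \<oplus>\<^bsub>Deg K n\<^esub> w'"]) (use w w' kd nd al k0 in simp_all)
 qed
 show "Lc (n + 1) x y" if h: "EX w:carrier (Deg K n). x = Diff K n w & y = Diff N n (a n w)" for x y
 proof -
 obtain w where w: "w : carrier (Deg K n)" "x = Diff K n w" "y = Diff N n (a n w)" using h by blast
 obtain u where u: "u : carrier (Deg K n)" "w = u \<oplus>\<^bsub>Deg K n\<^esub> pev n w" "L n u (a n w)" using a(2)[OF w(1)] unfolding La_def by blast
 show ?thesis unfolding Lc_def w(2,3) pev(3)[OF Z(4)[OF w(1)]]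
 using Ld[OF u(3)] dK[OF u(1,2) w(1)] Ndd[OF al(1)[OF w(1)]] kd(1)[OF w(1)] by simp
 qed
 show "y = \<zero>\<^bsub>Deg N (n + 1)\<^esub>" if h: "EX w:carrier (Deg K n). \<zero>\<^bsub>Deg K (n + 1)\<^esub> = Diff K n w & y = Diff N n (a n w)" for y
 proof -
 obtain w where w: "w : carrier (Deg K n)" "\<zero>\<^bsub>Deg K (n + 1)\<^esub> = Diff K n w" "y = Diff N n (a n w)" using h by blast
 have "Z n w" using w by (simp add: Z_def)
 then show ?thesis using w(3) a(3) nd0 by simp
 qed
 show "EX y. Lc (n + 1) x y" if x: "x : carrier (Deg K (n + 1))" for x
 unfolding Lc_def using cyc[of "pev (n + 1) x" "n + 1"] pev(2)[OF x] x unfolding Z_def by blast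
 qed
 then obtain c' where "!!n. Qc n (c' n)" by metis
 then have c': "!!n. linear_on k (Deg K (n + 1)) (Deg N (n + 1)) (c' n)" "!!n x. x : carrier (Deg K (n + 1)) ==> Lc (n + 1) x (c' n x)"
 "!!n w. w : carrier (Deg K n) ==> c' n (Diff K n w) = Diff N n (a n w)"
 unfolding Qc_def by blast+
 \<comment> \<open>Prescribing values on boundaries refers to the preceding degree, so
   \<open>c'\<close> was indexed by that degree.\<close>
 define c where "c n = c' (n - 1)" for n
 have c: "linear_on k (Deg K n) (Deg N n) (c n)" "x : carrier (Deg K n) ==> Lc n x (c n x)" for n x
 using c'(1)[where n = "n - 1"] c'(2)[where n = "n - 1"] by (simp_all add: c_def)
 have c3: "c (n + 1) (Diff K n w) = Diff N n (a n w)" if "w : carrier (Deg K n)" for n w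
 using c'(3)[OF that] by (simp add: c_def)
 note cl = linear_onD[OF c(1)]
 \<comment> \<open>On a boundary \<open>a\<close> vanishes and \<open>c\<close> is the differential
   of \<open>a\<close>, while \<open>c\<close> has closed values; thus both sides of the chain map
   equation equal the differential of \<open>a n x\<close>.\<close>
 define t where "t n x = a n x \<oplus>\<^bsub>Deg N n\<^esub> c n x" for n x
 have "linear_on k (Deg K n) (Deg N n) (t n)" for n
 proof -
 interpret N: module k "Deg N n" by (rule Nm)
 show ?thesis unfolding linear_on_def t_def
 by (auto simp: al cl N.smult_r_distr N.a_ac)
 qed
 moreover have "t (n + 1) (Diff K n x) = Diff N n (t n x)" if x: "x : carrier (Deg K n)" for n x
 proof -
 have "t (n + 1) (Diff K n x) = Diff N n (a n x)"
 unfolding t_def a(3)[OF Z(4)[OF x]] c3[OF x] using n0 nd(1)[OF al(1)[OF x]] by simp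
 moreover have "Diff N n (t n x) = Diff N n (a n x)"
 unfolding t_def using nd(2)[OF al(1)[OF x] cl(1)[OF x]] c(2)[OF x] n0 nd(1)[OF al(1)[OF x]] unfolding Lc_def by simp
 ultimately show ?thesis by simp
 qed
 moreover have "L n x (t n x)" if x: "x : carrier (Deg K n)" for n x
 proof -
 obtain u where u: "x = u \<oplus>\<^bsub>Deg K n\<^esub> pev n x" "L n u (a n x)" using a(2)[OF x] unfolding La_def by blast
 have "L n (u \<oplus>\<^bsub>Deg K n\<^esub> pev n x) (t n x)" unfolding t_def by (rule lin_relD(4)[OF L u(2)]) (use c(2)[OF x] in "simp add: Lc_def")
 then show ?thesis using u(1) by simp
 qed
 ultimately show ?thesis unfolding chain_map_def by blast
qed

section \<open>Complexes in the arrow category\<close>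

lemma prod_module_module:
 assumes "module k V" "module k V'" shows "module k (prod_module V V')"
proof -
 interpret V: module k V by fact
 interpret V': module k V' by fact
 have ab: "abelian_group (prod_module V V')"
 proof (rule abelian_groupI)
 fix x assume "x : carrier (prod_module V V')"
 then show "EX y:carrier (prod_module V V'). y \<oplus>\<^bsub>prod_module V V'\<^esub> x = \<zero>\<^bsub>prod_module V V'\<^esub>"
 by (intro bexI[of _ "(\<ominus>\<^bsub>V\<^esub> fst x, \<ominus>\<^bsub>V'\<^esub> snd x)"]) (auto simp: prod_module_def V.l_neg V'.l_neg)
 qed (auto simp: prod_module_def V.a_ac V'.a_ac)
 show ?thesis
 by (rule moduleI[OF V.R.is_cring ab])
 (auto simp: prod_module_def V.smult_l_distr V'.smult_l_distr V.smult_r_distr V'.smult_r_distr V.smult_assoc1 V'.smult_assoc1)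
qed

text \<open>Copies a complex along an injection. It is used to replace complexes of pairs by
  complexes with elements in \<open>'u\<close>, since tensors are given for those.\<close>

definition transport :: "('a => 'b) => ('k, 'a) cplx => ('k, 'b) cplx" where
 "transport e K = (let g = (%n. the_inv_into (carrier (Deg K n)) e) in
 \<lparr>Deg = (%n. \<lparr>carrier = e ` carrier (Deg K n), mult = undefined, one = undefined, zero = e \<zero>\<^bsub>Deg K n\<^esub>,
 add = (%x y. e (g n x \<oplus>\<^bsub>Deg K n\<^esub> g n y)), smult = (%a x. e (a \<odot>\<^bsub>Deg K n\<^esub> g n x))\<rparr>),
 Diff = (%n x. e (Diff K n (g n x)))\<rparr>)"

lemma transport_complex:
 assumes K: "complex k K" and e: "inj e"
 shows "complex k (transport e K)"
 "carrier (Deg (transport e K) n) = e ` carrier (Deg K n)"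
 "x : carrier (Deg K n) ==> Diff (transport e K) n (e x) = e (Diff K n x)"
 "x : carrier (Deg K n) ==> y : carrier (Deg K n) ==> e x \<oplus>\<^bsub>Deg (transport e K) n\<^esub> e y = e (x \<oplus>\<^bsub>Deg K n\<^esub> y)"
 "x : carrier (Deg K n) ==> a \<odot>\<^bsub>Deg (transport e K) n\<^esub> e x = e (a \<odot>\<^bsub>Deg K n\<^esub> x)"
proof -
 let ?T = "transport e K"
 have g: "the_inv_into (carrier (Deg K n)) e (e x) = x" if "x : carrier (Deg K n)" for n x
 by (rule the_inv_into_f_f[OF inj_on_subset[OF e] that]) simp
 show car: "carrier (Deg ?T n) = e ` carrier (Deg K n)" for n by (simp add: transport_def)
 show dif: "x : carrier (Deg K n) ==> Diff ?T n (e x) = e (Diff K n x)" for n x by (simp add: transport_def g)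
 show add: "x : carrier (Deg K n) ==> y : carrier (Deg K n) ==> e x \<oplus>\<^bsub>Deg ?T n\<^esub> e y = e (x \<oplus>\<^bsub>Deg K n\<^esub> y)" for n x y
 by (simp add: transport_def g)
 show smu: "x : carrier (Deg K n) ==> a \<odot>\<^bsub>Deg ?T n\<^esub> e x = e (a \<odot>\<^bsub>Deg K n\<^esub> x)" for n x a by (simp add: transport_def g)
 have zer: "\<zero>\<^bsub>Deg ?T n\<^esub> = e \<zero>\<^bsub>Deg K n\<^esub>" for n by (simp add: transport_def)
 have mo: "module k (Deg ?T n)" for n
 proof -
 interpret V: module k "Deg K n" using K by (simp add: complex_def)
 have ab: "abelian_group (Deg ?T n)"
 proof (rule abelian_groupI)
 fix x assume "x : carrier (Deg ?T n)"
 then obtain x' where "x = e x'" "x' : carrier (Deg K n)" unfolding car by blast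
 then show "EX y:carrier (Deg ?T n). y \<oplus>\<^bsub>Deg ?T n\<^esub> x = \<zero>\<^bsub>Deg ?T n\<^esub>"
 by (intro bexI[of _ "e (\<ominus>\<^bsub>Deg K n\<^esub> x')"]) (simp_all add: car add zer V.l_neg)
 qed (auto simp: car add zer V.a_ac)
 show ?thesis
 by (rule moduleI[OF V.R.is_cring ab])
 (auto simp: car add smu zer V.smult_l_distr V.smult_r_distr V.smult_assoc1)
 qed
 have Kd: "linear_on k (Deg K n) (Deg K (n + 1)) (Diff K n)" for n using K by (simp add: complex_def)
 have Kc: "x : carrier (Deg K n) ==> y : carrier (Deg K n) ==> x \<oplus>\<^bsub>Deg K n\<^esub> y : carrier (Deg K n)"
 "a : carrier k ==> x : carrier (Deg K n) ==> a \<odot>\<^bsub>Deg K n\<^esub> x : carrier (Deg K n)" for n x y a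
 proof -
 interpret V: module k "Deg K n" using K by (simp add: complex_def)
 show "x : carrier (Deg K n) ==> y : carrier (Deg K n) ==> x \<oplus>\<^bsub>Deg K n\<^esub> y : carrier (Deg K n)"
 "a : carrier k ==> x : carrier (Deg K n) ==> a \<odot>\<^bsub>Deg K n\<^esub> x : carrier (Deg K n)" by simp_all
 qed
 note kd = linear_onD[OF Kd]
 have "linear_on k (Deg ?T n) (Deg ?T (n + 1)) (Diff ?T n)" for n
 unfolding linear_on_def by (auto simp: car add smu dif kd Kc)
 moreover have "Diff ?T (n + 1) (Diff ?T n x) = \<zero>\<^bsub>Deg ?T (n + 1 + 1)\<^esub>" if "x : carrier (Deg ?T n)" for n x
 using that K unfolding complex_def by (auto simp: car zer dif kd)
 ultimately show "complex k ?T" unfolding complex_def using mo by blast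
qed

context dgc begin

text \<open>Commutativity of a square is a linear equation, so the squares of one degree form a
  submodule of the product; the differential preserves them because \<open>i\<close> and
  \<open>p\<close> are closed of degree zero.\<close>

lemma arr1_complex:
 assumes i: "i : UA" and p: "p : UA" shows "complex k (DHom (arr1 M) i p)"
proof -
 obtain A B f A' B' g where ie: "i = (A, B, f)" "p = (A', B', g)" by (metis prod_cases3)
 have O: "A : DObj M" "B : DObj M" "A' : DObj M" "B' : DObj M"
 and f: "f : homs M A B 0" "Diff (DHom M A B) 0 f = \<zero>\<^bsub>Deg (DHom M A B) 1\<^esub>"
 and g: "g : homs M A' B' 0" "Diff (DHom M A' B') 0 g = \<zero>\<^bsub>Deg (DHom M A' B') 1\<^esub>"
 using i p unfolding ie arrows_def by (simp_all add: underlying_def)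
 let ?P = "%n. prod_module (Deg (DHom M A A') n) (Deg (DHom M B B') n)"
 define H where "H n = {(a, b). a : homs M A A' n & b : homs M B B' n & DCmp M A B B' n 0 b f = DCmp M A A' B' 0 n g a}" for n
 have D: "Deg (DHom (arr1 M) i p) n = (?P n)\<lparr>carrier := H n\<rparr>" for n unfolding ie H_def by (simp add: arr1_def)
 have mA: "module k (Deg (DHom M A A') n)" and mB: "module k (Deg (DHom M B B') n)" and mC: "module k (Deg (DHom M A B') n)" for n
 using dg_mod O by blast+
 have ff: "linear_on k (Deg (DHom M B B') n) (Deg (DHom M A B') n) (%b. DCmp M A B B' n 0 b f)" for n
 using dg_linl[OF O(1,2,4) f(1), of n] by simp
 have gg: "linear_on k (Deg (DHom M A A') n) (Deg (DHom M A B') n) (%a. DCmp M A A' B' 0 n g a)" for n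
 using dg_linr[OF O(1,3,4) g(1), of n] by simp
 note fl = linear_onD[OF ff] and gl = linear_onD[OF gg]
 have abA: "abelian_group (Deg (DHom M A A') n)" and abB: "abelian_group (Deg (DHom M B B') n)" and abC: "abelian_group (Deg (DHom M A B') n)" for n
 using mA mB mC by (simp_all add: module_def)
 have mP: "module k (?P n)" for n by (rule prod_module_module[OF mA mB])
 have inv: "\<ominus>\<^bsub>?P n\<^esub> (a, b) = (\<ominus>\<^bsub>Deg (DHom M A A') n\<^esub> a, \<ominus>\<^bsub>Deg (DHom M B B') n\<^esub> b)" if "a : homs M A A' n" "b : homs M B B' n" for n a b
 proof -
 interpret P: module k "?P n" by (rule mP)
 interpret A: module k "Deg (DHom M A A') n" by (rule mA)
 interpret B: module k "Deg (DHom M B B') n" by (rule mB)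
 show ?thesis by (rule P.minus_equality) (use that in "auto simp: prod_module_def A.l_neg B.l_neg")
 qed
 have sub: "submodule (H n) k (?P n)" for n
 proof -
 interpret P: module k "?P n" by (rule mP)
 interpret A: module k "Deg (DHom M A A') n" by (rule mA)
 interpret B: module k "Deg (DHom M B B') n" by (rule mB)
 show ?thesis
 proof (rule P.submoduleI)
 show "H n \<subseteq> carrier (?P n)" by (auto simp: H_def prod_module_def)
 show "\<zero>\<^bsub>?P n\<^esub> : H n" using linear_on_zero[OF abB abC ff] linear_on_zero[OF abA abC gg] by (simp add: H_def prod_module_def)
 show "\<ominus>\<^bsub>?P n\<^esub> x : H n" if "x : H n" for x
 using that linear_on_minus[OF abB abC ff] linear_on_minus[OF abA abC gg] by (auto simp: H_def inv)
 show "x \<oplus>\<^bsub>?P n\<^esub> y : H n" if "x : H n" "y : H n" for x y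
 using that fl gl by (auto simp: H_def prod_module_def)
 show "c \<odot>\<^bsub>?P n\<^esub> x : H n" if "c : carrier k" "x : H n" for c x
 using that fl gl by (auto simp: H_def prod_module_def)
 qed
 qed
 have mo: "module k (Deg (DHom (arr1 M) i p) n)" for n
 unfolding D by (rule submodule.submodule_is_module[OF sub mP])
 have Df: "Diff (DHom (arr1 M) i p) n (a, b) = (Diff (DHom M A A') n a, Diff (DHom M B B') n b)" for n a b
 unfolding ie by (simp add: arr1_def)
 note dA = linear_onD[OF dg_d[OF O(1,3)]] and dB = linear_onD[OF dg_d[OF O(2,4)]]
 have Hd: "(Diff (DHom M A A') n a, Diff (DHom M B B') n b) : H (n + 1)" if h: "(a, b) : H n" for n a b
 proof -
 have a: "(A, A', n, a) : GA" and b: "(B, B', n, b) : GA" and f': "(A, B, 0, f) : GA" "cl (A, B, 0, f)" and g': "(A', B', 0, g) : GA" "cl (A', B', 0, g)"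
 using h O f g by (simp_all add: H_def gr_arrows cl_def df_def zr_def)
 have e: "(B, B', n, b) $ (A, B, 0, f) = (A', B', 0, g) $ (A, A', n, a)" using h by (simp add: H_def gr_cmp)
 have "df ((B, B', n, b) $ (A, B, 0, f)) = df (B, B', n, b) $ (A, B, 0, f)" by (rule leibniz_right) (use b f' in simp_all)
 moreover have "df ((A', B', 0, g) $ (A, A', n, a)) = (A', B', 0, g) $ df (A, A', n, a)" using leibniz_left[OF a g'(1) _ g'(2)] by (simp add: sg_def)
 ultimately have "df (B, B', n, b) $ (A, B, 0, f) = (A', B', 0, g) $ df (A, A', n, a)" using e by simp
 then show ?thesis using h dA(1) dB(1) by (simp add: H_def df_def gr_cmp)
 qed
 have "linear_on k (Deg (DHom (arr1 M) i p) n) (Deg (DHom (arr1 M) i p) (n + 1)) (Diff (DHom (arr1 M) i p) n)" for n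
 unfolding linear_on_def D
 proof (intro conjI ballI funcsetI)
 fix x assume x: "x : carrier ((?P n)\<lparr>carrier := H n\<rparr>)"
 obtain a b where ab: "x = (a, b)" by (cases x)
 have h: "(a, b) : H n" "a : homs M A A' n" "b : homs M B B' n" using x by (auto simp: ab H_def)
 show "Diff (DHom (arr1 M) i p) n x : carrier ((?P (n + 1))\<lparr>carrier := H (n + 1)\<rparr>)" unfolding ab Df using Hd[OF h(1)] by simp
 show "Diff (DHom (arr1 M) i p) n (c \<odot>\<^bsub>(?P n)\<lparr>carrier := H n\<rparr>\<^esub> x) = c \<odot>\<^bsub>(?P (n + 1))\<lparr>carrier := H (n + 1)\<rparr>\<^esub> Diff (DHom (arr1 M) i p) n x"
 if "c : carrier k" for c using h that dA dB by (simp add: ab Df prod_module_def)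
 fix y assume y: "y : carrier ((?P n)\<lparr>carrier := H n\<rparr>)"
 obtain a' b' where ab': "y = (a', b')" by (cases y)
 have h': "a' : homs M A A' n" "b' : homs M B B' n" using y by (auto simp: ab' H_def)
 show "Diff (DHom (arr1 M) i p) n (x \<oplus>\<^bsub>(?P n)\<lparr>carrier := H n\<rparr>\<^esub> y) =
 Diff (DHom (arr1 M) i p) n x \<oplus>\<^bsub>(?P (n + 1))\<lparr>carrier := H (n + 1)\<rparr>\<^esub> Diff (DHom (arr1 M) i p) n y"
 using h h' dA dB by (simp add: ab ab' Df prod_module_def)
 qed
 moreover have "Diff (DHom (arr1 M) i p) (n + 1) (Diff (DHom (arr1 M) i p) n x) = \<zero>\<^bsub>Deg (DHom (arr1 M) i p) (n + 1 + 1)\<^esub>"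
 if "x : carrier (Deg (DHom (arr1 M) i p) n)" for n x
 using that dg_dd[OF O(1,3)] dg_dd[OF O(2,4)] unfolding D by (auto simp: H_def Df prod_module_def)
 ultimately show ?thesis unfolding complex_def using mo by blast
qed

end

section \<open>Universal property of tensors\<close>

definition restr :: "('k, 'a) cplx => (int => 'a => 'b) => int => 'a => 'b" where
 "restr R t = (%p. \<lambda>x\<in>carrier (Deg R p). t p x)"

lemma int_hom_carrier: "h : carrier (Deg (int_hom k R S) n) \<longleftrightarrow>
 (ALL p. h p : extensional (carrier (Deg R p)) & linear_on k (Deg R p) (Deg S (p + n)) (h p))"
 by (simp add: int_hom_def)

lemma int_hom_zero: "\<zero>\<^bsub>Deg (int_hom k R S) n\<^esub> = restr R (%p x. \<zero>\<^bsub>Deg S (p + n)\<^esub>)"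
 by (simp add: int_hom_def restr_def)

lemma int_hom_Diff: "Diff (int_hom k R S) 0 h = restr R (%p x. Diff S p (h p x) \<ominus>\<^bsub>Deg S (p + 1)\<^esub> h (p + 1) (Diff R p x))"
 by (simp add: int_hom_def restr_def ksign_def)

lemma linear_restrict:
 assumes "module k V" "linear_on k V V' f" shows "linear_on k V V' (\<lambda>x\<in>carrier V. f x)"
proof -
 interpret module k V by fact
 show ?thesis using linear_onD[OF assms(2)] unfolding linear_on_def by auto
qed

lemma linear_comp: "linear_on k U V f ==> linear_on k V W g ==> linear_on k U W (%x. g (f x))"
 unfolding linear_on_def by (auto simp: Pi_iff)

lemma linear_minus:
 assumes V: "module k V" and f: "linear_on k U V f" and g: "linear_on k U V g"
 shows "linear_on k U V (%x. f x \<ominus>\<^bsub>V\<^esub> g x)"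
 unfolding linear_on_def
proof (intro conjI ballI funcsetI)
 interpret module k V by (rule V)
 fix x assume x: "x : carrier U"
 note fx = linear_onD(1)[OF f x] and gx = linear_onD(1)[OF g x]
 show "f x \<ominus>\<^bsub>V\<^esub> g x : carrier V" using fx gx by simp
 show "f (a \<odot>\<^bsub>U\<^esub> x) \<ominus>\<^bsub>V\<^esub> g (a \<odot>\<^bsub>U\<^esub> x) = a \<odot>\<^bsub>V\<^esub> (f x \<ominus>\<^bsub>V\<^esub> g x)" if a: "a : carrier k" for a
 unfolding linear_onD(3)[OF f a x] linear_onD(3)[OF g a x] using fx gx a by (simp add: a_minus_def smult_r_distr smult_r_minus)
 fix y assume y: "y : carrier U"
 note fy = linear_onD(1)[OF f y] and gy = linear_onD(1)[OF g y]
 show "f (x \<oplus>\<^bsub>U\<^esub> y) \<ominus>\<^bsub>V\<^esub> g (x \<oplus>\<^bsub>U\<^esub> y) = f x \<ominus>\<^bsub>V\<^esub> g x \<oplus>\<^bsub>V\<^esub> (f y \<ominus>\<^bsub>V\<^esub> g y)"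
 unfolding linear_onD(2)[OF f x y] linear_onD(2)[OF g x y] using fx gx fy gy by (simp add: a_minus_def minus_add a_ac)
qed

lemma chain_mapD:
 assumes "chain_map k R S t"
 shows "linear_on k (Deg R n) (Deg S n) (t n)" "x : carrier (Deg R n) ==> t (n + 1) (Diff R n x) = Diff S n (t n x)"
 using assms unfolding chain_map_def by blast+

lemma complexD:
 assumes "complex k R"
 shows "module k (Deg R n)" "linear_on k (Deg R n) (Deg R (n + 1)) (Diff R n)"
 "x : carrier (Deg R n) ==> Diff R n x : carrier (Deg R (n + 1))"
proof -
 show "module k (Deg R n)" and d: "linear_on k (Deg R n) (Deg R (n + 1)) (Diff R n)" using assms by (simp_all add: complex_def)
 show "x : carrier (Deg R n) ==> Diff R n x : carrier (Deg R (n + 1))" by (rule linear_onD(1)[OF d])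
qed

lemma closed_int_hom:
 assumes R: "complex k R" and S: "complex k S" and t: "chain_map k R S t"
 shows "restr R t : carrier (Deg (int_hom k R S) 0)" "Diff (int_hom k R S) 0 (restr R t) = \<zero>\<^bsub>Deg (int_hom k R S) 1\<^esub>"
proof -
 show "restr R t : carrier (Deg (int_hom k R S) 0)"
 unfolding int_hom_carrier using linear_restrict[OF complexD(1)[OF R] chain_mapD(1)[OF t]] by (simp add: restr_def)
 show "Diff (int_hom k R S) 0 (restr R t) = \<zero>\<^bsub>Deg (int_hom k R S) 1\<^esub>"
 unfolding int_hom_zero int_hom_Diff restr_def
 proof (intro ext)
 fix p x
 interpret V: module k "Deg S (p + 1)" using S by (simp add: complex_def)
 have "Diff S p (t p x) : carrier (Deg S (p + 1))" if "x : carrier (Deg R p)"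
 by (rule complexD(3)[OF S linear_onD(1)[OF chain_mapD(1)[OF t] that]])
 moreover have "Diff R p x : carrier (Deg R (p + 1))" if "x : carrier (Deg R p)"
 by (rule complexD(3)[OF R that])
 ultimately show "(\<lambda>x\<in>carrier (Deg R p). Diff S p ((\<lambda>x\<in>carrier (Deg R p). t p x) x) \<ominus>\<^bsub>Deg S (p + 1)\<^esub>
 (\<lambda>x\<in>carrier (Deg R (p + 1)). t (p + 1) x) (Diff R p x)) x = (\<lambda>x\<in>carrier (Deg R p). \<zero>\<^bsub>Deg S (p + 1)\<^esub>) x"
 using chain_mapD(2)[OF t, of x p] by (simp add: a_minus_def V.r_neg)
 qed
qed

lemma int_hom_closed:
 assumes R: "complex k R" and S: "complex k S" and h: "h : carrier (Deg (int_hom k R S) 0)"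
 and z: "Diff (int_hom k R S) 0 h = \<zero>\<^bsub>Deg (int_hom k R S) 1\<^esub>"
 shows "chain_map k R S h"
 unfolding chain_map_def
proof (intro conjI allI ballI)
 show hl: "linear_on k (Deg R n) (Deg S n) (h n)" for n using h unfolding int_hom_carrier by simp
 fix n x assume x: "x : carrier (Deg R n)"
 interpret V: module k "Deg S (n + 1)" using S by (simp add: complex_def)
 have c: "Diff S n (h n x) : carrier (Deg S (n + 1))" "h (n + 1) (Diff R n x) : carrier (Deg S (n + 1))"
 by (rule complexD(3)[OF S linear_onD(1)[OF hl x]], rule linear_onD(1)[OF hl complexD(3)[OF R x]])
 have "Diff S n (h n x) \<ominus>\<^bsub>Deg S (n + 1)\<^esub> h (n + 1) (Diff R n x) = \<zero>\<^bsub>Deg S (n + 1)\<^esub>"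
 using fun_cong[OF fun_cong[OF z[unfolded int_hom_zero int_hom_Diff], of n], of x] x by (simp add: restr_def)
 then show "h (n + 1) (Diff R n x) = Diff S n (h n x)"
 using c V.minus_equality[of "Diff S n (h n x)" "\<ominus>\<^bsub>Deg S (n + 1)\<^esub> h (n + 1) (Diff R n x)"] by (simp add: a_minus_def)
qed

text \<open>The enriched adjunction restated by a universal element: \<open>et\<close> is the chain
  map from \<open>R\<close> to \<open>M(A, V)\<close> that corresponds to the identity of the tensor
  \<open>V\<close>. Cycles of degree 0 in the internal Hom are chain maps, so arrows out of
  \<open>V\<close> are exactly chain maps out of \<open>R\<close>.\<close>

lemma (in dgc) tensor_universal:
 fixes elts :: "'m => 'm set" and R :: "('k, 'm) cplx"
 assumes te: "tensored elts k M" and A: "A : DObj M" and R: "complex k R" "small_complex elts R"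
 shows "EX V:DObj M. EX et. chain_map k R (DHom M A V) et &
 (ALL B:DObj M. ALL t. chain_map k R (DHom M A B) t -->
 (EX v:Arr UM V B. ALL n. ALL x:carrier (Deg R n). DCmp M A V B 0 n v (et n x) = t n x)) &
 (ALL B:DObj M. ALL v:Arr UM V B. ALL v':Arr UM V B.
 (ALL n. ALL x:carrier (Deg R n). DCmp M A V B 0 n v (et n x) = DCmp M A V B 0 n v' (et n x)) --> v = v')"
proof -
 obtain T phv where F: "is_functor (prod_cat UM (underlying (K_dg elts k))) UM T"
 and ci0: "ALL A:DObj M. ALL R:DObj (K_dg elts k). ALL B:DObj M. chain_iso k (int_hom k R (DHom M A B)) (DHom M (FO T (A, R)) B) (phv A R B)"
 and nat: "ALL A:DObj M. ALL A':DObj M. ALL B:DObj M. ALL B':DObj M. ALL R:DObj (K_dg elts k). ALL R':DObj (K_dg elts k).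
 ALL a:Arr UM A' A. ALL b:Arr UM B B'. ALL r:Arr (underlying (K_dg elts k)) R' R.
 ALL n. ALL h:carrier (Deg (int_hom k R (DHom M A B)) n).
 phv A' R' B' n (hom_hom_map elts k M R R' A A' B B' r a b n h) =
 hom_map M (FO T (A, R)) (FO T (A', R')) B B' (FA T (A', R') (A, R) (a, r)) b n (phv A R B n h)"
 using te unfolding tensored_def by (elim exE conjE) (rule that)
 have RK: "R : DObj (K_dg elts k)" using R by (simp add: K_dg_def)
 define V where "V = FO T (A, R)"
 have V: "V : DObj M"
 using F[unfolded is_functor_def, THEN conjunct1, THEN bspec, of "(A, R)"] A RK by (simp add: V_def prod_cat_def underlying_def)
 have ci: "chain_iso k (int_hom k R (DHom M A B)) (DHom M V B) (phv A R B)" if "B : DObj M" for B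
 using ci0[THEN bspec[OF _ A], THEN bspec[OF _ RK], THEN bspec[OF _ that]] unfolding V_def .
 have cm: "chain_map k (int_hom k R (DHom M A B)) (DHom M V B) (phv A R B)"
 and bij: "bij_betw (phv A R B n) (carrier (Deg (int_hom k R (DHom M A B)) n)) (homs M V B n)" if "B : DObj M" for B n
 using ci[OF that] unfolding chain_iso_def by simp_all
 have inj: "h = h'" if "B : DObj M" "h : carrier (Deg (int_hom k R (DHom M A B)) n)" "h' : carrier (Deg (int_hom k R (DHom M A B)) n)"
 "phv A R B n h = phv A R B n h'" for B n h h'
 by (rule inj_onD[OF bij_betw_imp_inj_on[OF bij[OF that(1)]] that(4,2,3)])
 have cAB: "complex k (DHom M A B)" if "B : DObj M" for B using dg_cplx A that by blast
 \<comment> \<open>Preservation of zero follows from additivity: the image of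
   \<open>z + z = z\<close> is an element of a group equal to its own double.\<close>
 have z: "\<zero>\<^bsub>Deg (int_hom k R (DHom M A B)) n\<^esub> : carrier (Deg (int_hom k R (DHom M A B)) n)"
 "phv A R B n \<zero>\<^bsub>Deg (int_hom k R (DHom M A B)) n\<^esub> = \<zero>\<^bsub>Deg (DHom M V B) n\<^esub>" if B: "B : DObj M" for B n
 proof -
 let ?z = "\<zero>\<^bsub>Deg (int_hom k R (DHom M A B)) n\<^esub>"
 have m: "module k (Deg (DHom M A B) p)" "module k (Deg R p)" for p using dg_mod[OF A B] R by (simp_all add: complex_def)
 have "linear_on k (Deg R p) (Deg (DHom M A B) (p + n)) (\<lambda>x\<in>carrier (Deg R p). \<zero>\<^bsub>Deg (DHom M A B) (p + n)\<^esub>)" for p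
 proof -
 interpret W: module k "Deg (DHom M A B) (p + n)" by (rule m)
 show ?thesis by (rule linear_restrict[OF m(2)]) (simp add: linear_on_def W.smult_r_null)
 qed
 then show zc: "?z : carrier (Deg (int_hom k R (DHom M A B)) n)" unfolding int_hom_carrier int_hom_zero restr_def by simp
 have "?z \<oplus>\<^bsub>Deg (int_hom k R (DHom M A B)) n\<^esub> ?z = ?z"
 proof -
 have "\<zero>\<^bsub>Deg (DHom M A B) p\<^esub> \<oplus>\<^bsub>Deg (DHom M A B) p\<^esub> \<zero>\<^bsub>Deg (DHom M A B) p\<^esub> = \<zero>\<^bsub>Deg (DHom M A B) p\<^esub>" for p
 proof - interpret W: module k "Deg (DHom M A B) p" by (rule m) show ?thesis by simp qed
 then show ?thesis by (auto simp: int_hom_def fun_eq_iff restrict_def)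
 qed
 then have e: "phv A R B n ?z \<oplus>\<^bsub>Deg (DHom M V B) n\<^esub> phv A R B n ?z = phv A R B n ?z"
 using linear_onD(2)[OF chain_mapD(1)[OF cm[OF B]] zc zc] by simp
 have c: "phv A R B n ?z : homs M V B n" by (rule linear_onD(1)[OF chain_mapD(1)[OF cm[OF B]] zc])
 interpret W: module k "Deg (DHom M V B) n" using dg_mod V B by blast
 show "phv A R B n ?z = \<zero>\<^bsub>Deg (DHom M V B) n\<^esub>" using e c by simp
 qed
 have "DId M V : phv A R V 0 ` carrier (Deg (int_hom k R (DHom M A V)) 0)"
 using bij[OF V, of 0] dg_id(1)[OF V] unfolding bij_betw_def by simp
 then obtain et where et: "et : carrier (Deg (int_hom k R (DHom M A V)) 0)" "phv A R V 0 et = DId M V" by (elim imageE) (rule that, simp_all)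
 have dc: "Diff (int_hom k R S) 0 h : carrier (Deg (int_hom k R S) 1)"
 if "complex k S" "h : carrier (Deg (int_hom k R S) 0)" for S :: "('k, 'm) cplx" and h
 proof -
 have hl: "linear_on k (Deg R n) (Deg S n) (h n)" for n using that(2) unfolding int_hom_carrier by simp
 have lin: "linear_on k (Deg R p) (Deg S (p + 1)) (%x. Diff S p (h p x) \<ominus>\<^bsub>Deg S (p + 1)\<^esub> h (p + 1) (Diff R p x))" for p
 by (rule linear_minus[OF complexD(1)[OF that(1)] linear_comp[OF hl complexD(2)[OF that(1)]] linear_comp[OF complexD(2)[OF R(1)] hl]])
 show ?thesis unfolding int_hom_carrier int_hom_Diff restr_def
 using linear_restrict[OF complexD(1)[OF R(1)] lin] by simp
 qed
 have hc: "chain_map k R (DHom M A V) et"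
 proof (rule int_hom_closed[OF R(1) cAB[OF V] et(1)])
 show "Diff (int_hom k R (DHom M A V)) 0 et = \<zero>\<^bsub>Deg (int_hom k R (DHom M A V)) 1\<^esub>"
 proof (rule inj[OF V dc[OF cAB[OF V] et(1)] z(1)[OF V]])
 show "phv A R V 1 (Diff (int_hom k R (DHom M A V)) 0 et) = phv A R V 1 \<zero>\<^bsub>Deg (int_hom k R (DHom M A V)) 1\<^esub>"
 using chain_mapD(2)[OF cm[OF V] et(1)] et(2) dg_id(2)[OF V] z(2)[OF V] by simp
 qed
 qed
 note etl = linear_onD[OF chain_mapD(1)[OF hc]]
 \<comment> \<open>Naturality at the identities of \<open>A\<close> and \<open>R\<close>, applied to
   \<open>et\<close>: the arrow \<open>b\<close> corresponds to the chain map obtained by composing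
   \<open>et\<close> with \<open>b\<close>.\<close>
 have key: "restr R (%n x. DCmp M A V B 0 n b (et n x)) : carrier (Deg (int_hom k R (DHom M A B)) 0)"
 "phv A R B 0 (restr R (%n x. DCmp M A V B 0 n b (et n x))) = b" if B: "B : DObj M" and b: "b : Arr UM V B" for B b
 proof -
 have bc: "b : homs M V B 0" using b by (simp add: underlying_def)
 have idA: "DId M A : Arr UM A A" using dg_id[OF A] by (simp add: underlying_def)
 let ?r = "restr R (%p x. x)"
 have "chain_map k R R (%p x. x)" by (simp add: chain_map_def linear_on_def)
 from closed_int_hom[OF R(1) R(1) this] have r: "?r : Arr (underlying (K_dg elts k)) R R"
 by (simp add: underlying_def K_dg_def)
 have rr: "Idn (underlying (K_dg elts k)) R = ?r" by (simp add: underlying_def K_dg_def restr_def)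
 have "FA T (A, R) (A, R) (Idn (prod_cat UM (underlying (K_dg elts k))) (A, R)) = Idn UM (FO T (A, R))"
 using F[unfolded is_functor_def, THEN conjunct2, THEN conjunct2, THEN conjunct1, THEN bspec, of "(A, R)"] A RK
 by (simp add: prod_cat_def underlying_def)
 then have Tid: "FA T (A, R) (A, R) (DId M A, ?r) = DId M V" unfolding V_def using rr by (simp add: prod_cat_def underlying_def)
 have lin: "linear_on k (Deg R p) (Deg (DHom M A B) (p + 0)) (%x. DCmp M A V B 0 p b (et p x))" for p
 using linear_comp[OF chain_mapD(1)[OF hc] dg_linr[OF A V B bc]] by simp
 show "restr R (%n x. DCmp M A V B 0 n b (et n x)) : carrier (Deg (int_hom k R (DHom M A B)) 0)"
 unfolding int_hom_carrier restr_def using linear_restrict[OF complexD(1)[OF R(1)] lin] by simp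
 have "hom_hom_map elts k M R R A A V B ?r (DId M A) b 0 et = restr R (%n x. DCmp M A V B 0 n b (et n x))"
 unfolding hom_hom_map_def K_dg_def hom_map_def restr_def
 by (intro ext) (simp add: restrict_def etl dg_unit(1)[OF A V])
 moreover have "hom_map M V V V B (DId M V) b 0 (DId M V) = b"
 using dg_id(1)[OF V] dg_unit[OF V V dg_id(1)[OF V]] dg_unit(1)[OF V B bc] by (simp add: hom_map_def)
 ultimately show "phv A R B 0 (restr R (%n x. DCmp M A V B 0 n b (et n x))) = b"
 using nat[THEN bspec[OF _ A], THEN bspec[OF _ A], THEN bspec[OF _ V], THEN bspec[OF _ B], THEN bspec[OF _ RK], THEN bspec[OF _ RK],
 THEN bspec[OF _ idA], THEN bspec[OF _ b], THEN bspec[OF _ r], THEN spec, THEN bspec[OF _ et(1)]]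
 unfolding V_def[symmetric] Tid et(2) by simp
 qed
 have ex: "EX v:Arr UM V B. ALL n. ALL x:carrier (Deg R n). DCmp M A V B 0 n v (et n x) = t n x"
 if B: "B : DObj M" and t: "chain_map k R (DHom M A B) t" for B t
 proof -
 note c = closed_int_hom[OF R(1) cAB[OF B] t]
 define v where "v = phv A R B 0 (restr R t)"
 have v: "v : Arr UM V B"
 using linear_onD(1)[OF chain_mapD(1)[OF cm[OF B]] c(1)] chain_mapD(2)[OF cm[OF B] c(1)] c(2) z(2)[OF B]
 by (simp add: underlying_def v_def)
 have "restr R (%n x. DCmp M A V B 0 n v (et n x)) = restr R t"
 by (rule inj[OF B key(1)[OF B v] c(1)]) (use key(2)[OF B v] in "simp add: v_def")
 then have e: "restr R (%n x. DCmp M A V B 0 n v (et n x)) n x = restr R t n x" for n x by simp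
 have "DCmp M A V B 0 n v (et n x) = t n x" if "x : carrier (Deg R n)" for n x
 using e[of n x] that by (simp add: restr_def)
 then show ?thesis using v by blast
 qed
 have un: "v = v'" if B: "B : DObj M" and v: "v : Arr UM V B" "v' : Arr UM V B"
 and eq: "ALL n. ALL x:carrier (Deg R n). DCmp M A V B 0 n v (et n x) = DCmp M A V B 0 n v' (et n x)" for B v v'
 proof -
 have "restr R (%n x. DCmp M A V B 0 n v (et n x)) = restr R (%n x. DCmp M A V B 0 n v' (et n x))"
 unfolding restr_def by (rule ext, rule restrict_ext, rule eq[THEN spec, THEN bspec])
 from arg_cong[OF this, of "phv A R B 0"] show ?thesis unfolding key(2)[OF B v(1)] key(2)[OF B v(2)] .
 qed
 show ?thesis
 by (rule bexI[OF _ V], rule exI[of _ et], rule conjI[OF hc conjI], intro ballI allI impI, rule ex, assumption+,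
 intro ballI impI, rule un, assumption+)
qed

section \<open>Families indexed by the commutative squares from a fixed arrow\<close>

context dgc begin

lemma UA_Obj [simp]: "f : UA ==> dm f : DObj M" "f : UA ==> cd f : DObj M"
 using arrows_Obj[of f UM] by simp_all

lemma GA_Obj [simp]: "f : GA ==> dm f : DObj M" "f : GA ==> cd f : DObj M"
 by (rule gr_arrD, assumption)+

text \<open>Squares of arbitrary degree with \<open>a\<close> and \<open>b\<close> not necessarily
  closed: these are the homogeneous elements of the Hom complex from \<open>i\<close> to
  \<open>p\<close> in the arrow category, in tagged form.\<close>

definition comm where
 "comm i p a b \<longleftrightarrow> a : GA & b : GA & dm a = dm i & cd a = dm p & dm b = cd i & cd b = cd p & deg b = deg a &
 io p $ a = b $ io i"

lemma commD:
 assumes "comm i p a b"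
 shows "a : GA" "b : GA" "dm a = dm i" "cd a = dm p" "dm b = cd i" "cd b = cd p" "deg b = deg a" "io p $ a = b $ io i"
 using assms unfolding comm_def by blast+

text \<open>A linear map of degree \<open>n\<close> from the complex of squares to
  \<open>M(A, B)\<close>, written as an operation on tagged arrows. The families that are chain maps
  are singled out below as \<open>chf\<close>.\<close>

definition fam where
 "fam i p n A B tu \<longleftrightarrow> (ALL a b. comm i p a b --> tu a b : GA & dm (tu a b) = A & cd (tu a b) = B & deg (tu a b) = n + deg a &
 (ALL c:carrier k. tu (sm c a) (sm c b) = sm c (tu a b)) &
 (ALL a' b'. comm i p a' b' --> deg a' = deg a --> tu (ad a a') (ad b b') = ad (tu a b) (tu a' b')))"

lemma famD:
 assumes "fam i p n A B tu" "comm i p a b"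
 shows "tu a b : GA" "dm (tu a b) = A" "cd (tu a b) = B" "deg (tu a b) = n + deg a"
 "c : carrier k ==> tu (sm c a) (sm c b) = sm c (tu a b)"
 "comm i p a' b' ==> deg a' = deg a ==> tu (ad a a') (ad b b') = ad (tu a b) (tu a' b')"
 using assms unfolding fam_def by blast+

lemma famI:
 assumes "!!a b. comm i p a b ==> tu a b : GA" "!!a b. comm i p a b ==> dm (tu a b) = A"
 "!!a b. comm i p a b ==> cd (tu a b) = B" "!!a b. comm i p a b ==> deg (tu a b) = n + deg a"
 "!!a b c. comm i p a b ==> c : carrier k ==> tu (sm c a) (sm c b) = sm c (tu a b)"
 "!!a b a' b'. comm i p a b ==> comm i p a' b' ==> deg a' = deg a ==> tu (ad a a') (ad b b') = ad (tu a b) (tu a' b')"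
 shows "fam i p n A B tu"
 unfolding fam_def by (intro allI impI conjI ballI assms)

definition chf where
 "chf i p A B tu \<longleftrightarrow> fam i p 0 A B tu & (ALL a b. comm i p a b --> tu (df a) (df b) = df (tu a b))"

context
 fixes i p assumes i: "i : UA" and p: "p : UA"
begin

lemma comm_df: assumes "comm i p a b" shows "comm i p (df a) (df b)"
proof -
 note c = commD[OF assms]
 have "df (io p $ a) = io p $ df a" using leibniz_left[of a "io p"] c p by (simp add: sg_def)
 moreover have "df (b $ io i) = df b $ io i" by (rule leibniz_right) (use c i in simp_all)
 ultimately show ?thesis unfolding comm_def using c by simp
qed

lemma comm_sm: assumes "comm i p a b" "c : carrier k" shows "comm i p (sm c a) (sm c b)"
 unfolding comm_def using commD[OF assms(1)] assms(2) i p by (simp add: cmp_sm_left cmp_sm_right)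

lemma comm_ad: assumes "comm i p a b" "comm i p a' b'" "deg a' = deg a" shows "comm i p (ad a a') (ad b b')"
 unfolding comm_def using commD[OF assms(1)] commD[OF assms(2)] assms(3) i p by (simp add: cmp_ad_left cmp_ad_right par_def)

lemma arr1_mem: "(x, y) : homs (arr1 M) i p n \<longleftrightarrow> comm i p (dm i, dm p, n, x) (cd i, cd p, n, y)"
proof -
 obtain A B f A' B' g where e: "i = (A, B, f)" "p = (A', B', g)" by (metis prod_cases3)
 show ?thesis using arrows_Obj[OF i] arrows_Obj[OF p] unfolding e
 by (auto simp: arr1_def comm_def gr_arrows gr_cmp io_def)
qed

lemma arr1_ops:
 "(x, y) \<oplus>\<^bsub>Deg (DHom (arr1 M) i p) n\<^esub> (x', y') = (x \<oplus>\<^bsub>Deg (DHom M (dm i) (dm p)) n\<^esub> x', y \<oplus>\<^bsub>Deg (DHom M (cd i) (cd p)) n\<^esub> y')"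
 "c \<odot>\<^bsub>Deg (DHom (arr1 M) i p) n\<^esub> (x, y) = (c \<odot>\<^bsub>Deg (DHom M (dm i) (dm p)) n\<^esub> x, c \<odot>\<^bsub>Deg (DHom M (cd i) (cd p)) n\<^esub> y)"
 "Diff (DHom (arr1 M) i p) n (x, y) = (Diff (DHom M (dm i) (dm p)) n x, Diff (DHom M (cd i) (cd p)) n y)"
 by (cases i; cases p; simp add: arr1_def prod_module_def)+

lemma comm_mem: "comm i p a b ==> (val a, val b) : homs (arr1 M) i p (deg a)"
 unfolding arr1_mem using commD[of i p a b] by (metis prod.collapse)

lemma chf_chain_map:
 assumes t: "chf i p A B tu"
 shows "chain_map k (DHom (arr1 M) i p) (DHom M A B) (%n s. val (tu (dm i, dm p, n, fst s) (cd i, cd p, n, snd s)))"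
proof -
 have f: "fam i p 0 A B tu" and d: "!!a b. comm i p a b ==> tu (df a) (df b) = df (tu a b)" using t unfolding chf_def by blast+
 let ?a = "%n x. (dm i, dm p, n, x)" and ?b = "%n y. (cd i, cd p, n :: int, y)"
 note F = famD[OF f]
 have L: "linear_on k (Deg (DHom (arr1 M) i p) n) (Deg (DHom M A B) n) (%s. val (tu (?a n (fst s)) (?b n (snd s))))" for n
 unfolding linear_on_def
 proof (intro conjI ballI funcsetI)
 fix s assume s: "s : homs (arr1 M) i p n"
 obtain x y where xy: "s = (x, y)" by (cases s)
 have c: "comm i p (?a n x) (?b n y)" using s unfolding xy arr1_mem .
 show "val (tu (?a n (fst s)) (?b n (snd s))) : homs M A B n"
 using gr_arrD(3)[OF F(1)[OF c]] F(2-4)[OF c] by (simp add: xy)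
 show "val (tu (?a n (fst (c \<odot>\<^bsub>Deg (DHom (arr1 M) i p) n\<^esub> s))) (?b n (snd (c \<odot>\<^bsub>Deg (DHom (arr1 M) i p) n\<^esub> s)))) =
 c \<odot>\<^bsub>Deg (DHom M A B) n\<^esub> val (tu (?a n (fst s)) (?b n (snd s)))" if "c : carrier k" for c
 using arg_cong[OF F(5)[OF c that], of val] F(2-4)[OF c] by (simp add: xy arr1_ops sm_def)
 fix s' assume s': "s' : homs (arr1 M) i p n"
 obtain x' y' where xy': "s' = (x', y')" by (cases s')
 have c': "comm i p (?a n x') (?b n y')" using s' unfolding xy' arr1_mem .
 show "val (tu (?a n (fst (s \<oplus>\<^bsub>Deg (DHom (arr1 M) i p) n\<^esub> s'))) (?b n (snd (s \<oplus>\<^bsub>Deg (DHom (arr1 M) i p) n\<^esub> s')))) =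
 val (tu (?a n (fst s)) (?b n (snd s))) \<oplus>\<^bsub>Deg (DHom M A B) n\<^esub> val (tu (?a n (fst s')) (?b n (snd s')))"
 using arg_cong[OF F(6)[OF c c'], of val] F(2-4)[OF c] by (simp add: xy xy' arr1_ops ad_def)
 qed
 have D: "val (tu (?a (n + 1) (fst (Diff (DHom (arr1 M) i p) n s))) (?b (n + 1) (snd (Diff (DHom (arr1 M) i p) n s)))) =
 Diff (DHom M A B) n (val (tu (?a n (fst s)) (?b n (snd s))))" if s: "s : homs (arr1 M) i p n" for n s
 proof -
 obtain x y where xy: "s = (x, y)" by (cases s)
 have c: "comm i p (?a n x) (?b n y)" using s unfolding xy arr1_mem .
 show ?thesis using arg_cong[OF d[OF c], of val] F(2-4)[OF c] by (simp add: xy arr1_ops df_def)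
 qed
 show ?thesis unfolding chain_map_def by (intro conjI allI ballI L D)
qed

lemma chain_map_chf:
 assumes t: "chain_map k (DHom (arr1 M) i p) (DHom M A B) t" and AB: "A : DObj M" "B : DObj M"
 shows "chf i p A B (%a b. (A, B, deg a, t (deg a) (val a, val b)))"
 unfolding chf_def
proof (intro conjI famI allI impI)
 note l = linear_onD[OF chain_mapD(1)[OF t]]
 fix a b assume c: "comm i p a b"
 note m = comm_mem[OF c] and cc = commD[OF c]
 show "(A, B, deg a, t (deg a) (val a, val b)) : GA" unfolding gr_arrows using AB l(1)[OF m] by simp
 show "(A, B, deg (sm ca a), t (deg (sm ca a)) (val (sm ca a), val (sm ca b))) = sm ca (A, B, deg a, t (deg a) (val a, val b))"
 if "ca : carrier k" for ca using l(3)[OF that m] cc by (simp add: sm_def arr1_ops)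
 show "(A, B, deg (df a), t (deg (df a)) (val (df a), val (df b))) = df (A, B, deg a, t (deg a) (val a, val b))"
 using chain_mapD(2)[OF t m] cc by (simp add: df_def arr1_ops)
 fix a' b' assume c': "comm i p a' b'" and e: "deg a' = deg a"
 show "(A, B, deg (ad a a'), t (deg (ad a a')) (val (ad a a'), val (ad b b'))) =
 ad (A, B, deg a, t (deg a) (val a, val b)) (A, B, deg a', t (deg a') (val a', val b'))"
 using l(2)[OF m, of "(val a', val b')"] comm_mem[OF c'] e cc by (simp add: ad_def arr1_ops)
qed simp_all

end

end

text \<open>\<open>I\<close> is a set of generators and \<open>S\<close> the class of maps it is
  meant to generate: the cofibrations in one application, the trivial cofibrations in the
  other.\<close>

locale gen = ptr k M + universe elts
 for k :: "'k ring" and M :: "('o, 'k, 'u) dgcat" and elts :: "'u => 'u set" +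
 fixes I S :: "('o \<times> 'o \<times> 'u) set"
 assumes Kc: "K_category elts k M" and te: "tensored elts k M" and hsc: "has_small_colimits elts UM"
 and I: "I \<subseteq> S" "small elts I" "permits_small_object_argument elts UM I"
 and S: "S \<subseteq> UA" "stable_under_shifts k M S" "stable_under_iCone k M S" "S \<subseteq> U.llp (rlp UM I)"
begin

text \<open>\<open>V\<close> is the tensor of \<open>A\<close> with the complex of squares from
  \<open>i\<close> to \<open>p\<close>, recoded by \<open>kpair\<close> so that it consists of
  elements of \<open>'u\<close>, and \<open>e\<close> is its universal family. Families that are
  chain maps are thus represented by arrows out of \<open>V\<close>.\<close>

lemma tensor_comm:
 assumes i: "i : UA" and p: "p : UA" and A: "A : DObj M"
 shows "EX V e. V : DObj M & chf i p A V e &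
 (ALL B tu. B : DObj M --> chf i p A B tu --> (EX v:UA. dm v = V & cd v = B & (ALL a b. comm i p a b --> io v $ e a b = tu a b))) &
 (ALL v v'. v : UA --> v' : UA --> dm v = V --> dm v' = V --> cd v = cd v' -->
 (ALL a b. comm i p a b --> io v $ e a b = io v' $ e a b) --> v = v')"
proof -
 define E :: "'u \<times> 'u => 'u" where "E = case_prod kpair"
 have E: "inj E" by (auto simp: E_def inj_on_def kpair_inject)
 define K where "K = DHom (arr1 M) i p"
 have Kx: "complex k K" unfolding K_def by (rule arr1_complex[OF i p])
 note tr = transport_complex[OF Kx E]
 let ?R = "transport E K"
 have "small_complex elts ?R"
 unfolding small_complex_def
 proof
 fix n
 have s: "small elts (homs M X Y n)" if "X : DObj M" "Y : DObj M" for X Y using Kc that by (simp add: K_category_def small_complex_def)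
 have "small elts (homs M (dm i) (dm p) n \<times> homs M (cd i) (cd p) n)"
 using small_Times[OF s s] arrows_Obj[OF i] arrows_Obj[OF p] by simp
 moreover have "carrier (Deg K n) \<subseteq> homs M (dm i) (dm p) n \<times> homs M (cd i) (cd p) n"
 unfolding K_def using arr1_mem[OF i p] by (auto simp: comm_def gr_arrows)
 ultimately show "small elts (carrier (Deg ?R n))" unfolding tr(2) by (intro small_image) (rule small_subset)
 qed
 from tensor_universal[OF te A tr(1) this] obtain V et where V: "V : DObj M" and h: "chain_map k ?R (DHom M A V) et"
 and ex: "ALL B:DObj M. ALL t. chain_map k ?R (DHom M A B) t -->
 (EX v:Arr UM V B. ALL n. ALL x:carrier (Deg ?R n). DCmp M A V B 0 n v (et n x) = t n x)"
 and un: "ALL B:DObj M. ALL v:Arr UM V B. ALL v':Arr UM V B.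
 (ALL n. ALL x:carrier (Deg ?R n). DCmp M A V B 0 n v (et n x) = DCmp M A V B 0 n v' (et n x)) --> v = v'"
 by (elim bexE exE conjE) (rule that)
 note hl = linear_onD[OF chain_mapD(1)[OF h]]
 interpret Kab: module k "Deg K n" for n using Kx by (simp add: complex_def)
 have Kd: "x : carrier (Deg K n) ==> Diff K n x : carrier (Deg K (n + 1))" for n x
 by (rule complexD(3)[OF Kx])
 have "chain_map k K (DHom M A V) (%n s. et n (E s))"
 proof -
 have El: "linear_on k (Deg K n) (Deg ?R n) E" for n by (auto simp: linear_on_def tr)
 have "et (n + 1) (E (Diff K n s)) = Diff (DHom M A V) n (et n (E s))" if "s : carrier (Deg K n)" for n s
 using chain_mapD(2)[OF h, of "E s" n] that by (simp add: tr)
 then show ?thesis unfolding chain_map_def using linear_comp[OF El chain_mapD(1)[OF h]] by blast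
 qed
 then have ef: "chf i p A V (%a b. (A, V, deg a, et (deg a) (E (val a, val b))))"
 unfolding K_def by (rule chain_map_chf[OF i p _ A V])
 let ?e = "%a b. (A, V, deg a, et (deg a) (E (val a, val b)))"
 have ve: "io v $ ?e a b = (A, cd v, deg a, DCmp M A V (cd v) 0 (deg a) (mor v) (et (deg a) (E (val a, val b))))"
 if "dm v = V" for v a b using that by (simp add: gr_cmp io_def)
 have x1: "EX v:UA. dm v = V & cd v = B & (ALL a b. comm i p a b --> io v $ ?e a b = tu a b)"
 if B: "B : DObj M" and t: "chf i p A B tu" for B tu
 proof -
 define t where "t n s = val (tu (dm i, dm p, n, fst s) (cd i, cd p, n, snd s))" for n s
 have tc: "chain_map k K (DHom M A B) t" using chf_chain_map[OF i p t] unfolding K_def t_def[abs_def] .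
 have Ei: "the_inv E (E s) = s" for s by (rule the_inv_f_f[OF E])
 have "chain_map k ?R (DHom M A B) (%n x. t n (the_inv E x))"
 proof -
 have El: "linear_on k (Deg ?R n) (Deg K n) (the_inv E)" for n by (auto simp: linear_on_def tr Ei)
 have "t (n + 1) (the_inv E (Diff ?R n x)) = Diff (DHom M A B) n (t n (the_inv E x))" if "x : carrier (Deg ?R n)" for n x
 using that chain_mapD(2)[OF tc] unfolding tr(2) by (elim imageE) (simp add: tr Ei)
 then show ?thesis unfolding chain_map_def using linear_comp[OF El chain_mapD(1)[OF tc]] by blast
 qed
 from ex[THEN bspec[OF _ B], THEN spec, THEN mp, OF this] obtain v where v: "v : Arr UM V B"
 and vt: "ALL n. ALL x:carrier (Deg ?R n). DCmp M A V B 0 n v (et n x) = t n (the_inv E x)" by (elim bexE)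
 show ?thesis
 proof (intro bexI[of _ "(V, B, v)"] conjI allI impI)
 show "(V, B, v) : UA" using v V B by (simp add: arrows_iff underlying_def del: arrows_Obj)
 fix a b assume c: "comm i p a b"
 have "E (val a, val b) : carrier (Deg ?R (deg a))" unfolding tr(2) unfolding K_def using comm_mem[OF i p c] by blast
 then have "DCmp M A V B 0 (deg a) v (et (deg a) (E (val a, val b))) = t (deg a) (val a, val b)" using vt Ei by simp
 moreover have ab: "(dm i, dm p, deg a, val a) = a" "(cd i, cd p, deg a, val b) = b" using commD[OF c] by (simp_all add: prod_eq_iff)
 moreover have "dm (tu a b) = A" "cd (tu a b) = B" "deg (tu a b) = deg a"
 using t famD(2-4)[OF _ c] unfolding chf_def by fastforce+
 ultimately show "io (V, B, v) $ ?e a b = tu a b" by (simp add: gr_cmp io_def t_def prod_eq_iff)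
 qed simp_all
 qed
 have x2: "v = v'" if v: "v : UA" "v' : UA" "dm v = V" "dm v' = V" "cd v = cd v'"
 and eq: "ALL a b. comm i p a b --> io v $ ?e a b = io v' $ ?e a b" for v v'
 proof -
 have B: "cd v : DObj M" using v by simp
 have "mor v = mor v'"
 proof (rule un[THEN bspec[OF _ B], THEN bspec, THEN bspec, THEN mp])
 show "mor v : Arr UM V (cd v)" using v(1)[unfolded arrows_iff] v(3) by simp
 show "mor v' : Arr UM V (cd v)" using v(2)[unfolded arrows_iff] v(4,5) by simp
 show "ALL n. ALL x:carrier (Deg ?R n). DCmp M A V (cd v) 0 n (mor v) (et n x) = DCmp M A V (cd v) 0 n (mor v') (et n x)"
 proof (intro allI ballI)
 fix n x assume "x : carrier (Deg ?R n)"
 then obtain y z where yz: "(y, z) : homs (arr1 M) i p n" "x = E (y, z)" unfolding tr(2) unfolding K_def by auto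
 have c: "comm i p (dm i, dm p, n, y) (cd i, cd p, n, z)" using yz(1) unfolding arr1_mem[OF i p] .
 show "DCmp M A V (cd v) 0 n (mor v) (et n x) = DCmp M A V (cd v) 0 n (mor v') (et n x)"
 using eq[THEN spec, THEN spec, THEN mp, OF c] v(5) unfolding ve[OF v(3)] ve[OF v(4)] by (simp add: yz(2))
 qed
 qed
 then show ?thesis using v by (simp add: prod_eq_iff)
 qed
 show ?thesis by (rule exI[of _ V], rule exI[of _ ?e], intro conjI allI impI V ef, rule x1, assumption+, rule x2, assumption+)
qed

end

section \<open>One step of the enriched small object argument\<close>

context dgc begin

lemma sm_ad:
 assumes "f : GA" "g : GA" "par f g" "c : carrier k" shows "sm c (ad f g) = ad (sm c f) (sm c g)"
proof -
 interpret V: module k "Deg (DHom M (dm g) (cd g)) (deg g)" using dg_mod gr_arrD[OF assms(2)] by blast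
 show ?thesis using gr_arrD(3)[OF assms(1)] gr_arrD(3)[OF assms(2)] assms(3,4) by (simp add: sm_def ad_def par_def V.smult_r_distr)
qed

lemma ad_swap:
 assumes "f : GA" "g : GA" "f' : GA" "g' : GA" "par f g" "par f f'" "par f g'"
 shows "ad (ad f g) (ad f' g') = ad (ad f f') (ad g g')"
proof -
 interpret V: abelian_group "Deg (DHom M (dm g') (cd g')) (deg g')" using dg_ab gr_arrD[OF assms(4)] by blast
 show ?thesis using gr_arrD(3)[OF assms(1)] gr_arrD(3)[OF assms(2)] gr_arrD(3)[OF assms(3)] gr_arrD(3)[OF assms(4)] assms(5-7)
 by (simp add: ad_def par_def V.a_ac)
qed

text \<open>The Leibniz rule for degree -1, solved for the first term: the sign turns the difference
  into a sum.\<close>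

lemma df_left:
 assumes z: "z : GA" "deg z = -1" and a: "a : GA" "cd a = dm z"
 shows "df z $ a = ad (df (z $ a)) (z $ df a)"
proof -
 have g: "df z $ a : GA" "z $ df a : GA" using z a by simp_all
 have "df (z $ a) = ad (df z $ a) (ng (z $ df a))" using leibniz[OF a(1) z(1) a(2)] z by (simp add: sg_def)
 then have "ad (df (z $ a)) (z $ df a) = ad (ad (df z $ a) (ng (z $ df a))) (z $ df a)" by simp
 also have "... = ad (df z $ a) (ad (ng (z $ df a)) (z $ df a))"
 by (rule ad_assoc) (use g z a in "simp_all add: par_def")
 also have "... = df z $ a" unfolding ad_ng(2)[OF g(2)] by (rule ad_zr(1)) (use g z a in simp_all)
 finally show ?thesis by simp
qed

text \<open>Extends the last part of \<open>disk_in\<close> to arrows of any degree; the values of a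
  family vary in degree with the square.\<close>

lemma disk_eps:
 assumes D: "disk E C n kav ep" and z: "z : GA" "cd z = E"
 shows "ep $ df (kav $ z) = z" "w : GA ==> cd w = E ==> ep $ kav $ w = zr (dm w) E (deg w - 1)"
proof -
 note d = diskD[OF D]
 have kz: "ep $ kav $ w = zr (dm w) E (deg w - 1)" if "w : GA" "cd w = E" for w
 proof -
 have "(ep $ kav) $ w = ep $ kav $ w" by (rule cmp_assoc) (use d(3-9) that in simp_all)
 then have "ep $ kav $ w = (ep $ kav) $ w" ..
 then show ?thesis unfolding d(11) using d that by simp
 qed
 then show "w : GA ==> cd w = E ==> ep $ kav $ w = zr (dm w) E (deg w - 1)" .
 have "ep $ df (kav $ z) = ep $ ad (df kav $ z) (sg (deg kav) (kav $ df z))" using leibniz[OF z(1) d(3)] z d by simp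
 also have "... = ad (ep $ df kav $ z) (ep $ sg (deg kav) (kav $ df z))"
 by (rule cmp_ad_right) (use z d in "simp_all add: par_def")
 also have "ep $ df kav $ z = (ep $ df kav) $ z"
 by (rule cmp_assoc[symmetric]) (use z d(3-9) in simp_all)
 also have "ep $ sg (deg kav) (kav $ df z) = zr (dm z) E (deg z)" using z d kz[of "df z"] arrows_Obj[OF z(1)] by simp
 also have "(ep $ df kav) $ z = z" unfolding d(12) using z d by simp
 finally show "ep $ df (kav $ z) = z" using z by simp
qed

lemma fam_left:
 assumes f: "fam i p n A B tu" and y: "y : GA" "dm y = B" "m = deg y + n"
 shows "fam i p m A (cd y) (%a b. y $ tu a b)"
 by (rule famI) (use famD[OF f] y in "simp_all add: cmp_sm_right cmp_ad_right par_def")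

lemma fam_right:
 assumes f: "fam i p n A B tu" and y: "y : GA" "cd y = A" "m = n + deg y"
 shows "fam i p m (dm y) B (%a b. tu a b $ y)"
 by (rule famI) (use famD[OF f] y in "simp_all add: cmp_sm_left cmp_ad_left par_def")

lemma fam_df:
 assumes f: "fam i p n A B tu" and m: "m = n + 1" shows "fam i p m A B (%a b. df (tu a b))"
 by (rule famI) (use famD[OF f] m in "simp_all add: df_sm df_ad par_def")

lemma fam_add:
 assumes f: "fam i p n A B tu" and g: "fam i p n A B si" shows "fam i p n A B (%a b. ad (tu a b) (si a b))"
 by (rule famI) (use famD[OF f] famD[OF g] in "simp_all add: sm_ad ad_swap par_def")

context
 fixes i p assumes i: "i : UA" and p: "p : UA"
begin

lemma fam_pre:
 assumes f: "fam i p n A B tu" and m: "m = n + 1" shows "fam i p m A B (%a b. tu (df a) (df b))"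
proof (rule famI)
 fix a b assume c: "comm i p a b"
 note F = famD[OF f comm_df[OF i p c]] and cc = commD[OF c]
 show "tu (df a) (df b) : GA" "dm (tu (df a) (df b)) = A" "cd (tu (df a) (df b)) = B" "deg (tu (df a) (df b)) = m + deg a"
 using F(1-4) m by simp_all
 show "tu (df (sm ca a)) (df (sm ca b)) = sm ca (tu (df a) (df b))" if "ca : carrier k" for ca
 using F(5)[OF that] cc that by (simp add: df_sm)
 fix a' b' assume c': "comm i p a' b'" and e: "deg a' = deg a"
 show "tu (df (ad a a')) (df (ad b b')) = ad (tu (df a) (df b)) (tu (df a') (df b'))"
 using F(6)[OF comm_df[OF i p c']] cc commD[OF c'] e by (simp add: df_ad par_def)
qed

lemma comm_zr: "comm i p (zr (dm i) (dm p) n) (zr (cd i) (cd p) n)"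
 unfolding comm_def using i p by simp

lemma fam_zr:
 assumes f: "fam i p n A B tu" shows "tu (zr (dm i) (dm p) m) (zr (cd i) (cd p) m) = zr A B (n + m)"
proof -
 let ?a = "zr (dm i) (dm p) m" and ?b = "zr (cd i) (cd p) m"
 have g: "?a : GA" "?b : GA" using i p by simp_all
 note F = famD[OF f comm_zr[of m]]
 have O: "A : DObj M" "B : DObj M" using gr_arrD(1,2)[OF F(1)] F(2,3) by simp_all
 have "ad (tu ?a ?b) (tu ?a ?b) = tu (ad ?a ?a) (ad ?b ?b)" using F(6)[OF comm_zr[of m]] by simp
 also have "... = ad (zr A B (n + m)) (tu ?a ?b)" using g F(1-4) by simp
 finally show ?thesis by (rule ad_cancel[rotated 5]) (use F(1-4) O in "simp_all add: par_def")
qed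

lemma chf_fst: "chf i p (dm i) (dm p) (%a b. a)" and chf_snd: "chf i p (cd i) (cd p) (%a b. b)"
 unfolding chf_def by (auto intro!: famI dest: commD)

lemma arr1_zero: "\<zero>\<^bsub>Deg (DHom (arr1 M) i p) n\<^esub> = (\<zero>\<^bsub>Deg (DHom M (dm i) (dm p)) n\<^esub>, \<zero>\<^bsub>Deg (DHom M (cd i) (cd p)) n\<^esub>)"
 by (cases i; cases p; simp add: arr1_def prod_module_def)

lemma chf_left: "chf i p A B tu ==> y : UA ==> dm y = B ==> chf i p A (cd y) (%a b. io y $ tu a b)"
 and chf_right: "chf i p A B tu ==> w : UA ==> cd w = A ==> chf i p (dm w) B (%a b. tu a b $ io w)"
proof -
 assume c: "chf i p A B tu"
 then have f: "fam i p 0 A B tu" and d: "!!a b. comm i p a b ==> tu (df a) (df b) = df (tu a b)" unfolding chf_def by blast+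
 { assume y: "y : UA" "dm y = B"
 have "fam i p 0 A (cd (io y)) (%a b. io y $ tu a b)" by (rule fam_left[OF f]) (use y in simp_all)
 moreover have "io y $ tu (df a) (df b) = df (io y $ tu a b)" if "comm i p a b" for a b
 using leibniz_left[of "tu a b" "io y"] famD[OF f that] d[OF that] y by (simp add: sg_def)
 ultimately show "chf i p A (cd y) (%a b. io y $ tu a b)" unfolding chf_def by simp }
 { assume w: "w : UA" "cd w = A"
 have "fam i p 0 (dm (io w)) B (%a b. tu a b $ io w)" by (rule fam_right[OF f]) (use w in simp_all)
 moreover have "tu (df a) (df b) $ io w = df (tu a b $ io w)" if "comm i p a b" for a b
 using leibniz_right[of "io w" "tu a b"] famD[OF f that] d[OF that] w by simp
 ultimately show "chf i p (dm w) B (%a b. tu a b $ io w)" unfolding chf_def by simp }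
qed

text \<open>The chain map into the disk object that classifies a family of degree \<open>n\<close>.\<close>

lemma chf_disk:
 assumes f: "fam i p n A E tu" and D: "disk E C n kav ep"
 shows "chf i p A C (%a b. ad (df (kav $ tu a b)) (kav $ tu (df a) (df b)))"
proof -
 note d = diskD[OF D]
 have f1: "fam i p (-1) A (cd kav) (%a b. kav $ tu a b)" by (rule fam_left[OF f]) (use d in simp_all)
 have f2: "fam i p 0 A (cd kav) (%a b. df (kav $ tu a b))" by (rule fam_df[OF f1]) simp
 have f3: "fam i p 0 A (cd kav) (%a b. kav $ tu (df a) (df b))" by (rule fam_pre[OF f1]) simp
 \<comment> \<open>With f the degree -1 family \<open>kav $ tu a b\<close>, this is the differential
   d f + f d of f in the internal Hom complex, which explains why it is a chain map.\<close>
 have f4: "fam i p 0 A C (%a b. ad (df (kav $ tu a b)) (kav $ tu (df a) (df b)))" using fam_add[OF f2 f3] d by simp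
 have "ad (df (kav $ tu (df a) (df b))) (kav $ tu (df (df a)) (df (df b))) = df (ad (df (kav $ tu a b)) (kav $ tu (df a) (df b)))"
 if c: "comm i p a b" for a b
 proof -
 note cc = commD[OF c] and F1 = famD[OF f1 c] and F2 = famD[OF f2 c] and F3 = famD[OF f3 c]
 have AC: "A : DObj M" "C : DObj M" using gr_arrD(1,2)[OF F1(1)] F1(2,3) d by simp_all
 have z: "tu (df (df a)) (df (df b)) = zr A E (n + (deg a + 2))"
 using fam_zr[OF f, of "deg a + 2"] df_df[OF cc(1)] df_df[OF cc(2)] cc by simp
 have "kav $ tu (df (df a)) (df (df b)) = zr A C (deg a + 1)" unfolding z using d AC by (simp add: ac_simps)
 then have "ad (df (kav $ tu (df a) (df b))) (kav $ tu (df (df a)) (df (df b))) = df (kav $ tu (df a) (df b))"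
 using F3 d by simp
 moreover have "df (ad (df (kav $ tu a b)) (kav $ tu (df a) (df b))) = ad (df (df (kav $ tu a b))) (df (kav $ tu (df a) (df b)))"
 by (rule df_ad) (use F2 F3 in "simp_all add: par_def")
 moreover have "df (df (kav $ tu a b)) = zr A C (deg a + 1)" using df_df[OF F1(1)] F1 d by (simp add: add.commute)
 ultimately show ?thesis using F3 d by simp
 qed
 then show ?thesis unfolding chf_def using f4 by simp
qed

end

end

context gen begin

abbreviation "RI \<equiv> rlp UM I"

lemma I_UA: "i : I ==> i : UA" using I(1) S(1) by blast

lemma RI_UA: "RI \<subseteq> UA" by (auto simp: rlp_def)

definition tens where
 "tens i p A V e \<longleftrightarrow> V : DObj M & chf i p A V e &
 (ALL B tu. B : DObj M --> chf i p A B tu --> (EX v:UA. dm v = V & cd v = B & (ALL a b. comm i p a b --> io v $ e a b = tu a b))) &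
 (ALL v v'. v : UA --> v' : UA --> dm v = V --> dm v' = V --> cd v = cd v' -->
 (ALL a b. comm i p a b --> io v $ e a b = io v' $ e a b) --> v = v')"

lemma tensD:
 assumes "tens i p A V e"
 shows "V : DObj M" "chf i p A V e"
 "B : DObj M ==> chf i p A B tu ==> EX v. v : UA & dm v = V & cd v = B & (ALL a b. comm i p a b --> io v $ e a b = tu a b)"
 "v : UA ==> v' : UA ==> dm v = V ==> dm v' = V ==> cd v = cd v' ==>
 (!!a b. comm i p a b ==> io v $ e a b = io v' $ e a b) ==> v = v'"
 using assms unfolding tens_def by blast+

text \<open>Lifts for all squares are wanted simultaneously and as a chain map. Single lifts exist
  in every degree by \<open>enriched_lift\<close>, and closed ones over cycles by
  \<open>enriched_lift_closed\<close>; \<open>chain_lift\<close> turns these into a linear choice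
  commuting with the differential.\<close>

lemma comm_lift:
 assumes i: "i : I" and p: "p : UA" and t: "chf i p (cd i) Y t" and v: "v : UA" "dm v = Y" and u: "u : UA" "dm u = dm p"
 and q: "q : RI" "cd u = dm q" "cd v = cd q" and sq: "!!a b. comm i p a b ==> io q $ io u $ a = (io v $ t a b) $ io i"
 shows "EX tu. chf i p (cd i) (dm q) tu & (ALL a b. comm i p a b --> tu a b $ io i = io u $ a & io q $ tu a b = io v $ t a b)"
proof -
 have iU: "i : UA" and qU: "q : UA" using I_UA[OF i] q(1) RI_UA by blast+
 have O: "cd i : DObj M" "dm q : DObj M" using arrows_Obj[OF iU] arrows_Obj[OF qU] by simp_all
 have f: "fam i p 0 (cd i) Y t" and d: "!!a b. comm i p a b ==> t (df a) (df b) = df (t a b)" using t unfolding chf_def by blast+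
 have iS: "i : S" using i I(1) by blast
 let ?a = "%n s. (dm i, dm p, n, fst s)" and ?b = "%n s. (cd i, cd p, n :: int, snd s)" and ?y = "%n y. (cd i, dm q, n :: int, y)"
 \<comment> \<open>\<open>y\<close> is a lift for the square \<open>(a, b)\<close>. The conditions
   are linear and stable under the differential, as \<open>chain_lift\<close> demands of a
   relation.\<close>
 define R where "R a b y \<longleftrightarrow> comm i p a b & y : GA & dm y = cd i & cd y = dm q & deg y = deg a &
 y $ io i = io u $ a & io q $ y = io v $ t a b" for a b y
 define L where "L n s y \<longleftrightarrow> R (?a n s) (?b n s) (?y n y)" for n s y
 have RD: "comm i p a b" "y : GA" "dm y = cd i" "cd y = dm q" "deg y = deg a" "y $ io i = io u $ a" "io q $ y = io v $ t a b"
 if "R a b y" for a b y using that unfolding R_def by blast+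
 have Rad: "R (ad a a') (ad b b') (ad y y')" if r: "R a b y" "R a' b' y'" "deg a' = deg a" for a b y a' b' y'
 unfolding R_def using RD[OF r(1)] RD[OF r(2)] r(3) commD[OF RD(1)[OF r(1)]] commD[OF RD(1)[OF r(2)]] famD[OF f RD(1)[OF r(1)]] famD[OF f RD(1)[OF r(2)]]
 comm_ad[OF iU p RD(1)[OF r(1)] RD(1)[OF r(2)] r(3)] iU qU u v q
 by (simp add: cmp_ad_left cmp_ad_right par_def)
 have Rsm: "R (sm c a) (sm c b) (sm c y)" if r: "R a b y" "c : carrier k" for a b y c
 unfolding R_def using RD[OF r(1)] r(2) commD[OF RD(1)[OF r(1)]] famD[OF f RD(1)[OF r(1)]]
 comm_sm[OF iU p RD(1)[OF r(1)] r(2)] iU qU u v q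
 by (simp add: cmp_sm_left cmp_sm_right)
 have Rdf: "R (df a) (df b) (df y)" if r: "R a b y" for a b y
 proof -
 note D = RD[OF r] and c = commD[OF RD(1)[OF r]] and F = famD[OF f RD(1)[OF r]]
 have "df y $ io i = df (y $ io i)" using leibniz_right[of "io i" y] D iU by simp
 also have "... = io u $ df a" unfolding D(6) using leibniz_left[of a "io u"] c u by (simp add: sg_def)
 finally have 1: "df y $ io i = io u $ df a" .
 have "io q $ df y = df (io q $ y)" using leibniz_left[of y "io q"] D qU by (simp add: sg_def)
 also have "... = io v $ t (df a) (df b)" unfolding D(7) d[OF D(1)] using leibniz_left[of "t a b" "io v"] F v by (simp add: sg_def)
 finally show ?thesis unfolding R_def using 1 D comm_df[OF iU p D(1)] by simp
 qed
 have Rzr: "R (zr (dm i) (dm p) n) (zr (cd i) (cd p) n) (zr (cd i) (dm q) n)" for n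
 unfolding R_def using comm_zr[OF iU p] fam_zr[OF iU p f, of n] iU qU p u v q O arrows_Obj[OF v(1)] by simp
 have lin: "lin_rel k (Deg (DHom (arr1 M) i p) n) (Deg (DHom M (cd i) (dm q)) n) (L n)" for n
 proof (rule lin_relI)
 show "L n \<zero>\<^bsub>Deg (DHom (arr1 M) i p) n\<^esub> \<zero>\<^bsub>Deg (DHom M (cd i) (dm q)) n\<^esub>"
 using Rzr[of n] unfolding L_def arr1_zero[OF iU p] by (simp add: zr_def)
 fix s y assume l: "L n s y"
 note r = l[unfolded L_def]
 show "s : homs (arr1 M) i p n" using comm_mem[OF iU p RD(1)[OF r]] by simp
 show "y : homs M (cd i) (dm q) n" using gr_arrD(3)[OF RD(2)[OF r]] by simp
 show "L n (c \<odot>\<^bsub>Deg (DHom (arr1 M) i p) n\<^esub> s) (c \<odot>\<^bsub>Deg (DHom M (cd i) (dm q)) n\<^esub> y)" if "c : carrier k" for c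
 using Rsm[OF r that] arr1_ops(2)[OF iU p, where n = n and c = c and x = "fst s" and y = "snd s"] unfolding L_def by (simp add: sm_def)
 fix s' y' assume l': "L n s' y'"
 show "L n (s \<oplus>\<^bsub>Deg (DHom (arr1 M) i p) n\<^esub> s') (y \<oplus>\<^bsub>Deg (DHom M (cd i) (dm q)) n\<^esub> y')"
 using Rad[OF r l'[unfolded L_def]] arr1_ops(1)[OF iU p, where n = n and x = "fst s" and y = "snd s" and x' = "fst s'" and y' = "snd s'"] unfolding L_def by (simp add: ad_def)
 qed
 have Ld: "L (n + 1) (Diff (DHom (arr1 M) i p) n s) (Diff (DHom M (cd i) (dm q)) n y)" if l: "L n s y" for n s y
 using Rdf[OF l[unfolded L_def]] arr1_ops(3)[OF iU p, where n = n and x = "fst s" and y = "snd s"] unfolding L_def by (simp add: df_def)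
 have sc: "comm i p (?a n s) (?b n s)" if "s : homs (arr1 M) i p n" for n s
 using that arr1_mem[OF iU p, of "fst s" "snd s" n] by simp
 have tot: "EX y. L n s y" if s: "s : homs (arr1 M) i p n" for n s
 proof -
 note c = sc[OF s]
 note cc = commD[OF c] and F = famD[OF f c]
 obtain h where h: "h : GA" "deg h = deg (io u $ ?a n s)" "dm h = cd i" "cd h = dm q" "h $ io i = io u $ ?a n s" "io q $ h = io v $ t (?a n s) (?b n s)"
 using enriched_lift[OF S iS q(1) RI_UA, of "io u $ ?a n s" "io v $ t (?a n s) (?b n s)"] cc F u v q sq[OF c] by auto
 have "?y n (val h) = h" using h by (simp add: prod_eq_iff)
 then have "L n s (val h)" unfolding L_def R_def using c h by simp
 then show ?thesis by blast
 qed
 \<comment> \<open>For a closed square both prescribed edges of the lifting problem are closed, so a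
   closed lift exists.\<close>
 have cyc: "EX y. L n s y & Diff (DHom M (cd i) (dm q)) n y = \<zero>\<^bsub>Deg (DHom M (cd i) (dm q)) (n + 1)\<^esub>"
 if s: "s : homs (arr1 M) i p n" and z: "Diff (DHom (arr1 M) i p) n s = \<zero>\<^bsub>Deg (DHom (arr1 M) i p) (n + 1)\<^esub>" for n s
 proof -
 note c = sc[OF s]
 note cc = commD[OF c] and F = famD[OF f c]
 have za: "df (?a n s) = zr (dm i) (dm p) (n + 1)" "df (?b n s) = zr (cd i) (cd p) (n + 1)"
 using z arr1_ops(3)[OF iU p, where n = n and x = "fst s" and y = "snd s"] unfolding arr1_zero[OF iU p] by (simp_all add: df_def zr_def)
 then have ca: "cl (?a n s)" by (simp add: cl_def)
 have "df (t (?a n s) (?b n s)) = zr (cd i) Y (n + 1)" using d[OF c] za fam_zr[OF iU p f, of "n + 1"] by simp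
 then have ct: "cl (t (?a n s) (?b n s))" using F by (simp add: cl_def)
 have cu: "cl (io u $ ?a n s)" by (rule cl_cmp) (use ca cc u in simp_all)
 have cv: "cl (io v $ t (?a n s) (?b n s))" by (rule cl_cmp) (use ct F v in simp_all)
 obtain h where h: "h : GA" "deg h = deg (io u $ ?a n s)" "cl h" "dm h = cd i" "cd h = dm q" "h $ io i = io u $ ?a n s" "io q $ h = io v $ t (?a n s) (?b n s)"
 using enriched_lift_closed[OF S iS q(1) RI_UA, of "io u $ ?a n s" "io v $ t (?a n s) (?b n s)"] cc F u v q sq[OF c] cu cv by auto
 have hy: "?y n (val h) = h" using h by (simp add: prod_eq_iff)
 then have "L n s (val h)" unfolding L_def R_def using c h by simp
 moreover have "Diff (DHom M (cd i) (dm q)) n (val h) = \<zero>\<^bsub>Deg (DHom M (cd i) (dm q)) (n + 1)\<^esub>"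
 using h by (simp add: cl_def df_def zr_def)
 ultimately show ?thesis by blast
 qed
 have "EX g. chain_map k (DHom (arr1 M) i p) (DHom M (cd i) (dm q)) g & (ALL n. ALL s:homs (arr1 M) i p n. L n s (g n s))"
 by (rule chain_lift[of k "DHom (arr1 M) i p" "DHom M (cd i) (dm q)" L, OF fk arr1_complex[OF iU p] dg_cplx[OF O] lin],
 rule Ld, assumption, rule tot, assumption, rule cyc, assumption+)
 then obtain g where g: "chain_map k (DHom (arr1 M) i p) (DHom M (cd i) (dm q)) g" "ALL n. ALL s:homs (arr1 M) i p n. L n s (g n s)"
 by (elim exE conjE) (rule that)
 show ?thesis
 proof (rule exI, intro conjI allI impI)
 show "chf i p (cd i) (dm q) (%a b. (cd i, dm q, deg a, g (deg a) (val a, val b)))" by (rule chain_map_chf[OF iU p g(1) O])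
 fix a b assume c: "comm i p a b"
 have ab: "(dm i, dm p, deg a, val a) = a" "(cd i, cd p, deg a, val b) = b" using commD[OF c] by (simp_all add: prod_eq_iff)
 have "R a b (?y (deg a) (g (deg a) (val a, val b)))"
 using g(2)[THEN spec, THEN bspec, OF comm_mem[OF iU p c]] unfolding L_def fst_conv snd_conv ab .
 then show "(cd i, dm q, deg a, g (deg a) (val a, val b)) $ io i = io u $ a" "io q $ (cd i, dm q, deg a, g (deg a) (val a, val b)) = io v $ t a b"
 using RD(6,7) by blast+
 qed
qed

end

context gen begin

text \<open>A family with boundary values given by \<open>x\<close>: the data needed to extend
  \<open>x\<close> over the newly attached cells.\<close>

definition sfam where
 "sfam p n Z x tu \<longleftrightarrow> (ALL i:I. fam i p n (cd i) Z (tu i) & (ALL a b. comm i p a b --> tu i a b $ io i = x $ a))"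

text \<open>\<open>j\<close> attaches to the source of \<open>p\<close>, for every generator
  \<open>i\<close>, the tensor of \<open>i\<close> with its complex of squares to \<open>p\<close>;
  \<open>t i a b\<close> is the cell belonging to \<open>(a, b)\<close>, and \<open>p'\<close> sends
  it to \<open>b\<close>. The last two clauses form the universal property for arrows of every
  degree, on which functoriality is based.\<close>

definition step_at where
 "step_at p j p' t \<longleftrightarrow> j : U.llp RI & p' : UA & dm j = dm p & dm p' = cd j & cd p' = cd p & io p' $ io j = io p &
 (ALL i:I. chf i p (cd i) (cd j) (t i) & (ALL a b. comm i p a b --> t i a b $ io i = io j $ a & io p' $ t i a b = b)) &
 (ALL x tu. x : GA --> dm x = dm p --> sfam p (deg x) (cd x) x tu -->
 (EX y:GA. dm y = cd j & cd y = cd x & deg y = deg x & y $ io j = x & (ALL i:I. ALL a b. comm i p a b --> y $ t i a b = tu i a b))) &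
 (ALL y y'. y : GA --> y' : GA --> dm y = cd j --> dm y' = cd j --> cd y' = cd y --> deg y' = deg y --> y $ io j = y' $ io j -->
 (ALL i:I. ALL a b. comm i p a b --> y $ t i a b = y' $ t i a b) --> y = y')"

lemma step_atD:
 assumes "step_at p j p' t"
 shows "j : U.llp RI" "j : UA" "p' : UA" "dm j = dm p" "dm p' = cd j" "cd p' = cd p" "io p' $ io j = io p"
 "i : I ==> chf i p (cd i) (cd j) (t i)" "i : I ==> comm i p a b ==> t i a b $ io i = io j $ a" "i : I ==> comm i p a b ==> io p' $ t i a b = b"
 "x : GA ==> dm x = dm p ==> sfam p (deg x) (cd x) x tu ==>
 EX y. y : GA & dm y = cd j & cd y = cd x & deg y = deg x & y $ io j = x & (ALL i:I. ALL a b. comm i p a b --> y $ t i a b = tu i a b)"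
 "y : GA ==> y' : GA ==> dm y = cd j ==> dm y' = cd j ==> cd y' = cd y ==> deg y' = deg y ==> y $ io j = y' $ io j ==>
 (!!i a b. i : I ==> comm i p a b ==> y $ t i a b = y' $ t i a b) ==> y = y'"
 using assms U.llp_arrows unfolding step_at_def by blast+

text \<open>The source and target of \<open>i\<close> are both tensored with the complex of squares,
  and all resulting maps are pushed out along evaluation. The pushout describes closed arrows of
  degree zero; disks extend this to all degrees, and linear lifting shows that \<open>j\<close> has
  the left lifting property.\<close>

theorem step_exists:
 assumes p: "p : UA"
 shows "EX j p' t. step_at p j p' t"
proof -
 have ex: "EX V e. tens i p A V e" if "i : I" "A : DObj M" for i A
 using tensor_comm[OF I_UA[OF that(1)] p that(2)] unfolding tens_def .
 have iO: "dm i : DObj M" "cd i : DObj M" if "i : I" for i using I_UA[OF that] by simp_all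
 have ch: "EX V e. ALL i:I. tens i p (A i) (V i) (e i)" if A: "!!i. i : I ==> A i : DObj M" for A
 proof -
 define z where "z i = (SOME z. tens i p (A i) (fst z) (snd z))" for i
 have "tens i p (A i) (fst (z i)) (snd (z i))" if i: "i : I" for i
 proof -
 obtain V e where "tens i p (A i) V e" using ex[OF i A[OF i]] by blast
 then have "EX z. tens i p (A i) (fst z) (snd z)" by (intro exI[of _ "(V, e)"]) simp
 then show ?thesis unfolding z_def by (rule someI_ex)
 qed
 then show ?thesis by (intro exI[of _ "%i. fst (z i)"] exI[of _ "%i. snd (z i)"]) simp
 qed
 obtain V e where V: "!!i. i : I ==> tens i p (dm i) (V i) (e i)" using ch[of dm, OF iO(1)] by blast
 obtain Q e' where Q: "!!i. i : I ==> tens i p (cd i) (Q i) (e' i)" using ch[of cd, OF iO(2)] by blast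
 have eD: "e i a b : GA" "dm (e i a b) = dm i" "cd (e i a b) = V i" "deg (e i a b) = deg a" if "i : I" "comm i p a b" for i a b
 using famD(1-4)[OF conjunct1[OF tensD(2)[OF V[OF that(1)], unfolded chf_def]] that(2)] by simp_all
 have e'D: "e' i a b : GA" "dm (e' i a b) = cd i" "cd (e' i a b) = Q i" "deg (e' i a b) = deg a" if "i : I" "comm i p a b" for i a b
 using famD(1-4)[OF conjunct1[OF tensD(2)[OF Q[OF that(1)], unfolded chf_def]] that(2)] by simp_all
 define F where "F i f \<longleftrightarrow> f : UA & dm f = V i & cd f = Q i & (ALL a b. comm i p a b --> io f $ e i a b = e' i a b $ io i)" for i f
 have "EX f. F i f" if i: "i : I" for i
 unfolding F_def by (rule tensD(3)[OF V[OF i] tensD(1)[OF Q[OF i]] chf_right[OF I_UA[OF i] p tensD(2)[OF Q[OF i]] I_UA[OF i] refl]])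
 then obtain f where f0: "!!i. i : I ==> F i (f i)" by metis
 then have f: "f i : UA" "dm (f i) = V i" "cd (f i) = Q i" "comm i p a b ==> io (f i) $ e i a b = e' i a b $ io i" if "i : I" for i a b
 using that unfolding F_def by blast+
 \<comment> \<open>\<open>g i\<close> is the evaluation from the tensor to the source of
   \<open>p\<close>, sending the component at \<open>(a, b)\<close> to \<open>a\<close>.\<close>
 define G where "G i g \<longleftrightarrow> g : UA & dm g = V i & cd g = dm p & (ALL a b. comm i p a b --> io g $ e i a b = a)" for i g
 have "EX g. G i g" if i: "i : I" for i
 unfolding G_def by (rule tensD(3)[OF V[OF i] _ chf_fst[OF I_UA[OF i] p]]) (simp add: p)
 then obtain g where g0: "!!i. i : I ==> G i (g i)" by metis
 then have g: "g i : UA" "dm (g i) = V i" "cd (g i) = dm p" "comm i p a b ==> io (g i) $ e i a b = a" if "i : I" for i a b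
 using that unfolding G_def by blast+
 have pX: "dm p : Obj UM" using p by simp
 define Po where "Po Y j w \<longleftrightarrow> (ALL Z:Obj UM. ALL x:hm UM (dm p) Z. ALL y. (ALL i:I. y i : hm UM (cd (f i)) Z &
 cmp UM x (g i) = cmp UM (y i) (f i)) -->
 (EX h:hm UM Y Z. cmp UM h j = x & (ALL i:I. cmp UM h (w i) = y i)))" for Y j w
 define Pu where "Pu Y j w \<longleftrightarrow> (ALL h h'. h : UA --> h' : UA --> dm h = Y --> dm h' = Y --> cd h = cd h' -->
 cmp UM h j = cmp UM h' j --> (ALL i:I. cmp UM h (w i) = cmp UM h' (w i)) --> h = h')" for Y j w
 have "EX Y j w. Y : Obj UM & j : hm UM (dm p) Y &
 (ALL i:I. w i : hm UM (cd (f i)) Y & cmp UM j (g i) = cmp UM (w i) (f i)) & Po Y j w & Pu Y j w"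
 unfolding Po_def Pu_def
 by (rule wide_pushout[OF U_category hsc I(2) pX]) (use f g in simp_all)
 then obtain Y j w where Y: "Y : Obj UM" and j: "j : hm UM (dm p) Y"
 and w0: "ALL i:I. w i : hm UM (cd (f i)) Y & cmp UM j (g i) = cmp UM (w i) (f i)" and po: "Po Y j w" and pu: "Pu Y j w"
 by (elim exE conjE) (rule that)
 have j: "j : UA" "dm j = dm p" "cd j = Y" using j by simp_all
 have w: "w i : UA" "dm (w i) = Q i" "cd (w i) = Y" "io j $ io (g i) = io (w i) $ io (f i)" if "i : I" for i
 using w0[THEN bspec, OF that] f(3)[OF that] io_cmp[of j "g i"] io_cmp[of "w i" "f i"] by simp_all
 define t where "t i a b = io (w i) $ e' i a b" for i a b
 have tc: "chf i p (cd i) Y (t i)" if i: "i : I" for i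
 using chf_left[OF I_UA[OF i] p tensD(2)[OF Q[OF i]] w(1)[OF i] w(2)[OF i]] w(3)[OF i] unfolding t_def by simp
 have tD: "t i a b : GA" "dm (t i a b) = cd i" "cd (t i a b) = Y" "deg (t i a b) = deg a" "df (t i a b) = t i (df a) (df b)" if "i : I" "comm i p a b" for i a b
 proof -
 show "t i a b : GA" "dm (t i a b) = cd i" "cd (t i a b) = Y" "deg (t i a b) = deg a"
 using famD(1-4)[OF conjunct1[OF tc[OF that(1), unfolded chf_def]] that(2)] by simp_all
 show "df (t i a b) = t i (df a) (df b)"
 by (rule tc[OF that(1), unfolded chf_def, THEN conjunct2, THEN spec, THEN spec, THEN mp, OF that(2), symmetric])
 qed
 have ti: "t i a b $ io i = io j $ a" if i: "i : I" and c: "comm i p a b" for i a b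
 proof -
 note gg = eD[OF i c] e'D[OF i c] f(1-3)[OF i] g(1-3)[OF i] w(1-3)[OF i] j I_UA[OF i]
 have "t i a b $ io i = io (w i) $ e' i a b $ io i" unfolding t_def using gg by simp
 also have "... = io (w i) $ io (f i) $ e i a b" unfolding f(4)[OF i c] ..
 also have "... = (io (w i) $ io (f i)) $ e i a b" using gg by simp
 also have "... = io j $ io (g i) $ e i a b" unfolding w(4)[OF i, symmetric] using gg by simp
 finally show ?thesis unfolding g(4)[OF i c] .
 qed
 \<comment> \<open>A chain map on cells is an arrow out of the tensor \<open>Q i\<close>. Its
   agreement with \<open>x\<close> on the tensor \<open>V i\<close> is tested on the universal
   family, where it is the boundary condition.\<close>
 have UC: "EX y. y : UA & dm y = Y & cd y = cd x & io y $ io j = io x & (ALL i:I. ALL a b. comm i p a b --> io y $ t i a b = tu i a b)"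
 if x: "x : UA" "dm x = dm p" and ch: "!!i. i : I ==> chf i p (cd i) (cd x) (tu i)"
 and ti: "!!i a b. i : I ==> comm i p a b ==> tu i a b $ io i = io x $ a" for x tu
 proof -
 define H where "H i y \<longleftrightarrow> y : UA & dm y = Q i & cd y = cd x & (ALL a b. comm i p a b --> io y $ e' i a b = tu i a b)" for i y
 have "EX y. H i y" if i: "i : I" for i
 unfolding H_def by (rule tensD(3)[OF Q[OF i] _ ch[OF i]]) (simp add: x)
 then obtain y where y0: "!!i. i : I ==> H i (y i)" by metis
 then have y: "y i : UA" "dm (y i) = Q i" "cd (y i) = cd x" "comm i p a b ==> io (y i) $ e' i a b = tu i a b" if "i : I" for i a b
 using that unfolding H_def by blast+
 have sq: "cmp UM x (g i) = cmp UM (y i) (f i)" if i: "i : I" for i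
 proof (rule tensD(4)[OF V[OF i]])
 note gg = f(1-3)[OF i] g(1-3)[OF i] y(1-3)[OF i] x I_UA[OF i]
 show "cmp UM x (g i) : UA" "cmp UM (y i) (f i) : UA" "dm (cmp UM x (g i)) = V i"
 "dm (cmp UM (y i) (f i)) = V i" "cd (cmp UM x (g i)) = cd (cmp UM (y i) (f i))" using gg by simp_all
 fix a b assume c: "comm i p a b"
 note gc = eD[OF i c] e'D[OF i c]
 have "(io x $ io (g i)) $ e i a b = io x $ io (g i) $ e i a b" using gg gc by simp
 also have "... = tu i a b $ io i" unfolding g(4)[OF i c] ti[OF i c] ..
 also have "... = io (y i) $ e' i a b $ io i" unfolding y(4)[OF i c, symmetric] using gg gc by simp
 also have "... = (io (y i) $ io (f i)) $ e i a b" unfolding f(4)[OF i c, symmetric] using gg gc by simp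
 finally show "io (cmp UM x (g i)) $ e i a b = io (cmp UM (y i) (f i)) $ e i a b" unfolding io_cmp .
 qed
 have "EX h:hm UM Y (cd x). cmp UM h j = x & (ALL i:I. cmp UM h (w i) = y i)"
 using po[unfolded Po_def, THEN bspec, of "cd x", THEN bspec, of x, THEN spec, of y, THEN mp] x y f(3) sq by simp
 then obtain h where h: "h : UA" "dm h = Y" "cd h = cd x" "cmp UM h j = x" "ALL i:I. cmp UM h (w i) = y i"
 by (elim bexE conjE) (rule that, simp_all)
 have "io h $ t i a b = tu i a b" if i: "i : I" and c: "comm i p a b" for i a b
 proof -
 have "io h $ t i a b = (io h $ io (w i)) $ e' i a b" unfolding t_def using h(1-3) w(1-3)[OF i] e'D[OF i c] by simp
 also have "... = io (y i) $ e' i a b" unfolding io_cmp[symmetric] using h(5) i by simp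
 finally show ?thesis unfolding y(4)[OF i c] .
 qed
 then show ?thesis using h io_cmp[of h j] by (intro exI[of _ h]) simp
 qed
 have UCb: "EX y. y : UA & dm y = Y & cd y = cd x & io y $ io j = io x & (ALL i:I. ALL a b. comm i p a b --> io y $ t i a b = tu i a b)"
 if "x : UA" "dm x = dm p" "ALL i:I. chf i p (cd i) (cd x) (tu i) & (ALL a b. comm i p a b --> tu i a b $ io i = io x $ a)" for x tu
 by (rule UC[OF that(1,2)]) (use that(3) in blast)+
 have UU: "y = y'" if y: "y : UA" "y' : UA" "dm y = Y" "dm y' = Y" "cd y = cd y'" and yj: "io y $ io j = io y' $ io j"
 and yt: "!!i a b. i : I ==> comm i p a b ==> io y $ t i a b = io y' $ t i a b" for y y'
 proof -
 have 1: "cmp UM y j = cmp UM y' j" by (rule io_inj) (simp add: io_cmp yj)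
 have "cmp UM y (w i) = cmp UM y' (w i)" if i: "i : I" for i
 proof (rule tensD(4)[OF Q[OF i]])
 note gg = w(1-3)[OF i] y
 show "cmp UM y (w i) : UA" "cmp UM y' (w i) : UA" "dm (cmp UM y (w i)) = Q i"
 "dm (cmp UM y' (w i)) = Q i" "cd (cmp UM y (w i)) = cd (cmp UM y' (w i))" using gg by simp_all
 fix a b assume c: "comm i p a b"
 show "io (cmp UM y (w i)) $ e' i a b = io (cmp UM y' (w i)) $ e' i a b"
 unfolding io_cmp using yt[OF i c] gg e'D[OF i c] unfolding t_def by simp
 qed
 then show ?thesis using pu[unfolded Pu_def, THEN spec, of y, THEN spec, of y'] y 1 by simp
 qed
 have c1: "chf i p (cd i) (cd p) (%a b. b)" if i: "i : I" for i by (rule chf_snd[OF I_UA[OF i] p])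
 have c2: "b $ io i = io p $ a" if "i : I" "comm i p a b" for i a b by (rule commD(8)[OF that(2), symmetric])
 have c12: "ALL i:I. chf i p (cd i) (cd p) (%a b. b) & (ALL a b. comm i p a b --> b $ io i = io p $ a)" using c1 c2 by blast
 from UCb[OF p refl c12] obtain p' where p': "p' : UA" "dm p' = Y" "cd p' = cd p" "io p' $ io j = io p"
 "ALL i:I. ALL a b. comm i p a b --> io p' $ t i a b = b" by (elim exE conjE) (rule that)
 have gex: "EX y:GA. dm y = cd j & cd y = cd x & deg y = deg x & y $ io j = x & (ALL i:I. ALL a b. comm i p a b --> y $ t i a b = tu i a b)"
 if x: "x : GA" "dm x = dm p" and sf: "sfam p (deg x) (cd x) x tu" for x tu
 proof -
 have fm: "fam i p (deg x) (cd i) (cd x) (tu i)" and tui: "comm i p a b ==> tu i a b $ io i = x $ a" if "i : I" for i a b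
 using sf that unfolding sfam_def by blast+
 have E: "cd x : DObj M" using x by simp
 obtain C kav ep where D: "disk (cd x) C (deg x) kav ep" using disk_exists[OF E] by blast
 note d = diskD[OF D]
 \<comment> \<open>\<open>x\<close> and the family are replaced by the closed degree zero data into
   the disk \<open>C\<close> that classify them. Composing the arrow found there with
   \<open>ep\<close> returns to degree \<open>deg x\<close>.\<close>
 let ?x = "df (kav $ x)" and ?tu = "%i a b. ad (df (kav $ tu i a b)) (kav $ tu i (df a) (df b))"
 note dx = disk_in(1-3)[OF D x(1) refl refl]
 have xi: "io (uo ?x) = ?x" by (rule io_uo[OF dx(3)])
 have xU: "uo ?x : UA" "dm (uo ?x) = dm p" "cd (uo ?x) = C" using uo_UA[OF dx(1,3,2)] x d by simp_all
 have tuT: "?tu i a b $ io i = io (uo ?x) $ a" if i: "i : I" and c: "comm i p a b" for i a b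
 proof -
 note cc = commD[OF c] and F = famD[OF fm[OF i] c] and F' = famD[OF fm[OF i] comm_df[OF I_UA[OF i] p c]] and iU = I_UA[OF i]
 have "?tu i a b $ io i = ad (df (kav $ tu i a b) $ io i) ((kav $ tu i (df a) (df b)) $ io i)"
 by (rule cmp_ad_left) (use F F' d iU cc in "simp_all add: par_def")
 also have "df (kav $ tu i a b) $ io i = df ((kav $ tu i a b) $ io i)"
 by (rule leibniz_right[symmetric]) (use F d iU in simp_all)
 also have "(kav $ tu i a b) $ io i = kav $ tu i a b $ io i" by (rule cmp_assoc) (use F d(3-10) iU in simp_all)
 also have "... = kav $ x $ a" unfolding tui[OF i c] ..
 also have "(kav $ tu i (df a) (df b)) $ io i = kav $ tu i (df a) (df b) $ io i" by (rule cmp_assoc) (use F' d(3-10) iU in simp_all)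
 also have "... = kav $ x $ df a" unfolding tui[OF i comm_df[OF iU p c]] ..
 also have "ad (df (kav $ x $ a)) (kav $ x $ df a) = ad (df ((kav $ x) $ a)) ((kav $ x) $ df a)" using x d(3-10) cc by simp
 also have "... = ?x $ a" by (rule df_left[symmetric]) (use x d(3-10) cc in simp_all)
 finally show ?thesis unfolding xi .
 qed
 have tuc: "chf i p (cd i) (cd (uo ?x)) (?tu i)" if "i : I" for i
 unfolding xU(3) by (rule chf_disk[OF I_UA[OF that] p fm[OF that] D])
 have c12: "ALL i:I. chf i p (cd i) (cd (uo ?x)) (?tu i) & (ALL a b. comm i p a b --> ?tu i a b $ io i = io (uo ?x) $ a)"
 by (intro ballI conjI allI impI tuc tuT)
 from UCb[OF xU(1,2) c12] obtain y where y: "y : UA" "dm y = Y" "cd y = C" "io y $ io j = ?x"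
 and yt: "ALL i:I. ALL a b. comm i p a b --> io y $ t i a b = ?tu i a b" unfolding xi xU(3) by (elim exE conjE) (rule that)
 show ?thesis
 proof (rule bexI[of _ "ep $ io y"], intro conjI ballI allI impI)
 have "(ep $ io y) $ io j = ep $ io y $ io j" by (rule cmp_assoc) (use d(3-10) y(1-3) j in simp_all)
 then show "(ep $ io y) $ io j = x" unfolding y(4) using disk_eps(1)[OF D x(1) refl] by simp
 fix i a b assume i: "i : I" and c: "comm i p a b"
 note cc = commD[OF c] and F = famD[OF fm[OF i] c] and F' = famD[OF fm[OF i] comm_df[OF I_UA[OF i] p c]] and iU = I_UA[OF i]
 have "(ep $ io y) $ t i a b = ep $ io y $ t i a b" by (rule cmp_assoc) (use d(3-10) y(1-3) tD[OF i c] in simp_all)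
 also have "... = ep $ ?tu i a b" unfolding yt[THEN bspec, OF i, THEN spec, THEN spec, THEN mp, OF c] ..
 also have "... = ad (ep $ df (kav $ tu i a b)) (ep $ kav $ tu i (df a) (df b))"
 by (rule cmp_ad_right) (use F F' d(3-10) cc in "simp_all add: par_def")
 also have "... = tu i a b"
 unfolding disk_eps(1)[OF D F(1,3)] disk_eps(2)[OF D F(1,3) F'(1,3)] using F F' by simp
 finally show "(ep $ io y) $ t i a b = tu i a b" .
 qed (use d(3-10) y(1-3) j x in simp_all)
 qed
 have gun: "y = y'" if y: "y : GA" "y' : GA" "dm y = cd j" "dm y' = cd j" "cd y' = cd y" "deg y' = deg y" and yj: "y $ io j = y' $ io j"
 and yt: "!!i a b. i : I ==> comm i p a b ==> y $ t i a b = y' $ t i a b" for y y'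
 proof -
 have E: "cd y : DObj M" using y by simp
 obtain C kav ep where D: "disk (cd y) C (deg y) kav ep" using disk_exists[OF E] by blast
 note d = diskD[OF D]
 note d1 = disk_in(1-3)[OF D y(1) refl refl] and d2 = disk_in(1-3)[OF D y(2,5,6)]
 have x1: "io (uo (df (kav $ y))) = df (kav $ y)" and x2: "io (uo (df (kav $ y'))) = df (kav $ y')" by (rule io_uo[OF d1(3)], rule io_uo[OF d2(3)])
 have "uo (df (kav $ y)) = uo (df (kav $ y'))"
 proof (rule UU)
 show "uo (df (kav $ y)) : UA" "uo (df (kav $ y')) : UA" by (rule uo_UA[OF d1(1,3,2)], rule uo_UA[OF d2(1,3,2)])
 show "dm (uo (df (kav $ y))) = Y" "dm (uo (df (kav $ y'))) = Y" "cd (uo (df (kav $ y))) = cd (uo (df (kav $ y')))" using y j by simp_all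
 have h: "df (kav $ z) $ io j = df (kav $ z $ io j)" if "z : GA" "dm z = cd j" "cd z = cd y" for z
 proof -
 have "df (kav $ z) $ io j = df ((kav $ z) $ io j)" by (rule leibniz_right[symmetric]) (use that d(3-10) j in simp_all)
 then show ?thesis using that d(3-10) j by simp
 qed
 show "io (uo (df (kav $ y))) $ io j = io (uo (df (kav $ y'))) $ io j"
 unfolding x1 x2 h[OF y(1,3) refl] h[OF y(2,4,5)] yj ..
 fix i a b assume i: "i : I" and c: "comm i p a b"
 have h: "df (kav $ z) $ t i a b = ad (df (kav $ z $ t i a b)) (kav $ z $ t i (df a) (df b))"
 if "z : GA" "dm z = cd j" "cd z = cd y" "deg z = deg y" for z
 proof -
 have "df (kav $ z) $ t i a b = ad (df ((kav $ z) $ t i a b)) ((kav $ z) $ df (t i a b))"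
 by (rule df_left) (use that d(3-10) j tD[OF i c] in simp_all)
 then show ?thesis using that d(3-10) j tD(1-4)[OF i c] tD(1-4)[OF i comm_df[OF I_UA[OF i] p c]] unfolding tD(5)[OF i c] by simp
 qed
 show "io (uo (df (kav $ y))) $ t i a b = io (uo (df (kav $ y'))) $ t i a b"
 unfolding x1 x2 h[OF y(1,3) refl refl] h[OF y(2,4,5,6)] yt[OF i c] yt[OF i comm_df[OF I_UA[OF i] p c]] ..
 qed
 from arg_cong[OF this, of io] have "df (kav $ y) = df (kav $ y')" unfolding x1 x2 .
 from arg_cong[OF this, of "%w. ep $ w"] show ?thesis unfolding disk_eps(1)[OF D y(1) refl] disk_eps(1)[OF D y(2,5)] .
 qed
 \<comment> \<open>A lift of \<open>j\<close> against \<open>q\<close> is an arrow out of the new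
   stage, that is, a chain map of lifts, one for each square. \<open>comm_lift\<close> provides it,
   and uniqueness of arrows out of the stage gives the lower triangle.\<close>
 have jl: "j : U.llp RI"
 proof (rule U.llpI[OF j(1) RI_UA])
 fix q u v assume q: "q : RI" "q : UA" and u: "u : UA" and v: "v : UA" and uv: "dm u = dm j" "cd u = dm q" "dm v = cd j" "cd v = cd q"
 and sq: "cmp UM q u = cmp UM v j"
 have sq': "io q $ io u = io v $ io j" using arg_cong[OF sq, of io] unfolding io_cmp .
 define T where "T i tu \<longleftrightarrow> chf i p (cd i) (dm q) tu & (ALL a b. comm i p a b --> tu a b $ io i = io u $ a & io q $ tu a b = io v $ t i a b)" for i tu
 have "EX tu. T i tu" if i: "i : I" for i
 unfolding T_def
 proof (rule comm_lift[OF i p tc[OF i] v _ u _ q(1) uv(2,4)])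
 show "dm v = Y" "dm u = dm p" using uv j by simp_all
 fix a b assume c: "comm i p a b"
 note gg = q u v uv j tD[OF i c] commD[OF c] I_UA[OF i]
 have "io q $ io u $ a = (io q $ io u) $ a" using gg by simp
 also have "... = io v $ io j $ a" unfolding sq' using gg by simp
 also have "... = (io v $ t i a b) $ io i" unfolding ti[OF i c, symmetric] using gg by simp
 finally show "io q $ io u $ a = (io v $ t i a b) $ io i" .
 qed
 then obtain tu where "!!i. i : I ==> T i (tu i)" by metis
 then have tu: "chf i p (cd i) (cd u) (tu i)" "comm i p a b ==> tu i a b $ io i = io u $ a" "comm i p a b ==> io q $ tu i a b = io v $ t i a b" if "i : I" for i a b
 using that unfolding T_def uv(2) by blast+
 have ud: "dm u = dm p" using uv j by simp
 have c12: "ALL i:I. chf i p (cd i) (cd u) (tu i) & (ALL a b. comm i p a b --> tu i a b $ io i = io u $ a)" using tu by blast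
 from UCb[OF u ud c12] obtain h where h: "h : UA" "dm h = Y" "cd h = cd u" "io h $ io j = io u" "ALL i:I. ALL a b. comm i p a b --> io h $ t i a b = tu i a b"
 by (elim exE conjE) (rule that)
 have "cmp UM q h = v"
 proof (rule UU)
 show "cmp UM q h : UA" "v : UA" "dm (cmp UM q h) = Y" "dm v = Y" "cd (cmp UM q h) = cd v"
 using q h(1-3) v uv j by simp_all
 have "(io q $ io h) $ io j = io q $ io h $ io j" using q h(1-3) v uv j by simp
 then show "io (cmp UM q h) $ io j = io v $ io j" unfolding io_cmp h(4) sq' .
 fix i a b assume i: "i : I" and c: "comm i p a b"
 have "(io q $ io h) $ t i a b = io q $ io h $ t i a b" using q h(1-3) uv j tD[OF i c] by simp
 then show "io (cmp UM q h) $ t i a b = io v $ t i a b" unfolding io_cmp h(5)[THEN bspec, OF i, THEN spec, THEN spec, THEN mp, OF c] tu(3)[OF i c] .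
 qed
 moreover have "cmp UM h j = u" by (rule io_inj) (simp add: io_cmp h(4))
 ultimately show "EX h. h : UA & dm h = cd j & cd h = dm q & cmp UM h j = u & cmp UM q h = v"
 using h(1-3) j uv by (intro exI[of _ h]) simp
 qed
 have A: "ALL x tu. x : GA --> dm x = dm p --> sfam p (deg x) (cd x) x tu -->
 (EX y:GA. dm y = cd j & cd y = cd x & deg y = deg x & y $ io j = x & (ALL i:I. ALL a b. comm i p a b --> y $ t i a b = tu i a b))"
 by (intro allI impI) (rule gex)
 have B: "ALL y y'. y : GA --> y' : GA --> dm y = cd j --> dm y' = cd j --> cd y' = cd y --> deg y' = deg y --> y $ io j = y' $ io j -->
 (ALL i:I. ALL a b. comm i p a b --> y $ t i a b = y' $ t i a b) --> y = y'"
 proof (intro allI impI)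
 fix y y' assume h: "y : GA" "y' : GA" "dm y = cd j" "dm y' = cd j" "cd y' = cd y" "deg y' = deg y" "y $ io j = y' $ io j"
 and e: "ALL i:I. ALL a b. comm i p a b --> y $ t i a b = y' $ t i a b"
 show "y = y'" by (rule gun[OF h]) (rule e[THEN bspec, THEN spec, THEN spec, THEN mp])
 qed
 have Cc: "ALL i:I. chf i p (cd i) (cd j) (t i) & (ALL a b. comm i p a b --> t i a b $ io i = io j $ a & io p' $ t i a b = b)"
 unfolding j(3) using tc ti p'(5) by blast
 have "step_at p j p' t"
 unfolding step_at_def by (intro conjI A B Cc) (use jl p'(1-4) j in simp_all)
 then show ?thesis by (intro exI)
qed

end

section \<open>The enriched tower\<close>

context gen begin

sublocale Q: soa UM elts I
proof unfold_locales
 show "has_small_colimits elts UM" by (rule hsc)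
 show "I \<subseteq> UA" using I(1) S(1) by blast
 show "small elts I" "permits_small_object_argument elts UM I" by (rule I)+
 fix X Y assume X: "X : Obj UM" and Y: "Y : Obj UM"
 have "small elts (homs M X Y 0)" using Kc X Y by (simp add: K_category_def small_complex_def)
 then have s: "small elts ((%f. (X, Y, f)) ` homs M X Y 0)" by (rule small_image)
 show "small elts (hm UM X Y)"
 proof (rule small_subset[OF s], rule subsetI)
 fix f assume f: "f : hm UM X Y"
 then have "mor f : homs M X Y 0" "f = (X, Y, mor f)" using io_GA[of f] unfolding gr_arrows by (simp_all add: io_def prod_eq_iff)
 then show "f : (%f. (X, Y, f)) ` homs M X Y 0" by blast
 qed
qed

text \<open>The colimit is one in the underlying category, yet it tests arrows of every degree: an
  arrow of degree n is recovered by \<open>ep\<close> from a closed degree zero arrow into a disk,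
  to which the universal property applies.\<close>

lemma colim_gr_unique:
 assumes co: "colim UM R D x L q" and dg: "diag UM R D x"
 and h: "h : GA" "h' : GA" "dm h = L" "dm h' = L" "cd h' = cd h" "deg h' = deg h"
 and eq: "!!a. a : Field R ==> h $ io (q a) = h' $ io (q a)"
 shows "h = h'"
proof -
 obtain C kav ep where D: "disk (cd h) C (deg h) kav ep" using disk_exists[of "cd h" "deg h"] h by auto
 note d = diskD[OF D] and q = colimD[OF co]
 note d1 = disk_in(1-3)[OF D h(1) refl refl] and d2 = disk_in(1-3)[OF D h(2,5,6)]
 have "uo (df (kav $ h)) = uo (df (kav $ h'))"
 proof (rule U.colim_eqI[OF co dg])
 show "uo (df (kav $ h)) : UA" "uo (df (kav $ h')) : UA" by (rule uo_UA[OF d1(1,3,2)], rule uo_UA[OF d2(1,3,2)])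
 show "dm (uo (df (kav $ h))) = L" "dm (uo (df (kav $ h'))) = L" "cd (uo (df (kav $ h))) = cd (uo (df (kav $ h')))" using h by simp_all
 fix a assume a: "a : Field R"
 have e: "df (kav $ z) $ io (q a) = df (kav $ z $ io (q a))" if "z : GA" "dm z = L" "cd z = cd h" for z
 proof -
 have "df (kav $ z) $ io (q a) = df ((kav $ z) $ io (q a))"
 by (rule leibniz_right[symmetric]) (use that d(3-10) q(2-4)[OF a] in simp_all)
 then show ?thesis using that d(3-10) q(2-4)[OF a] by simp
 qed
 show "cmp UM (uo (df (kav $ h))) (q a) = cmp UM (uo (df (kav $ h'))) (q a)"
 by (rule io_inj) (simp only: io_cmp io_uo[OF d1(3)] io_uo[OF d2(3)] e[OF h(1,3) refl] e[OF h(2,4,5)] eq[OF a])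
 qed
 from arg_cong[OF this, of io] have "df (kav $ h) = df (kav $ h')" unfolding io_uo[OF d1(3)] io_uo[OF d2(3)] .
 from arg_cong[OF this, of "%w. ep $ w"] show ?thesis unfolding disk_eps(1)[OF D h(1) refl] disk_eps(1)[OF D h(2,5)] .
qed

text \<open>The compatible family is sent into a disk, extended there by the universal property, and
  brought back by \<open>ep\<close>.\<close>

lemma colim_gr_ex:
 assumes co: "colim UM R D x L q" and dg: "diag UM R D x" and Z: "Z : DObj M"
 and y: "!!a. a : Field R ==> y a : GA & dm (y a) = D a & cd (y a) = Z & deg (y a) = n"
 and yx: "!!a b. (a, b) : R ==> y b $ io (x a b) = y a"
 shows "EX h. h : GA & dm h = L & cd h = Z & deg h = n & (ALL a:Field R. h $ io (q a) = y a)"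
proof -
 obtain C kav ep where D: "disk Z C n kav ep" using disk_exists[OF Z] by blast
 note d = diskD[OF D] and q = colimD[OF co] and g = diagD[OF dg]
 have y': "y a : GA" "dm (y a) = D a" "cd (y a) = Z" "deg (y a) = n" if "a : Field R" for a using y[OF that] by blast+
 note dy = disk_in(1-3)[OF D y'(1,3,4)]
 have "cocone UM R D x C (%a. uo (df (kav $ y a)))"
 unfolding cocone_def
 proof (intro conjI ballI allI impI)
 show "C : Obj UM" using d(2) by simp
 show "uo (df (kav $ y a)) : hm UM (D a) C" if a: "a : Field R" for a
 using uo_UA[OF dy(1)[OF a a a] dy(3)[OF a a a] dy(2)[OF a a a]] y'[OF a] d by simp
 fix a b assume ab: "(a, b) : R"
 then have a: "a : Field R" and b: "b : Field R" by (auto intro: FieldI1 FieldI2)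
 have "df (kav $ y b) $ io (x a b) = df ((kav $ y b) $ io (x a b))"
 by (rule leibniz_right[symmetric]) (use y'[OF b] d(3-10) g(2-4)[OF ab] in simp_all)
 also have "(kav $ y b) $ io (x a b) = kav $ y b $ io (x a b)" using y'[OF b] d(3-10) g(2-4)[OF ab] by simp
 finally have "df (kav $ y b) $ io (x a b) = df (kav $ y a)" unfolding yx[OF ab] .
 then show "cmp UM (uo (df (kav $ y b))) (x a b) = uo (df (kav $ y a))"
 by (intro io_inj) (simp only: io_cmp io_uo[OF dy(3)[OF a a a]] io_uo[OF dy(3)[OF b b b]])
 qed
 from colim_ex[OF co this] obtain h where h: "h : hm UM L C" "ALL a:Field R. cmp UM h (q a) = uo (df (kav $ y a))" by blast
 have h': "h : UA" "dm h = L" "cd h = C" using h(1) by simp_all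
 have "(ep $ io h) $ io (q a) = y a" if a: "a : Field R" for a
 proof -
 have "(ep $ io h) $ io (q a) = ep $ io h $ io (q a)" by (rule cmp_assoc) (use d(3-10) h' q(2-4)[OF a] in simp_all)
 also have "io h $ io (q a) = io (uo (df (kav $ y a)))" unfolding io_cmp[symmetric] using h(2) a by simp
 also have "... = df (kav $ y a)" by (rule io_uo[OF dy(3)[OF a a a]])
 finally show ?thesis using disk_eps(1)[OF D y'(1,3)[OF a]] by simp
 qed
 then show ?thesis using d(3-10) h' by (intro exI[of _ "ep $ io h"]) simp
qed

end

locale etower = gen k M elts I S + wo r
 for k :: "'k ring" and M :: "('o, 'k, 'u) dgcat" and elts :: "'u => 'u set" and I S and r :: "'u rel" +
 assumes good: "Q.good r"
begin

lemma small_r: "small elts (Field r)" using good unfolding Q.good_def by blast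

lemma r_ne: "Field r ~= {}" using good unfolding Q.good_def by auto

definition z where "z = (SOME m. m : Field r & (ALL s:Field r. (m, s) : r))"

lemma z: "z : Field r" "b : Field r ==> (z, b) : r"
proof -
 have "EX m. m : Field r & (ALL s:Field r. (m, s) : r)" using r_least[OF r_ne subset_refl] by blast
 from someI_ex[OF this] show "z : Field r" "b : Field r ==> (z, b) : r" unfolding z_def by blast+
qed

lemma underS_z: "underS r z = {}"
proof (rule equals0I)
 fix b assume b: "b : underS r z"
 then have "(b, z) : r" "b ~= z" by (simp_all add: underS_iff)
 then show False using r_antisym[of b z] z(2)[OF FieldI1] by blast
qed

lemma underS_empty: "b : Field r ==> underS r b = {} \<longleftrightarrow> b = z"
 using underS_z z(2)[of b] underS_iff[of z b] by blast

text \<open>A complete tower over \<open>f\<close>: stages \<open>X\<close> with maps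
  \<open>p\<close> to the target, transitions \<open>x\<close>, cells \<open>t\<close> at
  successors, and the colimit \<open>L\<close> with coprojections \<open>q\<close> and induced map
  \<open>P\<close>. The factorization of \<open>f\<close> will be \<open>q z\<close> followed by
  \<open>P\<close>.\<close>

definition tw where
 "tw f X p x t L q P \<longleftrightarrow> lamseq UM r X x & (ALL b:Field r. p b : UA & dm (p b) = X b & cd (p b) = cd f) &
 (ALL a b. (a, b) : r --> io (p b) $ io (x a b) = io (p a)) & X z = dm f & p z = f &
 (ALL a b. is_succ r a b --> step_at (p a) (x a b) (p b) (t a b)) & colim UM r X x L q &
 P : UA & dm P = L & cd P = cd f & (ALL a:Field r. io P $ io (q a) = io (p a))"

lemma twD:
 assumes "tw f X p x t L q P"
 shows "lamseq UM r X x" "diag UM r X x" "b : Field r ==> p b : UA" "b : Field r ==> dm (p b) = X b" "b : Field r ==> cd (p b) = cd f"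
 "(a, b) : r ==> io (p b) $ io (x a b) = io (p a)" "X z = dm f" "p z = f"
 "is_succ r a b ==> step_at (p a) (x a b) (p b) (t a b)" "colim UM r X x L q"
 "P : UA" "dm P = L" "cd P = cd f" "a : Field r ==> io P $ io (q a) = io (p a)"
 using assms unfolding tw_def lamseq_def by blast+

end

locale etower1 = etower k M elts I S r
 for k :: "'k ring" and M :: "('o, 'k, 'u) dgcat" and elts :: "'u => 'u set" and I S and r :: "'u rel" +
 fixes f :: "'o \<times> 'o \<times> 'u" assumes f: "f : UA"
begin

definition G where "G b Y p \<longleftrightarrow> p : hm UM Y (cd f)" for b :: 'u and Y p
definition Rl where "Rl a b X p Y p' x \<longleftrightarrow> cmp UM p' x = p" for a b :: 'u and X Y :: 'o and p p' x
definition St where "St a b X e x Y p j \<longleftrightarrow> a : Field r & (EX t. step_at (e a) j p t)"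
 for a b :: 'u and X :: "'u => 'o" and e and x :: "'u => 'u => 'o \<times> 'o \<times> 'u" and Y :: 'o and p j

sublocale T: tower_base UM r "dm f" f G Rl St by unfold_locales

lemma tow_p:
 assumes t: "T.tow X e x a" and b: "(bev, a) : r"
 shows "e a : UA" "dm (e a) = X a" "cd (e a) = cd f" "cmp UM (e a) (x bev a) = e bev"
proof -
 note D = tower_atD[OF t]
 show ea: "e a : UA" "dm (e a) = X a" "cd (e a) = cd f" using D(2) by (simp_all add: G_def)
 show "cmp UM (e a) (x bev a) = e bev"
 proof (cases "bev = a")
 case True then show ?thesis using D(1,3) ea by simp
 next
 case False
 then have "bev : underS r a" using b by (simp add: underS_iff)
 then show ?thesis using D(7)[of bev] by (simp add: Rl_def)
 qed
qed

sublocale T: tower_data UM r "dm f" f G Rl St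
proof unfold_locales
 show "dm f : Obj UM" using f by simp
 show "G b (dm f) f" for b using f by (simp add: G_def)
 show "Rl a a Y g Y g (idt UM Y)" if "G a Y g" for a Y g using that by (simp add: G_def Rl_def)
 show "Rl a c X e Y' g (cmp UM v u)"
 if "Rl a b X e Y h u" "Rl b c Y h Y' g v" "G a X e" "G b Y h" "G c Y' g" "u : hm UM X Y" "v : hm UM Y Y'"
 for a b c X e Y h Y' g u v
 proof -
 have "cmp UM g (cmp UM v u) = cmp UM (cmp UM g v) u" using that by (simp add: G_def)
 then show ?thesis using that(1,2) by (simp add: Rl_def)
 qed
 show "St a b X' e' x' Y g j"
 if c: "!!c. (c, a) : r ==> X c = X' c & e c = e' c & (ALL d. x d c = x' d c)" and s: "St a b X e x Y g j"
 for a b X e x X' e' x' Y g j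
 proof -
 have aF: "a : Field r" using s by (simp add: St_def)
 show ?thesis using c[OF r_refl[OF aF]] s by (simp add: St_def)
 qed
 show "EX Y g j. Y : Obj UM & G b Y g & j : hm UM (X a) Y & Rl a b (X a) (e a) Y g j & St a b X e x Y g j"
 if su: "is_succ r a b" and t: "!!c. (c, a) : r ==> T.tow X e x c" for a b X e x
 proof -
 have aF: "a : Field r" using succ_under(1)[OF su] by (rule FieldI1)
 note ea = tow_p(1-3)[OF t[OF r_refl[OF aF]] r_refl[OF aF]]
 obtain j p' t where s: "step_at (e a) j p' t" using step_exists[OF ea(1)] by blast
 note sd = step_atD[OF s]
 have "cmp UM p' j = e a" by (rule io_inj) (simp add: io_cmp sd(7))
 then show ?thesis
 using sd(2-6) ea s aF by (intro exI[of _ "cd j"] exI[of _ p'] exI[of _ j]) (auto simp: G_def Rl_def St_def)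
 qed
 show "EX L g q. colim UM (Restr r (underS r c)) X x L q & G c L g & (ALL a:underS r c. Rl a c (X a) (e a) L g (q a))"
 if l: "is_limit_elt r c" and t: "!!b. b : underS r c ==> T.tow X e x b" for c X e x
 proof -
 have cF: "c : Field r" using l by (simp add: is_limit_elt_def)
 have dg: "diag UM (Restr r (underS r c)) X x"
 by (rule T.tow_diag[OF underS_Field le_lt_trans t])
 have "EX L q. colim UM (Restr r (underS r c)) X x L q"
 by (rule small_poset_colimit[OF U_category hsc refl_Restr trans_Restr _ dg]) (simp add: Field_RU small_subset[OF small_r underS_Field])
 then obtain L q where co: "colim UM (Restr r (underS r c)) X x L q" by blast
 have "cocone UM (Restr r (underS r c)) X x (cd f) e"
 unfolding cocone_def Field_RU
 proof (intro conjI ballI allI impI)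
 show "cd f : Obj UM" using f by simp
 show "e a : hm UM (X a) (cd f)" if "a : underS r c" for a using tower_atD(2)[OF t[OF that]] by (simp add: G_def)
 show "cmp UM (e b) (x a b) = e a" if "(a, b) : Restr r (underS r c)" for a b
 using tow_p(4)[OF t, of b a] that by simp
 qed
 from colim_ex[OF co this] obtain p where "p : hm UM L (cd f)" "!!a. a : underS r c ==> cmp UM p (q a) = e a"
 unfolding Field_RU by blast
 then show ?thesis using co by (intro exI[of _ L] exI[of _ p] exI[of _ q]) (simp add: G_def Rl_def)
 qed
qed

theorem tower: "EX X p x t L q P. tw f X p x t L q P"
proof -
 obtain X e x where T: "!!b. b : Field r ==> T.tow X e x b" using T.tower_exists by blast
 have lm: "lamseq UM r X x" by (rule T.tow_lamseq[OF T])
 then have dg: "diag UM r X x" by (simp add: lamseq_def)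
 define t where "t a b = (SOME t. step_at (e a) (x a b) (e b) t)" for a b
 have st: "step_at (e a) (x a b) (e b) (t a b)" if s: "is_succ r a b" for a b
 proof -
 have "b : Field r" using succ_under(1)[OF s] by (rule FieldI2)
 then have "EX t. step_at (e a) (x a b) (e b) t" using tower_atD(11)[OF T s] by (simp add: St_def)
 then show ?thesis unfolding t_def by (rule someI_ex)
 qed
 have e: "e b : UA" "dm (e b) = X b" "cd (e b) = cd f" if "b : Field r" for b using tow_p(1-3)[OF T[OF that] r_refl[OF that]] .
 have ex: "cmp UM (e b) (x a b) = e a" if "(a, b) : r" for a b
 using tow_p(4)[OF T that] FieldI2[OF that] by blast
 obtain L q where co: "colim UM r X x L q"
 using small_poset_colimit[OF U_category hsc refl_r trans_r small_r dg] by blast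
 have "cocone UM r X x (cd f) e" unfolding cocone_def using e ex f by simp
 from colim_ex[OF co this] obtain P where P: "P : hm UM L (cd f)" "ALL a:Field r. cmp UM P (q a) = e a" by blast
 have "X z = dm f" "e z = f" using tower_atD(9,10)[OF T[OF z(1)] underS_z] by simp_all
 moreover have "io (e b) $ io (x a b) = io (e a)" if "(a, b) : r" for a b using arg_cong[OF ex[OF that], of io] unfolding io_cmp .
 moreover have "io P $ io (q a) = io (e a)" if "a : Field r" for a using arg_cong[OF P(2)[THEN bspec, OF that], of io] unfolding io_cmp .
 ultimately have "tw f X e x t L q P" unfolding tw_def using lm e st co P(1) by simp
 then show ?thesis by (intro exI)
qed

end

context etower begin

lemma tower_ex: "f : UA ==> EX X p x t L q P. tw f X p x t L q P"
proof -
 assume "f : UA"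
 then interpret etower1 k M elts I S r f by unfold_locales
 show ?thesis by (rule tower)
qed

lemma tower_llp:
 assumes t: "tw f X p x t L q P" shows "q z : U.llp RI"
 by (rule U.llp_transfinite[OF Wr twD(1,10)[OF t] RI_UA _ z]) (use step_atD(1)[OF twD(9)[OF t]] in blast)+

text \<open>A map from the source of a generator to the colimit comes from some stage
  \<open>a\<close>. The resulting square over \<open>p a\<close> is among those attached at the next
  stage, and its cell, composed into the colimit, is the required lift.\<close>

lemma tower_rlp:
 assumes t: "tw f X p x t L q P" shows "P : RI"
proof (rule U.rlpI[OF twD(11)[OF t]])
 note D = twD[OF t] and dg = diagD[OF twD(2)[OF t]] and qd = colimD[OF twD(10)[OF t]]
 \<comment> \<open>The successor maps are known only to have the left lifting property, so goodness
   is applied through the ladder of relative cell complexes.\<close>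
 interpret L: ladder UM elts I r X x z
 by unfold_locales (use D(1) small_r step_atD(1)[OF D(9)] z in blast)+
 show "I \<subseteq> UA" using I_UA by blast
 fix i u v assume i: "i : I" and iU: "i : UA" and u: "u : UA" and v: "v : UA" and c: "dm u = dm i" "cd u = dm P" "dm v = cd i" "cd v = cd P"
 and sq: "cmp UM P u = cmp UM v i"
 have "u : hm UM (dm i) L" using u c D(12) by simp
 from L.factors_through_stage[OF good D(10) i this] obtain a u' where a: "a : Field r" and u': "u' : hm UM (dm i) (X a)" and qu: "cmp UM (q a) u' = u" by blast
 have u'U: "u' : UA" "dm u' = dm i" "cd u' = X a" using u' by simp_all
 \<comment> \<open>An infinite cardinal has no largest element, hence the stage \<open>a\<close> has
   a next one.\<close>
 have "EX b. is_succ r a b"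
 proof -
 have "EX b. a : underS r b"
 proof (rule ccontr)
 assume n: "\<nexists>b. a : underS r b"
 have "(b, a) : r" if "b : Field r" for b using not_le[OF that a] n by blast
 moreover have cr: "Card_order r" "infinite (Field r)" using good unfolding Q.good_def by blast+
 ultimately show False using infinite_Card_order_limit[OF cr a] r_antisym by (metis FieldI2)
 qed
 then show ?thesis using ex_succ by blast
 qed
 then obtain b where s: "is_succ r a b" by blast
 have ab: "(a, b) : r" using succ_under(1)[OF s] .
 have b: "b : Field r" using ab by (rule FieldI2)
 note st = step_atD[OF D(9)[OF s]]
 have io_sq: "io P $ io u = io v $ io i" using arg_cong[OF sq, of io] unfolding io_cmp .
 have iqu: "io u = io (q a) $ io u'" unfolding io_cmp[symmetric] qu ..
 have "io (p a) $ io u' = io v $ io i"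
 proof -
 have "io (p a) $ io u' = (io P $ io (q a)) $ io u'" unfolding D(14)[OF a] ..
 also have "... = io P $ io (q a) $ io u'" using D(11-13) qd(2-4)[OF a] u'U by simp
 finally show ?thesis unfolding iqu[symmetric] io_sq .
 qed
 then have cm: "comm i (p a) (io u') (io v)" unfolding comm_def using u'U v c D(3-5)[OF a] D(13) by simp
 let ?l = "t a b i (io u') (io v)"
 have F: "?l : GA" "dm ?l = cd i" "cd ?l = X b" "deg ?l = 0" "df ?l = t a b i (df (io u')) (df (io v))"
 using famD(1-4)[OF conjunct1[OF st(8)[OF i, unfolded chf_def]] cm] st(8)[OF i, unfolded chf_def, THEN conjunct2, THEN spec, THEN spec, THEN mp, OF cm] dg(4)[OF ab] by simp_all
 \<comment> \<open>The cells form a chain map in the square, so a closed square has a closed cell;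
   the lift therefore lies in the underlying category.\<close>
 have "cl ?l"
 using F fam_zr[OF iU D(3)[OF a] conjunct1[OF st(8)[OF i, unfolded chf_def]], of 1] io_cl[OF u'U(1)] io_cl[OF v] u'U c D(4,5)[OF a] D(13) dg(4)[OF ab] unfolding cl_def by simp
 then have lU: "uo ?l : UA" "io (uo ?l) = ?l" using uo_UA[OF F(1,4)] io_uo[OF F(4)] by blast+
 define h where "h = cmp UM (q b) (uo ?l)"
 have ih: "io h = io (q b) $ ?l" unfolding h_def io_cmp lU(2) ..
 have "io h $ io i = io u"
 proof -
 have "io h $ io i = io (q b) $ ?l $ io i" unfolding ih using F qd(2-4)[OF b] iU by simp
 also have "... = io (q b) $ io (x a b) $ io u'" unfolding st(9)[OF i cm] ..
 also have "... = (io (q b) $ io (x a b)) $ io u'" using qd(2-4)[OF b] dg(2-4)[OF ab] u'U by simp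
 also have "io (q b) $ io (x a b) = io (q a)" unfolding io_cmp[symmetric] qd(5)[OF ab] ..
 finally show ?thesis unfolding iqu .
 qed
 then have 1: "cmp UM h i = u" by (intro io_inj) (simp add: io_cmp)
 have "io P $ io h = io v"
 proof -
 have "io P $ io h = (io P $ io (q b)) $ ?l" unfolding ih using F qd(2-4)[OF b] D(11-13) by simp
 then show ?thesis unfolding D(14)[OF b] st(10)[OF i cm] .
 qed
 then have "cmp UM P h = v" by (intro io_inj) (simp add: io_cmp)
 moreover have "h : UA" "dm h = cd i" "cd h = dm P" unfolding h_def using lU F qd(2-4)[OF b] D(12) by simp_all
 ultimately show "EX h. h : UA & dm h = cd i & cd h = dm P & cmp UM h i = u & cmp UM P h = v" using 1 by blast
qed

end

section \<open>Functoriality\<close>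

context etower begin

text \<open>A tower is fixed once for every arrow, which makes the assignment on objects a
  function.\<close>

definition dat where
 "dat f = (SOME d. case d of (X, p, x, t, L, q, P) => tw f X p x t L q P)"

abbreviation "XX f \<equiv> fst (dat f)"
abbreviation "pp f \<equiv> fst (snd (dat f))"
abbreviation "xx f \<equiv> fst (snd (snd (dat f)))"
abbreviation "tt f \<equiv> fst (snd (snd (snd (dat f))))"
abbreviation "LL f \<equiv> fst (snd (snd (snd (snd (dat f)))))"
abbreviation "qq f \<equiv> fst (snd (snd (snd (snd (snd (dat f))))))"
abbreviation "PP f \<equiv> snd (snd (snd (snd (snd (snd (dat f))))))"

lemma tw: assumes "f : UA" shows "tw f (XX f) (pp f) (xx f) (tt f) (LL f) (qq f) (PP f)"
proof -
 have "EX d. case d of (X, p, x, t, L, q, P) => tw f X p x t L q P"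
 proof -
 obtain X p x t L q P where t: "tw f X p x t L q P" using tower_ex[OF assms] by (elim exE) (rule that)
 show ?thesis by (rule exI[of _ "(X, p, x, t, L, q, P)"]) (simp only: prod.case t)
 qed
 from someI_ex[OF this] show ?thesis unfolding dat_def[symmetric] by (simp only: case_prod_beta)
qed

lemma qd:
 assumes "f : UA" "c : Field r"
 shows "qq f c : UA" "dm (qq f c) = XX f c" "cd (qq f c) = LL f"
 using colimD(2-4)[OF twD(10)[OF tw[OF assms(1)]] assms(2)] by simp_all

lemma xd:
 assumes "f : UA" "(b, c) : r"
 shows "xx f b c : UA" "dm (xx f b c) = XX f b" "cd (xx f b c) = XX f c"
 using diagD(2-4)[OF twD(2)[OF tw[OF assms(1)]] assms(2)] by simp_all

lemma pd:
 assumes "f : UA" "c : Field r"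
 shows "pp f c : UA" "dm (pp f c) = XX f c" "cd (pp f c) = cd f"
 using twD(3-5)[OF tw[OF assms(1)] assms(2)] by simp_all

lemma td:
 assumes f: "f : UA" and s: "is_succ r b c" and i: "i : I" and c: "comm i (pp f b) u v"
 shows "tt f b c i u v : GA" "dm (tt f b c i u v) = cd i" "cd (tt f b c i u v) = XX f c" "deg (tt f b c i u v) = deg u"
 "tt f b c i (df u) (df v) = df (tt f b c i u v)" "tt f b c i u v $ io i = io (xx f b c) $ u" "io (pp f c) $ tt f b c i u v = v"
 "e : carrier k ==> tt f b c i (sm e u) (sm e v) = sm e (tt f b c i u v)"
 "comm i (pp f b) u' v' ==> deg u' = deg u ==> tt f b c i (ad u u') (ad v v') = ad (tt f b c i u v) (tt f b c i u' v')"
proof -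
 note st = step_atD[OF twD(9)[OF tw[OF f] s]]
 note ch = st(8)[OF i, unfolded chf_def]
 note F = famD[OF conjunct1[OF ch] c]
 have "cd (xx f b c) = XX f c" by (rule xd(3)[OF f succ_under(1)[OF s]])
 then show "tt f b c i u v : GA" "dm (tt f b c i u v) = cd i" "cd (tt f b c i u v) = XX f c" "deg (tt f b c i u v) = deg u"
 using F(1-4) by simp_all
 show "tt f b c i (df u) (df v) = df (tt f b c i u v)" by (rule ch[THEN conjunct2, THEN spec, THEN spec, THEN mp, OF c])
 show "tt f b c i u v $ io i = io (xx f b c) $ u" "io (pp f c) $ tt f b c i u v = v" by (rule st(9)[OF i c], rule st(10)[OF i c])
 show "e : carrier k ==> tt f b c i (sm e u) (sm e v) = sm e (tt f b c i u v)" by (rule F(5))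
 show "comm i (pp f b) u' v' ==> deg u' = deg u ==> tt f b c i (ad u u') (ad v v') = ad (tt f b c i u v) (tt f b c i u' v')" by (rule F(6))
qed

text \<open>\<open>y\<close> is the component at stage \<open>c\<close> of the map of towers induced
  by the square \<open>(alv, bev)\<close> from \<open>f\<close> to \<open>g\<close>, with
  \<open>h\<close> holding the earlier components. It begins with \<open>alv\<close>, respects
  transitions and projections, and carries the cell of a square to the cell of the composed
  square.\<close>

definition phc where
 "phc f g alv bev h c y \<longleftrightarrow> y : GA & dm y = XX f c & cd y = XX g c & deg y = deg alv &
 (ALL b. (b, c) : r --> b ~= c --> y $ io (xx f b c) = io (xx g b c) $ h b) & io (pp g c) $ y = bev $ io (pp f c) & (c = z --> y = alv) &
 (ALL b. is_succ r b c --> (ALL i:I. ALL u v. comm i (pp f b) u v --> y $ tt f b c i u v = tt g b c i (h b $ u) (bev $ v)))"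

lemma phcD:
 assumes "phc f g alv bev h c y"
 shows "y : GA" "dm y = XX f c" "cd y = XX g c" "deg y = deg alv" "(b, c) : r ==> b ~= c ==> y $ io (xx f b c) = io (xx g b c) $ h b"
 "io (pp g c) $ y = bev $ io (pp f c)" "c = z ==> y = alv"
 "is_succ r b c ==> i : I ==> comm i (pp f b) u v ==> y $ tt f b c i u v = tt g b c i (h b $ u) (bev $ v)"
 using assms unfolding phc_def by blast+

lemma phcI:
 assumes "y : GA" "dm y = XX f c" "cd y = XX g c" "deg y = deg alv" "!!b. (b, c) : r ==> b ~= c ==> y $ io (xx f b c) = io (xx g b c) $ h b"
 "io (pp g c) $ y = bev $ io (pp f c)" "c = z ==> y = alv"
 "!!b i u v. is_succ r b c ==> i : I ==> comm i (pp f b) u v ==> y $ tt f b c i u v = tt g b c i (h b $ u) (bev $ v)"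
 shows "phc f g alv bev h c y"
 unfolding phc_def by (intro conjI allI impI ballI assms)

definition phi where "phi f g alv bev h \<longleftrightarrow> (ALL c:Field r. phc f g alv bev h c (h c))"

lemma phi_x:
 assumes ph: "phi f g alv bev h" and fg: "f : UA" "g : UA" and bc: "(b, c) : r"
 shows "h c $ io (xx f b c) = io (xx g b c) $ h b"
proof (cases "b = c")
 case True
 have c: "c : Field r" using bc by (rule FieldI2)
 note P = phcD(1-3)[OF ph[unfolded phi_def, THEN bspec, OF c]]
 have "xx f c c = idt UM (XX f c)" "xx g c c = idt UM (XX g c)"
 using diagD(5)[OF twD(2)[OF tw] c] fg by blast+
 then show ?thesis using P True by (simp add: io_idt)
next
 case False then show ?thesis using phcD(5)[OF ph[unfolded phi_def, THEN bspec, OF FieldI2[OF bc]] bc] by blast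
qed

lemma phi_comm:
 assumes h: "y : GA" "dm (y) = XX f b" "cd (y) = XX g b" "deg (y) = deg alv" "io (pp g b) $ y = bev $ io (pp f b)"
 and b: "b : Field r" and fg: "f : UA" "g : UA" "comm f g alv bev" and i: "i : I" and c: "comm i (pp f b) u v"
 shows "comm i (pp g b) (y $ u) (bev $ v)"
proof -
 note cc = commD[OF c] and ab = commD[OF fg(3)] and pf = pd[OF fg(1) b] and pg = pd[OF fg(2) b] and iU = I_UA[OF i]
 have "io (pp g b) $ y $ u = (io (pp g b) $ y) $ u" using h(1-4) cc pf pg by simp
 also have "... = bev $ io (pp f b) $ u" unfolding h(5) using ab cc pf by simp
 also have "... = (bev $ v) $ io i" unfolding cc(8) using ab cc pf iU by simp
 finally show ?thesis unfolding comm_def using h(1-4) cc pf pg ab by simp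
qed

lemma succ_F: "is_succ r b c ==> (b, c) : r & b ~= c & b : Field r & c : Field r"
 using succ_under(1) by (auto simp: is_succ_def underS_iff intro: FieldI1 FieldI2)

text \<open>In every degree, an arrow out of a successor stage is determined by the preceding stage
  and the cells, and an arrow out of a limit stage by the earlier stages. The functor laws all rest
  on this uniqueness.\<close>

lemma phi_unique:
 assumes ph: "phi f g alv bev h" "phi f g alv bev h'" and fg: "f : UA" "g : UA" and c: "c : Field r"
 shows "h c = h' c"
 using c
proof (induction c rule: r_induct)
 case (less c)
 note c = less(1)
 note A = phcD[OF ph(1)[unfolded phi_def, THEN bspec, OF c]] and B = phcD[OF ph(2)[unfolded phi_def, THEN bspec, OF c]]
 have IH: "h b = h' b" if "(b, c) : r" "b ~= c" for b using less(2) that by (simp add: underS_iff)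
 from c show ?case
 proof (cases rule: r_cases)
 case zero then have "c = z" using underS_empty[OF c] by blast
 then show ?thesis using A(7) B(7) by simp
 next
 case (succ b)
 note s = succ_F[OF succ]
 have bc: "(b, c) : r" "b ~= c" using s by blast+
 note x = xd[OF fg(1) bc(1)]
 note st = step_atD[OF twD(9)[OF tw[OF fg(1)] succ]]
 show ?thesis
 proof (rule st(12))
 show "h c $ io (xx f b c) = h' c $ io (xx f b c)" unfolding A(5)[OF bc] B(5)[OF bc] IH[OF bc] ..
 show "h c $ tt f b c i u v = h' c $ tt f b c i u v" if "i : I" "comm i (pp f b) u v" for i u v
 unfolding A(8)[OF succ that] B(8)[OF succ that] IH[OF bc] ..
 qed (use A(1-4) B(1-4) x in simp_all)
 next
 case lim
 have co: "colim UM (Restr r (underS r c)) (XX f) (xx f) (XX f c) (%b. xx f b c)"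
 using twD(1)[OF tw[OF fg(1)]] lim unfolding lamseq_def by blast
 have dg: "diag UM (Restr r (underS r c)) (XX f) (xx f)"
 using twD(2)[OF tw[OF fg(1)]] unfolding diag_def Field_RU using underS_F by blast
 show ?thesis
 proof (rule colim_gr_unique[OF co dg])
 show "h c $ io (xx f b c) = h' c $ io (xx f b c)" if "b : Field (Restr r (underS r c))" for b
 proof -
 have bc: "(b, c) : r" "b ~= c" using that unfolding Field_RU by (simp_all add: underS_iff)
 show ?thesis unfolding A(5)[OF bc] B(5)[OF bc] IH[OF bc] ..
 qed
 qed (use A(1-4) B(1-4) in simp_all)
 qed
qed

text \<open>Components are constructed by recursion on stages. At a successor the universal property
  of the step is applied to the cells in the tower of \<open>g\<close>, at a limit
  \<open>colim_gr_ex\<close> to the components found so far.\<close>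

lemma phi_ex:
 assumes f: "f : UA" and g: "g : UA" and ab: "comm f g alv bev"
 shows "EX h. phi f g alv bev h"
proof -
 note a = commD[OF ab] and twf = twD[OF tw[OF f]] and twg = twD[OF tw[OF g]]
 have "EX h. ALL c. c : Field r --> phc f g alv bev h c (h c)"
 proof (rule dependent_wf_choice[OF r_wf, of "%h c y. c : Field r --> phc f g alv bev h c y"])
 fix h h' :: "'u => 'o \<times> 'o \<times> int \<times> 'u" and c y
 assume e: "!!b. (b, c) : r - Id ==> h b = h' b"
 have e1: "h b = h' b" if "(b, c) : r" "b ~= c" for b using e that by blast
 have e2: "h b = h' b" if "is_succ r b c" for b using e1 succ_F[OF that] by blast
 show "(c : Field r --> phc f g alv bev h c y) = (c : Field r --> phc f g alv bev h' c y)"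
 unfolding phc_def using e1 e2 by (simp cong: conj_cong imp_cong)
 next
 fix c h assume IH0: "!!b. (b, c) : r - Id ==> b : Field r --> phc f g alv bev h b (h b)"
 have IH: "phc f g alv bev h b (h b)" if "(b, c) : r" "b ~= c" for b using IH0[of b] that FieldI1[OF that(1)] by blast
 show "EX y. c : Field r --> phc f g alv bev h c y"
 proof (cases "c : Field r")
 case c: True
 note pf = pd[OF f c] and pg = pd[OF g c]
 have "EX y. phc f g alv bev h c y"
 using c
 proof (cases rule: r_cases)
 case zero
 then have cz: "c = z" using underS_empty[OF c] by blast
 have n: "\<not> (b, c) : r \<or> b = c" for b using zero by (auto simp: underS_iff)
 show ?thesis
 proof (rule exI, rule phcI)
 show "alv : GA" "dm alv = XX f c" "cd alv = XX g c" "io (pp g c) $ alv = bev $ io (pp f c)" unfolding cz twf(7,8) twg(7,8) using a by simp_all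
 qed (use n succ_F in blast)+
 next
 case (succ b)
 have bc: "(b, c) : r" "b ~= c" and b: "b : Field r" using succ_F[OF succ] by blast+
 note H = phcD[OF IH[OF bc]] and x = xd[OF f bc(1)] and x' = xd[OF g bc(1)] and pb = pd[OF f b] and pb' = pd[OF g b]
 note st = step_atD[OF twf(9)[OF succ]]
 let ?x = "io (xx g b c) $ h b" and ?tu = "%i u v. tt g b c i (h b $ u) (bev $ v)"
 have cm: "comm i (pp g b) (h b $ u) (bev $ v)" if "i : I" "comm i (pp f b) u v" for i u v
 by (rule phi_comm[OF H(1-4,6) b f g ab that])
 \<comment> \<open>The cells of the composed squares form a family with the boundary values of
   \<open>?x\<close>: composing a square on the left is linear and introduces no sign.\<close>
 have sf: "sfam (pp f b) (deg ?x) (cd ?x) ?x ?tu"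
 unfolding sfam_def
 proof (intro ballI conjI allI impI famI)
 fix i u v assume i: "i : I" and c1: "comm i (pp f b) u v"
 note T = td[OF g succ i cm[OF i c1]] and cc = commD[OF c1]
 show "?tu i u v : GA" "dm (?tu i u v) = cd i" "cd (?tu i u v) = cd ?x" "deg (?tu i u v) = deg ?x + deg u" using T(1-4) x' H(4) by simp_all
 show "?tu i u v $ io i = ?x $ u" unfolding T(6) using x' H(1-3) cc pb by simp
 show "?tu i (sm e u) (sm e v) = sm e (?tu i u v)" if e: "e : carrier k" for e
 using T(8)[OF e] cmp_sm_right[OF cc(1) e H(1)] cmp_sm_right[OF cc(2) e a(2)] H(2) cc pb a by simp
 fix u' v' assume c2: "comm i (pp f b) u' v'" and d: "deg u' = deg u"
 note cc' = commD[OF c2]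
 show "?tu i (ad u u') (ad v v') = ad (?tu i u v) (?tu i u' v')"
 using T(9)[OF cm[OF i c2]] cmp_ad_right[OF cc(1) cc'(1) _ H(1)] cmp_ad_right[OF cc(2) cc'(2) _ a(2)] H(2) cc cc' pb a d by (simp add: par_def)
 qed
 have "EX y. y : GA & dm y = cd (xx f b c) & cd y = cd ?x & deg y = deg ?x & y $ io (xx f b c) = ?x &
 (ALL i:I. ALL u v. comm i (pp f b) u v --> y $ tt f b c i u v = ?tu i u v)"
 by (rule st(11)[OF _ _ sf]) (use H(1-3) x' pb in simp_all)
 then obtain y where y: "y : GA" "dm y = XX f c" "cd y = XX g c" "deg y = deg alv" "y $ io (xx f b c) = ?x"
 and yt: "!!i u v. i : I ==> comm i (pp f b) u v ==> y $ tt f b c i u v = ?tu i u v" using x x' H(4) by auto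
 show ?thesis
 proof (rule exI, rule phcI[OF y(1-4)])
 fix d assume d: "(d, c) : r" "d ~= c"
 have db: "(d, b) : r" using succ d unfolding is_succ_def by (auto simp: underS_iff under_iff)
 show "y $ io (xx f d c) = io (xx g d c) $ h d"
 proof (cases "d = b")
 case True then show ?thesis using y(5) by simp
 next
 case False
 have "xx f d c = cmp UM (xx f b c) (xx f d b)" "xx g d c = cmp UM (xx g b c) (xx g d b)"
 using diagD(6)[OF twf(2) db bc(1)] diagD(6)[OF twg(2) db bc(1)] by simp_all
 then have e: "io (xx f d c) = io (xx f b c) $ io (xx f d b)" "io (xx g d c) = io (xx g b c) $ io (xx g d b)" by (simp_all add: io_cmp)
 note xd' = xd[OF f db] xd[OF g db] and Hd = phcD[OF IH[OF d]]
 have "y $ io (xx f d c) = (y $ io (xx f b c)) $ io (xx f d b)" unfolding e using y(1-4) x xd' by simp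
 also have "... = io (xx g b c) $ h b $ io (xx f d b)" unfolding y(5) using H(1-3) x' xd' by simp
 also have "... = io (xx g b c) $ io (xx g d b) $ h d" unfolding H(5)[OF db False] ..
 also have "... = io (xx g d c) $ h d" unfolding e using Hd(1-3) x' xd' by simp
 finally show ?thesis .
 qed
 next
 \<comment> \<open>Both sides are arrows out of the new stage, so it suffices to compare them on the
   preceding stage and on the cells.\<close>
 show "io (pp g c) $ y = bev $ io (pp f c)"
 proof (rule st(12))
 have "(io (pp g c) $ y) $ io (xx f b c) = io (pp g c) $ y $ io (xx f b c)" using y(1-4) pg x by simp
 also have "... = (io (pp g c) $ io (xx g b c)) $ h b" unfolding y(5) using H(1-3) x' pg by simp
 also have "... = bev $ io (pp f b)" unfolding twg(6)[OF bc(1)] H(6) ..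
 also have "... = (bev $ io (pp f c)) $ io (xx f b c)" unfolding twf(6)[OF bc(1), symmetric] using a pf x by simp
 finally show "(io (pp g c) $ y) $ io (xx f b c) = (bev $ io (pp f c)) $ io (xx f b c)" .
 fix i u v assume i: "i : I" and c1: "comm i (pp f b) u v"
 note T = td[OF f succ i c1] and T' = td[OF g succ i cm[OF i c1]]
 have "(io (pp g c) $ y) $ tt f b c i u v = io (pp g c) $ y $ tt f b c i u v" using y(1-4) pg T(1-4) by simp
 also have "... = bev $ v" unfolding yt[OF i c1] T'(7) ..
 also have "... = (bev $ io (pp f c)) $ tt f b c i u v" using a pf T(1-4) T(7) by simp
 finally show "(io (pp g c) $ y) $ tt f b c i u v = (bev $ io (pp f c)) $ tt f b c i u v" .
 qed (use y(1-4) pf pg a x in simp_all)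
 next
 assume "c = z" then show "y = alv" using underS_empty[OF c] bc by (auto simp: underS_iff)
 next
 fix d i u v assume s: "is_succ r d c" and i: "i : I" and c1: "comm i (pp f d) u v"
 have "d = b" by (rule succ_unique[OF s succ])
 then show "y $ tt f d c i u v = tt g d c i (h d $ u) (bev $ v)" using yt[OF i] c1 by blast
 qed
 next
 case lim
 let ?R = "Restr r (underS r c)"
 have co: "colim UM ?R (XX f) (xx f) (XX f c) (%b. xx f b c)" using twf(1) lim unfolding lamseq_def by blast
 have dg: "diag UM ?R (XX f) (xx f)" using twf(2) unfolding diag_def Field_RU using underS_F by blast
 have Fb: "(b, c) : r" "b ~= c" if "b : Field ?R" for b using that unfolding Field_RU by (simp_all add: underS_iff)
 have cz: "c ~= z" using lim underS_z unfolding is_limit_elt_def by blast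
 have "EX y. y : GA & dm y = XX f c & cd y = XX g c & deg y = deg alv & (ALL b:Field ?R. y $ io (xx f b c) = io (xx g b c) $ h b)"
 proof (rule colim_gr_ex[OF co dg])
 show "XX g c : DObj M" using pg by (metis UA_Obj(1))
 show "io (xx g b c) $ h b : GA & dm (io (xx g b c) $ h b) = XX f b & cd (io (xx g b c) $ h b) = XX g c & deg (io (xx g b c) $ h b) = deg alv"
 if "b : Field ?R" for b using phcD(1-4)[OF IH[OF Fb[OF that]]] xd[OF g Fb(1)[OF that]] by simp
 fix d b assume db: "(d, b) : ?R"
 then have r: "(d, b) : r" and F: "d : Field ?R" "b : Field ?R" by (auto intro: FieldI1 FieldI2)
 note Hb = phcD[OF IH[OF Fb[OF F(2)]]] and Hd = phcD[OF IH[OF Fb[OF F(1)]]]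
 note xs = xd[OF g r] xd[OF f r] xd[OF g Fb(1)[OF F(2)]]
 show "(io (xx g b c) $ h b) $ io (xx f d b) = io (xx g d c) $ h d"
 proof (cases "d = b")
 case True
 have "xx f b b = idt UM (XX f b)" by (rule diagD(5)[OF twf(2) FieldI1[OF Fb(1)[OF F(2)]]])
 then show ?thesis using Hb(1-3) xs True by (simp add: io_idt)
 next
 case False
 have "(io (xx g b c) $ h b) $ io (xx f d b) = io (xx g b c) $ h b $ io (xx f d b)" using Hb(1-3) xs by simp
 also have "... = (io (xx g b c) $ io (xx g d b)) $ h d" unfolding Hb(5)[OF r False] using Hd(1-3) xs by simp
 also have "io (xx g b c) $ io (xx g d b) = io (xx g d c)" unfolding io_cmp[symmetric] diagD(6)[OF twg(2) r Fb(1)[OF F(2)]] ..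
 finally show ?thesis .
 qed
 qed
 then obtain y where y: "y : GA" "dm y = XX f c" "cd y = XX g c" "deg y = deg alv" and yx: "!!b. b : Field ?R ==> y $ io (xx f b c) = io (xx g b c) $ h b" by blast
 have yx': "y $ io (xx f b c) = io (xx g b c) $ h b" if "(b, c) : r" "b ~= c" for b
 by (rule yx) (simp add: Field_RU underS_iff that)
 show ?thesis
 proof (rule exI, rule phcI[OF y yx'])
 show "io (pp g c) $ y = bev $ io (pp f c)"
 proof (rule colim_gr_unique[OF co dg])
 fix b assume bF: "b : Field ?R"
 note bc = Fb[OF bF]
 note H = phcD[OF IH[OF bc]] and x = xd[OF f bc(1)] and x' = xd[OF g bc(1)]
 have "(io (pp g c) $ y) $ io (xx f b c) = io (pp g c) $ y $ io (xx f b c)" using y(1-4) pg x by simp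
 also have "... = (io (pp g c) $ io (xx g b c)) $ h b" unfolding yx[OF bF] using H(1-3) x' pg by simp
 also have "... = bev $ io (pp f b)" unfolding twg(6)[OF bc(1)] H(6) ..
 also have "... = (bev $ io (pp f c)) $ io (xx f b c)" unfolding twf(6)[OF bc(1), symmetric] using a pf x by simp
 finally show "(io (pp g c) $ y) $ io (xx f b c) = (bev $ io (pp f c)) $ io (xx f b c)" .
 qed (use y pf pg a in simp_all)
 show "y = alv" if "c = z" using cz that by blast
 show "y $ tt f b c i u v = tt g b c i (h b $ u) (bev $ v)" if "is_succ r b c" for b i u v
 using lim that unfolding is_limit_elt_def by blast
 qed
 qed
 then show ?thesis by blast
 qed blast
 qed
 then show ?thesis unfolding phi_def by blast
qed

text \<open>\<open>H\<close> is the arrow between the colimits induced by a map of towers over the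
  square \<open>(alv, bev)\<close>; it becomes the middle component of the dg functor.\<close>

definition psi where
 "psi f g alv bev H \<longleftrightarrow> (EX h. phi f g alv bev h & H : GA & dm H = LL f & cd H = LL g & deg H = deg alv &
 (ALL c:Field r. H $ io (qq f c) = io (qq g c) $ h c))"

lemma psi_unique:
 assumes H: "psi f g alv bev H" "psi f g alv bev H'" and f: "f : UA" and g: "g : UA" shows "H = H'"
proof -
 obtain h where h: "phi f g alv bev h" "H : GA" "dm H = LL f" "cd H = LL g" "deg H = deg alv" "ALL c:Field r. H $ io (qq f c) = io (qq g c) $ h c"
 using H(1) unfolding psi_def by (elim exE conjE) (rule that)
 obtain h' where h': "phi f g alv bev h'" "H' : GA" "dm H' = LL f" "cd H' = LL g" "deg H' = deg alv" "ALL c:Field r. H' $ io (qq f c) = io (qq g c) $ h' c"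
 using H(2) unfolding psi_def by (elim exE conjE) (rule that)
 show ?thesis
 by (rule colim_gr_unique[OF twD(10,2)[OF tw[OF f]]]) (use h(2-6) h'(2-6) phi_unique[OF h(1) h'(1) f g] in simp_all)
qed

lemma psi_ex:
 assumes f: "f : UA" and g: "g : UA" and ab: "comm f g alv bev" shows "EX H. psi f g alv bev H"
proof -
 obtain h where h: "phi f g alv bev h" using phi_ex[OF assms] by blast
 have hD: "h c : GA" "dm (h c) = XX f c" "cd (h c) = XX g c" "deg (h c) = deg alv" if "c : Field r" for c
 using phcD(1-4)[OF h[unfolded phi_def, THEN bspec, OF that]] .
 note qg = colimD(5)[OF twD(10)[OF tw[OF g]]]
 have "EX H. H : GA & dm H = LL f & cd H = LL g & deg H = deg alv & (ALL c:Field r. H $ io (qq f c) = io (qq g c) $ h c)"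
 proof (rule colim_gr_ex[OF twD(10,2)[OF tw[OF f]]])
 show "LL g : DObj M" using colimD(1)[OF twD(10)[OF tw[OF g]]] by simp
 show "io (qq g c) $ h c : GA & dm (io (qq g c) $ h c) = XX f c & cd (io (qq g c) $ h c) = LL g & deg (io (qq g c) $ h c) = deg alv"
 if "c : Field r" for c using hD[OF that] qd[OF g that] by simp
 fix b c assume bc: "(b, c) : r"
 have F: "b : Field r" "c : Field r" using bc by (auto intro: FieldI1 FieldI2)
 note gg = hD[OF F(1)] hD[OF F(2)] qd[OF g F(1)] qd[OF g F(2)] xd[OF f bc] xd[OF g bc]
 have "(io (qq g c) $ h c) $ io (xx f b c) = io (qq g c) $ h c $ io (xx f b c)" using gg by simp
 also have "... = (io (qq g c) $ io (xx g b c)) $ h b" unfolding phi_x[OF h f g bc] using gg by simp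
 also have "io (qq g c) $ io (xx g b c) = io (qq g b)" unfolding io_cmp[symmetric] qg[OF bc] ..
 finally show "(io (qq g c) $ h c) $ io (xx f b c) = io (qq g b) $ h b" .
 qed
 then show ?thesis unfolding psi_def using h by blast
qed

end

section \<open>Linear combinations, differentials and composites of maps of towers\<close>

context etower begin

context
 fixes f g assumes f: "f : UA" and g: "g : UA"
begin

lemma phiD: assumes "phi f g alv bev h" "c : Field r" shows "phc f g alv bev h c (h c)"
 using assms unfolding phi_def by blast

lemma phi_cm:
 assumes p: "phi f g alv bev h" and ab: "comm f g alv bev" and b: "b : Field r" and i: "i : I" and c: "comm i (pp f b) u v"
 shows "comm i (pp g b) (h b $ u) (bev $ v)"
 by (rule phi_comm[OF phcD(1-4,6)[OF phiD[OF p b]] b f g ab i c])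

lemma phi_ad:
 assumes p: "phi f g alv bev h" "phi f g alv' bev' h'" and ab: "comm f g alv bev" "comm f g alv' bev'" and d: "deg alv' = deg alv"
 shows "phi f g (ad alv alv') (ad bev bev') (%c. ad (h c) (h' c))"
 unfolding phi_def
proof (intro ballI phcI)
 fix c assume c: "c : Field r"
 note A = phcD[OF phiD[OF p(1) c]] and B = phcD[OF phiD[OF p(2) c]] and pf = pd[OF f c] and pg = pd[OF g c] and a = commD[OF ab(1)] and a' = commD[OF ab(2)]
 have par: "par (h c) (h' c)" "par bev bev'" using A B a a' d by (simp_all add: par_def)
 show "ad (h c) (h' c) : GA" using A(1) B(1) par by simp
 show "dm (ad (h c) (h' c)) = XX f c" "cd (ad (h c) (h' c)) = XX g c" "deg (ad (h c) (h' c)) = deg (ad alv alv')" using A by simp_all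
 show "io (pp g c) $ ad (h c) (h' c) = ad bev bev' $ io (pp f c)"
 using cmp_ad_right[OF A(1) B(1) par(1), of "io (pp g c)"] cmp_ad_left[OF a(2) a'(2) par(2), of "io (pp f c)"] A(3,6) B(6) pf pg a by simp
 show "ad (h c) (h' c) = ad alv alv'" if "c = z" using A(7) B(7) that by simp
 fix b
 { assume bc: "(b, c) : r" "b ~= c"
 note A' = phcD[OF phiD[OF p(1) FieldI1[OF bc(1)]]] and B' = phcD[OF phiD[OF p(2) FieldI1[OF bc(1)]]]
 have par': "par (h b) (h' b)" using A' B' d by (simp add: par_def)
 show "ad (h c) (h' c) $ io (xx f b c) = io (xx g b c) $ ad (h b) (h' b)"
 using cmp_ad_left[OF A(1) B(1) par(1), of "io (xx f b c)"] cmp_ad_right[OF A'(1) B'(1) par', of "io (xx g b c)"]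
 A(2) A(5)[OF bc] B(5)[OF bc] A'(3) xd[OF f bc(1)] xd[OF g bc(1)] by simp }
 fix i u v assume s: "is_succ r b c" and i: "i : I" and cm: "comm i (pp f b) u v"
 have b: "b : Field r" using succ_F[OF s] by blast
 note A' = phcD[OF phiD[OF p(1) b]] and B' = phcD[OF phiD[OF p(2) b]] and T = td[OF f s i cm] and cc = commD[OF cm] and pb = pd[OF f b]
 have par': "par (h b) (h' b)" using A' B' d by (simp add: par_def)
 have "ad (h c) (h' c) $ tt f b c i u v = ad (h c $ tt f b c i u v) (h' c $ tt f b c i u v)"
 by (rule cmp_ad_left[OF A(1) B(1) par(1)]) (use T A in simp_all)
 also have "... = tt g b c i (ad (h b $ u) (h' b $ u)) (ad (bev $ v) (bev' $ v))"
 unfolding A(8)[OF s i cm] B(8)[OF s i cm]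
 by (rule td(9)[OF g s i phi_cm[OF p(1) ab(1) b i cm] phi_cm[OF p(2) ab(2) b i cm], symmetric]) (use A' B' d in simp)
 also have "ad (h b $ u) (h' b $ u) = ad (h b) (h' b) $ u" by (rule cmp_ad_left[OF A'(1) B'(1) par', symmetric]) (use cc A' pb in simp_all)
 also have "ad (bev $ v) (bev' $ v) = ad bev bev' $ v" by (rule cmp_ad_left[OF a(2) a'(2) par(2), symmetric]) (use cc a pb in simp_all)
 finally show "ad (h c) (h' c) $ tt f b c i u v = tt g b c i (ad (h b) (h' b) $ u) (ad bev bev' $ v)" .
qed

lemma phi_sm:
 assumes p: "phi f g alv bev h" and ab: "comm f g alv bev" and e: "e : carrier k"
 shows "phi f g (sm e alv) (sm e bev) (%c. sm e (h c))"
 unfolding phi_def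
proof (intro ballI phcI)
 fix c assume c: "c : Field r"
 note A = phcD[OF phiD[OF p c]] and pf = pd[OF f c] and pg = pd[OF g c] and a = commD[OF ab]
 show "sm e (h c) : GA" using A(1) e by simp
 show "dm (sm e (h c)) = XX f c" "cd (sm e (h c)) = XX g c" "deg (sm e (h c)) = deg (sm e alv)" using A by simp_all
 show "io (pp g c) $ sm e (h c) = sm e bev $ io (pp f c)"
 using cmp_sm_right[OF A(1) e, of "io (pp g c)"] cmp_sm_left[OF a(2) e, of "io (pp f c)"] A(3,6) pf pg a by simp
 show "sm e (h c) = sm e alv" if "c = z" using A(7) that by simp
 fix b
 { assume bc: "(b, c) : r" "b ~= c"
 note A' = phcD[OF phiD[OF p FieldI1[OF bc(1)]]]
 show "sm e (h c) $ io (xx f b c) = io (xx g b c) $ sm e (h b)"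
 using cmp_sm_left[OF A(1) e, of "io (xx f b c)"] cmp_sm_right[OF A'(1) e, of "io (xx g b c)"]
 A(2) A(5)[OF bc] A'(3) xd[OF f bc(1)] xd[OF g bc(1)] by simp }
 fix i u v assume s: "is_succ r b c" and i: "i : I" and cm: "comm i (pp f b) u v"
 have b: "b : Field r" using succ_F[OF s] by blast
 note A' = phcD[OF phiD[OF p b]] and T = td[OF f s i cm] and cc = commD[OF cm] and pb = pd[OF f b]
 have "sm e (h c) $ tt f b c i u v = sm e (h c $ tt f b c i u v)" by (rule cmp_sm_left[OF A(1) e]) (use T A in simp_all)
 also have "... = tt g b c i (sm e (h b $ u)) (sm e (bev $ v))"
 unfolding A(8)[OF s i cm] by (rule td(8)[OF g s i phi_cm[OF p ab b i cm] e, symmetric])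
 also have "sm e (h b $ u) = sm e (h b) $ u" by (rule cmp_sm_left[OF A'(1) e, symmetric]) (use cc A' pb in simp_all)
 also have "sm e (bev $ v) = sm e bev $ v" by (rule cmp_sm_left[OF a(2) e, symmetric]) (use cc a pb in simp_all)
 finally show "sm e (h c) $ tt f b c i u v = tt g b c i (sm e (h b) $ u) (sm e bev $ v)" .
qed

lemma tt_ng:
 assumes s: "is_succ r b c" and i: "i : I" and c: "comm i (pp g b) u v"
 shows "tt g b c i (ng u) (ng v) = ng (tt g b c i u v)"
proof -
 have b: "b : Field r" using succ_F[OF s] by blast
 note cc = commD[OF c] and T = td[OF g s i c] and pb = pd[OF g b]
 have c': "comm i (pp g b) (ng u) (ng v)" unfolding comm_def using cc pb I_UA[OF i] by simp
 note T' = td[OF g s i c']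
 note ch = step_atD(8)[OF twD(9)[OF tw[OF g] s] i, unfolded chf_def, THEN conjunct1]
 have O: "dm i = dm u" "dm (pp g b) = cd u" "cd i = dm v" "cd (pp g b) = cd v" using cc by simp_all
 have "ad (tt g b c i (ng u) (ng v)) (tt g b c i u v) = tt g b c i (ad (ng u) u) (ad (ng v) v)" by (rule T'(9)[OF c, symmetric]) simp
 also have "... = zr (cd i) (cd (xx g b c)) (0 + deg u)"
 unfolding ad_ng(2)[OF cc(1)] ad_ng(2)[OF cc(2)] using fam_zr[OF I_UA[OF i] pb(1) ch, of "deg u"] cc by simp
 also have "... = ad (ng (tt g b c i u v)) (tt g b c i u v)" using ad_ng(2)[OF T(1)] T(2-4) xd(3)[OF g] succ_F[OF s] by simp
 finally show ?thesis by (rule ad_cancel[rotated 5]) (use T T' in "simp_all add: par_def")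
qed

text \<open>Only the condition on cells needs an argument. It is obtained by differentiating the
  cell equation of \<open>h\<close>, whose two sides are expanded by the Leibniz rule.\<close>

lemma phi_df:
 assumes p: "phi f g alv bev h" and ab: "comm f g alv bev"
 shows "phi f g (df alv) (df bev) (%c. df (h c))"
 unfolding phi_def
proof (intro ballI phcI)
 fix c assume c: "c : Field r"
 note A = phcD[OF phiD[OF p c]] and pf = pd[OF f c] and pg = pd[OF g c] and a = commD[OF ab]
 show "df (h c) : GA" using A(1) by simp
 show "dm (df (h c)) = XX f c" "cd (df (h c)) = XX g c" "deg (df (h c)) = deg (df alv)" using A by simp_all
 show "df (h c) = df alv" if "c = z" using A(7) that by simp
 have "io (pp g c) $ df (h c) = df (io (pp g c) $ h c)" using leibniz_left[OF A(1), of "io (pp g c)"] A(3) pg by (simp add: sg_def)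
 also have "... = df bev $ io (pp f c)" unfolding A(6) by (rule leibniz_right) (use a pf in simp_all)
 finally show "io (pp g c) $ df (h c) = df bev $ io (pp f c)" .
 fix b
 { assume bc: "(b, c) : r" "b ~= c"
 note A' = phcD[OF phiD[OF p FieldI1[OF bc(1)]]]
 have "df (h c) $ io (xx f b c) = df (h c $ io (xx f b c))" by (rule leibniz_right[symmetric]) (use A xd[OF f bc(1)] in simp_all)
 also have "... = io (xx g b c) $ df (h b)" unfolding A(5)[OF bc]
 using leibniz_left[OF A'(1), of "io (xx g b c)"] A'(3) xd[OF g bc(1)] by (simp add: sg_def)
 finally show "df (h c) $ io (xx f b c) = io (xx g b c) $ df (h b)" . }
 fix i u v assume s: "is_succ r b c" and i: "i : I" and cm: "comm i (pp f b) u v"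
 have b: "b : Field r" using succ_F[OF s] by blast
 note pb = pd[OF f b] and pb' = pd[OF g b]
 note A' = phcD[OF phiD[OF p b]] and T = td[OF f s i cm] and cc = commD[OF cm]
 note cm' = comm_df[OF I_UA[OF i] pb(1) cm]
 note hc = phi_cm[OF p ab b i cm] and hc' = phi_cm[OF p ab b i cm']
 note Tg = td[OF g s i hc] and Tg' = td[OF g s i hc'] and Td = td[OF f s i cm']
 let ?n = "deg alv"
 have cdf: "comm i (pp g b) (df (h b $ u)) (df (bev $ v))" by (rule comm_df[OF I_UA[OF i] pb'(1) hc])
 have sgt: "tt g b c i (sg ?n (h b $ df u)) (sg ?n (bev $ df v)) = sg ?n (tt g b c i (h b $ df u) (bev $ df v))"
 using tt_ng[OF s i hc'] by (simp add: sg_def)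
 have csg: "comm i (pp g b) (sg ?n (h b $ df u)) (sg ?n (bev $ df v))"
 unfolding comm_def using commD[OF hc'] pb' I_UA[OF i] by simp
 have cl1: "comm i (pp g b) (df (h b) $ u) (df bev $ v)"
 proof -
 have "io (pp g b) $ df (h b) = df (io (pp g b) $ h b)" using leibniz_left[OF A'(1), of "io (pp g b)"] A'(3) pb' by (simp add: sg_def)
 also have "... = df bev $ io (pp f b)" unfolding A'(6) by (rule leibniz_right) (use a pb in simp_all)
 finally have e: "io (pp g b) $ df (h b) = df bev $ io (pp f b)" .
 show ?thesis
 by (rule phi_comm[OF _ _ _ _ e b f g comm_df[OF f g ab] i cm]) (use A' in simp_all)
 qed
 \<comment> \<open>The terms containing the differential of the square agree, by the cell equation
   of \<open>h\<close> at \<open>(df u, df v)\<close>, and carry the same sign; cancelling them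
   leaves the claim.\<close>
 have "ad (df (h c) $ tt f b c i u v) (sg ?n (h c $ df (tt f b c i u v))) = df (h c $ tt f b c i u v)"
 using leibniz[OF T(1) A(1)] A T by simp
 also have "... = tt g b c i (df (h b $ u)) (df (bev $ v))" unfolding A(8)[OF s i cm] Tg(5) ..
 also have "df (h b $ u) = ad (df (h b) $ u) (sg ?n (h b $ df u))" using leibniz[OF cc(1) A'(1)] A' cc pb by simp
 also have "df (bev $ v) = ad (df bev $ v) (sg ?n (bev $ df v))" using leibniz[OF cc(2) a(2)] a cc pb by simp
 also have "tt g b c i (ad (df (h b) $ u) (sg ?n (h b $ df u))) (ad (df bev $ v) (sg ?n (bev $ df v))) =
 ad (tt g b c i (df (h b) $ u) (df bev $ v)) (sg ?n (tt g b c i (h b $ df u) (bev $ df v)))"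
 unfolding sgt[symmetric] by (rule td(9)[OF g s i cl1 csg]) (use A' in simp)
 also have "tt g b c i (h b $ df u) (bev $ df v) = h c $ df (tt f b c i u v)" unfolding A(8)[OF s i cm', symmetric] T(5) ..
 finally show "df (h c) $ tt f b c i u v = tt g b c i (df (h b) $ u) (df bev $ v)"
 by (rule ad_cancel[rotated 5]) (use A A' T td(1-4)[OF g s i cl1] cc in "simp_all add: par_def")
qed

end

end

context etower begin

lemma phi_id:
 assumes f: "f : UA"
 shows "phi f f (idt (gr M) (dm f)) (idt (gr M) (cd f)) (%c. idt (gr M) (XX f c))"
 unfolding phi_def
proof (intro ballI phcI)
 fix c assume c: "c : Field r"
 note p = pd[OF f c]
 have X: "XX f c : DObj M" using UA_Obj(1)[OF p(1)] p(2) by simp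
 show "idt (gr M) (XX f c) : GA" "dm (idt (gr M) (XX f c)) = XX f c" "cd (idt (gr M) (XX f c)) = XX f c"
 "deg (idt (gr M) (XX f c)) = deg (idt (gr M) (dm f))" using X by simp_all
 show "io (pp f c) $ idt (gr M) (XX f c) = idt (gr M) (cd f) $ io (pp f c)" using p f by simp
 show "idt (gr M) (XX f c) = idt (gr M) (dm f)" if "c = z" using twD(7)[OF tw[OF f]] that by simp
 show "idt (gr M) (XX f c) $ io (xx f b c) = io (xx f b c) $ idt (gr M) (XX f b)" if "(b, c) : r" for b
 using xd[OF f that] by simp
 fix b i u v assume s: "is_succ r b c" and i: "i : I" and cm: "comm i (pp f b) u v"
 have b: "b : Field r" using succ_F[OF s] by blast
 note T = td[OF f s i cm] and cc = commD[OF cm] and pb = pd[OF f b]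
 have "idt (gr M) (XX f b) $ u = u" "idt (gr M) (cd f) $ v = v" using cc pb by (metis cmp_idt_left)+
 then show "idt (gr M) (XX f c) $ tt f b c i u v = tt f b c i (idt (gr M) (XX f b) $ u) (idt (gr M) (cd f) $ v)"
 using T(1-4) by simp
qed

lemma phi_cmp:
 assumes f: "f : UA" and g: "g : UA" and g': "g' : UA" and p: "phi f g alv bev h" and p': "phi g g' alv' bev' h'"
 and ab: "comm f g alv bev" and ab': "comm g g' alv' bev'"
 shows "phi f g' (alv' $ alv) (bev' $ bev) (%c. h' c $ h c)"
 unfolding phi_def
proof (intro ballI phcI)
 fix c assume c: "c : Field r"
 note A = phcD[OF phiD[OF f g p c]] and B = phcD[OF phiD[OF g g' p' c]] and pf = pd[OF f c] and pg = pd[OF g c] and pg' = pd[OF g' c]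
 and a = commD[OF ab] and a' = commD[OF ab']
 show "h' c $ h c : GA" "dm (h' c $ h c) = XX f c" "cd (h' c $ h c) = XX g' c" "deg (h' c $ h c) = deg (alv' $ alv)"
 using A(1-4) B(1-4) by simp_all
 have "io (pp g' c) $ h' c $ h c = (io (pp g' c) $ h' c) $ h c" using A(1-4) B(1-4) pg' by simp
 also have "... = bev' $ io (pp g c) $ h c" unfolding B(6) using A(1-4) pg a' by simp
 also have "... = (bev' $ bev) $ io (pp f c)" unfolding A(6) using pf a a' by simp
 finally show "io (pp g' c) $ h' c $ h c = (bev' $ bev) $ io (pp f c)" .
 show "h' c $ h c = alv' $ alv" if "c = z" using A(7) B(7) that by simp
 fix b
 { assume bc: "(b, c) : r" "b ~= c"
 note A' = phcD[OF phiD[OF f g p FieldI1[OF bc(1)]]] and B' = phcD[OF phiD[OF g g' p' FieldI1[OF bc(1)]]]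
 and x = xd[OF f bc(1)] xd[OF g bc(1)] xd[OF g' bc(1)]
 have "(h' c $ h c) $ io (xx f b c) = h' c $ h c $ io (xx f b c)" using A(1-4) B(1-4) x by simp
 also have "... = (h' c $ io (xx g b c)) $ h b" unfolding A(5)[OF bc] using A'(1-4) B(1-4) x by simp
 also have "... = io (xx g' b c) $ h' b $ h b" unfolding B(5)[OF bc] using A'(1-4) B'(1-4) x by simp
 finally show "(h' c $ h c) $ io (xx f b c) = io (xx g' b c) $ h' b $ h b" . }
 fix i u v assume s: "is_succ r b c" and i: "i : I" and cm: "comm i (pp f b) u v"
 have b: "b : Field r" using succ_F[OF s] by blast
 note A' = phcD[OF phiD[OF f g p b]] and B' = phcD[OF phiD[OF g g' p' b]] and T = td[OF f s i cm] and cc = commD[OF cm] and pb = pd[OF f b]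
 note hc = phi_cm[OF f g p ab b i cm]
 have "(h' c $ h c) $ tt f b c i u v = h' c $ h c $ tt f b c i u v" using A(1-4) B(1-4) T(1-4) by simp
 also have "... = tt g' b c i (h' b $ h b $ u) (bev' $ bev $ v)" unfolding A(8)[OF s i cm] B(8)[OF s i hc] ..
 also have "h' b $ h b $ u = (h' b $ h b) $ u" using A'(1-4) B'(1-4) cc pb by simp
 also have "bev' $ bev $ v = (bev' $ bev) $ v" using a a' cc pb by simp
 finally show "(h' c $ h c) $ tt f b c i u v = tt g' b c i ((h' b $ h b) $ u) ((bev' $ bev) $ v)" .
qed

lemma psiI:
 assumes "phi f g alv bev h" "H : GA" "dm H = LL f" "cd H = LL g" "deg H = deg alv" "!!c. c : Field r ==> H $ io (qq f c) = io (qq g c) $ h c"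
 shows "psi f g alv bev H"
 unfolding psi_def using assms by blast

lemma psiE:
 assumes "psi f g alv bev H"
 obtains h where "phi f g alv bev h" "H : GA" "dm H = LL f" "cd H = LL g" "deg H = deg alv" "!!c. c : Field r ==> H $ io (qq f c) = io (qq g c) $ h c"
 using assms unfolding psi_def by blast

lemma psi_id: "f : UA ==> psi f f (idt (gr M) (dm f)) (idt (gr M) (cd f)) (idt (gr M) (LL f))"
proof (rule psiI[OF phi_id])
 assume f: "f : UA"
 have L: "LL f : DObj M" using colimD(1)[OF twD(10)[OF tw[OF f]]] by simp
 show "idt (gr M) (LL f) : GA" "dm (idt (gr M) (LL f)) = LL f" "cd (idt (gr M) (LL f)) = LL f" "deg (idt (gr M) (LL f)) = deg (idt (gr M) (dm f))"
 using L by simp_all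
 show "idt (gr M) (LL f) $ io (qq f c) = io (qq f c) $ idt (gr M) (XX f c)" if "c : Field r" for c using qd[OF f that] by simp
qed

context
 fixes f g assumes f: "f : UA" and g: "g : UA"
begin

lemma psi_ad:
 assumes "psi f g alv bev H" "psi f g alv' bev' H'" and ab: "comm f g alv bev" "comm f g alv' bev'" and d: "deg alv' = deg alv"
 shows "psi f g (ad alv alv') (ad bev bev') (ad H H')"
proof -
 obtain h where h: "phi f g alv bev h" "H : GA" "dm H = LL f" "cd H = LL g" "deg H = deg alv" "!!c. c : Field r ==> H $ io (qq f c) = io (qq g c) $ h c"
 using psiE[OF assms(1)] by blast
 obtain h' where h': "phi f g alv' bev' h'" "H' : GA" "dm H' = LL f" "cd H' = LL g" "deg H' = deg alv'" "!!c. c : Field r ==> H' $ io (qq f c) = io (qq g c) $ h' c"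
 using psiE[OF assms(2)] by blast
 have par: "par H H'" using h h' d by (simp add: par_def)
 show ?thesis
 proof (rule psiI[OF phi_ad[OF f g h(1) h'(1) ab d]])
 fix c assume c: "c : Field r"
 note A = phcD[OF phiD[OF f g h(1) c]] and B = phcD[OF phiD[OF f g h'(1) c]]
 have p: "par (h c) (h' c)" using A B d by (simp add: par_def)
 show "ad H H' $ io (qq f c) = io (qq g c) $ ad (h c) (h' c)"
 using cmp_ad_left[OF h(2) h'(2) par, of "io (qq f c)"] cmp_ad_right[OF A(1) B(1) p, of "io (qq g c)"] h(3) h(6)[OF c] h'(6)[OF c] A(3) qd[OF f c] qd[OF g c] by simp
 qed (use h h' par in simp_all)
qed

lemma psi_sm:
 assumes "psi f g alv bev H" and ab: "comm f g alv bev" and e: "e : carrier k"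
 shows "psi f g (sm e alv) (sm e bev) (sm e H)"
proof -
 obtain h where h: "phi f g alv bev h" "H : GA" "dm H = LL f" "cd H = LL g" "deg H = deg alv" "!!c. c : Field r ==> H $ io (qq f c) = io (qq g c) $ h c"
 using psiE[OF assms(1)] by blast
 show ?thesis
 proof (rule psiI[OF phi_sm[OF f g h(1) ab e]])
 fix c assume c: "c : Field r"
 note A = phcD[OF phiD[OF f g h(1) c]]
 show "sm e H $ io (qq f c) = io (qq g c) $ sm e (h c)"
 using cmp_sm_left[OF h(2) e, of "io (qq f c)"] cmp_sm_right[OF A(1) e, of "io (qq g c)"] h(3) h(6)[OF c] A(3) qd[OF f c] qd[OF g c] by simp
 qed (use h e in simp_all)
qed

lemma psi_df:
 assumes "psi f g alv bev H" and ab: "comm f g alv bev"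
 shows "psi f g (df alv) (df bev) (df H)"
proof -
 obtain h where h: "phi f g alv bev h" "H : GA" "dm H = LL f" "cd H = LL g" "deg H = deg alv" "!!c. c : Field r ==> H $ io (qq f c) = io (qq g c) $ h c"
 using psiE[OF assms(1)] by blast
 show ?thesis
 proof (rule psiI[OF phi_df[OF f g h(1) ab]])
 fix c assume c: "c : Field r"
 note A = phcD[OF phiD[OF f g h(1) c]]
 have "df H $ io (qq f c) = df (H $ io (qq f c))" by (rule leibniz_right[symmetric]) (use h(2-5) qd[OF f c] in simp_all)
 also have "... = io (qq g c) $ df (h c)" unfolding h(6)[OF c] using leibniz_left[OF A(1), of "io (qq g c)"] A(3) qd[OF g c] by (simp add: sg_def)
 finally show "df H $ io (qq f c) = io (qq g c) $ df (h c)" .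
 qed (use h in simp_all)
qed

lemma psi_q:
 assumes "psi f g alv bev H" shows "H $ io (qq f z) = io (qq g z) $ alv"
proof -
 obtain h where h: "phi f g alv bev h" "!!c. c : Field r ==> H $ io (qq f c) = io (qq g c) $ h c" using psiE[OF assms] by blast
 show ?thesis using h(2)[OF z(1)] phcD(7)[OF phiD[OF f g h(1) z(1)] refl] by simp
qed

lemma psi_P:
 assumes "psi f g alv bev H" and ab: "comm f g alv bev" shows "io (PP g) $ H = bev $ io (PP f)"
proof -
 obtain h where h: "phi f g alv bev h" "H : GA" "dm H = LL f" "cd H = LL g" "deg H = deg alv" "!!c. c : Field r ==> H $ io (qq f c) = io (qq g c) $ h c"
 using psiE[OF assms(1)] by blast
 note Pf = twD(11-13)[OF tw[OF f]] and Pg = twD(11-13)[OF tw[OF g]] and a = commD[OF ab]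
 show ?thesis
 proof (rule colim_gr_unique[OF twD(10,2)[OF tw[OF f]]])
 fix c assume c: "c : Field r"
 note A = phcD[OF phiD[OF f g h(1) c]] and q = qd[OF f c] qd[OF g c]
 have "(io (PP g) $ H) $ io (qq f c) = io (PP g) $ H $ io (qq f c)" using h(2-5) Pg q by simp
 also have "... = (io (PP g) $ io (qq g c)) $ h c" unfolding h(6)[OF c] using A(1-4) Pg q by simp
 also have "... = bev $ io (pp f c)" unfolding twD(14)[OF tw[OF g] c] A(6) ..
 also have "... = (bev $ io (PP f)) $ io (qq f c)" unfolding twD(14)[OF tw[OF f] c, symmetric] using a Pf q by simp
 finally show "(io (PP g) $ H) $ io (qq f c) = (bev $ io (PP f)) $ io (qq f c)" .
 qed (use h(2-5) Pf Pg a in simp_all)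
qed

end

lemma psi_cmp:
 assumes f: "f : UA" and g: "g : UA" and g': "g' : UA" and p: "psi f g alv bev H" and p': "psi g g' alv' bev' H'"
 and ab: "comm f g alv bev" and ab': "comm g g' alv' bev'"
 shows "psi f g' (alv' $ alv) (bev' $ bev) (H' $ H)"
proof -
 obtain h where h: "phi f g alv bev h" "H : GA" "dm H = LL f" "cd H = LL g" "deg H = deg alv" "!!c. c : Field r ==> H $ io (qq f c) = io (qq g c) $ h c"
 using psiE[OF p] by blast
 obtain h' where h': "phi g g' alv' bev' h'" "H' : GA" "dm H' = LL g" "cd H' = LL g'" "deg H' = deg alv'" "!!c. c : Field r ==> H' $ io (qq g c) = io (qq g' c) $ h' c"
 using psiE[OF p'] by blast
 show ?thesis
 proof (rule psiI[OF phi_cmp[OF f g g' h(1) h'(1) ab ab']])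
 fix c assume c: "c : Field r"
 note A = phcD[OF phiD[OF f g h(1) c]] and B = phcD[OF phiD[OF g g' h'(1) c]] and q = qd[OF f c] qd[OF g c] qd[OF g' c]
 have "(H' $ H) $ io (qq f c) = H' $ H $ io (qq f c)" using h(2-5) h'(2-5) q by simp
 also have "... = (H' $ io (qq g c)) $ h c" unfolding h(6)[OF c] using A(1-4) h'(2-5) q by simp
 also have "... = io (qq g' c) $ h' c $ h c" unfolding h'(6)[OF c] using A(1-4) B(1-4) q by simp
 finally show "(H' $ H) $ io (qq f c) = io (qq g' c) $ h' c $ h c" .
 qed (use h h' in simp_all)
qed

definition ta where "ta f g n a = (dm f, dm g, n :: int, a)" for f g :: "'o \<times> 'o \<times> 'u" and a :: 'u
definition tb where "tb f g n b = (cd f, cd g, n :: int, b)" for f g :: "'o \<times> 'o \<times> 'u" and b :: 'u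
definition HH where "HH f g n a b = (THE H. psi f g (ta f g n a) (tb f g n b) H)"

lemma HH:
 assumes f: "f : UA" and g: "g : UA" and m: "(a, b) : homs (arr1 M) f g n"
 shows "comm f g (ta f g n a) (tb f g n b)" "psi f g (ta f g n a) (tb f g n b) (HH f g n a b)"
 "psi f g (ta f g n a) (tb f g n b) H ==> HH f g n a b = H" "HH f g n a b = (LL f, LL g, n, val (HH f g n a b))"
 "HH f g n a b : GA"
proof -
 show c: "comm f g (ta f g n a) (tb f g n b)" using m unfolding arr1_mem[OF f g] ta_def tb_def .
 obtain H0 where H0: "psi f g (ta f g n a) (tb f g n b) H0" using psi_ex[OF f g c] by blast
 show p: "psi f g (ta f g n a) (tb f g n b) (HH f g n a b)" unfolding HH_def
 by (rule theI[of _ H0], rule H0, rule psi_unique[OF _ H0 f g], assumption)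
 show "psi f g (ta f g n a) (tb f g n b) H ==> HH f g n a b = H" by (rule psi_unique[OF p _ f g])
 show "HH f g n a b = (LL f, LL g, n, val (HH f g n a b))" "HH f g n a b : GA"
 using psiE[OF p] by (auto simp: prod_eq_iff ta_def)
qed

definition FF where
 "FF = \<lparr>DFO = (%f. (dm f, LL f, cd f, mor (qq f z), mor (PP f))),
 DFA = (%f g n s. (fst s, val (HH f g n (fst s) (snd s)), snd s))\<rparr>"

lemma FF_simps: "DFO FF f = (dm f, LL f, cd f, mor (qq f z), mor (PP f))"
 "DFA FF f g n (a, b) = (a, val (HH f g n a b), b)"
 by (simp_all add: FF_def)

text \<open>\<open>HH\<close> is characterized by \<open>psi\<close>, so each law holds because the
  corresponding sum, multiple, differential, identity or composite satisfies the same
  \<open>psi\<close>. Membership in the Hom complex of \<open>arr2\<close> amounts to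
  \<open>psi_q\<close> and \<open>psi_P\<close>.\<close>

theorem FF_functor: "dg_functor k (arr1 M) (arr2 M) FF"
proof -
 have O: "DObj (arr1 M) = UA" by (simp add: arr1_def)
 have qz: "qq f z : UA" "dm (qq f z) = dm f" "cd (qq f z) = LL f" and P: "PP f : UA" "dm (PP f) = LL f" "cd (PP f) = cd f" if f: "f : UA" for f
 using qd[OF f z(1)] twD(7,11-13)[OF tw[OF f]] by simp_all
 have qe: "(dm f, LL f, mor (qq f z)) = qq f z" "(LL f, cd f, mor (PP f)) = PP f" if f: "f : UA" for f
 using qz[OF f] P[OF f] by (simp_all add: prod_eq_iff)
 have D2: "DHom (arr2 M) (DFO FF f) (DFO FF g) = \<lparr>Deg = (%n. (prod_module (Deg (DHom M (dm f) (dm g)) n)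
 (prod_module (Deg (DHom M (LL f) (LL g)) n) (Deg (DHom M (cd f) (cd g)) n)))
 \<lparr>carrier := {(a, x, b). a : homs M (dm f) (dm g) n & x : homs M (LL f) (LL g) n & b : homs M (cd f) (cd g) n &
 DCmp M (dm f) (LL f) (LL g) n 0 x (mor (qq f z)) = DCmp M (dm f) (dm g) (LL g) 0 n (mor (qq g z)) a &
 DCmp M (LL f) (cd f) (cd g) n 0 b (mor (PP f)) = DCmp M (LL f) (LL g) (cd g) 0 n (mor (PP g)) x}\<rparr>),
 Diff = (%n (a, x, b). (Diff (DHom M (dm f) (dm g)) n a, Diff (DHom M (LL f) (LL g)) n x, Diff (DHom M (cd f) (cd g)) n b))\<rparr>" for f g
 by (simp add: arr2_def FF_simps)
 have mem: "(a, val (HH f g n a b), b) : homs (arr2 M) (DFO FF f) (DFO FF g) n"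
 if f: "f : UA" and g: "g : UA" and m: "(a, b) : homs (arr1 M) f g n" for f g n a b
 proof -
 note h = HH[OF f g m]
 note c = commD[OF h(1)]
 have ga: "a : homs M (dm f) (dm g) n" "b : homs M (cd f) (cd g) n" using gr_arrD(3)[OF c(1)] gr_arrD(3)[OF c(2)] by (simp_all add: ta_def tb_def)
 have gh: "val (HH f g n a b) : homs M (LL f) (LL g) n" using gr_arrD(3)[OF h(5)] h(4) by (metis fst_conv snd_conv)
 have "(LL f, LL g, n, val (HH f g n a b)) $ io (qq f z) = io (qq g z) $ ta f g n a" using psi_q[OF f g h(2)] h(4) by simp
 moreover have "io (PP g) $ (LL f, LL g, n, val (HH f g n a b)) = tb f g n b $ io (PP f)" using psi_P[OF f g h(2,1)] h(4) by simp
 ultimately have "DCmp M (dm f) (LL f) (LL g) n 0 (val (HH f g n a b)) (mor (qq f z)) = DCmp M (dm f) (dm g) (LL g) 0 n (mor (qq g z)) a"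
 "DCmp M (LL f) (LL g) (cd g) 0 n (mor (PP g)) (val (HH f g n a b)) = DCmp M (LL f) (cd f) (cd g) n 0 b (mor (PP f))"
 using qz[OF f] qz[OF g] P[OF f] P[OF g] by (simp_all add: gr_cmp io_def ta_def tb_def)
 then show ?thesis unfolding D2 using ga gh by simp
 qed
 have cm: "chain_map k (DHom (arr1 M) f g) (DHom (arr2 M) (DFO FF f) (DFO FF g)) (DFA FF f g)" if f: "f : UA" and g: "g : UA" for f g
 unfolding chain_map_def linear_on_def
 proof (intro conjI allI ballI funcsetI)
 fix n s assume s: "s : homs (arr1 M) f g n"
 obtain a b where ab: "s = (a, b)" by (cases s)
 note m = s[unfolded ab]
 note h = HH[OF f g m]
 show "DFA FF f g n s : homs (arr2 M) (DFO FF f) (DFO FF g) n" unfolding ab FF_simps(2) by (rule mem[OF f g m])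
 interpret K: module k "Deg (DHom (arr1 M) f g) n" by (rule complexD(1)[OF arr1_complex[OF f g]])
 { fix e assume e: "e : carrier k"
 have m': "(e \<odot>\<^bsub>Deg (DHom M (dm f) (dm g)) n\<^esub> a, e \<odot>\<^bsub>Deg (DHom M (cd f) (cd g)) n\<^esub> b) : homs (arr1 M) f g n"
 using K.smult_closed[OF e m] unfolding arr1_ops(2)[OF f g] .
 have "HH f g n (e \<odot>\<^bsub>Deg (DHom M (dm f) (dm g)) n\<^esub> a) (e \<odot>\<^bsub>Deg (DHom M (cd f) (cd g)) n\<^esub> b) = sm e (HH f g n a b)"
 by (rule HH(3)[OF f g m']) (use psi_sm[OF f g h(2,1) e] in "simp add: sm_def ta_def tb_def")
 then have "val (HH f g n (e \<odot>\<^bsub>Deg (DHom M (dm f) (dm g)) n\<^esub> a) (e \<odot>\<^bsub>Deg (DHom M (cd f) (cd g)) n\<^esub> b)) = e \<odot>\<^bsub>Deg (DHom M (LL f) (LL g)) n\<^esub> val (HH f g n a b)"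
 using h(4) unfolding sm_def by (metis fst_conv snd_conv)
 then show "DFA FF f g n (e \<odot>\<^bsub>Deg (DHom (arr1 M) f g) n\<^esub> s) = e \<odot>\<^bsub>Deg (DHom (arr2 M) (DFO FF f) (DFO FF g)) n\<^esub> DFA FF f g n s"
 unfolding ab arr1_ops(2)[OF f g] FF_simps(2) D2 by (simp add: prod_module_def) }
 { have m': "(Diff (DHom M (dm f) (dm g)) n a, Diff (DHom M (cd f) (cd g)) n b) : homs (arr1 M) f g (n + 1)"
 using complexD(3)[OF arr1_complex[OF f g] m] unfolding arr1_ops(3)[OF f g] .
 have "HH f g (n + 1) (Diff (DHom M (dm f) (dm g)) n a) (Diff (DHom M (cd f) (cd g)) n b) = df (HH f g n a b)"
 by (rule HH(3)[OF f g m']) (use psi_df[OF f g h(2,1)] in "simp add: df_def ta_def tb_def")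
 then have "val (HH f g (n + 1) (Diff (DHom M (dm f) (dm g)) n a) (Diff (DHom M (cd f) (cd g)) n b)) = Diff (DHom M (LL f) (LL g)) n (val (HH f g n a b))"
 using h(4) unfolding df_def by (metis fst_conv snd_conv)
 then show "DFA FF f g (n + 1) (Diff (DHom (arr1 M) f g) n s) = Diff (DHom (arr2 M) (DFO FF f) (DFO FF g)) n (DFA FF f g n s)"
 unfolding ab arr1_ops(3)[OF f g] FF_simps(2) D2 by simp }
 fix s' assume s': "s' : homs (arr1 M) f g n"
 obtain a' b' where ab': "s' = (a', b')" by (cases s')
 note m2 = s'[unfolded ab']
 note h2 = HH[OF f g m2]
 have m': "(a \<oplus>\<^bsub>Deg (DHom M (dm f) (dm g)) n\<^esub> a', b \<oplus>\<^bsub>Deg (DHom M (cd f) (cd g)) n\<^esub> b') : homs (arr1 M) f g n"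
 using K.a_closed[OF m m2] unfolding arr1_ops(1)[OF f g] .
 have "HH f g n (a \<oplus>\<^bsub>Deg (DHom M (dm f) (dm g)) n\<^esub> a') (b \<oplus>\<^bsub>Deg (DHom M (cd f) (cd g)) n\<^esub> b') = ad (HH f g n a b) (HH f g n a' b')"
 by (rule HH(3)[OF f g m']) (use psi_ad[OF f g h(2) h2(2) h(1) h2(1)] in "simp add: ad_def ta_def tb_def")
 then have "val (HH f g n (a \<oplus>\<^bsub>Deg (DHom M (dm f) (dm g)) n\<^esub> a') (b \<oplus>\<^bsub>Deg (DHom M (cd f) (cd g)) n\<^esub> b')) =
 val (HH f g n a b) \<oplus>\<^bsub>Deg (DHom M (LL f) (LL g)) n\<^esub> val (HH f g n a' b')"
 using h(4) unfolding ad_def by (metis fst_conv snd_conv)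
 then show "DFA FF f g n (s \<oplus>\<^bsub>Deg (DHom (arr1 M) f g) n\<^esub> s') = DFA FF f g n s \<oplus>\<^bsub>Deg (DHom (arr2 M) (DFO FF f) (DFO FF g)) n\<^esub> DFA FF f g n s'"
 unfolding ab ab' arr1_ops(1)[OF f g] FF_simps(2) D2 by (simp add: prod_module_def)
 qed
 have id: "DFA FF f f 0 (DId (arr1 M) f) = DId (arr2 M) (DFO FF f)" if f: "f : UA" for f
 proof -
 have e: "DId (arr1 M) f = (DId M (dm f), DId M (cd f))" by (cases f) (simp add: arr1_def)
 have c: "comm f f (idt (gr M) (dm f)) (idt (gr M) (cd f))" unfolding comm_def using f by simp
 have m: "(DId M (dm f), DId M (cd f)) : homs (arr1 M) f f 0" using c unfolding arr1_mem[OF f f] by (simp add: gr_idt)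
 have "HH f f 0 (DId M (dm f)) (DId M (cd f)) = idt (gr M) (LL f)"
 by (rule HH(3)[OF f f m]) (use psi_id[OF f] in "simp add: gr_idt ta_def tb_def")
 then show ?thesis unfolding e FF_simps by (simp add: arr2_def gr_idt)
 qed
 have comp: "DFA FF f g' (p + q) (DCmp (arr1 M) f g g' p q s' s) = DCmp (arr2 M) (DFO FF f) (DFO FF g) (DFO FF g') p q (DFA FF g g' p s') (DFA FF f g q s)"
 if f: "f : UA" and g: "g : UA" and g': "g' : UA" and s: "s : homs (arr1 M) f g q" and s': "s' : homs (arr1 M) g g' p" for f g g' p q s s'
 proof -
 obtain a b a' b' where ab: "s = (a, b)" "s' = (a', b')" by (cases s; cases s')
 note h = HH[OF f g s[unfolded ab]] and h' = HH[OF g g' s'[unfolded ab]]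
 let ?a = "DCmp M (dm f) (dm g) (dm g') p q a' a" and ?b = "DCmp M (cd f) (cd g) (cd g') p q b' b"
 have e: "DCmp (arr1 M) f g g' p q s' s = (?a, ?b)" unfolding ab by (cases f; cases g; cases g') (simp add: arr1_def)
 have tc: "ta f g' (p + q) ?a = ta g g' p a' $ ta f g q a" "tb f g' (p + q) ?b = tb g g' p b' $ tb f g q b" by (simp_all add: ta_def tb_def gr_cmp)
 have ps: "psi f g' (ta f g' (p + q) ?a) (tb f g' (p + q) ?b) (HH g g' p a' b' $ HH f g q a b)"
 unfolding tc by (rule psi_cmp[OF f g g' h(2) h'(2) h(1) h'(1)])
 note c = commD[OF h(1)] and c' = commD[OF h'(1)]
 have "comm f g' (ta f g' (p + q) ?a) (tb f g' (p + q) ?b)"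
 proof -
 have "io g' $ ta g g' p a' $ ta f g q a = (io g' $ ta g g' p a') $ ta f g q a" using c(1-7) c'(1-7) g' by simp
 also have "... = tb g g' p b' $ io g $ ta f g q a" unfolding c'(8) using c(1-7) c'(1-7) g by simp
 also have "... = (tb g g' p b' $ tb f g q b) $ io f" unfolding c(8) using c(1-7) c'(1-7) f by simp
 finally show ?thesis unfolding tc comm_def using c(1-7) c'(1-7) by simp
 qed
 then have m: "(?a, ?b) : homs (arr1 M) f g' (p + q)" unfolding arr1_mem[OF f g'] ta_def tb_def .
 have "HH f g' (p + q) ?a ?b = HH g g' p a' b' $ HH f g q a b" by (rule HH(3)[OF f g' m ps])
 also have "... = (LL g, LL g', p, val (HH g g' p a' b')) $ (LL f, LL g, q, val (HH f g q a b))" using h(4) h'(4) by simp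
 finally have "val (HH f g' (p + q) ?a ?b) = DCmp M (LL f) (LL g) (LL g') p q (val (HH g g' p a' b')) (val (HH f g q a b))" by (simp add: gr_cmp)
 then show ?thesis unfolding e unfolding ab FF_simps by (simp add: arr2_def)
 qed
 have ob: "DFO FF f : DObj (arr2 M)" if f: "f : UA" for f
 unfolding FF_simps arr2_def using qe[OF f] qz[OF f] P[OF f] by simp
 show ?thesis unfolding dg_functor_def O by (intro conjI ballI allI ob cm id comp)
qed

theorem enriched_factorization: "enriched_functorial_factorization k M FF & factors_through M FF (U.llp RI) RI"
proof -
 have O: "DObj (arr1 M) = UA" by (simp add: arr1_def)
 have fac: "DFO (composition_functor M) (DFO FF f) = f" "(dm f, LL f, mor (qq f z)) : U.llp RI & (LL f, cd f, mor (PP f)) : RI" if f: "f : UA" for f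
 proof -
 note q = qd[OF f z(1)] and P = twD(7,8,11-14)[OF tw[OF f]]
 have e: "(dm f, LL f, mor (qq f z)) = qq f z" "(LL f, cd f, mor (PP f)) = PP f" using q P by (simp_all add: prod_eq_iff)
 show "(dm f, LL f, mor (qq f z)) : U.llp RI & (LL f, cd f, mor (PP f)) : RI" unfolding e using tower_llp[OF tw[OF f]] tower_rlp[OF tw[OF f]] by blast
 have "io (PP f) $ io (qq f z) = io f" using P(6)[OF z(1)] P(2) by simp
 then have "DCmp M (dm f) (LL f) (cd f) 0 0 (mor (PP f)) (mor (qq f z)) = mor f" using q P by (simp add: gr_cmp io_def)
 then show "DFO (composition_functor M) (DFO FF f) = f" unfolding FF_simps composition_functor_def by (simp add: prod_eq_iff)
 qed
 have "DFA (composition_functor M) X Y n (DFA FF f g n u) = u" for X Y f g n u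
 by (cases u) (simp add: FF_simps composition_functor_def)
 then show ?thesis
 unfolding enriched_functorial_factorization_def factors_through_def O FF_simps prod.case
 using FF_functor fac(1)[unfolded FF_simps] fac(2) by (intro conjI ballI allI) (simp_all add: FF_simps)
qed

end

section \<open>From the generators to a class of maps, and the two factorizations\<close>

theorem (in gen) ex_enriched_factorization:
 "EX F. enriched_functorial_factorization k M F & factors_through M F (U.llp RI) RI"
proof -
 obtain r where r: "Q.good r" using Q.ex_good by blast
 then have "Well_order r" unfolding Q.good_def by (simp add: Card_order_wo_rel wo_rel_def card_order_on_well_order_on)
 then interpret etower k M elts I S r by unfold_locales (use r in simp_all)
 show ?thesis using enriched_factorization by blast
qed

text \<open>The retract argument identifies \<open>S\<close> with the maps having the left lifting
  property against \<open>rlp I\<close>. So the generators lie in \<open>S\<close>, and the left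
  factors produced by the tower do too. One statement serves cofibrations and trivial cofibrations
  alike.\<close>

lemma enriched_factorization_of_class:
 fixes elts :: "'u => 'u set" and k :: "'k ring" and M :: "('o, 'k, 'u) dgcat" and I S :: "('o \<times> 'o \<times> 'u) set"
 assumes gu: "grothendieck_universe elts" and fk: "field k" and Kc: "K_category elts k M" and spt: "strongly_pretriangulated k M"
 and Kb: "K_bicomplete elts k M"
 and I: "I \<subseteq> arrows (underlying M)" "small elts I" "permits_small_object_argument elts (underlying M) I"
 and S: "S \<subseteq> arrows (underlying M)" "retract_closed (underlying M) S" "has_factorizations (underlying M) S (rlp (underlying M) I)"
 and lift: "!!i p. i : S ==> p : rlp (underlying M) I ==> has_lifting (underlying M) i p"
 and st: "stable_under_shifts k M S" "stable_under_iCone k M S"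
 shows "EX F. enriched_functorial_factorization k M F & factors_through M F S (rlp (underlying M) I)"
proof -
 have dg: "dg_category k M" using Kc by (simp add: K_category_def)
 interpret D: ptr k M by (intro ptr.intro dgc.intro ptr_axioms.intro fk dg spt)
 have R: "rlp (underlying M) I \<subseteq> arrows (underlying M)" by (auto simp: rlp_def)
 have LS: "f : S" if "f : D.U.llp (rlp (underlying M) I)" for f
 by (rule D.U.llp_retract[OF S(2,3,1) R that])
 have SL: "S \<subseteq> D.U.llp (rlp (underlying M) I)" unfolding D.U.llp_def using S(1) lift by blast
 have "I \<subseteq> D.U.llp (rlp (underlying M) I)" unfolding D.U.llp_def rlp_def using I(1) by blast
 then have IS: "I \<subseteq> S" using LS by blast
 have te: "tensored elts k M" "has_small_colimits elts (underlying M)" using Kb by (simp_all add: K_bicomplete_def)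
 interpret gen k M elts I S
 by (intro gen.intro gen_axioms.intro universe.intro D.ptr_axioms gu Kc te IS I(2,3) S(1) st SL)
 obtain F where F: "enriched_functorial_factorization k M F" "factors_through M F (D.U.llp (rlp (underlying M) I)) (rlp (underlying M) I)"
 using ex_enriched_factorization by blast
 have "factors_through M F S (rlp (underlying M) I)"
 unfolding factors_through_def
 proof
 fix f assume "f : DObj (arr1 M)"
 from F(2)[unfolded factors_through_def, THEN bspec, OF this]
 show "case DFO F f of (A, X, B, l, r) => (A, X, l) : S & (X, B, r) : rlp (underlying M) I"
 using LS by (auto split: prod.splits)
 qed
 then show ?thesis using F(1) by blast
qed

theorem theorem3p6:
  fixes elts :: "'u \<Rightarrow> 'u set"
    and k :: "'k ring"
    and M :: "('o, 'k, 'u) dgcat"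
    and W Cof Fib :: "('o \<times> 'o \<times> 'u) set"
  assumes "grothendieck_universe elts"
    and "field k"
    and "small elts (carrier k)"
    and "K_category elts k M"
    and "strongly_pretriangulated k M"
    and "K_bicomplete elts k M"
    and "model_structure (underlying M) W Cof Fib"
    and "cofibrantly_generated elts (underlying M) W Fib"
    and "stable_under_shifts k M Cof"
    and "stable_under_shifts k M (Cof \<inter> W)"
    and "stable_under_iCone k M Cof"
    and "stable_under_iCone k M (Cof \<inter> W)"
  shows "admits_enriched_functorial_factorizations k M W Cof Fib"
proof -
 obtain I where I: "I \<subseteq> arrows (underlying M)" "small elts I" "permits_small_object_argument elts (underlying M) I"
 "Fib \<inter> W = rlp (underlying M) I"
 using assms(8) unfolding cofibrantly_generated_def by blast
 obtain J where J: "J \<subseteq> arrows (underlying M)" "small elts J" "permits_small_object_argument elts (underlying M) J"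
 "Fib = rlp (underlying M) J"
 using assms(8) unfolding cofibrantly_generated_def by blast
 note ms = assms(7)[unfolded model_structure_def]
 have sub: "Cof \<subseteq> arrows (underlying M)" "Cof \<inter> W \<subseteq> arrows (underlying M)" using ms by blast+
 have rc: "retract_closed (underlying M) Cof" "retract_closed (underlying M) W" using ms by blast+
 then have rcw: "retract_closed (underlying M) (Cof \<inter> W)" unfolding retract_closed_def by blast
 have fa: "has_factorizations (underlying M) (Cof \<inter> W) Fib" "has_factorizations (underlying M) Cof (Fib \<inter> W)" using ms by blast+
 have li: "!!i p. i : Cof \<inter> W ==> p : Fib ==> has_lifting (underlying M) i p"
 "!!i p. i : Cof ==> p : Fib \<inter> W ==> has_lifting (underlying M) i p" using ms by blast+
 have "EX F. enriched_functorial_factorization k M F & factors_through M F Cof (Fib \<inter> W)"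
 unfolding I(4)
 by (rule enriched_factorization_of_class[OF assms(1,2,4,5,6) I(1-3) sub(1) rc(1) fa(2)[unfolded I(4)] li(2)[unfolded I(4)] assms(9,11)])
 moreover have "EX F. enriched_functorial_factorization k M F & factors_through M F (Cof \<inter> W) Fib"
 unfolding J(4)
 by (rule enriched_factorization_of_class[OF assms(1,2,4,5,6) J(1-3) sub(2) rcw fa(1)[unfolded J(4)] li(1)[unfolded J(4)] assms(10,12)])
 ultimately show ?thesis unfolding admits_enriched_functorial_factorizations_def by blast
qed

end
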